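(* Let $m\ge1$ be such that $\lambda_m<\lambda_{m+1}$. Then \[ i(C_m^-\setminus\{0\})=i(X\setminus C_m^+)=m, \] where $i$ denotes the $\mathbb{Z}_2$-cohomological index of Fadell and Rabinowitz.
   Context: Let $N\ge1$, $s\in(0,1)$, $p\in(1,\infty)$, and let $\Omega\subset\mathbb{R}^N$ be a bounded domain with Lipschitz boundary. Set $C\Omega=\mathbb{R}^N\setminus\Omega$, $\mathcal{Q}=\mathbb{R}^{2N}\setminus (C\Omega)^2$, $[u]=\big(\iint_{\mathcal{Q}}\frac{|u(x)-u(y)|^p}{|x-y|^{N+ps}}dxdy\big)^{1/p}$, $\|u\|=([u]^p+\|u\|_{L^p(\Omega)}^p)^{1/p}$, and $X=\{u:\mathbb{R}^N\to\mathbb{R}\text{ measurable}:\|u\|<\infty\}$. Let $M=\{u\in X:\int_\Omega|u|^p\,dx=1\}$, and for $m\ge1$ define \[ \lambda_m=\inf\Big\{\sup_{u\in K}[u]^p:\ K\subseteq M \text{ symmetric, compact, } i(K)\ge m\Big\}, \] where $i$ is the $\mathbb{Z}_2$-cohomological index of Fadell–Rabinowitz; these are eigenvalues of the fractional $p$-Laplacian with nonlocal Neumann conditions, $\lambda_1=0$, and $\lambda_m\to\infty$. Define the cones \[ C_m^-=\{u\in X:[u]^p\le\lambda_m\textstyle\int_\Omega|u|^p dx\},\qquad C_m^+=\{u\in X:[u]^p\ge\lambda_{m+1}\textstyle\int_\Omega|u|^p dx\}. \] *)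

theory Defs
  imports "HOL-Analysis.Analysis" "HOL-Library.Z2"
begin

text \<open>A q-cochain on a space Y is a function from (q+1)-tuples (lists of length q+1)
  of points to Z2 (type bit). Only its values on lists of length q+1 are relevant.\<close>

type_synonym 'b cochain = "'b list \<Rightarrow> bit"

definition as_locally_zero :: "'b topology \<Rightarrow> nat \<Rightarrow> 'b cochain \<Rightarrow> bool" where
  "as_locally_zero Y q \<phi> \<longleftrightarrow>
     (\<exists>\<U>. (\<forall>U\<in>\<U>. openin Y U) \<and> \<Union>\<U> = topspace Y \<and>
          (\<forall>ys. length ys = Suc q \<and> (\<exists>U\<in>\<U>. set ys \<subseteq> U) \<longrightarrow> \<phi> ys = 0))"

definition as_cobound :: "'b cochain \<Rightarrow> 'b cochain" where
  "as_cobound \<phi> ys = (\<Sum>i<length ys. \<phi> (take i ys @ drop (Suc i) ys))"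

definition as_cup :: "nat \<Rightarrow> 'b cochain \<Rightarrow> 'b cochain \<Rightarrow> 'b cochain" where
  "as_cup p \<phi> \<psi> ys = \<phi> (take (Suc p) ys) * \<psi> (drop p ys)"

fun as_pow :: "'b cochain \<Rightarrow> nat \<Rightarrow> 'b cochain" where
  "as_pow \<phi> 0 = (\<lambda>_. 1)"
| "as_pow \<phi> (Suc j) = as_cup j (as_pow \<phi> j) \<phi>"

text \<open>phi defines a cohomology class of degree q in the Alexander--Spanier complex
  (cochains modulo locally zero cochains): its coboundary is locally zero.\<close>
definition as_cocycle :: "'b topology \<Rightarrow> nat \<Rightarrow> 'b cochain \<Rightarrow> bool" where
  "as_cocycle Y q \<phi> \<longleftrightarrow> as_locally_zero Y (Suc q) (as_cobound \<phi>)"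

definition as_class_zero :: "'b topology \<Rightarrow> nat \<Rightarrow> 'b cochain \<Rightarrow> bool" where
  "as_class_zero Y q \<phi> \<longleftrightarrow>
     (if q = 0 then as_locally_zero Y 0 \<phi>
      else (\<exists>\<psi>. as_locally_zero Y q (\<lambda>ys. \<phi> ys + as_cobound \<psi> ys)))"

definition as_pullback :: "('b \<Rightarrow> 'c) \<Rightarrow> 'c cochain \<Rightarrow> 'b cochain" where
  "as_pullback f \<phi> ys = \<phi> (map f ys)"

definition quotient_top :: "'a topology \<Rightarrow> ('a \<Rightarrow> 'b) \<Rightarrow> 'b topology" where
  "quotient_top X f = topology (\<lambda>U. U \<subseteq> f ` topspace X \<and> openin X {x \<in> topspace X. f x \<in> U})"

definition orbit2 :: "('a \<Rightarrow> 'a) \<Rightarrow> 'a \<Rightarrow> 'a set" where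
  "orbit2 neg u = {u, neg u}"

definition orbit_space :: "'a topology \<Rightarrow> ('a \<Rightarrow> 'a) \<Rightarrow> 'a set \<Rightarrow> 'a set topology" where
  "orbit_space T neg A = quotient_top (subtopology T A) (orbit2 neg)"

text \<open>The infinite dimensional sphere S^infinity (unit sphere of the space of finitely
  supported real sequences) with the direct limit (weak) topology of the spheres S^n.\<close>
definition Sinf :: "(nat \<Rightarrow> real) set" where
  "Sinf = {x. finite {i. x i \<noteq> 0} \<and> (\<Sum>i\<in>{i. x i \<noteq> 0}. (x i)\<^sup>2) = 1}"

definition Sfin :: "nat \<Rightarrow> (nat \<Rightarrow> real) set" where
  "Sfin n = {x \<in> Sinf. \<forall>i>n. x i = 0}"

definition Sinf_top :: "(nat \<Rightarrow> real) topology" where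
  "Sinf_top = topology (\<lambda>U. U \<subseteq> Sinf \<and>
     (\<forall>n. \<forall>x\<in>U \<inter> Sfin n. \<exists>e>0. \<forall>y\<in>Sfin n. (\<Sum>i\<le>n. (x i - y i)\<^sup>2) < e\<^sup>2 \<longrightarrow> y \<in> U))"

definition RPinf_top :: "(nat \<Rightarrow> real) set topology" where
  "RPinf_top = orbit_space Sinf_top uminus Sinf"

text \<open>A representative of the generator omega of H^1(RP^infinity; Z2) = Z2.\<close>
definition omega_RP :: "(nat \<Rightarrow> real) set cochain" where
  "omega_RP = (SOME \<phi>. as_cocycle RPinf_top 1 \<phi> \<and> \<not> as_class_zero RPinf_top 1 \<phi>)"

definition induced_orbit_map :: "('a \<Rightarrow> nat \<Rightarrow> real) \<Rightarrow> 'a set \<Rightarrow> (nat \<Rightarrow> real) set" where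
  "induced_orbit_map g Orb = orbit2 uminus (g (SOME u. u \<in> Orb))"

text \<open>Fadell--Rabinowitz Z2-cohomological index of a symmetric set A (free Z2-action):
  i(A) = sup { k >= 1 : f*(omega^(k-1)) \<noteq> 0 } where f : A/Z2 -> RP^infinity is the
  classifying map (induced by an odd continuous map A -> S^infinity); i(empty) = 0.\<close>
definition FR_index :: "'a topology \<Rightarrow> ('a \<Rightarrow> 'a) \<Rightarrow> 'a set \<Rightarrow> enat" where
  "FR_index T neg A = Sup {enat k | k. k \<ge> 1 \<and>
     (\<exists>g. continuous_map (subtopology T A) Sinf_top g \<and> (\<forall>u\<in>A. g (neg u) = - g u) \<and>
          \<not> as_class_zero (orbit_space T neg A) (k - 1)
               (as_pullback (induced_orbit_map g) (as_pow omega_RP (k - 1))))}"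

definition Lipschitz_boundary :: "(real^'n) set \<Rightarrow> bool" where
  "Lipschitz_boundary \<Omega> \<longleftrightarrow>
     (\<forall>x\<in>frontier \<Omega>. \<exists>r>0. \<exists>e::real^'n. norm e = 1 \<and> (\<exists>C \<gamma>. C-lipschitz_on UNIV (\<gamma> :: real^'n \<Rightarrow> real) \<and>
        \<Omega> \<inter> ball x r = {y \<in> ball x r. y \<bullet> e < \<gamma> (y - (y \<bullet> e) *\<^sub>R e)}))"

definition bounded_Lipschitz_domain :: "(real^'n) set \<Rightarrow> bool" where
  "bounded_Lipschitz_domain \<Omega> \<longleftrightarrow>
     open \<Omega> \<and> connected \<Omega> \<and> \<Omega> \<noteq> {} \<and> bounded \<Omega> \<and> Lipschitz_boundary \<Omega>"

definition Qset :: "(real^'n) set \<Rightarrow> ((real^'n) \<times> (real^'n)) set" where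
  "Qset \<Omega> = {(x, y). x \<in> \<Omega> \<or> y \<in> \<Omega>}"

definition gagp :: "real \<Rightarrow> real \<Rightarrow> (real^'n) set \<Rightarrow> (real^'n \<Rightarrow> real) \<Rightarrow> ennreal" where
  "gagp p s \<Omega> u = (\<integral>\<^sup>+ z \<in> Qset \<Omega>.
      ennreal (\<bar>u (fst z) - u (snd z)\<bar> powr p / norm (fst z - snd z) powr (real CARD('n) + p * s))
      \<partial>lebesgue)"

definition Lpp :: "real \<Rightarrow> (real^'n) set \<Rightarrow> (real^'n \<Rightarrow> real) \<Rightarrow> ennreal" where
  "Lpp p \<Omega> u = (\<integral>\<^sup>+ x \<in> \<Omega>. ennreal (\<bar>u x\<bar> powr p) \<partial>lebesgue)"

definition Xraw :: "real \<Rightarrow> real \<Rightarrow> (real^'n) set \<Rightarrow> (real^'n \<Rightarrow> real) set" where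
  "Xraw p s \<Omega> = {u. u \<in> borel_measurable lebesgue \<and> gagp p s \<Omega> u < \<infinity> \<and> Lpp p \<Omega> u < \<infinity>}"

text \<open>Elements of X are identified when equal almost everywhere in R^N: an element of X
  is represented by its class.\<close>
definition Xcls :: "real \<Rightarrow> real \<Rightarrow> (real^'n) set \<Rightarrow> (real^'n \<Rightarrow> real) \<Rightarrow> (real^'n \<Rightarrow> real) set" where
  "Xcls p s \<Omega> u = {v \<in> Xraw p s \<Omega>. AE x in lebesgue. v x = u x}"

definition Xsp :: "real \<Rightarrow> real \<Rightarrow> (real^'n) set \<Rightarrow> (real^'n \<Rightarrow> real) set set" where
  "Xsp p s \<Omega> = Xcls p s \<Omega> ` Xraw p s \<Omega>"

definition rep :: "(real^'n \<Rightarrow> real) set \<Rightarrow> (real^'n \<Rightarrow> real)" where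
  "rep U = (SOME u. u \<in> U)"

definition semp :: "real \<Rightarrow> real \<Rightarrow> (real^'n) set \<Rightarrow> (real^'n \<Rightarrow> real) set \<Rightarrow> real" where
  "semp p s \<Omega> U = enn2real (gagp p s \<Omega> (rep U))"

definition lpp :: "real \<Rightarrow> (real^'n) set \<Rightarrow> (real^'n \<Rightarrow> real) set \<Rightarrow> real" where
  "lpp p \<Omega> U = enn2real (Lpp p \<Omega> (rep U))"

definition Xdist :: "real \<Rightarrow> real \<Rightarrow> (real^'n) set \<Rightarrow> (real^'n \<Rightarrow> real) set \<Rightarrow> (real^'n \<Rightarrow> real) set \<Rightarrow> real" where
  "Xdist p s \<Omega> U V = (let w = (\<lambda>x. rep U x - rep V x) in
      (enn2real (gagp p s \<Omega> w) + enn2real (Lpp p \<Omega> w)) powr (1 / p))"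

definition Xtop :: "real \<Rightarrow> real \<Rightarrow> (real^'n) set \<Rightarrow> (real^'n \<Rightarrow> real) set topology" where
  "Xtop p s \<Omega> = Metric_space.mtopology (Xsp p s \<Omega>) (Xdist p s \<Omega>)"

definition Xneg :: "(real^'n \<Rightarrow> real) set \<Rightarrow> (real^'n \<Rightarrow> real) set" where
  "Xneg U = (\<lambda>v x. - v x) ` U"

definition Xzero :: "real \<Rightarrow> real \<Rightarrow> (real^'n) set \<Rightarrow> (real^'n \<Rightarrow> real) set" where
  "Xzero p s \<Omega> = Xcls p s \<Omega> (\<lambda>x. 0)"

definition Xindex :: "real \<Rightarrow> real \<Rightarrow> (real^'n) set \<Rightarrow> (real^'n \<Rightarrow> real) set set \<Rightarrow> enat" where
  "Xindex p s \<Omega> A = FR_index (Xtop p s \<Omega>) Xneg A"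

definition Mset :: "real \<Rightarrow> real \<Rightarrow> (real^'n) set \<Rightarrow> (real^'n \<Rightarrow> real) set set" where
  "Mset p s \<Omega> = {U \<in> Xsp p s \<Omega>. lpp p \<Omega> U = 1}"

definition eigval :: "real \<Rightarrow> real \<Rightarrow> (real^'n) set \<Rightarrow> nat \<Rightarrow> real" where
  "eigval p s \<Omega> m = Inf {(SUP U\<in>K. semp p s \<Omega> U) | K.
      K \<subseteq> Mset p s \<Omega> \<and> (\<forall>U\<in>K. Xneg U \<in> K) \<and> compactin (Xtop p s \<Omega>) K \<and>
      Xindex p s \<Omega> K \<ge> enat m}"

definition Cminus :: "real \<Rightarrow> real \<Rightarrow> (real^'n) set \<Rightarrow> nat \<Rightarrow> (real^'n \<Rightarrow> real) set set" where
  "Cminus p s \<Omega> m = {U \<in> Xsp p s \<Omega>. semp p s \<Omega> U \<le> eigval p s \<Omega> m * lpp p \<Omega> U}"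

definition Cplus :: "real \<Rightarrow> real \<Rightarrow> (real^'n) set \<Rightarrow> nat \<Rightarrow> (real^'n \<Rightarrow> real) set set" where
  "Cplus p s \<Omega> m = {U \<in> Xsp p s \<Omega>. semp p s \<Omega> U \<ge> eigval p s \<Omega> (Suc m) * lpp p \<Omega> U}"

end

theory Submission
  imports Defs "HOL-Library.Function_Algebras" "HOL-Library.Diagonal_Subsequence"
begin

text \<open>Upstairs on a symmetric set \<open>A\<close>, the class \<open>\<omega>\<close> of the double cover is the coboundary of an arbitrary
  odd \<open>\<int>\<^sub>2\<close>-valued function, so the index is governed by the relation \<open>eqz A q\<close>: the \<open>q\<close>-th power of
  \<open>\<omega>\<close> is, near the diagonal, the coboundary of an invariant cochain. Write \<open>G = [u]\<^sup>p\<close> and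
  \<open>L = \<integral>\<^sub>\<Omega> \<bar>u\<bar>\<^sup>p\<close>. The resolvent sending \<open>u\<close> to the minimiser of \<open>v \<mapsto> G v + c L (u - v)\<close> is odd, does not
  increase the Rayleigh quotient \<open>G / L\<close>, and is compact because bounded sets of \<open>X\<close> are precompact in
  \<open>L\<^sup>p(\<Omega>)\<close>. Hence vanishing of \<open>\<omega>\<^sup>q\<close> on \<open>{G \<le> \<lambda>\<^sub>m L}\<close> extends to a neighbourhood that absorbs the
  levels slightly above \<open>\<lambda>\<^sub>m\<close>, which contradicts the definition of \<open>\<lambda>\<^sub>m\<close> for \<open>q = m - 1\<close>; this is the
  lower bound. For the upper bound, if \<open>\<omega>\<^sup>m\<close> does not vanish on the open cone \<open>{G < \<lambda>\<^sub>m\<^sub>+\<^sub>1 L}\<close>, then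
  by iterated barycentric subdivision and the compactness of products of finite sets it does not
  vanish on some compact symmetric subset, which contradicts the definition of \<open>\<lambda>\<^sub>m\<^sub>+\<^sub>1\<close>.\<close>

subsection \<open>Cochains and double covers\<close>

text \<open>The index refers to two unspecified objects, the generator \<open>omega_RP\<close> and
  an odd continuous map into the infinite sphere. Both are removed once and for all. A nontrivial
  cocycle of degree one on the projective space is, near each point of the sphere, the coboundary of
  an odd function; composed with an odd map this is an odd function on \<open>A\<close>, and any two
  odd functions there differ by an even one, hence give the same class. What remains is that the
  cones admit some odd map at all. Continuity into the weak topology of the sphere is manageable for
  maps with values in one finite-dimensional subspace, and the resolvent provides such a map: its
  image is totally bounded and stays away from zero, so finitely many odd bump functions detect it.
  The other obstacle is that the cones are not compact, so the vanishing of a class does not by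
  itself pass to limits of sets. For sublevels shrinking to a closed cone the resolvent supplies the
  compactness. For an open cone, a primitive has to satisfy infinitely many conditions, but each
  reads only finitely many bits, so an obstruction already sits on finitely many small
  simplices.\<close>

declare add_bit_eq_xor [simp del] mult_bit_eq_and [simp del]

lemma bit_add_self [simp]: "(a::bit) + a = 0"
  by (cases a) auto

lemma bit_add_left_cancel [simp]: "(a::bit) + (a + b) = b"
  by (cases a; cases b) auto

lemma bit_add_eq_0_iff: "(a::bit) + b = 0 \<longleftrightarrow> a = b"
  by (cases a; cases b) auto

lemma as_cobound_Nil [simp]: "as_cobound \<phi> [] = 0"
  by (simp add: as_cobound_def)

text \<open>Modulo two all signs disappear, and the coboundary obeys a recursion in the first entry:
  delete it, or keep it as a cone point and delete a later one. The inductions over tuples rest on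
  this.\<close>

lemma as_cobound_Cons: "as_cobound \<phi> (x # ys) = \<phi> ys + as_cobound (\<lambda>t. \<phi> (x # t)) ys"
  unfolding as_cobound_def by (simp add: sum.lessThan_Suc_shift del: sum.lessThan_Suc)

lemma as_cobound_add: "as_cobound (\<lambda>t. \<phi> t + \<psi> t) ys = as_cobound \<phi> ys + as_cobound \<psi> ys"
  unfolding as_cobound_def by (simp add: sum.distrib)

lemma as_cobound_mult: "as_cobound (\<lambda>t. c * \<phi> t) ys = c * as_cobound \<phi> ys"
  unfolding as_cobound_def by (simp add: sum_distrib_left)

lemma as_cobound_zero [simp]: "as_cobound (\<lambda>t. 0) ys = 0"
  unfolding as_cobound_def by simp

lemma as_cobound_cobound [simp]: "as_cobound (as_cobound \<phi>) ys = 0"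
proof (induction ys arbitrary: \<phi>)
  case (Cons x ys)
  have "as_cobound (as_cobound \<phi>) (x # ys)
      = as_cobound \<phi> ys + as_cobound (\<lambda>t. \<phi> t + as_cobound (\<lambda>t. \<phi> (x # t)) t) ys"
    by (simp add: as_cobound_Cons)
  also have "\<dots> = 0" using Cons by (simp add: as_cobound_add)
  finally show ?case .
qed simp

lemma as_cobound_map: "as_cobound (\<lambda>t. \<phi> (map f t)) ys = as_cobound \<phi> (map f ys)"
  unfolding as_cobound_def by (simp add: take_map drop_map)

lemma as_cobound_cong:
  assumes "\<And>t. length ys = Suc (length t) \<Longrightarrow> set t \<subseteq> set ys \<Longrightarrow> \<phi> t = \<psi> t"
  shows "as_cobound \<phi> ys = as_cobound \<psi> ys"
  unfolding as_cobound_def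
proof (rule sum.cong)
  fix i assume i: "i \<in> {..<length ys}"
  have "set (take i ys @ drop (Suc i) ys) \<subseteq> set ys"
    by (auto dest: in_set_takeD in_set_dropD)
  then show "\<phi> (take i ys @ drop (Suc i) ys) = \<psi> (take i ys @ drop (Suc i) ys)"
    using i by (intro assms) auto
qed simp

text \<open>The cup power of the coboundary of \<open>s\<close>, with the empty product 1 on a
  single point. The value 0 on the empty list makes the coboundary vanish on single points as
  well.\<close>

fun wp :: "('a \<Rightarrow> bit) \<Rightarrow> 'a cochain" where
  "wp s [] = 0"
| "wp s [x] = 1"
| "wp s (x # y # zs) = (s x + s y) * wp s (y # zs)"

lemma as_cobound_wp [simp]: "as_cobound (wp s) ys = 0"
proof (induction ys rule: induct_list012)
  case (3 x y zs)
  have IH: "as_cobound (\<lambda>t. wp s (y # t)) zs = wp s zs"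
    using 3(2) by (simp add: as_cobound_Cons bit_add_eq_0_iff)
  have "as_cobound (wp s) (x # y # zs) = wp s (y # zs) + (wp s (x # zs) + (s x + s y) * wp s zs)"
    using IH by (simp add: as_cobound_Cons as_cobound_mult)
  also have "\<dots> = 0" by (cases zs) (auto simp: algebra_simps)
  finally show ?case .
qed (auto simp: as_cobound_Cons)

text \<open>Unfolded, this is the sum over the entries \<open>x\<close> of a tuple of three factors:
  \<open>wp s\<close> up to \<open>x\<close>, then \<open>s x + s' x\<close>, then
  \<open>wp s'\<close> from \<open>x\<close> on. It is the standard homotopy between the powers of
  two cohomologous cocycles, and it is invariant when \<open>s\<close> and \<open>s'\<close> are
  both odd.\<close>

fun wp_homotopy :: "('a \<Rightarrow> bit) \<Rightarrow> ('a \<Rightarrow> bit) \<Rightarrow> 'a cochain" where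
  "wp_homotopy s s' [] = 0"
| "wp_homotopy s s' [x] = s x + s' x"
| "wp_homotopy s s' (x # y # zs) =
     (s x + s' x) * wp s' (x # y # zs) + (s x + s y) * wp_homotopy s s' (y # zs)"

lemma as_cobound_wp_homotopy: "as_cobound (wp_homotopy s s') ys = wp s ys + wp s' ys"
proof (induction ys rule: induct_list012)
  case (3 x y zs)
  have IH: "as_cobound (\<lambda>t. wp_homotopy s s' (y # t)) zs
      = wp s (y # zs) + wp s' (y # zs) + wp_homotopy s s' zs"
    using 3(2) by (simp add: as_cobound_Cons) (metis add.commute bit_add_left_cancel)
  have "as_cobound (wp s') (y # zs) = 0" by simp
  then have W: "as_cobound (\<lambda>t. wp s' (y # t)) zs = wp s' zs"
    by (simp add: as_cobound_Cons bit_add_eq_0_iff del: as_cobound_wp)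
  have eq: "as_cobound (wp_homotopy s s') (x # y # zs)
     = wp_homotopy s s' (y # zs) + (wp_homotopy s s' (x # zs)
       + ((s x + s' x) * ((s' x + s' y) * wp s' zs)
       + (s x + s y) * (wp s (y # zs) + wp s' (y # zs) + wp_homotopy s s' zs)))"
    by (simp add: as_cobound_Cons as_cobound_add as_cobound_mult IH W)
  show ?case
  proof (cases zs)
    case Nil
    then show ?thesis unfolding eq by (simp add: algebra_simps)
  next
    case (Cons z r)
    show ?thesis unfolding eq unfolding Cons
      by (cases "s x"; cases "s y"; cases "s z"; cases "s' x"; cases "s' y"; cases "s' z")
        (simp_all add: algebra_simps)
  qed
qed (auto simp: as_cobound_Cons)

text \<open>The cup product of the coboundary of \<open>s\<close> with \<open>\<psi>\<close>; it
  carries a primitive of one power of the class to a primitive of the next.\<close>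

fun wp_cup :: "('a \<Rightarrow> bit) \<Rightarrow> 'a cochain \<Rightarrow> 'a cochain" where
  "wp_cup s \<psi> [] = 0"
| "wp_cup s \<psi> [x] = 0"
| "wp_cup s \<psi> (x # y # zs) = (s x + s y) * \<psi> (y # zs)"

lemma as_cobound_wp_cup:
  assumes "\<psi> [] = 0"
  shows "as_cobound (wp_cup s \<psi>) (x # y # zs) = (s x + s y) * as_cobound \<psi> (y # zs)"
proof (cases zs)
  case Nil
  then show ?thesis using assms by (simp add: as_cobound_Cons)
next
  case (Cons z r)
  show ?thesis
    unfolding Cons by (simp add: as_cobound_Cons as_cobound_mult as_cobound_add algebra_simps)
qed

lemma wp_map: "wp s (map f ys) = wp (\<lambda>x. s (f x)) ys"
  by (induction ys rule: induct_list012) auto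

lemma wp_cong: "(\<And>x. x \<in> set ys \<Longrightarrow> s x = s' x) \<Longrightarrow> wp s ys = wp s' ys"
  by (induction ys rule: induct_list012) auto

lemma wp_shift: "wp (\<lambda>x. s x + 1) ys = wp s ys"
  by (induction ys rule: induct_list012) (auto simp: algebra_simps)

lemma wp_neg:
  assumes "\<And>x. x \<in> set ys \<Longrightarrow> s (ng x) = s x + 1"
  shows "wp s (map ng ys) = wp s ys"
  using assms wp_cong[of ys "\<lambda>x. s (ng x)" "\<lambda>x. s x + 1"] by (simp add: wp_map wp_shift)

lemma wp_homotopy_neg:
  assumes "\<And>x. x \<in> set ys \<Longrightarrow> s (ng x) = s x + 1" "\<And>x. x \<in> set ys \<Longrightarrow> s' (ng x) = s' x + 1"
  shows "wp_homotopy s s' (map ng ys) = wp_homotopy s s' ys"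
  using assms
proof (induction ys rule: induct_list012)
  case (3 x y zs)
  have "wp s' (map ng (x # y # zs)) = wp s' (x # y # zs)" using 3 by (intro wp_neg) auto
  then show ?case using 3 by (simp add: algebra_simps)
qed (auto simp: algebra_simps)

text \<open>\<open>eqze d ng A q e\<close> says that the \<open>q\<close>-th power of the characteristic class of the double
  cover \<open>A \<rightarrow> A/ng\<close> vanishes. Cochains on the orbit space are represented by \<open>ng\<close>-invariant
  cochains on \<open>A\<close>; upstairs the class is the coboundary of any odd function \<open>s\<close>, and \<open>wp s\<close>
  is the product of its translates. The radii \<open>e\<close> describe the open cover.\<close>

definition eqze :: "('a \<Rightarrow> 'a \<Rightarrow> real) \<Rightarrow> ('a \<Rightarrow> 'a) \<Rightarrow> 'a set \<Rightarrow> nat \<Rightarrow> ('a \<Rightarrow> real) \<Rightarrow> bool" where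
  "eqze d ng A q e \<longleftrightarrow> (\<forall>x\<in>A. 0 < e x) \<and>
     (\<exists>s \<psi>. (\<forall>x\<in>A. s (ng x) = s x + 1) \<and> \<psi> [] = 0 \<and>
        (\<forall>xs. set xs \<subseteq> A \<longrightarrow> \<psi> (map ng xs) = \<psi> xs) \<and>
        (\<forall>x\<in>A. \<forall>ys. length ys = Suc q \<and> set ys \<subseteq> A \<and> (\<forall>y\<in>set ys. d x y < e x) \<longrightarrow>
            wp s ys = as_cobound \<psi> ys))"

definition eqz :: "('a \<Rightarrow> 'a \<Rightarrow> real) \<Rightarrow> ('a \<Rightarrow> 'a) \<Rightarrow> 'a set \<Rightarrow> nat \<Rightarrow> bool" where
  "eqz d ng A q \<longleftrightarrow> (\<exists>e. eqze d ng A q e)"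

lemma eqzeE:
  assumes "eqze d ng A q e"
  obtains s \<psi> where "\<And>x. x \<in> A \<Longrightarrow> 0 < e x" "\<And>x. x \<in> A \<Longrightarrow> s (ng x) = s x + 1" "\<psi> [] = 0"
    "\<And>xs. set xs \<subseteq> A \<Longrightarrow> \<psi> (map ng xs) = \<psi> xs"
    "\<And>x ys. x \<in> A \<Longrightarrow> length ys = Suc q \<Longrightarrow> set ys \<subseteq> A \<Longrightarrow> (\<And>y. y \<in> set ys \<Longrightarrow> d x y < e x) \<Longrightarrow>
        wp s ys = as_cobound \<psi> ys"
proof -
  from assms obtain s \<psi> where "\<forall>x\<in>A. 0 < e x" "\<forall>x\<in>A. s (ng x) = s x + 1" "\<psi> [] = 0"
    "\<forall>xs. set xs \<subseteq> A \<longrightarrow> \<psi> (map ng xs) = \<psi> xs"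
    "\<forall>x\<in>A. \<forall>ys. length ys = Suc q \<and> set ys \<subseteq> A \<and> (\<forall>y\<in>set ys. d x y < e x) \<longrightarrow>
            wp s ys = as_cobound \<psi> ys"
    unfolding eqze_def by (elim conjE exE) (rule that)
  then show ?thesis by (intro that[of s \<psi>]) auto
qed

lemma eqze_mono_radius:
  assumes "eqze d ng A q e" "\<And>x. x \<in> A \<Longrightarrow> 0 < e' x" "\<And>x. x \<in> A \<Longrightarrow> e' x \<le> e x"
  shows "eqze d ng A q e'"
proof (rule eqzeE[OF assms(1)])
  fix s \<psi>
  assume *: "\<And>x. x \<in> A \<Longrightarrow> s (ng x) = s x + 1" "\<psi> [] = 0"
    "\<And>xs. set xs \<subseteq> A \<Longrightarrow> \<psi> (map ng xs) = \<psi> xs"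
    "\<And>x ys. x \<in> A \<Longrightarrow> length ys = Suc q \<Longrightarrow> set ys \<subseteq> A \<Longrightarrow> (\<And>y. y \<in> set ys \<Longrightarrow> d x y < e x) \<Longrightarrow>
        wp s ys = as_cobound \<psi> ys"
  show ?thesis
    unfolding eqze_def
  proof (intro conjI exI[of _ s] exI[of _ \<psi>] ballI allI impI)
    fix x ys assume "x \<in> A" "length ys = Suc q \<and> set ys \<subseteq> A \<and> (\<forall>y\<in>set ys. d x y < e' x)"
    then show "wp s ys = as_cobound \<psi> ys"
      using assms(3)[of x] by (intro *(4)[of x]) fastforce+
  qed (use assms * in auto)
qed

text \<open>Two odd functions differ by an even one, so their powers differ by the coboundary of the
  invariant cochain \<open>wp_homotopy\<close>. This permits prescribing the odd function from
  outside, for instance one pulled back from the sphere, without changing the radii.\<close>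

lemma eqze_section:
  assumes "eqze d ng A q e" and s': "\<And>x. x \<in> A \<Longrightarrow> s' (ng x) = s' x + 1"
  obtains \<psi> where "\<psi> [] = 0" "\<And>xs. set xs \<subseteq> A \<Longrightarrow> \<psi> (map ng xs) = \<psi> xs"
    "\<And>x ys. x \<in> A \<Longrightarrow> length ys = Suc q \<Longrightarrow> set ys \<subseteq> A \<Longrightarrow> (\<And>y. y \<in> set ys \<Longrightarrow> d x y < e x) \<Longrightarrow>
        wp s' ys = as_cobound \<psi> ys"
proof -
  from assms(1) obtain s \<psi> where s: "\<And>x. x \<in> A \<Longrightarrow> s (ng x) = s x + 1" and 0: "\<psi> [] = 0"
    and inv: "\<And>xs. set xs \<subseteq> A \<Longrightarrow> \<psi> (map ng xs) = \<psi> xs"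
    and eq: "\<And>x ys. x \<in> A \<Longrightarrow> length ys = Suc q \<Longrightarrow> set ys \<subseteq> A \<Longrightarrow> (\<And>y. y \<in> set ys \<Longrightarrow> d x y < e x) \<Longrightarrow>
        wp s ys = as_cobound \<psi> ys"
    by (rule eqzeE) blast
  show ?thesis
  proof (rule that[of "\<lambda>t. \<psi> t + wp_homotopy s s' t"])
    show "\<psi> (map ng xs) + wp_homotopy s s' (map ng xs) = \<psi> xs + wp_homotopy s s' xs"
      if "set xs \<subseteq> A" for xs
      using inv[OF that] wp_homotopy_neg[of xs s ng s'] s s' that by (auto simp: subset_iff)
    show "wp s' ys = as_cobound (\<lambda>t. \<psi> t + wp_homotopy s s' t) ys"
      if "x \<in> A" "length ys = Suc q" "set ys \<subseteq> A" "\<And>y. y \<in> set ys \<Longrightarrow> d x y < e x" for x ys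
      using eq[OF that] by (simp add: as_cobound_add as_cobound_wp_homotopy add.assoc[symmetric])
  qed (simp add: 0)
qed

text \<open>Multiplying a primitive by the class gives a primitive of the next power. The surviving
  powers therefore form an initial segment, and the supremum in the index can be tested at one
  exponent.\<close>

lemma eqz_Suc:
  assumes "eqz d ng A q" and ng: "\<And>x. x \<in> A \<Longrightarrow> ng x \<in> A"
  shows "eqz d ng A (Suc q)"
proof -
  from assms obtain e s \<psi> where e: "\<And>x. x \<in> A \<Longrightarrow> e x > 0" and s: "\<And>x. x \<in> A \<Longrightarrow> s (ng x) = s x + 1" and 0: "\<psi> [] = 0"
    and inv: "\<And>xs. set xs \<subseteq> A \<Longrightarrow> \<psi> (map ng xs) = \<psi> xs"
    and eq: "\<And>x ys. x \<in> A \<Longrightarrow> length ys = Suc q \<Longrightarrow> set ys \<subseteq> A \<Longrightarrow> (\<And>y. y \<in> set ys \<Longrightarrow> d x y < e x) \<Longrightarrow>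
        wp s ys = as_cobound \<psi> ys"
    unfolding eqz_def by (elim exE, elim eqzeE) blast
  have "eqze d ng A (Suc q) e"
    unfolding eqze_def
  proof (intro conjI exI[of _ s] exI[of _ "wp_cup s \<psi>"] ballI allI impI)
    fix xs assume xs: "set xs \<subseteq> A"
    show "wp_cup s \<psi> (map ng xs) = wp_cup s \<psi> xs"
    proof (cases "(s, \<psi>, xs)" rule: wp_cup.cases)
      case (3 s' \<psi>' x y zs)
      then have "\<psi> (map ng (y # zs)) = \<psi> (y # zs)" using xs by (intro inv) auto
      then show ?thesis using s[of x] s[of y] 3 xs by (simp add: algebra_simps)
    qed auto
  next
    fix x ys assume x: "x \<in> A" and ys: "length ys = Suc (Suc q) \<and> set ys \<subseteq> A \<and> (\<forall>y\<in>set ys. d x y < e x)"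
    then obtain a b zs where "ys = a # b # zs" by (metis length_Suc_conv)
    then show "wp s ys = as_cobound (wp_cup s \<psi>) ys"
      using eq[OF x, of "b # zs"] ys by (simp add: as_cobound_wp_cup[of \<psi>, OF 0])
  qed (use e s in auto)
  then show ?thesis unfolding eqz_def by blast
qed

lemma eqz_le:
  assumes "eqz d ng A q" "q \<le> r" and ng: "\<And>x. x \<in> A \<Longrightarrow> ng x \<in> A"
  shows "eqz d ng A r"
  using assms(2,1) by (induction r rule: dec_induct) (auto intro: eqz_Suc ng)

lemma eqze_pull:
  assumes A: "eqze dA ngA A q e"
    and f: "\<And>y. y \<in> B \<Longrightarrow> f y \<in> A" "\<And>y. y \<in> B \<Longrightarrow> f (ngB y) = ngA (f y)"
    and loc: "\<And>y. y \<in> B \<Longrightarrow> \<exists>\<delta>>0. \<exists>x\<in>A. \<forall>z\<in>B. dB y z < \<delta> \<longrightarrow> dA x (f z) < e x"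
  shows "eqz dB ngB B q"
proof -
  from A obtain s \<psi> where s: "\<And>x. x \<in> A \<Longrightarrow> s (ngA x) = s x + 1" and 0: "\<psi> [] = 0"
    and inv: "\<And>xs. set xs \<subseteq> A \<Longrightarrow> \<psi> (map ngA xs) = \<psi> xs"
    and eq: "\<And>x ys. x \<in> A \<Longrightarrow> length ys = Suc q \<Longrightarrow> set ys \<subseteq> A \<Longrightarrow> (\<And>y. y \<in> set ys \<Longrightarrow> dA x y < e x) \<Longrightarrow>
        wp s ys = as_cobound \<psi> ys"
    by (rule eqzeE) blast
  from loc obtain \<delta> x where \<delta>: "\<And>y. y \<in> B \<Longrightarrow> \<delta> y > 0 \<and> x y \<in> A \<and> (\<forall>z\<in>B. dB y z < \<delta> y \<longrightarrow> dA (x y) (f z) < e (x y))"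
    by metis
  have "eqze dB ngB B q \<delta>"
    unfolding eqze_def
  proof (intro conjI exI[of _ "\<lambda>y. s (f y)"] exI[of _ "\<lambda>t. \<psi> (map f t)"] ballI allI impI)
    fix xs assume xs: "set xs \<subseteq> B"
    have "map f (map ngB xs) = map ngA (map f xs)" using xs f by auto
    then show "\<psi> (map f (map ngB xs)) = \<psi> (map f xs)"
      using inv[of "map f xs"] xs f by (metis (no_types, lifting) image_subset_iff list.set_map subset_iff)
  next
    fix y ys assume y: "y \<in> B" and ys: "length ys = Suc q \<and> set ys \<subseteq> B \<and> (\<forall>z\<in>set ys. dB y z < \<delta> y)"
    have "wp s (map f ys) = as_cobound \<psi> (map f ys)"
      using \<delta>[OF y] ys f by (intro eq[of "x y"]) auto
    then show "wp (\<lambda>y. s (f y)) ys = as_cobound (\<lambda>t. \<psi> (map f t)) ys"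
      by (simp add: as_cobound_map wp_map)
  qed (use \<delta> s f 0 in auto)
  then show ?thesis unfolding eqz_def by blast
qed

lemma eqz_pull:
  assumes A: "eqz dA ngA A q"
    and f: "\<And>y. y \<in> B \<Longrightarrow> f y \<in> A" "\<And>y. y \<in> B \<Longrightarrow> f (ngB y) = ngA (f y)"
    and cont: "\<And>y e. y \<in> B \<Longrightarrow> e > 0 \<Longrightarrow> \<exists>\<delta>>0. \<forall>z\<in>B. dB y z < \<delta> \<longrightarrow> dA (f y) (f z) < e"
  shows "eqz dB ngB B q"
proof -
  from A obtain e where e: "eqze dA ngA A q e" unfolding eqz_def by blast
  then have "\<And>x. x \<in> A \<Longrightarrow> e x > 0" unfolding eqze_def by blast
  then show ?thesis
    by (intro eqze_pull[OF e, where f = f]) (use cont f in blast)+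
qed

lemma odd_bit_exists:
  assumes "\<And>x. x \<in> A \<Longrightarrow> ng x \<in> A" "\<And>x. x \<in> A \<Longrightarrow> ng (ng x) = x" "\<And>x. x \<in> A \<Longrightarrow> ng x \<noteq> x"
  obtains s :: "'a \<Rightarrow> bit" where "\<And>x. x \<in> A \<Longrightarrow> s (ng x) = s x + 1"
proof -
  \<comment> \<open>The choice depends only on the unordered pair, so both points of an orbit
    receive the same representative.\<close>
  define c where "c = (\<lambda>x. SOME y. y \<in> {x, ng x})"
  define s where "s = (\<lambda>x. if c x = x then 0 else (1::bit))"
  have "s (ng x) = s x + 1" if "x \<in> A" for x
  proof -
    have "{ng x, ng (ng x)} = {x, ng x}" using assms that by auto
    then have "c (ng x) = c x" unfolding c_def by simp
    moreover have "c x \<in> {x, ng x}" unfolding c_def by (rule someI[of _ x]) simp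
    ultimately show ?thesis using assms(3)[OF that] unfolding s_def by auto
  qed
  then show ?thesis using that by blast
qed

text \<open>An odd bit function singles out one point in each orbit; choose there and transport the
  choice by the involution. This is how resolvents, nearest points and representatives are selected
  equivariantly.\<close>

lemma odd_choice:
  assumes ng: "\<And>x. x \<in> B \<Longrightarrow> ng x \<in> B" "\<And>x. x \<in> B \<Longrightarrow> ng (ng x) = x" "\<And>x. x \<in> B \<Longrightarrow> ng x \<noteq> x"
    and ex: "\<And>x. x \<in> B \<Longrightarrow> \<exists>v. P x v"
    and sym: "\<And>x v. x \<in> B \<Longrightarrow> P x v \<Longrightarrow> P (ng x) (ng' v)"
    and inv: "\<And>x v. x \<in> B \<Longrightarrow> P x v \<Longrightarrow> ng' (ng' v) = v"
  obtains f where "\<And>x. x \<in> B \<Longrightarrow> P x (f x)" "\<And>x. x \<in> B \<Longrightarrow> f (ng x) = ng' (f x)"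
proof -
  obtain s :: "'a \<Rightarrow> bit" where s: "\<And>x. x \<in> B \<Longrightarrow> s (ng x) = s x + 1"
    using odd_bit_exists[of B ng] ng by blast
  obtain f0 where f0: "\<And>x. x \<in> B \<Longrightarrow> P x (f0 x)" using ex by metis
  define f where "f = (\<lambda>x. if s x = 0 then f0 x else ng' (f0 (ng x)))"
  show ?thesis
  proof (rule that[of f])
    fix x assume x: "x \<in> B"
    show "P x (f x)" unfolding f_def using f0 x sym[OF _ f0, of "ng x"] ng by auto
    show "f (ng x) = ng' (f x)"
      unfolding f_def using s[OF x] inv[OF _ f0, of "ng x"] x ng by (cases "s x") auto
  qed
qed

text \<open>Tautness: the class is pulled back along a map that sends each point of the
  neighbourhood to some nearby point of \<open>C\<close>. No continuous retraction is available, so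
  the map is an arbitrary equivariant choice, and the radii are tuned to make
  \<open>eqze_pull\<close> applicable.\<close>

lemma eqz_neighbourhood:
  fixes d :: "'a \<Rightarrow> 'a \<Rightarrow> real"
  assumes tri: "\<And>x y z. x \<in> M \<Longrightarrow> y \<in> M \<Longrightarrow> z \<in> M \<Longrightarrow> d x z \<le> d x y + d y z"
    and sym: "\<And>x y. x \<in> M \<Longrightarrow> y \<in> M \<Longrightarrow> d x y = d y x"
    and ng: "\<And>x. x \<in> M \<Longrightarrow> ng x \<in> M" "\<And>x. x \<in> M \<Longrightarrow> ng (ng x) = x"
    and iso: "\<And>x y. x \<in> M \<Longrightarrow> y \<in> M \<Longrightarrow> d (ng x) (ng y) = d x y"
    and C: "C \<subseteq> M" "\<And>x. x \<in> C \<Longrightarrow> ng x \<in> C" "\<And>x. x \<in> C \<Longrightarrow> d x (ng x) > 0"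
    and z: "eqz d ng C q"
  obtains r where "\<And>x. x \<in> C \<Longrightarrow> r x > 0" "eqz d ng {y\<in>M. \<exists>x\<in>C. d x y < r x} q"
proof -
  obtain e0 where e0: "eqze d ng C q e0" using z unfolding eqz_def by blast
  then have e0pos: "\<And>x. x \<in> C \<Longrightarrow> e0 x > 0" unfolding eqze_def by blast
  \<comment> \<open>Symmetric under \<open>ng\<close>, so that the neighbourhood is symmetric; at
    most 1, so that suprema of radii exist; at most the distance to the antipode, so that the
    neighbourhood contains no fixed point.\<close>
  define e where "e = (\<lambda>x. min (min (e0 x) (e0 (ng x))) (min 1 (d x (ng x))))"
  have e: "eqze d ng C q e"
    by (rule eqze_mono_radius[OF e0]) (use e0pos C in \<open>auto simp: e_def\<close>)
  define r where "r = (\<lambda>x. e x / 8)"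
  have rpos: "r x > 0" if "x \<in> C" for x using that e0pos C unfolding r_def e_def by auto
  have r1: "r x \<le> 1" for x unfolding r_def e_def by auto
  have rd: "r x \<le> d x (ng x) / 8" for x unfolding r_def e_def by auto
  have rng: "r (ng x) = r x" if "x \<in> C" for x
  proof -
    have "x \<in> M" using that C by auto
    then have "ng (ng x) = x" "d (ng x) x = d x (ng x)" using ng sym by auto
    then show ?thesis unfolding r_def e_def by (simp add: min.commute)
  qed
  define N where "N = {y\<in>M. \<exists>x\<in>C. d x y < r x}"
  have Nng: "ng y \<in> N" if "y \<in> N" for y
  proof -
    from that obtain x where x: "x \<in> C" "d x y < r x" "y \<in> M" unfolding N_def by auto
    then have "d (ng x) (ng y) < r (ng x)" using iso rng C by auto
    then show ?thesis unfolding N_def using x C ng by auto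
  qed
  have Nfree: "ng y \<noteq> y" if "y \<in> N" for y
  proof
    assume eq: "ng y = y"
    from that obtain x where x: "x \<in> C" "d x y < r x" "y \<in> M" unfolding N_def by auto
    then have xM: "x \<in> M" "ng x \<in> M" using C ng by auto
    have "d x (ng x) \<le> d x y + d y (ng x)" using tri xM x by auto
    also have "d y (ng x) = d (ng y) (ng x)" using eq by simp
    also have "\<dots> = d x y" using iso sym xM x by auto
    finally show False using x rd[of x] C(3)[of x] by linarith
  qed
  obtain \<rho> where \<rho>: "\<And>y. y \<in> N \<Longrightarrow> \<rho> y \<in> C \<and> d (\<rho> y) y < r (\<rho> y)"
    and \<rho>ng: "\<And>y. y \<in> N \<Longrightarrow> \<rho> (ng y) = ng (\<rho> y)"
  proof (rule odd_choice[of N ng "\<lambda>y x. x \<in> C \<and> d x y < r x" ng])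
    show "\<And>x. x \<in> N \<Longrightarrow> ng (ng x) = x" using ng unfolding N_def by auto
    show "\<exists>v. v \<in> C \<and> d v x < r v" if "x \<in> N" for x using that unfolding N_def by auto
    show "ng v \<in> C \<and> d (ng v) (ng x) < r (ng v)" if "x \<in> N" "v \<in> C \<and> d v x < r v" for x v
      using that iso rng C unfolding N_def by auto
    show "ng (ng v) = v" if "x \<in> N" "v \<in> C \<and> d v x < r v" for x v using that C ng by auto
  qed (use Nng Nfree in auto)
  have "eqz d ng N q"
  proof (rule eqze_pull[OF e, of N \<rho>])
    fix y assume y: "y \<in> N"
    define \<delta> where "\<delta> = r (\<rho> y)"
    have \<delta>: "\<delta> > 0" using \<rho>[OF y] rpos unfolding \<delta>_def by auto
    have yM: "y \<in> M" using y unfolding N_def by auto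
    define Z where "Z = {z\<in>N. d y z < \<delta>}"
    have yy: "d (\<rho> y) y < \<delta>" unfolding \<delta>_def using \<rho>[OF y] by auto
    show "\<exists>\<delta>>0. \<exists>x\<in>C. \<forall>z\<in>N. d y z < \<delta> \<longrightarrow> d x (\<rho> z) < e x"
    proof (cases "Z = {}")
      case True
      then show ?thesis using \<delta> \<rho>[OF y] unfolding Z_def by blast
    next
      case False
      have bdd: "bdd_above ((\<lambda>z. max \<delta> (r (\<rho> z))) ` Z)" by (rule bdd_aboveI[of _ 1]) (auto simp: r1 \<delta>_def)
      \<comment> \<open>Centres with very different radii may compete near \<open>y\<close>. One
        centre \<open>x\<close> whose radius exceeds half of the supremum dominates them all: its
        distance to any \<open>\<rho> z\<close> is below \<open>3 * r x + 2 * r x + 2 * r x\<close>,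
        which is less than \<open>8 * r x = e x\<close>. This is the origin of the factor 8 in
        \<open>r\<close>.\<close>
      define S where "S = (SUP z\<in>Z. max \<delta> (r (\<rho> z)))"
      have S: "max \<delta> (r (\<rho> z)) \<le> S" if "z \<in> Z" for z unfolding S_def by (rule cSUP_upper[OF that bdd])
      obtain z where "z \<in> Z" using False by auto
      with S[OF this] \<delta> have "S > 0" by linarith
      then have "S / 2 < S" by simp
      then obtain z0 where z0: "z0 \<in> Z" "S / 2 < max \<delta> (r (\<rho> z0))"
        unfolding S_def using less_cSUP_iff[OF False bdd] by blast
      obtain x where x: "x \<in> C" "S / 2 < r x" "d x y < 3 * r x"
      proof (cases "r (\<rho> z0) \<le> \<delta>")
        case True
        show ?thesis by (rule that[of "\<rho> y"]) (use True z0 \<rho>[OF y] yy rpos[of "\<rho> y"] in \<open>auto simp: \<delta>_def\<close>)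
      next
        case F: False
        have z0N: "z0 \<in> N" "z0 \<in> M" "d y z0 < \<delta>" using z0 unfolding Z_def N_def by auto
        have xM: "\<rho> z0 \<in> M" using \<rho>[OF z0N(1)] C by auto
        have "d (\<rho> z0) y \<le> d (\<rho> z0) z0 + d z0 y" using tri z0N xM yM by auto
        then have "d (\<rho> z0) y < 3 * r (\<rho> z0)"
          using \<rho>[OF z0N(1)] F z0N sym[OF yM z0N(2)] \<delta> by linarith
        then show ?thesis using that[of "\<rho> z0"] \<rho>[OF z0N(1)] F z0 by auto
      qed
      have xM: "x \<in> M" using x C by auto
      have "d x (\<rho> z) < e x" if "z \<in> N" "d y z < \<delta>" for z
      proof -
        have zZ: "z \<in> Z" "z \<in> M" using that unfolding Z_def N_def by auto
        have zM: "\<rho> z \<in> M" using \<rho>[OF that(1)] C by auto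
        have "d x (\<rho> z) \<le> d x y + d y (\<rho> z)" using tri xM yM zM by auto
        also have "d y (\<rho> z) \<le> d y z + d z (\<rho> z)" using tri zZ yM zM by auto
        also have "d z (\<rho> z) < r (\<rho> z)" using \<rho>[OF that(1)] sym[OF zZ(2) zM] by auto
        finally show ?thesis using S[OF zZ(1)] x that rpos[OF x(1)] unfolding r_def by auto
      qed
      then show ?thesis using \<delta> x by blast
    qed
  qed (use \<rho> \<rho>ng in auto)
  then show ?thesis using that[of r] rpos unfolding N_def by blast
qed

section \<open>Function spaces and seminorms on subspaces\<close>

instantiation "fun" :: (type, real_vector) real_vector
begin

definition scaleR_fun :: "real \<Rightarrow> ('a \<Rightarrow> 'b) \<Rightarrow> 'a \<Rightarrow> 'b" where
  "scaleR_fun c f = (\<lambda>x. c *\<^sub>R f x)"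

instance
  by standard (auto simp: scaleR_fun_def fun_eq_iff algebra_simps)

end

lemma scaleR_fun_apply [simp]: "(c *\<^sub>R f) x = c *\<^sub>R f x"
  by (simp add: scaleR_fun_def)

text \<open>A seminorm on a subspace, so that it applies to \<open>X\<close> before functions equal
  almost everywhere are identified.\<close>

locale seminormed =
  fixes E :: "'a::real_vector set" and N :: "'a \<Rightarrow> real"
  assumes sub: "subspace E"
    and tri: "\<And>x y. x \<in> E \<Longrightarrow> y \<in> E \<Longrightarrow> N (x + y) \<le> N x + N y"
    and hom: "\<And>x c. x \<in> E \<Longrightarrow> N (c *\<^sub>R x) = \<bar>c\<bar> * N x"
begin

lemma E_simps [simp, intro]:
  "0 \<in> E" "x \<in> E \<Longrightarrow> y \<in> E \<Longrightarrow> x + y \<in> E" "x \<in> E \<Longrightarrow> y \<in> E \<Longrightarrow> x - y \<in> E"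
  "x \<in> E \<Longrightarrow> c *\<^sub>R x \<in> E" "x \<in> E \<Longrightarrow> - x \<in> E"
  using sub by (auto intro: subspace_0 subspace_add subspace_diff subspace_scale subspace_neg)

lemma N_0 [simp]: "N 0 = 0"
  using hom[of 0 0] by simp

lemma N_minus [simp]: "x \<in> E \<Longrightarrow> N (- x) = N x"
  using hom[of x "-1"] by simp

lemma N_nonneg: "x \<in> E \<Longrightarrow> 0 \<le> N x"
  using tri[of x "- x"] by auto

lemma N_diff_commute: "x \<in> E \<Longrightarrow> y \<in> E \<Longrightarrow> N (x - y) = N (y - x)"
  using N_minus[of "x - y"] by auto

lemma N_tri_diff: "x \<in> E \<Longrightarrow> y \<in> E \<Longrightarrow> z \<in> E \<Longrightarrow> N (x - z) \<le> N (x - y) + N (y - z)"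
  using tri[of "x - y" "y - z"] by auto

lemma N_le: "x \<in> E \<Longrightarrow> y \<in> E \<Longrightarrow> N x \<le> N y + N (x - y)"
  using tri[of y "x - y"] by auto

lemma N_abs_diff: "x \<in> E \<Longrightarrow> y \<in> E \<Longrightarrow> \<bar>N x - N y\<bar> \<le> N (x - y)"
  using N_le[of x y] N_le[of y x] N_diff_commute[of x y] by auto

end

section \<open>Cocycles on segments and star-shaped sets\<close>

lemma locally_constant_unit_interval:
  fixes f :: "real \<Rightarrow> 'b"
  assumes "\<And>t. 0 \<le> t \<Longrightarrow> t \<le> 1 \<Longrightarrow> \<exists>\<delta>>0. \<forall>t'. 0 \<le> t' \<and> t' \<le> 1 \<and> \<bar>t' - t\<bar> < \<delta> \<longrightarrow> f t' = f t"
  shows "f 0 = f 1"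
proof -
  have "0 \<le> (0::real) \<and> 1 \<le> (1::real) \<longrightarrow> f 0 = f 1"
  proof (rule Bolzano[of 0 1 "\<lambda>u v. 0 \<le> u \<and> v \<le> 1 \<longrightarrow> f u = f v"])
    fix x :: real assume x: "0 \<le> x" "x \<le> 1"
    obtain \<delta> where \<delta>: "\<delta> > 0" "\<And>t'. 0 \<le> t' \<and> t' \<le> 1 \<and> \<bar>t' - x\<bar> < \<delta> \<Longrightarrow> f t' = f x"
      using assms[OF x] by blast
    show "\<exists>d>0. \<forall>a b. a \<le> x \<and> x \<le> b \<and> b - a < d \<longrightarrow> 0 \<le> a \<and> b \<le> 1 \<longrightarrow> f a = f b"
    proof (intro exI[of _ \<delta>] conjI allI impI \<delta>)
      fix a b assume "a \<le> x \<and> x \<le> b \<and> b - a < \<delta>" "0 \<le> a \<and> b \<le> 1"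
      then have "f a = f x" "f b = f x" by (auto intro!: \<delta>(2))
      then show "f a = f b" by simp
    qed
  qed auto
  then show ?thesis by simp
qed

text \<open>The first cohomology of an interval vanishes. On a short interval around
  \<open>x\<close> the function \<open>\<theta> x\<close> is a primitive; primitives on adjacent
  intervals are glued after adding the constant that makes them agree at the common end, and Bolzano
  bisection globalises this.\<close>

lemma unit_interval_cocycle:
  fixes \<theta> :: "real \<Rightarrow> real \<Rightarrow> bit"
  assumes "\<And>t. 0 \<le> t \<Longrightarrow> t \<le> 1 \<Longrightarrow> \<exists>\<delta>>0. \<forall>a\<in>{0..1}. \<forall>b\<in>{0..1}. \<forall>c\<in>{0..1}.
     \<bar>a - t\<bar> < \<delta> \<and> \<bar>b - t\<bar> < \<delta> \<and> \<bar>c - t\<bar> < \<delta> \<longrightarrow> \<theta> a b + \<theta> b c + \<theta> a c = 0"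
  obtains k where "k 0 = 0"
    "\<forall>t\<in>{0..1}. \<exists>\<delta>>0. \<forall>t'\<in>{0..1}. \<bar>t' - t\<bar> < \<delta> \<longrightarrow> \<theta> t t' = k t + k t'"
proof -
  define Q where "Q = (\<lambda>u v k. \<forall>t\<in>{u..v}. \<exists>\<delta>>0. \<forall>t'\<in>{u..v}. \<bar>t' - t\<bar> < \<delta> \<longrightarrow> \<theta> t t' = k t + k t')"
  have "0 \<le> (0::real) \<and> 1 \<le> (1::real) \<longrightarrow> (\<exists>k. Q 0 1 k)"
  proof (rule Bolzano[of 0 1 "\<lambda>u v. 0 \<le> u \<and> v \<le> 1 \<longrightarrow> (\<exists>k. Q u v k)"])
    fix a b c :: real
    assume ab: "0 \<le> a \<and> b \<le> 1 \<longrightarrow> (\<exists>k. Q a b k)" and bc: "0 \<le> b \<and> c \<le> 1 \<longrightarrow> (\<exists>k. Q b c k)"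
      and le: "a \<le> b" "b \<le> c"
    show "0 \<le> a \<and> c \<le> 1 \<longrightarrow> (\<exists>k. Q a c k)"
    proof
      assume "0 \<le> a \<and> c \<le> 1"
      then obtain k1 k2 where k1: "Q a b k1" and k2: "Q b c k2" using ab bc le by auto
      define k where "k = (\<lambda>t. if t \<le> b then k1 t else k2 t + k2 b + k1 b)"
      have kb: "k t = k2 t + k2 b + k1 b" if "b \<le> t" for t
        using that unfolding k_def by (auto simp: add.assoc)
      have "Q a c k"
        unfolding Q_def
      proof
        fix t assume t: "t \<in> {a..c}"
        consider "t < b" | "t > b" | "t = b" by linarith
        then show "\<exists>\<delta>>0. \<forall>t'\<in>{a..c}. \<bar>t' - t\<bar> < \<delta> \<longrightarrow> \<theta> t t' = k t + k t'"
        proof cases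
          case 1
          then obtain \<delta> where \<delta>: "\<delta> > 0" "\<And>t'. t' \<in> {a..b} \<Longrightarrow> \<bar>t' - t\<bar> < \<delta> \<Longrightarrow> \<theta> t t' = k1 t + k1 t'"
            using k1 t unfolding Q_def by (metis atLeastAtMost_iff less_eq_real_def)
          show ?thesis
            by (rule exI[of _ "min \<delta> (b - t)"]) (use \<delta> 1 in \<open>auto simp: k_def\<close>)
        next
          case 2
          then obtain \<delta> where \<delta>: "\<delta> > 0" "\<And>t'. t' \<in> {b..c} \<Longrightarrow> \<bar>t' - t\<bar> < \<delta> \<Longrightarrow> \<theta> t t' = k2 t + k2 t'"
            using k2 t unfolding Q_def by (metis atLeastAtMost_iff less_eq_real_def)
          show ?thesis
            by (rule exI[of _ "min \<delta> (t - b)"]) (use \<delta> 2 in \<open>auto simp: kb algebra_simps\<close>)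
        next
          case 3
          obtain \<delta>1 where \<delta>1: "\<delta>1 > 0" "\<And>t'. t' \<in> {a..b} \<Longrightarrow> \<bar>t' - t\<bar> < \<delta>1 \<Longrightarrow> \<theta> t t' = k1 t + k1 t'"
            using k1 t 3 unfolding Q_def by (metis atLeastAtMost_iff order_refl)
          obtain \<delta>2 where \<delta>2: "\<delta>2 > 0" "\<And>t'. t' \<in> {b..c} \<Longrightarrow> \<bar>t' - t\<bar> < \<delta>2 \<Longrightarrow> \<theta> t t' = k2 t + k2 t'"
            using k2 t 3 unfolding Q_def by (metis atLeastAtMost_iff order_refl)
          show ?thesis
          proof (intro exI[of _ "min \<delta>1 \<delta>2"] conjI ballI impI)
            fix t' assume t': "t' \<in> {a..c}" "\<bar>t' - t\<bar> < min \<delta>1 \<delta>2"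
            show "\<theta> t t' = k t + k t'"
            proof (cases "t' \<le> b")
              case True
              then show ?thesis using \<delta>1 t' 3 by (auto simp: k_def)
            next
              case False
              then show ?thesis using \<delta>2(2)[of t'] t' 3 by (auto simp: kb algebra_simps)
            qed
          qed (use \<delta>1 \<delta>2 in auto)
        qed
      qed
      then show "\<exists>k. Q a c k" by blast
    qed
  next
    fix x :: real assume x: "0 \<le> x" "x \<le> 1"
    obtain \<delta> where \<delta>: "\<delta> > 0" "\<forall>a\<in>{0..1}. \<forall>b\<in>{0..1}. \<forall>c\<in>{0..1}.
     \<bar>a - x\<bar> < \<delta> \<and> \<bar>b - x\<bar> < \<delta> \<and> \<bar>c - x\<bar> < \<delta> \<longrightarrow> \<theta> a b + \<theta> b c + \<theta> a c = 0"
      using assms[OF x] by blast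
    show "\<exists>d>0. \<forall>a b. a \<le> x \<and> x \<le> b \<and> b - a < d \<longrightarrow> 0 \<le> a \<and> b \<le> 1 \<longrightarrow> (\<exists>k. Q a b k)"
    proof (intro exI[of _ \<delta>] conjI allI impI \<delta>(1))
      fix a b assume ab: "a \<le> x \<and> x \<le> b \<and> b - a < \<delta>" "0 \<le> a \<and> b \<le> 1"
      have "\<theta> t t' = \<theta> x t + \<theta> x t'" if "t \<in> {a..b}" "t' \<in> {a..b}" for t t'
      proof -
        have "\<theta> x t + \<theta> t t' + \<theta> x t' = 0"
          using ab that x by (intro \<delta>(2)[rule_format]) auto
        then show ?thesis by (cases "\<theta> x t"; cases "\<theta> t t'"; cases "\<theta> x t'") auto
      qed
      then have "Q a b (\<theta> x)" unfolding Q_def by (metis zero_less_one)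
      then show "\<exists>k. Q a b k" by blast
    qed
  qed auto
  then obtain k where k: "Q 0 1 k" by auto
  show ?thesis
  proof (rule that[of "\<lambda>t. k t + k 0"])
    show "\<forall>t\<in>{0..1}. \<exists>\<delta>>0. \<forall>t'\<in>{0..1}. \<bar>t' - t\<bar> < \<delta> \<longrightarrow> \<theta> t t' = (k t + k 0) + (k t' + k 0)"
      using k unfolding Q_def by (simp add: algebra_simps)
  qed simp
qed

lemma bit_cancel_common: "a + b + c = 0 \<Longrightarrow> d + e + c = 0 \<Longrightarrow> a + b + (d + e) = (0::bit)"
  by (cases a; cases b; cases c; cases d; cases e) auto

definition segment_primitive :: "('a::real_vector \<Rightarrow> 'a \<Rightarrow> bit) \<Rightarrow> 'a \<Rightarrow> 'a \<Rightarrow> (real \<Rightarrow> bit) \<Rightarrow> bool" where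
  "segment_primitive \<phi> b x k \<longleftrightarrow> k 0 = 0 \<and> (\<forall>t\<in>{0..1}. \<exists>\<delta>>0. \<forall>t'\<in>{0..1}. \<bar>t' - t\<bar> < \<delta> \<longrightarrow>
     \<phi> ((1 - t) *\<^sub>R b + t *\<^sub>R x) ((1 - t') *\<^sub>R b + t' *\<^sub>R x) = k t + k t')"

definition segment_integral :: "('a::real_vector \<Rightarrow> 'a \<Rightarrow> bit) \<Rightarrow> 'a \<Rightarrow> 'a \<Rightarrow> bit" where
  "segment_integral \<phi> b x = (SOME k. segment_primitive \<phi> b x k) 1"

lemma (in seminormed) N_segment:
  assumes "b \<in> E" "x \<in> E"
  shows "N (((1 - t) *\<^sub>R b + t *\<^sub>R x) - ((1 - t') *\<^sub>R b + t' *\<^sub>R x)) = \<bar>t - t'\<bar> * N (x - b)"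
proof -
  have "((1 - t) *\<^sub>R b + t *\<^sub>R x) - ((1 - t') *\<^sub>R b + t' *\<^sub>R x) = (t - t') *\<^sub>R (x - b)"
    by (simp add: algebra_simps)
  then show ?thesis using assms by (simp add: hom)
qed

text \<open>A Poincare lemma: the primitive is obtained by integrating along the segments issuing
  from the centre \<open>b\<close>, and two neighbouring segments are compared through the thin
  triangles between them.\<close>

lemma (in seminormed) star_cocycle_exact:
  assumes DE: "D \<subseteq> E" and b: "b \<in> D"
    and star: "\<And>x t. x \<in> D \<Longrightarrow> 0 \<le> t \<Longrightarrow> t \<le> 1 \<Longrightarrow> (1 - t) *\<^sub>R b + t *\<^sub>R x \<in> D"
    and coc: "\<And>z. z \<in> D \<Longrightarrow> \<exists>e>0. \<forall>x\<in>D. \<forall>y\<in>D. \<forall>w\<in>D.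
        N (x - z) < e \<and> N (y - z) < e \<and> N (w - z) < e \<longrightarrow> \<phi> x y + \<phi> y w + \<phi> x w = 0"
    and z: "z \<in> D"
  shows "\<exists>e>0. \<forall>x\<in>D. N (x - z) < e \<longrightarrow> \<phi> z x = segment_integral \<phi> b z + segment_integral \<phi> b x"
proof -
  define \<gamma> where "\<gamma> = (\<lambda>x t. (1 - t) *\<^sub>R b + t *\<^sub>R x)"
  have \<gamma>D: "\<gamma> x t \<in> D" if "x \<in> D" "0 \<le> t" "t \<le> 1" for x t using star that unfolding \<gamma>_def by auto
  have \<gamma>d: "N (\<gamma> x t - \<gamma> x t') = \<bar>t - t'\<bar> * N (x - b)" if "x \<in> D" for x t t'
    unfolding \<gamma>_def using N_segment that b DE by blast
  have prim: "segment_primitive \<phi> b x (SOME k. segment_primitive \<phi> b x k)" if x: "x \<in> D" for x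
  proof -
    obtain k where "k 0 = 0"
      "\<forall>t\<in>{0..1}. \<exists>\<delta>>0. \<forall>t'\<in>{0..1}. \<bar>t' - t\<bar> < \<delta> \<longrightarrow> \<phi> (\<gamma> x t) (\<gamma> x t') = k t + k t'"
    proof (rule unit_interval_cocycle[of "\<lambda>t t'. \<phi> (\<gamma> x t) (\<gamma> x t')"])
      fix t :: real assume t: "0 \<le> t" "t \<le> 1"
      obtain e where e: "e > 0" "\<forall>u\<in>D. \<forall>y\<in>D. \<forall>w\<in>D.
        N (u - \<gamma> x t) < e \<and> N (y - \<gamma> x t) < e \<and> N (w - \<gamma> x t) < e \<longrightarrow> \<phi> u y + \<phi> y w + \<phi> u w = 0"
        using coc[OF \<gamma>D[OF x t]] by blast
      have nb: "N (x - b) \<ge> 0" using x b DE by (intro N_nonneg) auto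
      define \<delta> where "\<delta> = e / (N (x - b) + 1)"
      have \<delta>: "\<delta> > 0" "\<delta> * N (x - b) < e" using e nb unfolding \<delta>_def by (auto simp: field_simps)
      have near: "N (\<gamma> x a - \<gamma> x t) < e" if "\<bar>a - t\<bar> < \<delta>" for a
        unfolding \<gamma>d[OF x] using that \<delta> nb by (meson le_less_trans less_eq_real_def mult_right_mono)
      show "\<exists>\<delta>>0. \<forall>a\<in>{0..1}. \<forall>b\<in>{0..1}. \<forall>c\<in>{0..1}. \<bar>a - t\<bar> < \<delta> \<and> \<bar>b - t\<bar> < \<delta> \<and> \<bar>c - t\<bar> < \<delta> \<longrightarrow>
         \<phi> (\<gamma> x a) (\<gamma> x b) + \<phi> (\<gamma> x b) (\<gamma> x c) + \<phi> (\<gamma> x a) (\<gamma> x c) = 0"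
        by (rule exI[of _ \<delta>]) (use \<delta> near \<gamma>D[OF x] e in auto)
    qed
    then have "segment_primitive \<phi> b x k" unfolding segment_primitive_def \<gamma>_def by blast
    then show ?thesis by (rule someI[of "segment_primitive \<phi> b x"])
  qed
  \<comment> \<open>A Lebesgue number for the segment from \<open>b\<close> to \<open>z\<close>. It
    has to cover points of \<open>D\<close> close to the segment, not only points on it, because the
    second segment runs beside the first.\<close>
  have leb: "\<exists>l>0. \<forall>t\<in>{0..1}. \<forall>u\<in>D. \<forall>y\<in>D. \<forall>w\<in>D.
     N (u - \<gamma> z t) < l \<and> N (y - \<gamma> z t) < l \<and> N (w - \<gamma> z t) < l \<longrightarrow> \<phi> u y + \<phi> y w + \<phi> u w = 0"
  proof (rule ccontr)
    assume no: "\<not> ?thesis"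
    have "\<exists>t\<in>{0..1}. \<exists>u\<in>D. \<exists>y\<in>D. \<exists>w\<in>D. (N (u - \<gamma> z t) < inverse (Suc n) \<and> N (y - \<gamma> z t) < inverse (Suc n)
       \<and> N (w - \<gamma> z t) < inverse (Suc n)) \<and> \<phi> u y + \<phi> y w + \<phi> u w \<noteq> 0" for n
      using no by (metis inverse_positive_iff_positive of_nat_0_less_iff zero_less_Suc)
    then obtain t u y w where bad: "\<And>n. t n \<in> {0..1}" "\<And>n::nat. u n \<in> D \<and> y n \<in> D \<and> w n \<in> D"
       "\<And>n. N (u n - \<gamma> z (t n)) < inverse (Suc n) \<and> N (y n - \<gamma> z (t n)) < inverse (Suc n)
       \<and> N (w n - \<gamma> z (t n)) < inverse (Suc n)" "\<And>n. \<phi> (u n) (y n) + \<phi> (y n) (w n) + \<phi> (u n) (w n) \<noteq> 0"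
      by metis
    obtain l r where l: "l \<in> {0..1}" and r: "strict_mono (r :: nat \<Rightarrow> nat)" and lim: "(t \<circ> r) \<longlonglongrightarrow> l"
      using compact_Icc[of 0 "1::real"] bad(1) unfolding compact_def by metis
    then have lD: "\<gamma> z l \<in> D" using \<gamma>D[OF z] by auto
    then obtain e where e: "e > 0" "\<forall>u\<in>D. \<forall>y\<in>D. \<forall>w\<in>D.
        N (u - \<gamma> z l) < e \<and> N (y - \<gamma> z l) < e \<and> N (w - \<gamma> z l) < e \<longrightarrow> \<phi> u y + \<phi> y w + \<phi> u w = 0"
      using coc by blast
    have "(\<lambda>n. \<bar>(t \<circ> r) n - l\<bar> * N (z - b) + inverse (Suc n)) \<longlonglongrightarrow> \<bar>l - l\<bar> * N (z - b) + 0"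
      by (intro tendsto_intros lim LIMSEQ_inverse_real_of_nat)
    then have "eventually (\<lambda>n. \<bar>(t \<circ> r) n - l\<bar> * N (z - b) + inverse (Suc n) < e) sequentially"
      using e(1) by (intro order_tendstoD) auto
    then obtain n where n: "\<bar>t (r n) - l\<bar> * N (z - b) + inverse (Suc n) < e"
      by (auto simp: eventually_sequentially)
    have "Suc n \<le> Suc (r n)" using seq_suble[OF r] by simp
    then have inv: "inverse (real (Suc (r n))) \<le> inverse (Suc n)" by (simp add: field_simps)
    have near: "N (v - \<gamma> z l) < e" if "v \<in> D" "N (v - \<gamma> z (t (r n))) < inverse (Suc (r n))" for v
    proof -
      have tD: "\<gamma> z (t (r n)) \<in> D" using \<gamma>D[OF z] bad(1)[of "r n"] by auto
      then have "N (v - \<gamma> z l) \<le> N (v - \<gamma> z (t (r n))) + N (\<gamma> z (t (r n)) - \<gamma> z l)"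
        using N_tri_diff that lD DE by blast
      then show ?thesis using that(2) n inv unfolding \<gamma>d[OF z] by linarith
    qed
    show False using bad(4)[of "r n"] e(2) near bad(2,3)[of "r n"] by blast
  qed
  then obtain l where l: "l > 0" "\<And>t u y w. t \<in> {0..1} \<Longrightarrow> u \<in> D \<Longrightarrow> y \<in> D \<Longrightarrow> w \<in> D \<Longrightarrow>
     N (u - \<gamma> z t) < l \<Longrightarrow> N (y - \<gamma> z t) < l \<Longrightarrow> N (w - \<gamma> z t) < l \<Longrightarrow> \<phi> u y + \<phi> y w + \<phi> u w = 0"
    by blast
  show ?thesis
  proof (intro exI[of _ l] conjI l(1) ballI impI)
    fix x assume x: "x \<in> D" and xz: "N (x - z) < l"
    define kx where "kx = (SOME k. segment_primitive \<phi> b x k)"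
    define kz where "kz = (SOME k. segment_primitive \<phi> b z k)"
    have kx: "segment_primitive \<phi> b x kx" and kz: "segment_primitive \<phi> b z kz"
      unfolding kx_def kz_def using prim x z by auto
    \<comment> \<open>The defect of the claim at parameter \<open>t\<close>. It is locally constant,
      because the quadrilateral between the two segments splits into two triangles on which the
      cocycle condition holds. It vanishes at 0, where both segments start at \<open>b\<close>, and
      at 1 it is the claim.\<close>
    define f where "f = (\<lambda>t. kx t + kz t + \<phi> (\<gamma> z t) (\<gamma> x t))"
    have "f 0 = f 1"
    proof (rule locally_constant_unit_interval)
      fix t :: real assume t: "0 \<le> t" "t \<le> 1"
      obtain \<delta>1 where \<delta>1: "\<delta>1 > 0" "\<And>t'. t' \<in> {0..1} \<Longrightarrow> \<bar>t' - t\<bar> < \<delta>1 \<Longrightarrow> \<phi> (\<gamma> x t) (\<gamma> x t') = kx t + kx t'"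
        using kx t unfolding segment_primitive_def \<gamma>_def by (metis atLeastAtMost_iff)
      obtain \<delta>2 where \<delta>2: "\<delta>2 > 0" "\<And>t'. t' \<in> {0..1} \<Longrightarrow> \<bar>t' - t\<bar> < \<delta>2 \<Longrightarrow> \<phi> (\<gamma> z t) (\<gamma> z t') = kz t + kz t'"
        using kz t unfolding segment_primitive_def \<gamma>_def by (metis atLeastAtMost_iff)
      have nb: "N (x - b) \<ge> 0" "N (z - b) \<ge> 0" using x z b DE by (auto intro!: N_nonneg)
      define \<delta>3 where "\<delta>3 = (l - N (x - z)) / (N (x - b) + N (z - b) + 1)"
      have \<delta>3: "\<delta>3 > 0" "\<delta>3 * (N (x - b) + N (z - b) + 1) \<le> l - N (x - z)"
        using xz nb unfolding \<delta>3_def by auto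
      show "\<exists>\<delta>>0. \<forall>t'. 0 \<le> t' \<and> t' \<le> 1 \<and> \<bar>t' - t\<bar> < \<delta> \<longrightarrow> f t' = f t"
      proof (intro exI[of _ "min (min \<delta>1 \<delta>2) \<delta>3"] conjI allI impI)
        fix t' assume t': "0 \<le> t' \<and> t' \<le> 1 \<and> \<bar>t' - t\<bar> < min (min \<delta>1 \<delta>2) \<delta>3"
        note D = \<gamma>D[OF x t] \<gamma>D[OF z t] \<gamma>D[OF x, of t'] \<gamma>D[OF z, of t']
        have a: "\<gamma> x t - \<gamma> z t = t *\<^sub>R (x - z)" unfolding \<gamma>_def by (simp add: algebra_simps)
        have xz0: "0 \<le> N (x - z)" using x z DE by (auto intro!: N_nonneg)
        have "N (\<gamma> x t - \<gamma> z t) = t * N (x - z)" unfolding a using x z DE t by (subst hom) auto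
        then have n1: "N (\<gamma> x t - \<gamma> z t) \<le> N (x - z)" using t xz0 by (simp add: mult_left_le_one_le)
        have le: "\<bar>t' - t\<bar> * (N (x - b) + N (z - b) + 1) < l - N (x - z)"
        proof -
          have "\<bar>t' - t\<bar> * (N (x - b) + N (z - b) + 1) < \<delta>3 * (N (x - b) + N (z - b) + 1)"
            using t' nb by (intro mult_strict_right_mono) auto
          then show ?thesis using \<delta>3 by linarith
        qed
        have le1: "\<bar>t' - t\<bar> * N (x - b) < l - N (x - z)" "\<bar>t' - t\<bar> * N (z - b) < l - N (x - z)"
          by (rule le_less_trans[OF _ le], intro mult_left_mono; use nb in linarith)+
        have n2: "N (\<gamma> z t' - \<gamma> z t) < l" unfolding \<gamma>d[OF z] using le1 xz0 by linarith
        have n3: "N (\<gamma> x t' - \<gamma> z t) < l"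
        proof -
          have "N (\<gamma> x t' - \<gamma> z t) \<le> N (\<gamma> x t' - \<gamma> x t) + N (\<gamma> x t - \<gamma> z t)"
            using N_tri_diff D t' DE by blast
          then show ?thesis using n1 le1 unfolding \<gamma>d[OF x] by linarith
        qed
        have n0: "N (\<gamma> z t - \<gamma> z t) < l" "N (\<gamma> x t - \<gamma> z t) < l" using l n1 xz by auto
        have "\<phi> (\<gamma> z t) (\<gamma> z t') + \<phi> (\<gamma> z t') (\<gamma> x t') + \<phi> (\<gamma> z t) (\<gamma> x t') = 0"
          using D t' t n0 n2 n3 by (intro l(2)[of t]) auto
        moreover have "\<phi> (\<gamma> z t) (\<gamma> x t) + \<phi> (\<gamma> x t) (\<gamma> x t') + \<phi> (\<gamma> z t) (\<gamma> x t') = 0"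
          using D t' t n0 n2 n3 by (intro l(2)[of t]) auto
        moreover have "\<phi> (\<gamma> x t) (\<gamma> x t') = kx t + kx t'" "\<phi> (\<gamma> z t) (\<gamma> z t') = kz t + kz t'"
          using \<delta>1 \<delta>2 t' by auto
        ultimately have "kz t + kz t' + \<phi> (\<gamma> z t') (\<gamma> x t') + (\<phi> (\<gamma> z t) (\<gamma> x t) + (kx t + kx t')) = 0"
          using bit_cancel_common by metis
        then have "f t' + f t = 0" unfolding f_def by (simp add: ac_simps)
        then show "f t' = f t" by (simp add: bit_add_eq_0_iff)
      qed (use \<delta>1 \<delta>2 \<delta>3 in auto)
    qed
    moreover have "f 0 = 0"
    proof -
      have "\<gamma> x 0 = b" "\<gamma> z 0 = b" unfolding \<gamma>_def by auto
      moreover have "\<phi> b b + \<phi> b b + \<phi> b b = 0" using l(2)[of 0 b b b] b l(1) \<open>\<gamma> z 0 = b\<close> by auto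
      ultimately show ?thesis using kx kz unfolding f_def segment_primitive_def by simp
    qed
    ultimately have "kx 1 + kz 1 + \<phi> z x = 0" unfolding f_def \<gamma>_def by simp
    then show "\<phi> z x = segment_integral \<phi> b z + segment_integral \<phi> b x"
      unfolding segment_integral_def kx_def[symmetric] kz_def[symmetric]
      by (cases "kx 1"; cases "kz 1"; cases "\<phi> z x") auto
  qed
qed

subsection \<open>Orbit spaces\<close>

lemma openin_quotient_top:
  "openin (quotient_top X f) U \<longleftrightarrow> U \<subseteq> f ` topspace X \<and> openin X {x \<in> topspace X. f x \<in> U}"
proof -
  have eqI: "{x \<in> topspace X. f x \<in> S \<inter> T} = {x \<in> topspace X. f x \<in> S} \<inter> {x \<in> topspace X. f x \<in> T}" for S T
    by auto
  have eqU: "{x \<in> topspace X. f x \<in> \<Union>\<K>} = \<Union>((\<lambda>K. {x \<in> topspace X. f x \<in> K}) ` \<K>)" for \<K>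
    by auto
  have "istopology (\<lambda>U. U \<subseteq> f ` topspace X \<and> openin X {x \<in> topspace X. f x \<in> U})"
    unfolding istopology_def
  proof (intro conjI allI impI)
    fix \<K> assume "\<forall>K\<in>\<K>. K \<subseteq> f ` topspace X \<and> openin X {x \<in> topspace X. f x \<in> K}"
    then show "openin X {x \<in> topspace X. f x \<in> \<Union> \<K>}" unfolding eqU by (intro openin_Union) auto
  next
    fix S T assume "S \<subseteq> f ` topspace X \<and> openin X {x \<in> topspace X. f x \<in> S}"
      "T \<subseteq> f ` topspace X \<and> openin X {x \<in> topspace X. f x \<in> T}"
    then show "openin X {x \<in> topspace X. f x \<in> S \<inter> T}" unfolding eqI by auto
  qed auto
  then show ?thesis unfolding quotient_top_def by (simp add: topology_inverse')
qed

lemma openin_orbit_space: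
  "openin (orbit_space T ng A) U \<longleftrightarrow>
     U \<subseteq> orbit2 ng ` (topspace T \<inter> A) \<and> openin (subtopology T A) {x \<in> topspace T \<inter> A. orbit2 ng x \<in> U}"
  unfolding orbit_space_def openin_quotient_top by simp

lemma topspace_orbit_space: "topspace (orbit_space T ng A) = orbit2 ng ` (topspace T \<inter> A)"
proof -
  have "openin (orbit_space T ng A) (orbit2 ng ` (topspace T \<inter> A))"
  proof -
    have "{x \<in> topspace T \<inter> A. orbit2 ng x \<in> orbit2 ng ` (topspace T \<inter> A)} = topspace (subtopology T A)"
      by auto
    then show ?thesis unfolding openin_orbit_space using openin_topspace[of "subtopology T A"] by simp
  qed
  then show ?thesis
    by (metis openin_orbit_space openin_subset openin_topspace subset_antisym)
qed

lemma orbit2_eqD: "orbit2 ng x = orbit2 ng y \<Longrightarrow> y = x \<or> y = ng x"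
  unfolding orbit2_def by blast

lemma orbit2_ng: "ng (ng x) = x \<Longrightarrow> orbit2 ng (ng x) = orbit2 ng x"
  unfolding orbit2_def by auto

text \<open>A small tuple of orbits has, up to a global sign, exactly one lift consisting of mutually
  near points, so invariant cochains descend.\<close>

lemma descend_cochain:
  fixes \<psi> :: "'a cochain"
  assumes excl: "\<And>x y. x \<in> A \<Longrightarrow> y \<in> A \<Longrightarrow> near x y \<Longrightarrow> \<not> near x (ng y)"
    and nng: "\<And>x y. x \<in> A \<Longrightarrow> y \<in> A \<Longrightarrow> near x y \<Longrightarrow> near (ng x) (ng y)"
    and ng: "\<And>x. x \<in> A \<Longrightarrow> ng x \<in> A"
    and inv: "\<And>xs. set xs \<subseteq> A \<Longrightarrow> \<psi> (map ng xs) = \<psi> xs"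
  obtains \<Psi> where "\<And>xs. set xs \<subseteq> A \<Longrightarrow> (\<And>x y. x \<in> set xs \<Longrightarrow> y \<in> set xs \<Longrightarrow> near x y) \<Longrightarrow>
     \<Psi> (map (orbit2 ng) xs) = \<psi> xs"
proof -
  define sm where "sm = (\<lambda>xs. set xs \<subseteq> A \<and> (\<forall>x\<in>set xs. \<forall>y\<in>set xs. near x y))"
  define \<Psi> where "\<Psi> = (\<lambda>os. \<psi> (SOME xs. sm xs \<and> map (orbit2 ng) xs = os))"
  have uniq: "\<psi> xs' = \<psi> xs" if sm: "sm xs" "sm xs'" and eq: "map (orbit2 ng) xs' = map (orbit2 ng) xs" for xs xs'
  proof (cases "xs = []")
    case False
    have len: "length xs' = length xs" using eq by (metis length_map)
    have i: "xs' ! i = xs ! i \<or> xs' ! i = ng (xs ! i)" if "i < length xs" for i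
    proof -
      have "orbit2 ng (xs ! i) = orbit2 ng (xs' ! i)" using eq that len by (metis nth_map)
      then show ?thesis by (rule orbit2_eqD)
    qed
    have A: "xs ! i \<in> A" if "i < length xs" for i using sm that unfolding sm_def by auto
    have n: "near (xs ! i) (xs ! j)" "near (xs' ! i) (xs' ! j)" if "i < length xs" "j < length xs" for i j
      using sm that len unfolding sm_def by auto
    have 0: "0 < length xs" using False by simp
    show ?thesis
    proof (cases "xs' ! 0 = xs ! 0")
      case True
      have "xs' ! j = xs ! j" if "j < length xs" for j
        using i[OF that] n[OF 0 that] excl[OF A[OF 0] A[OF that]] True by auto
      then have "xs' = xs" using len by (auto intro: nth_equalityI)
      then show ?thesis by simp
    next
      case False
      then have x0: "xs' ! 0 = ng (xs ! 0)" using i[OF 0] by auto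
      have "xs' ! j = ng (xs ! j)" if "j < length xs" for j
        using i[OF that] n[OF 0 that] nng[OF A[OF 0] A[OF that]] excl[OF ng[OF A[OF 0]] A[OF that]] x0 by auto
      then have "xs' = map ng xs" using len by (auto intro: nth_equalityI)
      then show ?thesis using inv sm unfolding sm_def by auto
    qed
  qed (use eq in auto)
  show ?thesis
  proof (rule that[of \<Psi>])
    fix xs assume "set xs \<subseteq> A" "\<And>x y. x \<in> set xs \<Longrightarrow> y \<in> set xs \<Longrightarrow> near x y"
    then have sm: "sm xs" unfolding sm_def by auto
    have "sm (SOME ys. sm ys \<and> map (orbit2 ng) ys = map (orbit2 ng) xs) \<and>
        map (orbit2 ng) (SOME ys. sm ys \<and> map (orbit2 ng) ys = map (orbit2 ng) xs) = map (orbit2 ng) xs"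
      by (rule someI[of _ xs]) (use sm in auto)
    then show "\<Psi> (map (orbit2 ng) xs) = \<psi> xs"
      unfolding \<Psi>_def using uniq[OF sm] by blast
  qed
qed

lemma descend_cobound:
  assumes \<Psi>: "\<And>xs. set xs \<subseteq> A \<Longrightarrow> (\<And>x y. x \<in> set xs \<Longrightarrow> y \<in> set xs \<Longrightarrow> near x y) \<Longrightarrow>
     \<Psi> (map (orbit2 ng) xs) = \<psi> xs"
    and xs: "set xs \<subseteq> A" "\<And>x y. x \<in> set xs \<Longrightarrow> y \<in> set xs \<Longrightarrow> near x y"
  shows "as_cobound \<Psi> (map (orbit2 ng) xs) = as_cobound \<psi> xs"
  unfolding as_cobound_map[symmetric]
  by (rule as_cobound_cong) (use assms in blast)

subsection \<open>The infinite sphere\<close>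

definition Efin :: "nat \<Rightarrow> (nat \<Rightarrow> real) set" where
  "Efin n = {x. \<forall>i>n. x i = 0}"

definition Einf :: "(nat \<Rightarrow> real) set" where
  "Einf = {x. finite {i. x i \<noteq> 0}}"

definition l2 :: "(nat \<Rightarrow> real) \<Rightarrow> real" where
  "l2 x = L2_set x {i. x i \<noteq> 0}"

lemma Efin_mono: "n \<le> m \<Longrightarrow> Efin n \<subseteq> Efin m"
  unfolding Efin_def by auto

lemma Efin_support: "x \<in> Efin n \<Longrightarrow> {i. x i \<noteq> 0} \<subseteq> {..n}"
  unfolding Efin_def using not_le by blast

lemma Einf_Efin: "Einf = (\<Union>n. Efin n)"
proof
  show "Einf \<subseteq> (\<Union>n. Efin n)"
  proof
    fix x assume "x \<in> Einf"
    then obtain n where "\<forall>i\<in>{i. x i \<noteq> 0}. i \<le> n" unfolding Einf_def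
      using finite_nat_set_iff_bounded_le by blast
    then have "x \<in> Efin n" unfolding Efin_def using not_le by blast
    then show "x \<in> (\<Union>n. Efin n)" by auto
  qed
  show "(\<Union>n. Efin n) \<subseteq> Einf"
  proof
    fix x assume "x \<in> (\<Union>n. Efin n)"
    then obtain n where "x \<in> Efin n" by auto
    then have "{i. x i \<noteq> 0} \<subseteq> {..n}" by (rule Efin_support)
    then show "x \<in> Einf" unfolding Einf_def using finite_subset by auto
  qed
qed

lemma Einf_pairE:
  assumes "x \<in> Einf" "y \<in> Einf"
  obtains n where "x \<in> Efin n" "y \<in> Efin n"
proof -
  from assms obtain a b where "x \<in> Efin a" "y \<in> Efin b" unfolding Einf_Efin by auto
  then show ?thesis using that[of "max a b"] Efin_mono[of a "max a b"] Efin_mono[of b "max a b"] by auto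
qed

lemma l2_Efin: "x \<in> Efin n \<Longrightarrow> l2 x = L2_set x {..n}"
  unfolding l2_def L2_set_def
  by (intro arg_cong[where f = sqrt] sum.mono_neutral_left Efin_support) auto

lemma subspace_Efin: "subspace (Efin n)"
  unfolding subspace_def Efin_def by auto

lemma subspace_Einf: "subspace Einf"
  unfolding subspace_def
proof (intro conjI ballI allI)
  show "0 \<in> Einf" unfolding Einf_def by simp
  fix x y c assume x: "x \<in> Einf" and y: "y \<in> Einf"
  obtain n where "x \<in> Efin n" "y \<in> Efin n" by (rule Einf_pairE[OF x y])
  then show "x + y \<in> Einf" unfolding Einf_Efin using subspace_add[OF subspace_Efin] by blast
next
  fix x and c :: real assume "x \<in> Einf"
  then show "c *\<^sub>R x \<in> Einf" unfolding Einf_Efin using subspace_scale[OF subspace_Efin] by blast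
qed

interpretation l2: seminormed Einf l2
proof
  show "subspace Einf" by (rule subspace_Einf)
  fix x y assume x: "x \<in> Einf" and y: "y \<in> Einf"
  obtain n where n: "x \<in> Efin n" "y \<in> Efin n" by (rule Einf_pairE[OF x y])
  then have "x + y \<in> Efin n" using subspace_add[OF subspace_Efin] by blast
  then show "l2 (x + y) \<le> l2 x + l2 y" using n L2_set_triangle_ineq[of x y "{..n}"]
    by (simp add: l2_Efin plus_fun_def)
next
  fix x and c :: real assume "x \<in> Einf"
  then obtain n where n: "x \<in> Efin n" unfolding Einf_Efin by auto
  then have "c *\<^sub>R x \<in> Efin n" using subspace_scale[OF subspace_Efin] by blast
  then show "l2 (c *\<^sub>R x) = \<bar>c\<bar> * l2 x" using n
    by (simp add: l2_Efin L2_set_def power_mult_distrib sum_distrib_left[symmetric] real_sqrt_mult)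
qed

interpretation l2n: seminormed "Efin n" l2 for n
  by unfold_locales (auto simp: subspace_Efin Einf_Efin intro!: l2.tri l2.hom)

lemma Efin_Einf: "x \<in> Efin n \<Longrightarrow> x \<in> Einf"
  unfolding Einf_Efin by auto

lemma abs_le_l2: "x \<in> Einf \<Longrightarrow> \<bar>x i\<bar> \<le> l2 x"
  using member_le_L2_set[of "{i. x i \<noteq> 0}" i "\<lambda>i. \<bar>x i\<bar>"] L2_set_nonneg[of x]
  by (cases "x i = 0") (auto simp: l2_def Einf_def L2_set_def)

lemma l2_pos: "x \<in> Einf \<Longrightarrow> x \<noteq> 0 \<Longrightarrow> l2 x > 0"
  using abs_le_l2 by (metis abs_le_zero_iff ext linorder_not_less order_trans zero_fun_apply)

lemma Sinf_iff: "x \<in> Sinf \<longleftrightarrow> x \<in> Einf \<and> l2 x = 1"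
  unfolding Sinf_def Einf_def l2_def L2_set_def by auto

lemma Sfin_iff: "x \<in> Sfin n \<longleftrightarrow> x \<in> Efin n \<and> l2 x = 1"
  unfolding Sfin_def Sinf_iff Efin_def Einf_Efin by auto

lemma Sfin_dist: "x \<in> Sfin n \<Longrightarrow> y \<in> Sfin n \<Longrightarrow> e > 0 \<Longrightarrow> (\<Sum>i\<le>n. (x i - y i)\<^sup>2) < e\<^sup>2 \<longleftrightarrow> l2 (y - x) < e"
proof -
  assume a: "x \<in> Sfin n" "y \<in> Sfin n" "e > 0"
  then have "l2 (y - x) = l2 (x - y)" by (intro l2n.N_diff_commute[of _ n]) (auto simp: Sfin_iff)
  also have "\<dots> = sqrt (\<Sum>i\<le>n. (x i - y i)\<^sup>2)"
    using a by (subst l2_Efin[of _ n]) (auto simp: Sfin_iff L2_set_def)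
  finally show ?thesis using a(3)
    by (metis abs_of_pos real_sqrt_abs real_sqrt_less_iff)
qed

lemma openin_Sinf_top:
  "openin Sinf_top U \<longleftrightarrow> U \<subseteq> Sinf \<and>
     (\<forall>n. \<forall>x\<in>U \<inter> Sfin n. \<exists>e>0. \<forall>y\<in>Sfin n. l2 (y - x) < e \<longrightarrow> y \<in> U)"
proof -
  define P where "P = (\<lambda>U. U \<subseteq> Sinf \<and>
     (\<forall>n. \<forall>x\<in>U \<inter> Sfin n. \<exists>e>0. \<forall>y\<in>Sfin n. l2 (y - x) < e \<longrightarrow> y \<in> U))"
  have eq: "(\<lambda>U. U \<subseteq> Sinf \<and>
     (\<forall>n. \<forall>x\<in>U \<inter> Sfin n. \<exists>e>0. \<forall>y\<in>Sfin n. (\<Sum>i\<le>n. (x i - y i)\<^sup>2) < e\<^sup>2 \<longrightarrow> y \<in> U)) = P"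
    unfolding P_def
    by (intro ext conj_cong refl all_cong1 ball_cong ex_cong1) (auto simp: Sfin_dist)
  have "istopology P"
    unfolding istopology_def
  proof (intro conjI allI impI)
    fix S T assume S: "P S" and T: "P T"
    show "P (S \<inter> T)"
      unfolding P_def
    proof (intro conjI allI ballI)
      fix n x assume x: "x \<in> S \<inter> T \<inter> Sfin n"
      obtain e1 where "e1 > 0" "\<forall>y\<in>Sfin n. l2 (y - x) < e1 \<longrightarrow> y \<in> S" using S x unfolding P_def by blast
      moreover obtain e2 where "e2 > 0" "\<forall>y\<in>Sfin n. l2 (y - x) < e2 \<longrightarrow> y \<in> T" using T x unfolding P_def by blast
      ultimately show "\<exists>e>0. \<forall>y\<in>Sfin n. l2 (y - x) < e \<longrightarrow> y \<in> S \<inter> T"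
        by (intro exI[of _ "min e1 e2"]) auto
    qed (use S in \<open>auto simp: P_def\<close>)
  next
    fix \<K> assume "\<forall>K\<in>\<K>. P K"
    then have *: "K \<subseteq> Sinf" "x \<in> K \<inter> Sfin n \<Longrightarrow> \<exists>e>0. \<forall>y\<in>Sfin n. l2 (y - x) < e \<longrightarrow> y \<in> K"
      if "K \<in> \<K>" for K n x using that unfolding P_def by auto
    show "P (\<Union>\<K>)"
      unfolding P_def
    proof (intro conjI allI ballI)
      fix n x assume "x \<in> \<Union>\<K> \<inter> Sfin n"
      then obtain K where K: "K \<in> \<K>" "x \<in> K \<inter> Sfin n" by blast
      from *(2)[OF this] show "\<exists>e>0. \<forall>y\<in>Sfin n. l2 (y - x) < e \<longrightarrow> y \<in> \<Union>\<K>" using K by blast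
    qed (use * in blast)
  qed
  then show ?thesis unfolding Sinf_top_def eq by (simp add: topology_inverse' P_def)
qed

lemma topspace_Sinf_top [simp]: "topspace Sinf_top = Sinf"
proof -
  have "openin Sinf_top Sinf"
    unfolding openin_Sinf_top by (auto simp: Sfin_def intro: exI[of _ 1])
  then show ?thesis by (metis openin_Sinf_top openin_subset openin_topspace subset_antisym)
qed

lemma uminus_Sinf [simp]: "- x \<in> Sinf \<longleftrightarrow> x \<in> Sinf"
  unfolding Sinf_iff using l2.N_minus l2.E_simps(5) by (metis minus_minus)

lemma openin_RPinf_top:
  "openin RPinf_top U \<longleftrightarrow> U \<subseteq> orbit2 uminus ` Sinf \<and> openin Sinf_top {x \<in> Sinf. orbit2 uminus x \<in> U}"
proof -
  have "subtopology Sinf_top Sinf = Sinf_top" by (metis subtopology_topspace topspace_Sinf_top)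
  then show ?thesis unfolding RPinf_top_def openin_orbit_space by simp
qed

lemma topspace_RPinf_top: "topspace RPinf_top = orbit2 uminus ` Sinf"
  unfolding RPinf_top_def topspace_orbit_space by simp

definition nrm :: "(nat \<Rightarrow> real) \<Rightarrow> nat \<Rightarrow> real" where
  "nrm x = (1 / l2 x) *\<^sub>R x"

lemma nrm_Sfin: "x \<in> Efin n \<Longrightarrow> x \<noteq> 0 \<Longrightarrow> nrm x \<in> Sfin n"
  using l2_pos[of x] Efin_Einf[of x n] unfolding Sfin_iff nrm_def by (auto simp: l2.hom)

lemma nrm_Sinf: "x \<in> Einf \<Longrightarrow> x \<noteq> 0 \<Longrightarrow> nrm x \<in> Sinf"
  using l2_pos[of x] unfolding Sinf_iff nrm_def by (auto simp: l2.hom)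

lemma nrm_id: "x \<in> Sinf \<Longrightarrow> nrm x = x"
  unfolding Sinf_iff nrm_def by auto

lemma nrm_minus: "x \<in> Einf \<Longrightarrow> nrm (- x) = - nrm x"
  unfolding nrm_def by simp

lemma nrm_dist:
  assumes "x \<in> Einf" "z \<in> Einf" "x \<noteq> 0" "z \<noteq> 0"
  shows "l2 (nrm x - nrm z) \<le> 2 * l2 (x - z) / l2 z"
proof -
  have p: "l2 x > 0" "l2 z > 0" using l2_pos assms by auto
  have eq: "nrm x - nrm z = (1 / l2 z) *\<^sub>R (x - z) + (1 / l2 x - 1 / l2 z) *\<^sub>R x"
    unfolding nrm_def by (simp add: scaleR_diff_right scaleR_diff_left)
  have "l2 (nrm x - nrm z) \<le> l2 ((1 / l2 z) *\<^sub>R (x - z)) + l2 ((1 / l2 x - 1 / l2 z) *\<^sub>R x)"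
    unfolding eq using assms by (intro l2.tri) auto
  also have "\<dots> = l2 (x - z) / l2 z + \<bar>1 / l2 x - 1 / l2 z\<bar> * l2 x"
    using assms p by (simp add: l2.hom)
  also have "\<bar>1 / l2 x - 1 / l2 z\<bar> * l2 x = \<bar>(1 / l2 x - 1 / l2 z) * l2 x\<bar>" using p by (simp add: abs_mult)
  also have "\<dots> = \<bar>l2 z - l2 x\<bar> / l2 z" 
  proof -
    have "(1 / l2 x - 1 / l2 z) * l2 x = (l2 z - l2 x) / l2 z" using p by (simp add: left_diff_distrib diff_divide_distrib)
    then show ?thesis using p by simp
  qed
  also have "\<dots> \<le> l2 (x - z) / l2 z"
    using l2.N_abs_diff[OF assms(1,2)] p by (intro divide_right_mono) auto
  finally show ?thesis by (simp add: fun_diff_def)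
qed

definition eunit :: "nat \<Rightarrow> nat \<Rightarrow> real" where
  "eunit k i = (if i = k then 1 else 0)"

lemma eunit_Efin: "k \<le> n \<Longrightarrow> eunit k \<in> Efin n"
  unfolding Efin_def eunit_def by auto

text \<open>Connectedness with one dimension to spare: every point of \<open>Efin n\<close> is
  joined to \<open>eunit (Suc n)\<close> inside \<open>W\<close>, since a fresh coordinate keeps the
  segment away from what was removed. Only the finite-dimensional norm topologies enter.\<close>

lemma locally_constant_Einf:
  fixes f :: "(nat \<Rightarrow> real) \<Rightarrow> 'b"
  assumes loc: "\<And>n z. z \<in> Efin n \<Longrightarrow> z \<in> W \<Longrightarrow> \<exists>e>0. \<forall>x\<in>Efin n \<inter> W. l2 (x - z) < e \<longrightarrow> f x = f z"
    and seg: "\<And>n x k t. x \<in> Efin n \<Longrightarrow> x \<in> W \<Longrightarrow> n < k \<Longrightarrow> 0 \<le> t \<Longrightarrow> t \<le> 1 \<Longrightarrow>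
       (1 - t) *\<^sub>R x + t *\<^sub>R eunit k \<in> W"
    and x: "x \<in> Einf" "x \<in> W" and y: "y \<in> Einf" "y \<in> W"
  shows "f x = f y"
proof -
  obtain n where n: "x \<in> Efin n" "y \<in> Efin n" by (rule Einf_pairE[OF x(1) y(1)])
  have "f v = f (eunit (Suc n))" if v: "v \<in> Efin n" "v \<in> W" for v
  proof -
    define \<gamma> where "\<gamma> = (\<lambda>t. (1 - t) *\<^sub>R v + t *\<^sub>R eunit (Suc n))"
    have vE: "v \<in> Efin (Suc n)" "eunit (Suc n) \<in> Efin (Suc n)"
      using v Efin_mono[of n "Suc n"] eunit_Efin by auto
    have \<gamma>E: "\<gamma> t \<in> Efin (Suc n)" for t unfolding \<gamma>_def using vE by auto
    have \<gamma>W: "\<gamma> t \<in> W" if "0 \<le> t" "t \<le> 1" for t unfolding \<gamma>_def using seg v that by auto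
    have "f (\<gamma> 0) = f (\<gamma> 1)"
    proof (rule locally_constant_unit_interval[of "\<lambda>t. f (\<gamma> t)"])
      fix t :: real assume t: "0 \<le> t" "t \<le> 1"
      obtain e where e: "e > 0" "\<forall>x\<in>Efin (Suc n) \<inter> W. l2 (x - \<gamma> t) < e \<longrightarrow> f x = f (\<gamma> t)"
        using loc[OF \<gamma>E \<gamma>W[OF t]] by blast
      define c where "c = l2 (eunit (Suc n) - v)"
      have c: "c \<ge> 0" unfolding c_def using vE by (intro l2n.N_nonneg[of _ "Suc n"]) auto
      have d: "l2 (\<gamma> t' - \<gamma> t) = \<bar>t' - t\<bar> * c" for t'
        unfolding \<gamma>_def c_def by (rule l2n.N_segment[OF vE])
      show "\<exists>\<delta>>0. \<forall>t'. 0 \<le> t' \<and> t' \<le> 1 \<and> \<bar>t' - t\<bar> < \<delta> \<longrightarrow> f (\<gamma> t') = f (\<gamma> t)"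
      proof (intro exI[of _ "e / (c + 1)"] conjI allI impI)
        fix t' assume t': "0 \<le> t' \<and> t' \<le> 1 \<and> \<bar>t' - t\<bar> < e / (c + 1)"
        then have "\<bar>t' - t\<bar> * (c + 1) < e" using c by (simp add: field_simps)
        then have "\<bar>t' - t\<bar> * c < e" by (simp add: algebra_simps)
        then show "f (\<gamma> t') = f (\<gamma> t)" using e d \<gamma>E \<gamma>W t' by auto
      qed (use e c in auto)
    qed
    then show ?thesis unfolding \<gamma>_def by simp
  qed
  then show ?thesis using n x y by metis
qed

section \<open>The first cohomology of the infinite projective space\<close>

lemma as_locally_zero_iff:
  "as_locally_zero Y q \<phi> \<longleftrightarrow> (\<forall>y\<in>topspace Y. \<exists>U. openin Y U \<and> y \<in> U \<and>
     (\<forall>ys. length ys = Suc q \<longrightarrow> set ys \<subseteq> U \<longrightarrow> \<phi> ys = 0))" (is "?L \<longleftrightarrow> ?R")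
proof
  assume ?L
  then obtain \<U> where \<U>: "\<forall>U\<in>\<U>. openin Y U" "\<Union>\<U> = topspace Y"
    "\<forall>ys. length ys = Suc q \<and> (\<exists>U\<in>\<U>. set ys \<subseteq> U) \<longrightarrow> \<phi> ys = 0"
    unfolding as_locally_zero_def by (elim exE conjE) (rule that)
  show ?R
  proof
    fix y assume "y \<in> topspace Y"
    then obtain U where "U \<in> \<U>" "y \<in> U" using \<U>(2) by blast
    then show "\<exists>U. openin Y U \<and> y \<in> U \<and> (\<forall>ys. length ys = Suc q \<longrightarrow> set ys \<subseteq> U \<longrightarrow> \<phi> ys = 0)"
      using \<U>(1,3) by (intro exI[of _ U]) auto
  qed
next
  assume R: ?R
  show ?L
    unfolding as_locally_zero_def
  proof (intro exI[of _ "{U. openin Y U \<and> (\<forall>ys. length ys = Suc q \<longrightarrow> set ys \<subseteq> U \<longrightarrow> \<phi> ys = 0)}"] conjI)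
    show "\<Union>{U. openin Y U \<and> (\<forall>ys. length ys = Suc q \<longrightarrow> set ys \<subseteq> U \<longrightarrow> \<phi> ys = 0)} = topspace Y"
      using R openin_subset by fastforce
  qed auto
qed

lemma segment_nonzero:
  assumes "x \<in> Efin n" "x \<noteq> 0" "n < k" "0 \<le> t" "t \<le> 1"
  shows "(1 - t) *\<^sub>R x + t *\<^sub>R eunit k \<noteq> 0"
proof (cases "t = 0")
  case False
  have "((1 - t) *\<^sub>R x + t *\<^sub>R eunit k) k = t" using assms unfolding Efin_def eunit_def by auto
  then show ?thesis using False by (metis zero_fun_apply)
qed (use assms in auto)

text \<open>Extending \<open>f\<close> to be constant along rays replaces the sphere by the
  punctured space, where segments are available.\<close>

lemma locally_constant_Sinf:
  fixes f :: "(nat \<Rightarrow> real) \<Rightarrow> 'b"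
  assumes loc: "\<And>n z. z \<in> Sfin n \<Longrightarrow> \<exists>e>0. \<forall>x\<in>Sfin n. l2 (x - z) < e \<longrightarrow> f x = f z"
    and x: "x \<in> Sinf" and y: "y \<in> Sinf"
  shows "f x = f y"
proof -
  have x': "x \<in> Einf" "x \<noteq> 0" and y': "y \<in> Einf" "y \<noteq> 0" using x y unfolding Sinf_iff by auto
  have "f (nrm x) = f (nrm y)"
  proof (rule locally_constant_Einf[of "- {0}" "\<lambda>x. f (nrm x)"])
    fix n z assume z: "z \<in> Efin n" "z \<in> - {0}"
    then obtain e where e: "e > 0" "\<forall>x\<in>Sfin n. l2 (x - nrm z) < e \<longrightarrow> f x = f (nrm z)"
      using loc[OF nrm_Sfin, of z n] by auto
    have zp: "l2 z > 0" using z l2_pos Efin_Einf by auto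
    show "\<exists>e>0. \<forall>x\<in>Efin n \<inter> - {0}. l2 (x - z) < e \<longrightarrow> f (nrm x) = f (nrm z)"
    proof (intro exI[of _ "e * l2 z / 2"] conjI ballI impI)
      fix v assume v: "v \<in> Efin n \<inter> - {0}" "l2 (v - z) < e * l2 z / 2"
      have "l2 (nrm v - nrm z) \<le> 2 * l2 (v - z) / l2 z" using v z Efin_Einf by (intro nrm_dist) auto
      also have "\<dots> < e" using v zp by (simp add: field_simps)
      finally show "f (nrm v) = f (nrm z)" using e v nrm_Sfin by auto
    qed (use e zp in auto)
  next
    fix n x k t assume "x \<in> Efin n" "x \<in> - {0}" "n < k" "0 \<le> t" "t \<le> (1::real)"
    then show "(1 - t) *\<^sub>R x + t *\<^sub>R eunit k \<in> - {0}" using segment_nonzero by auto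
  qed (use x' y' in auto)
  then show ?thesis using nrm_id x y by simp
qed

text \<open>A cocycle whose restriction to every finite sphere is locally the coboundary of \<open>h\<close> is so on
  weakly open sets: the set where it holds relative to a fixed point is weakly open.\<close>

lemma RPinf_cocycle_primitive:
  assumes "as_cocycle RPinf_top 1 \<phi>"
  obtains h :: "(nat \<Rightarrow> real) \<Rightarrow> bit" where
    "\<And>x. x \<in> Sinf \<Longrightarrow> \<exists>V. openin Sinf_top V \<and> x \<in> V \<and>
       (\<forall>a\<in>V. \<forall>b\<in>V. \<phi> [orbit2 uminus a, orbit2 uminus b] = h a + h b)"
proof -
  define \<phi>1 where "\<phi>1 = (\<lambda>a b. \<phi> [orbit2 uminus a, orbit2 uminus (b :: nat \<Rightarrow> real)])"
  have coc: "\<exists>U. openin Sinf_top U \<and> x \<in> U \<and> (\<forall>a\<in>U. \<forall>b\<in>U. \<forall>c\<in>U. \<phi>1 a b + \<phi>1 b c + \<phi>1 a c = 0)"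
    if x: "x \<in> Sinf" for x
  proof -
    have "orbit2 uminus x \<in> topspace RPinf_top" using x topspace_RPinf_top by auto
    then obtain U where U: "openin RPinf_top U" "orbit2 uminus x \<in> U"
      "\<And>ys. length ys = Suc (Suc 1) \<Longrightarrow> set ys \<subseteq> U \<Longrightarrow> as_cobound \<phi> ys = 0"
      using assms unfolding as_cocycle_def as_locally_zero_iff by meson
    define V where "V = {x \<in> Sinf. orbit2 uminus x \<in> U}"
    have "openin Sinf_top V" using U(1) unfolding V_def openin_RPinf_top by auto
    moreover have "\<phi>1 a b + \<phi>1 b c + \<phi>1 a c = 0" if "a \<in> V" "b \<in> V" "c \<in> V" for a b c
      using U(3)[of "[orbit2 uminus a, orbit2 uminus b, orbit2 uminus c]"] that
      unfolding V_def \<phi>1_def by (auto simp: as_cobound_Cons ac_simps)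
    ultimately show ?thesis using x U unfolding V_def by blast
  qed
  \<comment> \<open>Constant along rays, so that star-shaped subsets of the punctured space can take
    the place of caps of the sphere.\<close>
  define \<phi>2 where "\<phi>2 = (\<lambda>x y. \<phi>1 (nrm x) (nrm y))"
  have coc2: "\<exists>e>0. \<forall>x\<in>Efin n - {0}. \<forall>y\<in>Efin n - {0}. \<forall>w\<in>Efin n - {0}. l2 (x - z) < e \<and> l2 (y - z) < e \<and> l2 (w - z) < e \<longrightarrow>
        \<phi>2 x y + \<phi>2 y w + \<phi>2 x w = 0" if z: "z \<in> Efin n" "z \<noteq> 0" for n z
  proof -
    have zs: "nrm z \<in> Sfin n" using nrm_Sfin z by auto
    then obtain U where U: "openin Sinf_top U" "nrm z \<in> U" "\<forall>a\<in>U. \<forall>b\<in>U. \<forall>c\<in>U. \<phi>1 a b + \<phi>1 b c + \<phi>1 a c = 0"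
      using coc[of "nrm z"] unfolding Sfin_def by auto
    then obtain e where e: "e > 0" "\<forall>y\<in>Sfin n. l2 (y - nrm z) < e \<longrightarrow> y \<in> U"
      using zs unfolding openin_Sinf_top by blast
    have zp: "l2 z > 0" using z l2_pos Efin_Einf by auto
    have "nrm v \<in> U" if v: "v \<in> Efin n - {0}" "l2 (v - z) < e * l2 z / 2" for v
    proof -
      have "l2 (nrm v - nrm z) \<le> 2 * l2 (v - z) / l2 z" using v z Efin_Einf by (intro nrm_dist) auto
      also have "\<dots> < e" using v zp by (simp add: field_simps)
      finally show ?thesis using e v nrm_Sfin by auto
    qed
    then show ?thesis
      by (intro exI[of _ "e * l2 z / 2"]) (use e zp U(3) in \<open>auto simp: \<phi>2_def\<close>)
  qed
  \<comment> \<open>\<open>Dp\<close> and \<open>Dm\<close> each omit one closed half of the first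
    coordinate axis. They are star-shaped about \<open>eunit 0\<close> and \<open>- eunit 0\<close>,
    together they cover the punctured space, and they overlap exactly in \<open>W\<close>.\<close>
  define W where "W = {x :: nat \<Rightarrow> real. \<exists>i>0. x i \<noteq> 0}"
  define Dp where "Dp = {x :: nat \<Rightarrow> real. x 0 > 0} \<union> W"
  define Dm where "Dm = {x :: nat \<Rightarrow> real. x 0 < 0} \<union> W"
  have W0: "x \<noteq> 0" if "x \<in> Dp \<or> x \<in> Dm" for x using that unfolding Dp_def Dm_def W_def by auto
  define hp where "hp = segment_integral \<phi>2 (eunit 0)"
  define hm where "hm = segment_integral \<phi>2 (- eunit 0)"
  have e0: "eunit 0 \<in> Efin n" "- eunit 0 \<in> Efin n" for n using eunit_Efin[of 0 n] by auto
  have hp: "\<exists>e>0. \<forall>x\<in>Efin n \<inter> Dp. l2 (x - z) < e \<longrightarrow> \<phi>2 z x = hp z + hp x" if z: "z \<in> Efin n" "z \<in> Dp" for n z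
    unfolding hp_def
  proof (rule l2n.star_cocycle_exact[of _ n])
    show "eunit 0 \<in> Efin n \<inter> Dp" using e0 unfolding Dp_def by (auto simp: eunit_def)
    show "(1 - t) *\<^sub>R eunit 0 + t *\<^sub>R x \<in> Efin n \<inter> Dp" if "x \<in> Efin n \<inter> Dp" "0 \<le> t" "t \<le> 1" for x t
    proof -
      have "(1 - t) *\<^sub>R eunit 0 + t *\<^sub>R x \<in> Dp"
      proof (cases "t = 0 \<or> x \<in> W")
        case True
        then show ?thesis
        proof
          assume "x \<in> W"
          then obtain i where "i > 0" "x i \<noteq> 0" unfolding W_def by auto
          then show ?thesis unfolding Dp_def W_def
            by (cases "t = 0") (auto simp: eunit_def intro!: exI[of _ i])
        qed (auto simp: Dp_def eunit_def)
      next
        case False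
        then have "x 0 > 0" "t > 0" using that unfolding Dp_def by auto
        then have "(1 - t) + t * x 0 > 0" using that by (simp add: add_nonneg_pos)
        then show ?thesis unfolding Dp_def by (auto simp: eunit_def)
      qed
      then show ?thesis using that e0 by auto
    qed
    show "\<exists>e>0. \<forall>x\<in>Efin n \<inter> Dp. \<forall>y\<in>Efin n \<inter> Dp. \<forall>w\<in>Efin n \<inter> Dp. l2 (x - z) < e \<and> l2 (y - z) < e \<and> l2 (w - z) < e \<longrightarrow>
        \<phi>2 x y + \<phi>2 y w + \<phi>2 x w = 0" if "z \<in> Efin n \<inter> Dp" for z
    proof -
      have "z \<in> Efin n" "z \<noteq> 0" using that W0 by auto
      from coc2[OF this] obtain e where e: "e > 0" "\<forall>x\<in>Efin n - {0}. \<forall>y\<in>Efin n - {0}. \<forall>w\<in>Efin n - {0}. l2 (x - z) < e \<and> l2 (y - z) < e \<and> l2 (w - z) < e \<longrightarrow>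
        \<phi>2 x y + \<phi>2 y w + \<phi>2 x w = 0" by blast
      moreover have "Efin n \<inter> Dp \<subseteq> Efin n - {0}" using W0 by auto
      ultimately show ?thesis by (intro exI[of _ e] conjI e(1)) blast
    qed
  qed (use z in auto)
  have hm: "\<exists>e>0. \<forall>x\<in>Efin n \<inter> Dm. l2 (x - z) < e \<longrightarrow> \<phi>2 z x = hm z + hm x" if z: "z \<in> Efin n" "z \<in> Dm" for n z
    unfolding hm_def
  proof (rule l2n.star_cocycle_exact[of _ n])
    show "- eunit 0 \<in> Efin n \<inter> Dm" using e0 unfolding Dm_def by (auto simp: eunit_def)
    show "(1 - t) *\<^sub>R (- eunit 0) + t *\<^sub>R x \<in> Efin n \<inter> Dm" if "x \<in> Efin n \<inter> Dm" "0 \<le> t" "t \<le> 1" for x t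
    proof -
      have "(1 - t) *\<^sub>R (- eunit 0) + t *\<^sub>R x \<in> Dm"
      proof (cases "t = 0 \<or> x \<in> W")
        case True
        then show ?thesis
        proof
          assume "x \<in> W"
          then obtain i where "i > 0" "x i \<noteq> 0" unfolding W_def by auto
          then show ?thesis unfolding Dm_def W_def
            by (cases "t = 0") (auto simp: eunit_def intro!: exI[of _ i])
        qed (auto simp: Dm_def eunit_def)
      next
        case False
        then have "- x 0 > 0" "t > 0" using that unfolding Dm_def by auto
        then have "(1 - t) + t * (- x 0) > 0" using that by (intro add_nonneg_pos mult_pos_pos) auto
        then show ?thesis unfolding Dm_def by (auto simp: eunit_def)
      qed
      then show ?thesis using that e0 by auto
    qed
    show "\<exists>e>0. \<forall>x\<in>Efin n \<inter> Dm. \<forall>y\<in>Efin n \<inter> Dm. \<forall>w\<in>Efin n \<inter> Dm. l2 (x - z) < e \<and> l2 (y - z) < e \<and> l2 (w - z) < e \<longrightarrow>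
        \<phi>2 x y + \<phi>2 y w + \<phi>2 x w = 0" if "z \<in> Efin n \<inter> Dm" for z
    proof -
      have "z \<in> Efin n" "z \<noteq> 0" using that W0 by auto
      from coc2[OF this] obtain e where e: "e > 0" "\<forall>x\<in>Efin n - {0}. \<forall>y\<in>Efin n - {0}. \<forall>w\<in>Efin n - {0}. l2 (x - z) < e \<and> l2 (y - z) < e \<and> l2 (w - z) < e \<longrightarrow>
        \<phi>2 x y + \<phi>2 y w + \<phi>2 x w = 0" by blast
      moreover have "Efin n \<inter> Dm \<subseteq> Efin n - {0}" using W0 by auto
      ultimately show ?thesis by (intro exI[of _ e] conjI e(1)) blast
    qed
  qed (use z in auto)
  \<comment> \<open>A Mayer-Vietoris argument: on the connected overlap the two primitives differ by
    a constant, namely \<open>c0\<close> below, and after this correction they glue to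
    \<open>h\<close>.\<close>
  have const: "hp x + hm x = hp y + hm y" if xy: "x \<in> Einf" "x \<in> W" "y \<in> Einf" "y \<in> W" for x y
  proof (rule locally_constant_Einf[of W "\<lambda>x. hp x + hm x"])
    fix n z assume z: "z \<in> Efin n" "z \<in> W"
    obtain e1 where e1: "e1 > 0" "\<forall>x\<in>Efin n \<inter> Dp. l2 (x - z) < e1 \<longrightarrow> \<phi>2 z x = hp z + hp x"
      using hp[OF z(1)] z unfolding Dp_def by auto
    obtain e2 where e2: "e2 > 0" "\<forall>x\<in>Efin n \<inter> Dm. l2 (x - z) < e2 \<longrightarrow> \<phi>2 z x = hm z + hm x"
      using hm[OF z(1)] z unfolding Dm_def by auto
    show "\<exists>e>0. \<forall>x\<in>Efin n \<inter> W. l2 (x - z) < e \<longrightarrow> hp x + hm x = hp z + hm z"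
    proof (intro exI[of _ "min e1 e2"] conjI ballI impI)
      fix x assume x: "x \<in> Efin n \<inter> W" "l2 (x - z) < min e1 e2"
      then have "hp z + hp x = hm z + hm x" using e1 e2 unfolding Dp_def Dm_def by auto
      then show "hp x + hm x = hp z + hm z"
        by (cases "hp x"; cases "hm x"; cases "hp z"; cases "hm z") auto
    qed (use e1 e2 in auto)
  next
    fix n x k t assume a: "x \<in> Efin n" "x \<in> W" "n < k" "0 \<le> t" "t \<le> (1::real)"
    show "(1 - t) *\<^sub>R x + t *\<^sub>R eunit k \<in> W"
    proof (cases "t = 0")
      case False
      have "((1 - t) *\<^sub>R x + t *\<^sub>R eunit k) k \<noteq> 0" using a False unfolding Efin_def eunit_def by auto
      moreover have "k > 0" using a by auto
      ultimately show ?thesis unfolding W_def by (intro CollectI exI[of _ k]) simp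
    qed (use a in auto)
  qed (use xy in auto)
  define c0 where "c0 = hp (eunit 1) + hm (eunit 1)"
  have e1: "eunit 1 \<in> Einf" "eunit 1 \<in> W"
    using eunit_Efin[of 1 1] Efin_Einf unfolding W_def by (auto simp: eunit_def)
  have c0: "hp x = hm x + c0" if "x \<in> Einf" "x \<in> W" for x
    using const[OF that e1] unfolding c0_def
    by (cases "hp x"; cases "hm x"; cases "hp (eunit 1)"; cases "hm (eunit 1)") auto
  define h where "h = (\<lambda>x. if x \<in> Dp then hp x else hm x + c0)"
  have hloc: "\<exists>e>0. \<forall>x\<in>Efin n - {0}. l2 (x - z) < e \<longrightarrow> \<phi>2 z x = h z + h x" if z: "z \<in> Efin n" "z \<noteq> 0" for n z
  proof -
    have coord: "\<bar>x i - z i\<bar> \<le> l2 (x - z)" if "x \<in> Efin n" for x i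
      using abs_le_l2[of "x - z" i] Efin_Einf[of _ n] that z by auto
    show ?thesis
    proof (cases "z \<in> Dp")
      case True
      obtain e where e: "e > 0" "\<forall>x\<in>Efin n \<inter> Dp. l2 (x - z) < e \<longrightarrow> \<phi>2 z x = hp z + hp x"
        using hp[OF z(1) True] by blast
      obtain e' where e': "e' > 0" "\<forall>x\<in>Efin n. l2 (x - z) < e' \<longrightarrow> x \<in> Dp"
      proof (cases "z 0 > 0")
        case T: True
        show ?thesis by (rule that[of "z 0"]) (use T coord[of _ 0] in \<open>fastforce simp: Dp_def\<close>)+
      next
        case False
        then obtain i where i: "i > 0" "z i \<noteq> 0" using True unfolding Dp_def W_def by auto
        show ?thesis
        proof (rule that[of "\<bar>z i\<bar>"])
          show "\<forall>x\<in>Efin n. l2 (x - z) < \<bar>z i\<bar> \<longrightarrow> x \<in> Dp"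
          proof (intro ballI impI)
            fix x assume "x \<in> Efin n" "l2 (x - z) < \<bar>z i\<bar>"
            with coord[of x i] have "x i \<noteq> 0" by auto
            then show "x \<in> Dp" using i unfolding Dp_def W_def by auto
          qed
        qed (use i in auto)
      qed
      show ?thesis
        by (rule exI[of _ "min e e'"]) (use e e' True in \<open>auto simp: h_def\<close>)
    next
      case False
      have z0: "z 0 < 0"
      proof -
        have "z i = 0" if "i > 0" for i using False that unfolding Dp_def W_def by blast
        then have "z 0 \<noteq> 0" using z(2) by (metis ext gr0I zero_fun_apply)
        then show ?thesis using False unfolding Dp_def by auto
      qed
      then have zm: "z \<in> Dm" unfolding Dm_def by auto
      obtain e where e: "e > 0" "\<forall>x\<in>Efin n \<inter> Dm. l2 (x - z) < e \<longrightarrow> \<phi>2 z x = hm z + hm x"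
        using hm[OF z(1) zm] by blast
      show ?thesis
      proof (intro exI[of _ "min e (- z 0)"] conjI ballI impI)
        fix x assume x: "x \<in> Efin n - {0}" "l2 (x - z) < min e (- z 0)"
        then have x0: "x 0 < 0" using coord[of x 0] by auto
        then have xm: "x \<in> Dm" unfolding Dm_def by auto
        have "h x = hm x + c0"
        proof (cases "x \<in> W")
          case True
          then show ?thesis using c0[of x] x Efin_Einf[of x n] unfolding h_def Dp_def by auto
        next
          case False
          then show ?thesis using x0 unfolding h_def Dp_def by auto
        qed
        moreover have "h z = hm z + c0" using False unfolding h_def by auto
        ultimately show "\<phi>2 z x = h z + h x" using e x xm by (auto simp: algebra_simps)
      qed (use e z0 in auto)
    qed
  qed
  have hS: "\<exists>e>0. \<forall>x\<in>Sfin n. l2 (x - z) < e \<longrightarrow> \<phi>1 z x = h z + h x" if z: "z \<in> Sfin n" for n z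
  proof -
    have S: "x \<in> Efin n - {0}" "nrm x = x" if "x \<in> Sfin n" for x
      using that nrm_id[of x] by (auto simp: Sfin_iff Sinf_iff intro: Efin_Einf)
    obtain e where e: "e > 0" "\<forall>x\<in>Efin n - {0}. l2 (x - z) < e \<longrightarrow> \<phi>2 z x = h z + h x"
      using hloc[of z n] S[OF z] by blast
    then show ?thesis using S z unfolding \<phi>2_def by metis
  qed
  show ?thesis
  proof (rule that[of h])
    fix x assume x: "x \<in> Sinf"
    obtain U where U: "openin Sinf_top U" "x \<in> U" "\<And>a b c. a \<in> U \<Longrightarrow> b \<in> U \<Longrightarrow> c \<in> U \<Longrightarrow> \<phi>1 a b + \<phi>1 b c + \<phi>1 a c = 0"
      using coc[OF x] by blast
    define V where "V = {z \<in> U. \<phi>1 x z = h x + h z}"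
    have "openin Sinf_top V"
      unfolding openin_Sinf_top
    proof (intro conjI allI ballI)
      show "V \<subseteq> Sinf" using U(1) unfolding V_def openin_Sinf_top by auto
      fix n z assume z: "z \<in> V \<inter> Sfin n"
      obtain e1 where e1: "e1 > 0" "\<forall>y\<in>Sfin n. l2 (y - z) < e1 \<longrightarrow> y \<in> U"
        using U(1) z unfolding openin_Sinf_top V_def by blast
      obtain e2 where e2: "e2 > 0" "\<forall>y\<in>Sfin n. l2 (y - z) < e2 \<longrightarrow> \<phi>1 z y = h z + h y"
        using hS z by blast
      show "\<exists>e>0. \<forall>y\<in>Sfin n. l2 (y - z) < e \<longrightarrow> y \<in> V"
      proof (intro exI[of _ "min e1 e2"] conjI ballI impI)
        fix y assume y: "y \<in> Sfin n" "l2 (y - z) < min e1 e2"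
        then have "y \<in> U" "\<phi>1 z y = h z + h y" using e1 e2 by auto
        moreover have "\<phi>1 x z + \<phi>1 z y + \<phi>1 x y = 0" using U(3)[OF U(2), of z y] calculation z unfolding V_def by auto
        moreover have "\<phi>1 x z = h x + h z" using z unfolding V_def by auto
        ultimately show "y \<in> V" unfolding V_def
          by (cases "\<phi>1 x y"; cases "h x"; cases "h z"; cases "h y") auto
      qed (use e1 e2 in auto)
    qed
    moreover have "x \<in> V" using U(3)[OF U(2) U(2) U(2)] U(2) unfolding V_def by auto
    moreover have "\<phi>1 a b = h a + h b" if "a \<in> V" "b \<in> V" for a b
      using U(3)[OF U(2), of a b] that unfolding V_def
      by (cases "\<phi>1 a b"; cases "h x"; cases "h a"; cases "h b") auto
    ultimately show "\<exists>V. openin Sinf_top V \<and> x \<in> V \<and>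
       (\<forall>a\<in>V. \<forall>b\<in>V. \<phi> [orbit2 uminus a, orbit2 uminus b] = h a + h b)"
      unfolding \<phi>1_def by blast
  qed
qed

lemma orbit2_uminus [simp]: "orbit2 uminus (- x) = orbit2 uminus (x :: nat \<Rightarrow> real)"
  by (rule orbit2_ng) simp

lemma openin_uminus_Sinf:
  assumes "openin Sinf_top V"
  shows "openin Sinf_top (uminus ` V)"
  unfolding openin_Sinf_top
proof (intro conjI allI ballI)
  show "uminus ` V \<subseteq> Sinf" using assms unfolding openin_Sinf_top by auto
  have Sn: "- y \<in> Sfin n" if "y \<in> Sfin n" for y n using that unfolding Sfin_def by auto
  fix n z assume z: "z \<in> uminus ` V \<inter> Sfin n"
  then have "- z \<in> V \<inter> Sfin n" using Sn by auto
  then obtain e where e: "e > 0" "\<forall>y\<in>Sfin n. l2 (y - - z) < e \<longrightarrow> y \<in> V" using assms unfolding openin_Sinf_top by meson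
  show "\<exists>e>0. \<forall>y\<in>Sfin n. l2 (y - z) < e \<longrightarrow> y \<in> uminus ` V"
  proof (intro exI[of _ e] conjI ballI impI e(1))
    fix y assume y: "y \<in> Sfin n" "l2 (y - z) < e"
    have "l2 (- y - - z) = l2 (y - z)"
    proof -
      have "y - z \<in> Efin n" using y z by (auto simp: Sfin_iff)
      then have "l2 (- (y - z)) = l2 (y - z)" by (rule l2n.N_minus)
      then show ?thesis by simp
    qed
    then have "- y \<in> V" using e Sn y by auto
    then show "y \<in> uminus ` V" by (metis image_eqI minus_minus)
  qed
qed

text \<open>Since \<open>omega_RP\<close> is defined by a choice, a witness is needed: the class of
  the double cover. The coboundary of an odd bit function is invariant and descends to tuples of
  mutually near orbits. If it had a primitive downstairs, adding the lift of that primitive to the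
  odd function would give a function that is locally constant, hence constant on the sphere, and
  still odd.\<close>

lemma RPinf_nontrivial_cocycle: "\<exists>\<phi>. as_cocycle RPinf_top 1 \<phi> \<and> \<not> as_class_zero RPinf_top 1 \<phi>"
proof -
  have ne: "- x \<noteq> x" if "x \<in> Sinf" for x
  proof
    assume "- x = x"
    then have "x = 0" by (auto simp: fun_eq_iff)
    then show False using that unfolding Sinf_iff by simp
  qed
  obtain s0 :: "(nat \<Rightarrow> real) \<Rightarrow> bit" where s0: "\<And>x. x \<in> Sinf \<Longrightarrow> s0 (- x) = s0 x + 1"
    using odd_bit_exists[of Sinf uminus] ne by auto
  define near where "near = (\<lambda>x y :: nat \<Rightarrow> real. l2 (x - y) < l2 (x + y))"
  obtain \<Phi> where \<Phi>: "\<And>xs. set xs \<subseteq> Sinf \<Longrightarrow> (\<And>x y. x \<in> set xs \<Longrightarrow> y \<in> set xs \<Longrightarrow> near x y) \<Longrightarrow>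
     \<Phi> (map (orbit2 uminus) xs) = wp s0 xs"
  proof (rule descend_cochain[of Sinf near uminus "wp s0"])
    show "wp s0 (map uminus xs) = wp s0 xs" if "set xs \<subseteq> Sinf" for xs
      using wp_neg[of xs s0 uminus] s0 that by auto
    show "near (- x) (- y)" if "x \<in> Sinf" "y \<in> Sinf" "near x y" for x y
    proof -
      have "x - y \<in> Einf" "x + y \<in> Einf" using that by (auto simp: Sinf_iff)
      then have "l2 (- (x - y)) = l2 (x - y)" "l2 (- (x + y)) = l2 (x + y)" using l2.N_minus by blast+
      then show ?thesis using that unfolding near_def by (simp add: algebra_simps)
    qed
  qed (auto simp: near_def)
  \<comment> \<open>With radius 1/4 two points of \<open>V x\<close> are less than 1/2 apart, while
    their sum has norm above 1; hence all pairs in \<open>V x\<close> are near.\<close>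
  define V where "V = (\<lambda>x. {y \<in> Sinf. l2 (y - x) < 1/4})"
  have Vnear: "near y z" if "x \<in> Sinf" "y \<in> V x" "z \<in> V x" for x y z
  proof -
    have E: "x \<in> Einf" "y \<in> Einf" "z \<in> Einf" "l2 x = 1" "l2 (y - x) < 1/4" "l2 (z - x) < 1/4"
      using that unfolding V_def Sinf_iff by auto
    have "l2 (y - z) \<le> l2 (y - x) + l2 (x - z)" using E by (intro l2.N_tri_diff) auto
    then have 1: "l2 (y - z) < 1/2" using E l2.N_diff_commute[of x z] by auto
    have "l2 (2 *\<^sub>R x) \<le> l2 (y + z) + l2 (2 *\<^sub>R x - (y + z))" using E by (intro l2.N_le) auto
    moreover have "2 *\<^sub>R x - (y + z) = (x - y) + (x - z)" by (simp add: scaleR_2)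
    moreover have "l2 ((x - y) + (x - z)) \<le> l2 (x - y) + l2 (x - z)" using E by (intro l2.tri) auto
    moreover have "l2 (2 *\<^sub>R x) = 2 * l2 x" using E by (simp add: l2.hom)
    ultimately have "2 * l2 x \<le> l2 (y + z) + (l2 (x - y) + l2 (x - z))" by simp
    then have "l2 (y + z) > 1" using E l2.N_diff_commute[of x z] l2.N_diff_commute[of x y] by auto
    then show ?thesis using 1 unfolding near_def by auto
  qed
  have Vopen: "openin Sinf_top (V x)" if x: "x \<in> Sinf" for x
    unfolding openin_Sinf_top
  proof (intro conjI allI ballI)
    fix n z assume z: "z \<in> V x \<inter> Sfin n"
    show "\<exists>e>0. \<forall>y\<in>Sfin n. l2 (y - z) < e \<longrightarrow> y \<in> V x"
    proof (intro exI[of _ "1/4 - l2 (z - x)"] conjI ballI impI)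
      fix y assume y: "y \<in> Sfin n" "l2 (y - z) < 1/4 - l2 (z - x)"
      then have "y \<in> Sinf" unfolding Sfin_def by auto
      moreover have "l2 (y - x) \<le> l2 (y - z) + l2 (z - x)"
        using x calculation z unfolding V_def Sinf_iff by (intro l2.N_tri_diff) auto
      ultimately show "y \<in> V x" using y unfolding V_def by auto
    qed (use z in \<open>auto simp: V_def\<close>)
  qed (auto simp: V_def)
  have Vself: "x \<in> V x" if "x \<in> Sinf" for x using that unfolding V_def by auto
  have oV: "openin RPinf_top (orbit2 uminus ` V x)" if x: "x \<in> Sinf" for x
  proof -
    have "{y \<in> Sinf. orbit2 uminus y \<in> orbit2 uminus ` V x} = V x \<union> uminus ` V x"
    proof
      show "{y \<in> Sinf. orbit2 uminus y \<in> orbit2 uminus ` V x} \<subseteq> V x \<union> uminus ` V x"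
        by (auto dest!: orbit2_eqD) (metis image_eqI minus_minus)
      show "V x \<union> uminus ` V x \<subseteq> {y \<in> Sinf. orbit2 uminus y \<in> orbit2 uminus ` V x}"
        unfolding V_def by auto
    qed
    then show ?thesis unfolding openin_RPinf_top
      using Vopen[OF x] openin_uminus_Sinf[OF Vopen[OF x]] by (auto simp: V_def)
  qed
  have lift: "\<exists>xs. ys = map (orbit2 uminus) xs \<and> set xs \<subseteq> V x" if "set ys \<subseteq> orbit2 uminus ` V x" for ys x
  proof -
    have "\<forall>y\<in>set ys. \<exists>a. y = orbit2 uminus a \<and> a \<in> V x" using that by auto
    then obtain c where "\<forall>y\<in>set ys. y = orbit2 uminus (c y) \<and> c y \<in> V x" by metis
    then show ?thesis by (intro exI[of _ "map c ys"]) (auto simp: map_idI comp_def)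
  qed
  have "as_cocycle RPinf_top 1 \<Phi>"
    unfolding as_cocycle_def as_locally_zero_iff
  proof
    fix y assume "y \<in> topspace RPinf_top"
    then obtain x where x: "x \<in> Sinf" "y = orbit2 uminus x" unfolding topspace_RPinf_top by auto
    have "as_cobound \<Phi> ys = 0" if ys: "set ys \<subseteq> orbit2 uminus ` V x" for ys
    proof -
    obtain xs where xs: "ys = map (orbit2 uminus) xs" "set xs \<subseteq> V x" using lift[OF ys] by blast
    have "as_cobound \<Phi> ys = as_cobound (wp s0) xs"
      unfolding xs(1)
    proof (rule descend_cobound[of Sinf near])
      show "set xs \<subseteq> Sinf" using xs unfolding V_def by auto
      show "\<And>a b. a \<in> set xs \<Longrightarrow> b \<in> set xs \<Longrightarrow> near a b" using Vnear[OF x(1)] xs by auto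
    qed (use \<Phi> in auto)
    then show "as_cobound \<Phi> ys = 0" by simp
    qed
    then show "\<exists>U. openin RPinf_top U \<and> y \<in> U \<and>
        (\<forall>ys. length ys = Suc (Suc 1) \<longrightarrow> set ys \<subseteq> U \<longrightarrow> as_cobound \<Phi> ys = 0)"
      using oV[OF x(1)] Vself[OF x(1)] x by (intro exI[of _ "orbit2 uminus ` V x"]) auto
  qed
  moreover have "\<not> as_class_zero RPinf_top 1 \<Phi>"
  proof
    assume "as_class_zero RPinf_top 1 \<Phi>"
    then obtain \<Psi> where \<Psi>: "as_locally_zero RPinf_top 1 (\<lambda>ys. \<Phi> ys + as_cobound \<Psi> ys)"
      unfolding as_class_zero_def by auto
    define t where "t = (\<lambda>x. s0 x + \<Psi> [orbit2 uminus x])"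
    have loc: "\<exists>e>0. \<forall>x\<in>Sfin n. l2 (x - z) < e \<longrightarrow> t x = t z" if z: "z \<in> Sfin n" for n z
    proof -
      have zS: "z \<in> Sinf" using z unfolding Sfin_def by auto
      then have "orbit2 uminus z \<in> topspace RPinf_top" using topspace_RPinf_top by auto
      then obtain U where U: "openin RPinf_top U" "orbit2 uminus z \<in> U"
        "\<And>ys. length ys = Suc 1 \<Longrightarrow> set ys \<subseteq> U \<Longrightarrow> \<Phi> ys + as_cobound \<Psi> ys = 0"
        using \<Psi> unfolding as_locally_zero_iff by meson
      have "openin Sinf_top {x \<in> Sinf. orbit2 uminus x \<in> U}" using U(1) unfolding openin_RPinf_top by auto
      then have "openin Sinf_top ({x \<in> Sinf. orbit2 uminus x \<in> U} \<inter> V z)" using Vopen[OF zS] by auto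
      moreover have "z \<in> ({x \<in> Sinf. orbit2 uminus x \<in> U} \<inter> V z) \<inter> Sfin n" using z zS U Vself by auto
      ultimately obtain e where e: "e > 0" "\<forall>y\<in>Sfin n. l2 (y - z) < e \<longrightarrow> y \<in> {x \<in> Sinf. orbit2 uminus x \<in> U} \<inter> V z"
        unfolding openin_Sinf_top by meson
      show ?thesis
      proof (intro exI[of _ e] conjI e(1) ballI impI)
        fix x assume "x \<in> Sfin n" "l2 (x - z) < e"
        then have x: "x \<in> Sinf" "orbit2 uminus x \<in> U" "x \<in> V z" using e by auto
        have "\<Phi> (map (orbit2 uminus) [z, x]) = wp s0 [z, x]"
          using x zS Vnear[OF zS] Vself[OF zS] by (intro \<Phi>) auto
        moreover have "\<Phi> (map (orbit2 uminus) [z, x]) + as_cobound \<Psi> (map (orbit2 uminus) [z, x]) = 0"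
          by (rule U(3)) (use U x in auto)
        ultimately have "s0 z + s0 x + (\<Psi> [orbit2 uminus x] + \<Psi> [orbit2 uminus z]) = 0"
          by (simp add: as_cobound_Cons)
        then show "t x = t z" unfolding t_def
          by (cases "s0 z"; cases "s0 x"; cases "\<Psi> [orbit2 uminus x]"; cases "\<Psi> [orbit2 uminus z]") auto
      qed
    qed
    have e: "eunit 0 \<in> Sinf"
    proof -
      have "eunit 0 \<in> Efin 0" by (rule eunit_Efin) simp
      moreover have "l2 (eunit 0) = 1" unfolding l2_Efin[OF calculation] by (simp add: L2_set_def eunit_def)
      ultimately show ?thesis unfolding Sinf_iff using Efin_Einf by auto
    qed
    have "t (eunit 0) = t (- eunit 0)" by (rule locally_constant_Sinf[OF loc]) (use e in auto)
    then show False unfolding t_def using s0[OF e] by (cases "s0 (eunit 0)"; cases "\<Psi> [orbit2 uminus (eunit 0)]") auto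
  qed
  ultimately show ?thesis by blast
qed

text \<open>The sum of \<open>h\<close> at antipodal points is locally constant, hence constant on
  the sphere. If the constant were 0, then \<open>h\<close> would descend to the projective space
  and exhibit the generator as a coboundary; so it is 1, and \<open>h\<close> is odd.\<close>

lemma omega_RP_primitive:
  obtains h :: "(nat \<Rightarrow> real) \<Rightarrow> bit" where "\<And>x. x \<in> Sinf \<Longrightarrow> h (- x) = h x + 1"
    "\<And>x. x \<in> Sinf \<Longrightarrow> \<exists>V. openin Sinf_top V \<and> x \<in> V \<and>
       (\<forall>a\<in>V. \<forall>b\<in>V. omega_RP [orbit2 uminus a, orbit2 uminus b] = h a + h b)"
proof -
  have om: "as_cocycle RPinf_top 1 omega_RP" "\<not> as_class_zero RPinf_top 1 omega_RP"
    using someI_ex[OF RPinf_nontrivial_cocycle] unfolding omega_RP_def by auto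
  obtain h where h: "\<And>x. x \<in> Sinf \<Longrightarrow> \<exists>V. openin Sinf_top V \<and> x \<in> V \<and>
       (\<forall>a\<in>V. \<forall>b\<in>V. omega_RP [orbit2 uminus a, orbit2 uminus b] = h a + h b)"
    using RPinf_cocycle_primitive[OF om(1)] by blast
  have const: "h x + h (- x) = h y + h (- y)" if "x \<in> Sinf" "y \<in> Sinf" for x y
  proof (rule locally_constant_Sinf[of "\<lambda>x. h x + h (- x)", OF _ that])
    fix n z assume z: "z \<in> Sfin n"
    then have zS: "z \<in> Sinf" "- z \<in> Sinf" unfolding Sfin_def by auto
    obtain V1 where V1: "openin Sinf_top V1" "z \<in> V1" "\<And>a b. a \<in> V1 \<Longrightarrow> b \<in> V1 \<Longrightarrow> omega_RP [orbit2 uminus a, orbit2 uminus b] = h a + h b"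
      using h[OF zS(1)] by auto
    obtain V2 where V2: "openin Sinf_top V2" "- z \<in> V2" "\<And>a b. a \<in> V2 \<Longrightarrow> b \<in> V2 \<Longrightarrow> omega_RP [orbit2 uminus a, orbit2 uminus b] = h a + h b"
      using h[OF zS(2)] by auto
    have "openin Sinf_top (V1 \<inter> uminus ` V2)" using V1 openin_uminus_Sinf[OF V2(1)] by auto
    moreover have "z \<in> (V1 \<inter> uminus ` V2) \<inter> Sfin n" using V1 V2 z by (metis IntI image_eqI minus_minus)
    ultimately obtain e where e: "e > 0" "\<forall>y\<in>Sfin n. l2 (y - z) < e \<longrightarrow> y \<in> V1 \<inter> uminus ` V2"
      unfolding openin_Sinf_top by meson
    show "\<exists>e>0. \<forall>x\<in>Sfin n. l2 (x - z) < e \<longrightarrow> h x + h (- x) = h z + h (- z)"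
    proof (intro exI[of _ e] conjI e(1) ballI impI)
      fix x assume "x \<in> Sfin n" "l2 (x - z) < e"
      then have "x \<in> V1" "- x \<in> V2" using e by auto
      then have "h z + h x = h (- z) + h (- x)" using V1(3)[of z x] V2(3)[of "- z" "- x"] V1 V2 by simp
      then show "h x + h (- x) = h z + h (- z)"
        by (cases "h x"; cases "h z"; cases "h (- x)"; cases "h (- z)") auto
    qed
  qed
  have odd: "h (- x) = h x + 1" if x: "x \<in> Sinf" for x
  proof (rule ccontr)
    assume no: "h (- x) \<noteq> h x + 1"
    then have "h x + h (- x) = 0" by (cases "h x"; cases "h (- x)") auto
    then have sym: "h (- y) = h y" if "y \<in> Sinf" for y using const[OF x that] by (simp add: bit_add_eq_0_iff)
    define \<Psi> where "\<Psi> = (\<lambda>os. h (SOME u. u \<in> hd os))"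
    have \<Psi>: "\<Psi> [orbit2 uminus y] = h y" if "y \<in> Sinf" for y
    proof -
      have "(SOME u. u \<in> orbit2 uminus y) \<in> orbit2 uminus y" by (rule someI[of _ y]) (simp add: orbit2_def)
      then show ?thesis unfolding \<Psi>_def using sym[OF that] by (auto simp: orbit2_def)
    qed
    obtain V where V: "\<And>x. x \<in> Sinf \<Longrightarrow> openin Sinf_top (V x) \<and> x \<in> V x \<and>
       (\<forall>a\<in>V x. \<forall>b\<in>V x. omega_RP [orbit2 uminus a, orbit2 uminus b] = h a + h b)"
      using h by metis
    have VS: "V x \<subseteq> Sinf" if "x \<in> Sinf" for x using V[OF that] unfolding openin_Sinf_top by auto
    have "as_locally_zero RPinf_top 1 (\<lambda>ys. omega_RP ys + as_cobound \<Psi> ys)"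
      unfolding as_locally_zero_iff
    proof
      fix y assume "y \<in> topspace RPinf_top"
      then obtain x where x: "x \<in> Sinf" "y = orbit2 uminus x" unfolding topspace_RPinf_top by auto
      have op: "openin RPinf_top (orbit2 uminus ` V x)"
      proof -
        have "{y \<in> Sinf. orbit2 uminus y \<in> orbit2 uminus ` V x} = V x \<union> uminus ` V x"
        proof
          show "{y \<in> Sinf. orbit2 uminus y \<in> orbit2 uminus ` V x} \<subseteq> V x \<union> uminus ` V x"
            by (auto dest!: orbit2_eqD) (metis image_eqI minus_minus)
          show "V x \<union> uminus ` V x \<subseteq> {y \<in> Sinf. orbit2 uminus y \<in> orbit2 uminus ` V x}"
            using VS[OF x(1)] by auto
        qed
        then show ?thesis unfolding openin_RPinf_top
          using V[OF x(1)] openin_uminus_Sinf[of "V x"] VS[OF x(1)] by auto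
      qed
      have "omega_RP ys + as_cobound \<Psi> ys = 0" if ys: "length ys = Suc 1" "set ys \<subseteq> orbit2 uminus ` V x" for ys
      proof -
      obtain o1 o2 where "ys = [o1, o2]" using ys by (auto simp: length_Suc_conv)
      then obtain a b where ab: "a \<in> V x" "b \<in> V x" "ys = [orbit2 uminus a, orbit2 uminus b]" using ys by auto
      then have "omega_RP ys = h a + h b" using V[OF x(1)] by auto
      then show "omega_RP ys + as_cobound \<Psi> ys = 0"
        using ab \<Psi>[OF subsetD[OF VS[OF x(1)] ab(1)]] \<Psi>[OF subsetD[OF VS[OF x(1)] ab(2)]]
        by (simp add: as_cobound_Cons ac_simps)
      qed
      then show "\<exists>U. openin RPinf_top U \<and> y \<in> U \<and>
          (\<forall>ys. length ys = Suc 1 \<longrightarrow> set ys \<subseteq> U \<longrightarrow> omega_RP ys + as_cobound \<Psi> ys = 0)"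
        using op V[OF x(1)] x by (intro exI[of _ "orbit2 uminus ` V x"]) auto
    qed
    then have "as_class_zero RPinf_top 1 omega_RP" unfolding as_class_zero_def by auto
    then show False using om by simp
  qed
  then show ?thesis using that h by blast
qed

subsection \<open>The index in terms of invariant cochains\<close>

text \<open>\<open>as_pow\<close> appends factors on the right while \<open>wp\<close> unfolds from
  the left; this reconciles the two recursions.\<close>

lemma wp_snoc: "wp s (xs @ [a, b]) = wp s (xs @ [a]) * (s a + s b)"
  by (induction xs rule: induct_list012) (auto simp: algebra_simps)

lemma as_pow_map:
  assumes "length ys = Suc q" "\<And>a b. a \<in> set ys \<Longrightarrow> b \<in> set ys \<Longrightarrow> \<phi> [F a, F b] = s a + s b"
  shows "as_pow \<phi> q (map F ys) = wp s ys"
  using assms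
proof (induction q arbitrary: ys)
  case 0
  then show ?case by (auto simp: length_Suc_conv)
next
  case (Suc j)
  from Suc.prems(1) obtain zs b where zs: "ys = zs @ [b]" "length zs = Suc j" by (metis length_Suc_conv_rev)
  then obtain xs a where xs: "zs = xs @ [a]" "length xs = j" by (metis length_Suc_conv_rev)
  have "as_pow \<phi> j (map F (xs @ [a])) = wp s (xs @ [a])"
    using Suc.prems zs xs by (intro Suc.IH) auto
  moreover have "\<phi> [F a, F b] = s a + s b" using Suc.prems zs xs by auto
  ultimately show ?case using zs xs wp_snoc[of s xs a b] by (simp add: as_cup_def)
qed

lemma lift_list:
  assumes "set ys \<subseteq> F ` V"
  obtains xs where "ys = map F xs" "set xs \<subseteq> V"
proof -
  have "\<forall>y\<in>set ys. \<exists>a. y = F a \<and> a \<in> V" using assms by auto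
  then obtain c where "\<forall>y\<in>set ys. y = F (c y) \<and> c y \<in> V" by metis
  then show ?thesis by (intro that[of "map c ys"]) (auto simp: map_idI comp_def)
qed

locale invol_metric = Metric_space M d for M :: "'a set" and d +
  fixes ng :: "'a \<Rightarrow> 'a"
  assumes ng_M: "\<And>x. x \<in> M \<Longrightarrow> ng x \<in> M"
    and ng_ng: "\<And>x. x \<in> M \<Longrightarrow> ng (ng x) = x"
    and ng_iso: "\<And>x y. x \<in> M \<Longrightarrow> y \<in> M \<Longrightarrow> d (ng x) (ng y) = d x y"
begin

lemma openin_sub:
  assumes "A \<subseteq> M"
  shows "openin (subtopology mtopology A) S \<longleftrightarrow> S \<subseteq> A \<and> (\<forall>x\<in>S. \<exists>r>0. \<forall>y\<in>A. d x y < r \<longrightarrow> y \<in> S)"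
    (is "?L \<longleftrightarrow> ?R")
proof
  assume ?L
  then obtain T where T: "openin mtopology T" "S = T \<inter> A" unfolding openin_subtopology by blast
  show ?R
  proof (intro conjI ballI)
    fix x assume x: "x \<in> S"
    then obtain r where "r > 0" "mball x r \<subseteq> T" using T unfolding openin_mtopology by blast
    then show "\<exists>r>0. \<forall>y\<in>A. d x y < r \<longrightarrow> y \<in> S"
      using x T assms by (intro exI[of _ r]) (auto simp: subset_iff in_mball)
  qed (use T in auto)
next
  assume R: ?R
  then obtain r where r: "\<And>x. x \<in> S \<Longrightarrow> r x > 0 \<and> (\<forall>y\<in>A. d x y < r x \<longrightarrow> y \<in> S)" by metis
  have "S = (\<Union>x\<in>S. mball x (r x)) \<inter> A"
  proof
    show "S \<subseteq> (\<Union>x\<in>S. mball x (r x)) \<inter> A"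
      using R r assms by (fastforce intro: centre_in_mball_iff[THEN iffD2])
    show "(\<Union>x\<in>S. mball x (r x)) \<inter> A \<subseteq> S" using r by (auto simp: in_mball)
  qed
  moreover have "openin mtopology (\<Union>x\<in>S. mball x (r x))" by auto
  ultimately show ?L unfolding openin_subtopology by blast
qed

definition odd_map :: "'a set \<Rightarrow> ('a \<Rightarrow> nat \<Rightarrow> real) \<Rightarrow> bool" where
  "odd_map A g \<longleftrightarrow> continuous_map (subtopology mtopology A) Sinf_top g \<and> (\<forall>u\<in>A. g (ng u) = - g u)"

context
  fixes A :: "'a set" and g :: "'a \<Rightarrow> nat \<Rightarrow> real"
  assumes A: "A \<subseteq> M" "\<And>x. x \<in> A \<Longrightarrow> ng x \<in> A" "\<And>x. x \<in> A \<Longrightarrow> ng x \<noteq> x"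
    and g: "odd_map A g"
begin

lemma g_Sinf: "x \<in> A \<Longrightarrow> g x \<in> Sinf"
  using g A unfolding odd_map_def continuous_map by (auto simp: Int_absorb1)

lemma g_preimage: "openin Sinf_top V \<Longrightarrow> x \<in> A \<Longrightarrow> g x \<in> V \<Longrightarrow> \<exists>r>0. \<forall>y\<in>A. d x y < r \<longrightarrow> g y \<in> V"
proof -
  assume V: "openin Sinf_top V" and x: "x \<in> A" "g x \<in> V"
  have "openin (subtopology mtopology A) {x \<in> topspace (subtopology mtopology A). g x \<in> V}"
    using g V unfolding odd_map_def continuous_map by blast
  moreover have "topspace (subtopology mtopology A) = A" using A by auto
  ultimately have "openin (subtopology mtopology A) {x \<in> A. g x \<in> V}" by (simp only:)
  then show ?thesis using x unfolding openin_sub[OF A(1)] by auto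
qed

text \<open>The choice operator may pick either point of the orbit; by oddness of \<open>g\<close>
  both lead to the same orbit in the sphere.\<close>

lemma induced_orbit_map_orbit: "x \<in> A \<Longrightarrow> induced_orbit_map g (orbit2 ng x) = orbit2 uminus (g x)"
proof -
  assume x: "x \<in> A"
  have "(SOME u. u \<in> orbit2 ng x) \<in> orbit2 ng x" by (rule someI[of _ x]) (simp add: orbit2_def)
  then have "(SOME u. u \<in> orbit2 ng x) = x \<or> (SOME u. u \<in> orbit2 ng x) = ng x" by (simp add: orbit2_def)
  then show ?thesis unfolding induced_orbit_map_def
    using g x unfolding odd_map_def by auto
qed

lemma omega_pullback_local:
  assumes "x \<in> A"
    and h: "\<And>x. x \<in> Sinf \<Longrightarrow> \<exists>V. openin Sinf_top V \<and> x \<in> V \<and>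
       (\<forall>a\<in>V. \<forall>b\<in>V. omega_RP [orbit2 uminus a, orbit2 uminus b] = h a + h b)"
  shows "\<exists>r>0. \<forall>xs. length xs = Suc q \<longrightarrow> set xs \<subseteq> A \<longrightarrow> (\<forall>y\<in>set xs. d x y < r) \<longrightarrow>
    as_pullback (induced_orbit_map g) (as_pow omega_RP q) (map (orbit2 ng) xs) = wp (\<lambda>x. h (g x)) xs"
proof -
  obtain V where V: "openin Sinf_top V" "g x \<in> V"
    "\<And>a b. a \<in> V \<Longrightarrow> b \<in> V \<Longrightarrow> omega_RP [orbit2 uminus a, orbit2 uminus b] = h a + h b"
    using h[OF g_Sinf[OF assms(1)]] by auto
  obtain r where r: "r > 0" "\<And>y. y \<in> A \<Longrightarrow> d x y < r \<Longrightarrow> g y \<in> V" using g_preimage[OF V(1) assms(1) V(2)] by auto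
  show ?thesis
  proof (intro exI[of _ r] conjI r(1) allI impI)
    fix xs assume xs: "length xs = Suc q" "set xs \<subseteq> A" "\<forall>y\<in>set xs. d x y < r"
    have eq: "map (induced_orbit_map g) (map (orbit2 ng) xs) = map (\<lambda>x. orbit2 uminus (g x)) xs"
      using xs induced_orbit_map_orbit by auto
    show "as_pullback (induced_orbit_map g) (as_pow omega_RP q) (map (orbit2 ng) xs) = wp (\<lambda>x. h (g x)) xs"
      unfolding as_pullback_def eq 
      by (rule as_pow_map[OF xs(1)], rule V(3)) (use xs r in auto)
  qed
qed

lemma topspace_orbits: "topspace (orbit_space mtopology ng A) = orbit2 ng ` A"
  unfolding topspace_orbit_space using A by (simp add: Int_absorb1)

text \<open>The bridge between the orbit space and cochains upstairs. The pulled-back generator is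
  locally the coboundary of the odd function \<open>\<lambda>x. h (g x)\<close>. A primitive
  downstairs is composed with the orbit map; an invariant primitive upstairs is first adapted to
  this odd function by \<open>eqze_section\<close> and then descends along near lifts. The
  right-hand side does not mention \<open>g\<close>, so the index is independent of the classifying
  map.\<close>

lemma class_zero_iff_eqz:
  "as_class_zero (orbit_space mtopology ng A) q (as_pullback (induced_orbit_map g) (as_pow omega_RP q))
     \<longleftrightarrow> eqz d ng A q" (is "as_class_zero ?Y q ?\<phi> \<longleftrightarrow> _")
proof -
  obtain h where h1: "\<And>x. x \<in> Sinf \<Longrightarrow> h (- x) = h x + 1"
    and h2: "\<And>x. x \<in> Sinf \<Longrightarrow> \<exists>V. openin Sinf_top V \<and> x \<in> V \<and>
       (\<forall>a\<in>V. \<forall>b\<in>V. omega_RP [orbit2 uminus a, orbit2 uminus b] = h a + h b)"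
    using omega_RP_primitive by blast
  have s: "h (g (ng x)) = h (g x) + 1" if "x \<in> A" for x
    using g that h1 g_Sinf unfolding odd_map_def by auto
  have dpos: "d x (ng x) > 0" if "x \<in> A" for x
    using A that ng_M mdist_pos_less by (metis subsetD)
  show ?thesis
  proof (cases "A = {}")
    case True
    then have "as_locally_zero ?Y q \<psi>" for \<psi>
      unfolding as_locally_zero_iff topspace_orbits by simp
    moreover have "eqz d ng A q" unfolding eqz_def eqze_def using True by (auto intro: exI[of _ "\<lambda>_. 0"])
    ultimately show ?thesis unfolding as_class_zero_def by auto
  next
    case ne: False
    then obtain x0 where x0: "x0 \<in> A" by auto
    show ?thesis
    proof (cases "q = 0")
      case True
      \<comment> \<open>In degree 0 the unit class of a nonempty space is nonzero. The normalisation
        \<open>\<psi> [] = 0\<close> in \<open>eqze\<close> is what makes the other side fail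
        too.\<close>
      have "\<not> as_class_zero ?Y q ?\<phi>"
      proof
        assume "as_class_zero ?Y q ?\<phi>"
        then have "as_locally_zero ?Y 0 ?\<phi>" using True unfolding as_class_zero_def by simp
        moreover have "orbit2 ng x0 \<in> topspace ?Y" using x0 topspace_orbits by auto
        ultimately obtain U where "orbit2 ng x0 \<in> U"
          "\<forall>ys. length ys = Suc 0 \<longrightarrow> set ys \<subseteq> U \<longrightarrow> ?\<phi> ys = 0"
          unfolding as_locally_zero_iff by meson
        then have "?\<phi> [orbit2 ng x0] = 0" by auto
        then show False using True by (simp add: as_pullback_def)
      qed
      moreover have "\<not> eqz d ng A q"
      proof
        assume "eqz d ng A q"
        then obtain e where "eqze d ng A q e" unfolding eqz_def by blast
        then show False
        proof (rule eqzeE)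
          fix s \<psi> assume *: "\<And>x. x \<in> A \<Longrightarrow> 0 < e x" "\<psi> [] = 0"
            "\<And>x ys. x \<in> A \<Longrightarrow> length ys = Suc q \<Longrightarrow> set ys \<subseteq> A \<Longrightarrow> (\<And>y. y \<in> set ys \<Longrightarrow> d x y < e x) \<Longrightarrow>
              wp s ys = as_cobound \<psi> ys"
          have "wp s [x0] = as_cobound \<psi> [x0]" using * x0 A(1) True by (intro *(3)[of x0]) auto
          then show False using * by (simp add: as_cobound_Cons)
        qed
      qed
      ultimately show ?thesis by simp
    next
      case False
      show ?thesis
      proof
        assume "as_class_zero ?Y q ?\<phi>"
        then obtain \<Psi> where \<Psi>: "as_locally_zero ?Y q (\<lambda>ys. ?\<phi> ys + as_cobound \<Psi> ys)"
          using False unfolding as_class_zero_def by auto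
        \<comment> \<open>The value on the empty tuple is reset to meet the normalisation; in
          positive degree no face of a tuple is empty, so coboundaries do not change.\<close>
        define \<psi> where "\<psi> = (\<lambda>xs. if xs = [] then 0 else \<Psi> (map (orbit2 ng) xs))"
        have "\<exists>e>0. \<forall>ys. length ys = Suc q \<longrightarrow> set ys \<subseteq> A \<longrightarrow> (\<forall>y\<in>set ys. d x y < e) \<longrightarrow>
            wp (\<lambda>x. h (g x)) ys = as_cobound \<psi> ys" if x: "x \<in> A" for x
        proof -
          have "orbit2 ng x \<in> topspace ?Y" using x topspace_orbits by auto
          then obtain U where U: "openin ?Y U" "orbit2 ng x \<in> U"
            "\<And>ys. length ys = Suc q \<Longrightarrow> set ys \<subseteq> U \<Longrightarrow> ?\<phi> ys + as_cobound \<Psi> ys = 0"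
            using \<Psi> unfolding as_locally_zero_iff by meson
          have "openin (subtopology mtopology A) {x \<in> A. orbit2 ng x \<in> U}"
            using U(1) A unfolding openin_orbit_space by (simp add: Int_absorb1)
          then obtain r1 where r1: "r1 > 0" "\<And>y. y \<in> A \<Longrightarrow> d x y < r1 \<Longrightarrow> orbit2 ng y \<in> U"
            unfolding openin_sub[OF A(1)] using x U(2) by auto
          obtain r2 where r2: "r2 > 0" "\<And>xs. length xs = Suc q \<Longrightarrow> set xs \<subseteq> A \<Longrightarrow> (\<forall>y\<in>set xs. d x y < r2) \<Longrightarrow>
            ?\<phi> (map (orbit2 ng) xs) = wp (\<lambda>x. h (g x)) xs"
            using omega_pullback_local[OF x h2, of q] by blast
          show ?thesis
          proof (intro exI[of _ "min r1 r2"] conjI allI impI)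
            fix ys assume ys: "length ys = Suc q" "set ys \<subseteq> A" "\<forall>y\<in>set ys. d x y < min r1 r2"
            have "?\<phi> (map (orbit2 ng) ys) + as_cobound \<Psi> (map (orbit2 ng) ys) = 0"
              using ys r1 by (intro U(3)) auto
            moreover have "?\<phi> (map (orbit2 ng) ys) = wp (\<lambda>x. h (g x)) ys" using ys by (intro r2) auto
            moreover have "as_cobound \<psi> ys = as_cobound (\<lambda>xs. \<Psi> (map (orbit2 ng) xs)) ys"
              using False ys(1) by (intro as_cobound_cong) (auto simp: \<psi>_def)
            ultimately show "wp (\<lambda>x. h (g x)) ys = as_cobound \<psi> ys"
              by (simp add: as_cobound_map bit_add_eq_0_iff)
          qed (use r1 r2 in auto)
        qed
        then obtain e where e: "\<And>x. x \<in> A \<Longrightarrow> e x > 0 \<and> (\<forall>ys. length ys = Suc q \<longrightarrow> set ys \<subseteq> A \<longrightarrow> (\<forall>y\<in>set ys. d x y < e x) \<longrightarrow>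
            wp (\<lambda>x. h (g x)) ys = as_cobound \<psi> ys)" by metis
        have "eqze d ng A q e"
          unfolding eqze_def
        proof (intro conjI exI[of _ "\<lambda>x. h (g x)"] exI[of _ \<psi>] ballI allI impI)
          fix xs assume xs: "set xs \<subseteq> A"
          have "map (orbit2 ng) (map ng xs) = map (orbit2 ng) xs"
            using xs A ng_ng by (auto intro!: orbit2_ng)
          then show "\<psi> (map ng xs) = \<psi> xs" unfolding \<psi>_def by (metis map_is_Nil_conv)
        qed (use e s in \<open>auto simp: \<psi>_def\<close>)
        then show "eqz d ng A q" unfolding eqz_def by blast
      next
        assume "eqz d ng A q"
        then obtain e where e: "eqze d ng A q e" unfolding eqz_def by blast
        then have epos: "\<And>x. x \<in> A \<Longrightarrow> e x > 0" unfolding eqze_def by blast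
        obtain \<psi> where \<psi>: "\<psi> [] = 0" "\<And>xs. set xs \<subseteq> A \<Longrightarrow> \<psi> (map ng xs) = \<psi> xs"
          "\<And>x ys. x \<in> A \<Longrightarrow> length ys = Suc q \<Longrightarrow> set ys \<subseteq> A \<Longrightarrow> (\<And>y. y \<in> set ys \<Longrightarrow> d x y < e x) \<Longrightarrow>
            wp (\<lambda>x. h (g x)) ys = as_cobound \<psi> ys"
          using eqze_section[OF e, of "\<lambda>x. h (g x)"] s by blast
        define near where "near = (\<lambda>x y. d x y < d x (ng y))"
        obtain \<Psi> where \<Psi>: "\<And>xs. set xs \<subseteq> A \<Longrightarrow> (\<And>x y. x \<in> set xs \<Longrightarrow> y \<in> set xs \<Longrightarrow> near x y) \<Longrightarrow>
           \<Psi> (map (orbit2 ng) xs) = \<psi> xs"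
        proof (rule descend_cochain[of A near ng \<psi>])
          show "\<not> near x (ng y)" if "x \<in> A" "y \<in> A" "near x y" for x y
            using that A ng_ng[of y] unfolding near_def by auto
          show "near (ng x) (ng y)" if "x \<in> A" "y \<in> A" "near x y" for x y
            using that A ng_M ng_iso[of x y] ng_iso[of x "ng y"] unfolding near_def by (auto simp: subset_iff)
        qed (use A \<psi> in auto)
        have "as_locally_zero ?Y q (\<lambda>ys. ?\<phi> ys + as_cobound \<Psi> ys)"
          unfolding as_locally_zero_iff
        proof
          fix y assume "y \<in> topspace ?Y"
          then obtain x where x: "x \<in> A" "y = orbit2 ng x" using topspace_orbits by auto
          then have xM: "x \<in> M" "ng x \<in> M" using A ng_M by auto
          obtain r2 where r2: "r2 > 0" "\<And>xs. length xs = Suc q \<Longrightarrow> set xs \<subseteq> A \<Longrightarrow> (\<forall>y\<in>set xs. d x y < r2) \<Longrightarrow>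
            ?\<phi> (map (orbit2 ng) xs) = wp (\<lambda>x. h (g x)) xs"
            using omega_pullback_local[OF x(1) h2, of q] by blast
          \<comment> \<open>A quarter of the distance to the antipode: points of \<open>V\<close>
            are then less than \<open>2 * r\<close> apart, and each is more than
            \<open>2 * r\<close> away from the antipodes of the others, so all of them are mutually
            near.\<close>
          define r where "r = min (min (e x) r2) (d x (ng x) / 4)"
          have r: "r > 0" "r \<le> e x" "r \<le> r2" "r \<le> d x (ng x) / 4"
            using epos[OF x(1)] r2 dpos[OF x(1)] unfolding r_def by auto
          define V where "V = {y \<in> A. d x y < r}"
          have VA: "V \<subseteq> A" "x \<in> V" using x r xM unfolding V_def by auto
          have nearV: "near a b" if ab: "a \<in> V" "b \<in> V" for a b
          proof -
            have M: "a \<in> M" "b \<in> M" "ng b \<in> M" using ab A ng_M unfolding V_def by auto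
            have l: "d x a < r" "d x b < r" using ab unfolding V_def by auto
            have "d a b \<le> d a x + d x b" using triangle M xM by blast
            then have 1: "d a b < 2 * r" using l commute[of a x] by auto
            have "d x (ng x) \<le> d x a + d a (ng x)" using triangle M xM by blast
            also have "d a (ng x) \<le> d a (ng b) + d (ng b) (ng x)" using triangle M xM by blast
            also have "d (ng b) (ng x) = d x b" using ng_iso[OF M(2) xM(1)] commute[of b x] by simp
            finally show ?thesis using 1 l r unfolding near_def by linarith
          qed
          have op: "openin ?Y (orbit2 ng ` V)"
          proof -
            have eq: "{y \<in> A. orbit2 ng y \<in> orbit2 ng ` V} = V \<union> {y \<in> A. d (ng x) y < r}"
            proof (intro equalityI subsetI)
              fix y assume "y \<in> {y \<in> A. orbit2 ng y \<in> orbit2 ng ` V}"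
              then obtain z where z: "y \<in> A" "z \<in> V" "orbit2 ng y = orbit2 ng z" by auto
              then have "z = y \<or> z = ng y" by (intro orbit2_eqD)
              then show "y \<in> V \<union> {y \<in> A. d (ng x) y < r}"
              proof
                assume zy: "z = ng y"
                have "d (ng x) y = d (ng (ng x)) (ng y)" using ng_iso[of "ng x" y] z A xM by auto
                then have "d (ng x) y < r" using z zy ng_ng[OF xM(1)] unfolding V_def by auto
                then show ?thesis using z by auto
              qed (use z in auto)
            next
              fix y assume "y \<in> V \<union> {y \<in> A. d (ng x) y < r}"
              then show "y \<in> {y \<in> A. orbit2 ng y \<in> orbit2 ng ` V}"
              proof
                assume "y \<in> {y \<in> A. d (ng x) y < r}"
                then have y: "y \<in> A" "d (ng x) y < r" by auto
                have "d x (ng y) = d (ng x) (ng (ng y))" using ng_iso[of x "ng y"] y A xM ng_M by auto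
                then have "ng y \<in> V" using y A ng_ng[of y] unfolding V_def by auto
                moreover have "orbit2 ng y = orbit2 ng (ng y)" using orbit2_ng[of ng y] ng_ng[of y] y A by auto
                ultimately show ?thesis using y by auto
              qed (use VA in auto)
            qed
            have opb: "openin (subtopology mtopology A) {y \<in> A. d c y < r}" if "c \<in> M" for c
              unfolding openin_sub[OF A(1)]
            proof (intro conjI ballI)
              fix z assume z: "z \<in> {y \<in> A. d c y < r}"
              show "\<exists>\<delta>>0. \<forall>y\<in>A. d z y < \<delta> \<longrightarrow> y \<in> {y \<in> A. d c y < r}"
              proof (intro exI[of _ "r - d c z"] conjI ballI impI)
                fix y assume "y \<in> A" "d z y < r - d c z"
                moreover have "d c y \<le> d c z + d z y" using triangle that z A calculation by blast
                ultimately show "y \<in> {y \<in> A. d c y < r}" by auto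
              qed (use z in auto)
            qed auto
            have "openin (subtopology mtopology A) {y \<in> A. orbit2 ng y \<in> orbit2 ng ` V}"
              unfolding eq using opb[OF xM(1)] opb[OF xM(2)] unfolding V_def by blast
            then show ?thesis unfolding openin_orbit_space using VA A by (auto simp: Int_absorb1)
          qed
          have "?\<phi> ys + as_cobound \<Psi> ys = 0" if ys: "length ys = Suc q" "set ys \<subseteq> orbit2 ng ` V" for ys
          proof -
            obtain xs where xs: "ys = map (orbit2 ng) xs" "set xs \<subseteq> V" using lift_list[OF ys(2)] by blast
            have "as_cobound \<Psi> ys = as_cobound \<psi> xs"
              unfolding xs(1)
            proof (rule descend_cobound[of A near])
              show "\<And>a b. a \<in> set xs \<Longrightarrow> b \<in> set xs \<Longrightarrow> near a b" using nearV xs by auto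
            qed (use \<Psi> xs VA in auto)
            moreover have "?\<phi> ys = wp (\<lambda>x. h (g x)) xs"
              unfolding xs(1) using xs ys r unfolding V_def by (intro r2) auto
            moreover have "wp (\<lambda>x. h (g x)) xs = as_cobound \<psi> xs"
              using xs ys r VA unfolding V_def by (intro \<psi>(3)[of x]) (auto simp: x)
            ultimately show ?thesis by simp
          qed
          then show "\<exists>U. openin ?Y U \<and> y \<in> U \<and>
            (\<forall>ys. length ys = Suc q \<longrightarrow> set ys \<subseteq> U \<longrightarrow> ?\<phi> ys + as_cobound \<Psi> ys = 0)"
            using op x VA by (intro exI[of _ "orbit2 ng ` V"]) auto
        qed
        then show "as_class_zero ?Y q ?\<phi>" using False unfolding as_class_zero_def by auto
      qed
    qed
  qed
qed

end

text \<open>By \<open>eqz_le\<close> the surviving powers have no gaps, so the supremum reaches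
  \<open>m\<close> exactly when the power \<open>m - 1\<close> survives. The shift by one is that of
  the definition, in which the unit class of a nonempty set counts as 1.\<close>

lemma FR_index_ge_iff:
  assumes A: "A \<subseteq> M" "\<And>x. x \<in> A \<Longrightarrow> ng x \<in> A" "\<And>x. x \<in> A \<Longrightarrow> ng x \<noteq> x" and m: "1 \<le> m"
  shows "enat m \<le> FR_index mtopology ng A \<longleftrightarrow> (\<exists>g. odd_map A g) \<and> \<not> eqz d ng A (m - 1)"
proof -
  define S where "S = {k. k \<ge> 1 \<and> (\<exists>g. odd_map A g) \<and> \<not> eqz d ng A (k - 1)}"
  have "(\<exists>g. continuous_map (subtopology mtopology A) Sinf_top g \<and> (\<forall>u\<in>A. g (ng u) = - g u) \<and>
          \<not> as_class_zero (orbit_space mtopology ng A) (k - 1)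
               (as_pullback (induced_orbit_map g) (as_pow omega_RP (k - 1))))
      \<longleftrightarrow> (\<exists>g. odd_map A g) \<and> \<not> eqz d ng A (k - 1)" for k
    using class_zero_iff_eqz[OF A, of _ "k - 1"] unfolding odd_map_def by blast
  then have eq: "FR_index mtopology ng A = Sup (enat ` S)"
    unfolding FR_index_def S_def by (intro arg_cong[where f = Sup]) auto
  show ?thesis
  proof
    assume *: "enat m \<le> FR_index mtopology ng A"
    have "\<exists>k\<in>S. m \<le> k"
    proof (rule ccontr)
      assume "\<not> ?thesis"
      then have "\<forall>x\<in>enat ` S. x \<le> enat (m - 1)" by auto
      then have "Sup (enat ` S) \<le> enat (m - 1)" by (intro Sup_least) auto
      then have "enat m \<le> enat (m - 1)" using * eq by (metis order_trans)
      then show False using m by simp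
    qed
    then obtain k where k: "k \<in> S" "m \<le> k" by auto
    then show "(\<exists>g. odd_map A g) \<and> \<not> eqz d ng A (m - 1)"
      unfolding S_def using eqz_le[of d ng A "m - 1" "k - 1"] A by (auto simp: diff_le_mono)
  next
    assume "(\<exists>g. odd_map A g) \<and> \<not> eqz d ng A (m - 1)"
    then have "m \<in> S" unfolding S_def using m by auto
    then show "enat m \<le> FR_index mtopology ng A" unfolding eq by (intro Sup_upper) auto
  qed
qed

text \<open>Since all values lie in one \<open>Efin n\<close>, a weakly open set is only met inside
  one finite sphere, where it contains norm balls; coordinatewise continuity is then enough.\<close>

lemma odd_map_exists:
  assumes A: "A \<subseteq> M"
    and f: "\<And>u. u \<in> A \<Longrightarrow> f u \<in> Efin n" "\<And>u. u \<in> A \<Longrightarrow> f u \<noteq> 0" "\<And>u. u \<in> A \<Longrightarrow> f (ng u) = - f u"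
    and cont: "\<And>u e. u \<in> A \<Longrightarrow> e > 0 \<Longrightarrow> \<exists>\<delta>>0. \<forall>v\<in>A. d u v < \<delta> \<longrightarrow> (\<forall>i. \<bar>f v i - f u i\<bar> < e)"
  shows "odd_map A (\<lambda>u. nrm (f u))"
  unfolding odd_map_def
proof
  show "\<forall>u\<in>A. nrm (f (ng u)) = - nrm (f u)"
    using f(3) nrm_minus[OF Efin_Einf[OF f(1)]] by simp
  have top: "topspace (subtopology mtopology A) = A" using A by auto
  show "continuous_map (subtopology mtopology A) Sinf_top (\<lambda>u. nrm (f u))"
    unfolding continuous_map top
  proof (intro conjI allI impI)
    show "(\<lambda>u. nrm (f u)) ` A \<subseteq> topspace Sinf_top"
      using nrm_Sinf[OF Efin_Einf[OF f(1)] f(2)] by auto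
    fix U assume U: "openin Sinf_top U"
    show "openin (subtopology mtopology A) {u \<in> A. nrm (f u) \<in> U}"
      unfolding openin_sub[OF A]
    proof (intro conjI ballI)
      fix u assume u: "u \<in> {u \<in> A. nrm (f u) \<in> U}"
      then have "nrm (f u) \<in> U \<inter> Sfin n" using nrm_Sfin f by auto
      then obtain e where e: "e > 0" "\<forall>y\<in>Sfin n. l2 (y - nrm (f u)) < e \<longrightarrow> y \<in> U"
        using U unfolding openin_Sinf_top by blast
      have fu: "l2 (f u) > 0" using u l2_pos[OF Efin_Einf[OF f(1)] f(2)] by auto
      \<comment> \<open>There are \<open>n + 1\<close> coordinates, each moving by less than
        \<open>e'\<close>, and radial projection costs at most \<open>2 / l2 (f u)\<close>; the
        result is at most half of \<open>e\<close>.\<close>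
      define e' where "e' = e * l2 (f u) / (4 * (real n + 1))"
      have "e' > 0" using e fu unfolding e'_def by auto
      then obtain \<delta> where \<delta>: "\<delta> > 0" "\<And>v i. v \<in> A \<Longrightarrow> d u v < \<delta> \<Longrightarrow> \<bar>f v i - f u i\<bar> < e'"
        using cont[of u e'] u by blast
      show "\<exists>r>0. \<forall>y\<in>A. d u y < r \<longrightarrow> y \<in> {u \<in> A. nrm (f u) \<in> U}"
      proof (intro exI[of _ \<delta>] conjI \<delta>(1) ballI impI)
        fix v assume v: "v \<in> A" "d u v < \<delta>"
        have E: "f v - f u \<in> Efin n" using f u v by auto
        have "l2 (f v - f u) \<le> (\<Sum>i\<le>n. \<bar>(f v - f u) i\<bar>)"
          unfolding l2_Efin[OF E] by (rule L2_set_le_sum_abs)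
        also have "\<dots> \<le> (\<Sum>i\<le>n. e')" using \<delta>(2)[OF v] by (intro sum_mono) (auto simp: less_imp_le)
        also have "\<dots> = e * l2 (f u) / 4" unfolding e'_def by (simp add: field_simps)
        finally have 1: "l2 (f v - f u) \<le> e * l2 (f u) / 4" .
        have "l2 (nrm (f v) - nrm (f u)) \<le> 2 * l2 (f v - f u) / l2 (f u)"
          using f u v by (intro nrm_dist) (auto intro: Efin_Einf[OF f(1)])
        also have "\<dots> \<le> 2 * (e * l2 (f u) / 4) / l2 (f u)" using 1 fu by (intro divide_right_mono) auto
        also have "\<dots> < e" using fu e by simp
        finally show "v \<in> {u \<in> A. nrm (f u) \<in> U}" using e nrm_Sfin f v by auto
      qed
    qed auto
  qed
qed

end

subsection \<open>Barycentric subdivision on cochains\<close>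

text \<open>The dual of barycentric subdivision, in which a simplex becomes the cone from its centre
  over its subdivided boundary. The counter stands for the length of the tuple, because the faces
  are not structural parts of the list.\<close>

primrec sdn :: "nat \<Rightarrow> ('a list \<Rightarrow> 'a) \<Rightarrow> 'a cochain \<Rightarrow> 'a cochain" where
  "sdn 0 b \<phi> xs = \<phi> xs"
| "sdn (Suc n) b \<phi> xs = as_cobound (sdn n b (\<lambda>t. \<phi> (b xs # t))) xs"

definition sdc :: "('a list \<Rightarrow> 'a) \<Rightarrow> 'a cochain \<Rightarrow> 'a cochain" where
  "sdc b \<phi> xs = sdn (length xs) b \<phi> xs"

lemma sdc_Nil [simp]: "sdc b \<phi> [] = \<phi> []"
  by (simp add: sdc_def)

lemma sdc_rec: "xs \<noteq> [] \<Longrightarrow> sdc b \<phi> xs = as_cobound (sdc b (\<lambda>t. \<phi> (b xs # t))) xs"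
  unfolding sdc_def
  by (cases "length xs") (auto intro!: as_cobound_cong)

text \<open>The dual of the chain homotopy from the identity to subdivision: the cone from the
  centre over the whole simplex, corrected by the cones over the homotopy on its faces.\<close>

primrec sdhn :: "nat \<Rightarrow> ('a list \<Rightarrow> 'a) \<Rightarrow> 'a cochain \<Rightarrow> 'a cochain" where
  "sdhn 0 b \<phi> xs = 0"
| "sdhn (Suc n) b \<phi> xs = \<phi> (b xs # xs) + as_cobound (sdhn n b (\<lambda>t. \<phi> (b xs # t))) xs"

definition sdh :: "('a list \<Rightarrow> 'a) \<Rightarrow> 'a cochain \<Rightarrow> 'a cochain" where
  "sdh b \<phi> xs = sdhn (length xs) b \<phi> xs"

lemma sdh_Nil [simp]: "sdh b \<phi> [] = 0"
  by (simp add: sdh_def)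

lemma sdh_rec: "xs \<noteq> [] \<Longrightarrow> sdh b \<phi> xs = \<phi> (b xs # xs) + as_cobound (sdh b (\<lambda>t. \<phi> (b xs # t))) xs"
  unfolding sdh_def
  by (cases "length xs") (auto intro!: as_cobound_cong)

lemma sdc_add: "sdc b (\<lambda>t. \<phi> t + \<psi> t) xs = sdc b \<phi> xs + sdc b \<psi> xs"
proof (induction xs arbitrary: \<phi> \<psi> rule: length_induct)
  case (1 xs)
  show ?case
  proof (cases "xs = []")
    case False
    have "as_cobound (sdc b (\<lambda>t. \<phi> (b xs # t) + \<psi> (b xs # t))) xs
        = as_cobound (\<lambda>t. sdc b (\<lambda>t. \<phi> (b xs # t)) t + sdc b (\<lambda>t. \<psi> (b xs # t)) t) xs"
      by (rule as_cobound_cong) (simp add: 1)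
    then show ?thesis using False by (simp add: sdc_rec as_cobound_add)
  qed simp
qed

lemma sdh_add: "sdh b (\<lambda>t. \<phi> t + \<psi> t) xs = sdh b \<phi> xs + sdh b \<psi> xs"
proof (induction xs arbitrary: \<phi> \<psi> rule: length_induct)
  case (1 xs)
  show ?case
  proof (cases "xs = []")
    case False
    have "as_cobound (sdh b (\<lambda>t. \<phi> (b xs # t) + \<psi> (b xs # t))) xs
        = as_cobound (\<lambda>t. sdh b (\<lambda>t. \<phi> (b xs # t)) t + sdh b (\<lambda>t. \<psi> (b xs # t)) t) xs"
      by (rule as_cobound_cong) (simp add: 1)
    then show ?thesis using False by (simp add: sdh_rec as_cobound_add ac_simps)
  qed simp
qed

lemma sdc_cobound: "sdc b (as_cobound \<phi>) xs = as_cobound (sdc b \<phi>) xs"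
proof (induction xs arbitrary: \<phi> rule: length_induct)
  case (1 xs)
  show ?case
  proof (cases "xs = []")
    case False
    define \<phi>' where "\<phi>' = (\<lambda>t. \<phi> (b xs # t))"
    have "sdc b (as_cobound \<phi>) xs = as_cobound (sdc b (\<lambda>t. \<phi> t + as_cobound \<phi>' t)) xs"
      using False by (simp add: sdc_rec as_cobound_Cons \<phi>'_def)
    also have "\<dots> = as_cobound (\<lambda>t. sdc b \<phi> t + as_cobound (sdc b \<phi>') t) xs"
      by (rule as_cobound_cong) (simp add: 1 sdc_add)
    also have "\<dots> = as_cobound (sdc b \<phi>) xs + as_cobound (as_cobound (sdc b \<phi>')) xs"
      by (rule as_cobound_add)
    finally show ?thesis by simp
  qed simp
qed

text \<open>The homotopy formula is purely formal and holds for every choice of centres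
  \<open>b\<close>; geometry enters only when diameters are estimated.\<close>

lemma sdh_homotopy: "sdh b (as_cobound \<phi>) xs = \<phi> xs + sdc b \<phi> xs + as_cobound (sdh b \<phi>) xs"
proof (induction xs arbitrary: \<phi> rule: length_induct)
  case (1 xs)
  show ?case
  proof (cases "xs = []")
    case False
    define \<phi>' where "\<phi>' = (\<lambda>t. \<phi> (b xs # t))"
    have "as_cobound (sdh b (\<lambda>t. as_cobound \<phi> (b xs # t))) xs
        = as_cobound (sdh b (\<lambda>t. \<phi> t + as_cobound \<phi>' t)) xs"
      by (simp add: as_cobound_Cons \<phi>'_def)
    also have "\<dots> = as_cobound (\<lambda>t. sdh b \<phi> t + (\<phi>' t + sdc b \<phi>' t + as_cobound (sdh b \<phi>') t)) xs"
      by (rule as_cobound_cong) (simp add: 1 sdh_add)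
    also have "\<dots> = as_cobound (sdh b \<phi>) xs + (as_cobound \<phi>' xs + sdc b \<phi> xs)"
      using False by (simp add: as_cobound_add sdc_rec \<phi>'_def)
    finally show ?thesis using False
      by (simp add: sdh_rec as_cobound_Cons \<phi>'_def ac_simps)
  qed simp
qed

text \<open>Two cochains are carried along because coning fixes a first point: the induction passes
  from \<open>\<phi>\<close> to \<open>\<lambda>t. \<phi> (- b xs # t)\<close>, which is no longer
  invariant by itself but matches the cone at \<open>b xs\<close>.\<close>

lemma sdc_neg:
  fixes \<phi> \<phi>' :: "'a::real_vector cochain"
  assumes b: "\<And>xs. xs \<noteq> [] \<Longrightarrow> 0 \<notin> set xs \<Longrightarrow> b (map uminus xs) = - b xs \<and> b xs \<noteq> 0"
    and eq: "\<And>t. 0 \<notin> set t \<Longrightarrow> \<phi> (map uminus t) = \<phi>' t" and xs: "0 \<notin> set xs"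
  shows "sdc b \<phi> (map uminus xs) = sdc b \<phi>' xs"
  using eq xs
proof (induction xs arbitrary: \<phi> \<phi>' rule: length_induct)
  case (1 xs)
  show ?case
  proof (cases "xs = []")
    case False
    have "as_cobound (\<lambda>t. sdc b (\<lambda>t. \<phi> (- b xs # t)) (map uminus t)) xs
        = as_cobound (sdc b (\<lambda>t. \<phi>' (b xs # t))) xs"
    proof (rule as_cobound_cong)
      fix t assume t: "length xs = Suc (length t)" "set t \<subseteq> set xs"
      have "\<phi> (- b xs # map uminus u) = \<phi>' (b xs # u)" if "0 \<notin> set u" for u
        using 1(2)[of "b xs # u"] b[OF False 1(3)] that by auto
      then show "sdc b (\<lambda>t. \<phi> (- b xs # t)) (map uminus t) = sdc b (\<lambda>t. \<phi>' (b xs # t)) t"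
        using 1(3) t by (intro 1(1)[rule_format]) auto
    qed
    then show ?thesis using False b[OF False 1(3)] by (simp add: sdc_rec as_cobound_map)
  qed (use 1(2)[of "[]"] in auto)
qed

lemma sdh_neg:
  fixes \<phi> \<phi>' :: "'a::real_vector cochain"
  assumes b: "\<And>xs. xs \<noteq> [] \<Longrightarrow> 0 \<notin> set xs \<Longrightarrow> b (map uminus xs) = - b xs \<and> b xs \<noteq> 0"
    and eq: "\<And>t. 0 \<notin> set t \<Longrightarrow> \<phi> (map uminus t) = \<phi>' t" and xs: "0 \<notin> set xs"
  shows "sdh b \<phi> (map uminus xs) = sdh b \<phi>' xs"
  using eq xs
proof (induction xs arbitrary: \<phi> \<phi>' rule: length_induct)
  case (1 xs)
  show ?case
  proof (cases "xs = []")
    case False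
    have "as_cobound (\<lambda>t. sdh b (\<lambda>t. \<phi> (- b xs # t)) (map uminus t)) xs
        = as_cobound (sdh b (\<lambda>t. \<phi>' (b xs # t))) xs"
    proof (rule as_cobound_cong)
      fix t assume t: "length xs = Suc (length t)" "set t \<subseteq> set xs"
      have "\<phi> (- b xs # map uminus u) = \<phi>' (b xs # u)" if "0 \<notin> set u" for u
        using 1(2)[of "b xs # u"] b[OF False 1(3)] that by auto
      then show "sdh b (\<lambda>t. \<phi> (- b xs # t)) (map uminus t) = sdh b (\<lambda>t. \<phi>' (b xs # t)) t"
        using 1(3) t by (intro 1(1)[rule_format]) auto
    qed
    moreover have "\<phi> (- b xs # map uminus xs) = \<phi>' (b xs # xs)"
      using 1(2)[of "b xs # xs"] b[OF False 1(3)] 1(3) by auto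
    ultimately show ?thesis using False b[OF False 1(3)] by (simp add: sdh_rec as_cobound_map)
  qed simp
qed

text \<open>The fallback value \<open>hd xs\<close> keeps the barycentre of a tuple of nonzero vectors nonzero; it never
  occurs for tuples whose convex hull omits the origin.\<close>

definition bary :: "'a::real_vector list \<Rightarrow> 'a" where
  "bary xs = (let c = (1 / real (length xs)) *\<^sub>R sum_list xs in if c = 0 then hd xs else c)"

lemma bary_neg:
  assumes "xs \<noteq> []" "0 \<notin> set xs"
  shows "bary (map uminus xs) = - bary xs \<and> bary xs \<noteq> 0"
proof -
  have "sum_list (map uminus xs) = - sum_list xs" by (induction xs) auto
  moreover have "hd xs \<noteq> 0" using assms by (metis hd_in_set)
  ultimately show ?thesis using assms unfolding bary_def by (auto simp: Let_def hd_map)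
qed

text \<open>Tuples through the origin are left out since 0 is fixed by the sign change, and no
  function is odd there.\<close>

definition zinv :: "'a::real_vector cochain \<Rightarrow> bool" where
  "zinv \<phi> \<longleftrightarrow> (\<forall>xs. 0 \<notin> set xs \<longrightarrow> \<phi> (map uminus xs) = \<phi> xs)"

lemma zinv_sdc: "zinv \<phi> \<Longrightarrow> zinv (sdc bary \<phi>)"
  unfolding zinv_def using sdc_neg[of bary \<phi> \<phi>] bary_neg by blast

lemma zinv_sdh: "zinv \<phi> \<Longrightarrow> zinv (sdh bary \<phi>)"
  unfolding zinv_def using sdh_neg[of bary \<phi> \<phi>] bary_neg by blast

lemma zinv_sdc_funpow: "zinv \<phi> \<Longrightarrow> zinv ((sdc bary ^^ n) \<phi>)"
  by (induction n) (auto intro: zinv_sdc)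

lemma sdc_funpow_Nil: "(sdc b ^^ n) \<phi> [] = \<phi> []"
  by (induction n) auto

lemma sdc_funpow_add: "(sdc b ^^ n) (\<lambda>t. \<phi> t + \<psi> t) = (\<lambda>t. (sdc b ^^ n) \<phi> t + (sdc b ^^ n) \<psi> t)"
  by (induction n) (auto simp: sdc_add)

lemma sdc_funpow_cobound: "(sdc b ^^ n) (as_cobound \<phi>) = as_cobound ((sdc b ^^ n) \<phi>)"
proof (induction n)
  case (Suc n)
  have "sdc b (as_cobound \<theta>) = as_cobound (sdc b \<theta>)" for \<theta>
    by (rule ext) (rule sdc_cobound)
  then show ?case using Suc by simp
qed simp

text \<open>One subdivision alters a cocycle by the coboundary of \<open>sdh\<close> of the current
  iterate. The corrections add up to \<open>\<epsilon>\<close>, which inherits the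
  invariance.\<close>

lemma sdc_funpow_cohomologous:
  assumes coc: "\<And>xs. as_cobound \<phi> xs = 0" and inv: "zinv \<phi>"
  shows "\<exists>\<epsilon>. zinv \<epsilon> \<and> \<epsilon> [] = 0 \<and> (\<forall>xs. (sdc bary ^^ n) \<phi> xs = \<phi> xs + as_cobound \<epsilon> xs)"
proof (induction n)
  case 0
  show ?case by (rule exI[of _ "\<lambda>_. 0"]) (auto simp: zinv_def)
next
  case (Suc n)
  then obtain \<epsilon> where \<epsilon>: "zinv \<epsilon>" "\<epsilon> [] = 0" "\<And>xs. (sdc bary ^^ n) \<phi> xs = \<phi> xs + as_cobound \<epsilon> xs" by blast
  define \<phi>n where "\<phi>n = (sdc bary ^^ n) \<phi>"
  have "as_cobound \<phi> = (\<lambda>_. 0)" using coc by auto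
  then have z: "as_cobound \<phi>n = (sdc bary ^^ n) (\<lambda>_. 0)" unfolding \<phi>n_def by (simp flip: sdc_funpow_cobound)
  have "sdc bary (\<lambda>_. 0) xs = 0" for xs :: "'a list"
    using sdc_add[of bary "\<lambda>_. 0" "\<lambda>_. 0" xs] by simp
  then have "sdc bary (\<lambda>_ :: 'a list. 0) = (\<lambda>_. 0)" by auto
  then have "(sdc bary ^^ n) (\<lambda>_ :: 'a list. 0) = (\<lambda>_. 0)" by (induction n) auto
  then have "as_cobound \<phi>n = (\<lambda>_. 0)" using z by simp
  moreover have "sdh bary (\<lambda>_. 0) xs = 0" for xs :: "'a list"
    using sdh_add[of bary "\<lambda>_. 0" "\<lambda>_. 0" xs] by simp
  ultimately have "\<phi>n xs + sdc bary \<phi>n xs + as_cobound (sdh bary \<phi>n) xs = 0" for xs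
    using sdh_homotopy[of bary \<phi>n xs] by simp
  then have "sdc bary \<phi>n xs = \<phi>n xs + as_cobound (sdh bary \<phi>n) xs" for xs
    by (metis (no_types, lifting) add.assoc add.commute bit_add_eq_0_iff)
  then show ?case
    using \<epsilon> zinv_sdh[OF zinv_sdc_funpow[OF inv, of n]]
    by (intro exI[of _ "\<lambda>t. \<epsilon> t + sdh bary \<phi>n t"])
      (auto simp: \<phi>n_def[symmetric] zinv_def as_cobound_add add.assoc)
qed

section \<open>Shrinking of simplices under subdivision\<close>

context seminormed
begin

lemma bary_mean:
  assumes "xs \<noteq> []" "0 \<notin> convex hull (set xs)"
  shows "bary xs = (1 / real (length xs)) *\<^sub>R sum_list xs" "bary xs \<in> convex hull (set xs)"
proof -
  have "(\<Sum>i<length xs. (1 / real (length xs)) *\<^sub>R xs ! i) \<in> convex hull (set xs)"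
    using assms(1) by (intro convex_sum) (auto simp: convex_convex_hull hull_inc)
  also have "(\<Sum>i<length xs. (1 / real (length xs)) *\<^sub>R xs ! i) = (1 / real (length xs)) *\<^sub>R sum_list xs"
    by (simp add: sum_list_sum_nth scaleR_sum_right atLeast0LessThan)
  finally have *: "(1 / real (length xs)) *\<^sub>R sum_list xs \<in> convex hull (set xs)" .
  then have "(1 / real (length xs)) *\<^sub>R sum_list xs \<noteq> 0" using assms by metis
  then show "bary xs = (1 / real (length xs)) *\<^sub>R sum_list xs" unfolding bary_def by (simp add: Let_def)
  then show "bary xs \<in> convex hull (set xs)" using * by simp
qed

lemma convex_seminorm_ball: "c \<in> E \<Longrightarrow> convex {y\<in>E. N (y - c) \<le> r}"
  unfolding convex_def
proof (intro ballI allI impI)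
  fix x y and u v :: real
  assume c: "c \<in> E" and x: "x \<in> {y\<in>E. N (y - c) \<le> r}" and y: "y \<in> {y\<in>E. N (y - c) \<le> r}" and uv: "0 \<le> u" "0 \<le> v" "u + v = 1"
  have "u *\<^sub>R x + v *\<^sub>R y - c = u *\<^sub>R (x - c) + v *\<^sub>R (y - c) + ((u + v) *\<^sub>R c - c)"
    by (simp add: algebra_simps)
  then have eq: "u *\<^sub>R x + v *\<^sub>R y - c = u *\<^sub>R (x - c) + v *\<^sub>R (y - c)" using uv by simp
  have "N (u *\<^sub>R (x - c) + v *\<^sub>R (y - c)) \<le> u * N (x - c) + v * N (y - c)"
    using tri[of "u *\<^sub>R (x - c)" "v *\<^sub>R (y - c)"] x y c uv by (simp add: hom)
  also have "\<dots> \<le> u * r + v * r" using x y uv by (intro add_mono mult_left_mono) auto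
  also have "\<dots> = r" using uv by (metis distrib_right mult_1)
  finally show "u *\<^sub>R x + v *\<^sub>R y \<in> {y\<in>E. N (y - c) \<le> r}" using x y eq by auto
qed

lemma N_sum: "finite I \<Longrightarrow> (\<And>i. i \<in> I \<Longrightarrow> f i \<in> E) \<Longrightarrow> (\<Sum>i\<in>I. f i) \<in> E \<and> N (\<Sum>i\<in>I. f i) \<le> (\<Sum>i\<in>I. N (f i))"
proof (induction I rule: finite_induct)
  case (insert i I)
  then have "sum f I \<in> E" "N (sum f I) \<le> (\<Sum>i\<in>I. N (f i))" "f i \<in> E" by auto
  then show ?case using insert tri[of "f i" "sum f I"] by auto
qed simp

text \<open>In the mean of the differences to a fixed vertex, the term of that vertex is zero; this
  saves one summand out of \<open>length xs\<close> and yields the contraction factor. Convexity of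
  balls extends the bound from the vertices to the hull.\<close>

lemma bary_dist:
  assumes xs: "xs \<noteq> []" "0 \<notin> convex hull (set xs)" "set xs \<subseteq> E"
    and D: "\<And>x y. x \<in> set xs \<Longrightarrow> y \<in> set xs \<Longrightarrow> N (x - y) \<le> D"
    and y: "y \<in> convex hull (set xs)"
  shows "N (y - bary xs) \<le> (real (length xs) - 1) / real (length xs) * D"
proof -
  define n where "n = length xs"
  have n: "n > 0" using xs unfolding n_def by simp
  have hE: "convex hull (set xs) \<subseteq> E" using xs sub by (simp add: hull_minimal subspace_imp_convex)
  then have bE: "bary xs \<in> E" using bary_mean[OF xs(1,2)] by auto
  have vert: "N (x - bary xs) \<le> (real n - 1) / real n * D" if x: "x \<in> set xs" for x
  proof -
    obtain j where j: "j < n" "xs ! j = x" using x unfolding n_def by (metis in_set_conv_nth)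
    have D0: "N (x - x) \<le> D" using D x by blast
    have "bary xs - x = (\<Sum>i<n. (1 / real n) *\<^sub>R (xs ! i - x))"
    proof -
      have "(\<Sum>i<n. (1 / real n) *\<^sub>R (xs ! i - x)) = (1 / real n) *\<^sub>R (\<Sum>i<n. xs ! i) - (\<Sum>i<n. (1 / real n) *\<^sub>R x)"
        by (simp add: scaleR_diff_right sum_subtractf scaleR_sum_right)
      also have "(\<Sum>i<n. (1 / real n) *\<^sub>R x) = x" using n by (simp add: sum_constant_scaleR)
      also have "(\<Sum>i<n. xs ! i) = sum_list xs" unfolding n_def by (simp add: sum_list_sum_nth atLeast0LessThan)
      finally show ?thesis using bary_mean[OF xs(1,2)] unfolding n_def by simp
    qed
    then have "N (bary xs - x) \<le> (\<Sum>i<n. N ((1 / real n) *\<^sub>R (xs ! i - x)))"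
      using N_sum[of "{..<n}" "\<lambda>i. (1 / real n) *\<^sub>R (xs ! i - x)"] xs x unfolding n_def by (auto simp: subset_iff)
    also have "\<dots> = (\<Sum>i<n. (1 / real n) * N (xs ! i - x))"
      using xs x by (intro sum.cong refl) (subst hom, auto simp: n_def subset_iff)
    also have "\<dots> = (\<Sum>i\<in>{..<n} - {j}. (1 / real n) * N (xs ! i - x))"
      using j by (intro sum.mono_neutral_right) auto
    also have "\<dots> \<le> (\<Sum>i\<in>{..<n} - {j}. (1 / real n) * D)"
      using x D by (intro sum_mono mult_left_mono) (auto simp: n_def)
    also have "\<dots> = (real n - 1) / real n * D" using j n by (simp add: of_nat_diff)
    finally show ?thesis using N_diff_commute[of x "bary xs"] x xs bE by auto
  qed
  have "convex hull (set xs) \<subseteq> {y\<in>E. N (y - bary xs) \<le> (real n - 1) / real n * D}"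
    using vert xs by (intro hull_minimal convex_seminorm_ball bE) auto
  then show ?thesis using y unfolding n_def by auto
qed

text \<open>The subdivided cochain is a sum of values on simplices of the subdivision, which have
  the same number of vertices, stay in the hull and are smaller. Faces are contracted at least as
  strongly as the simplex itself, because \<open>(n - 1) / n\<close> increases with
  \<open>n\<close>.\<close>

lemma sdc_vanish:
  assumes "0 \<notin> convex hull (set xs)" "set xs \<subseteq> E" "0 \<le> D"
    and "\<And>x y. x \<in> set xs \<Longrightarrow> y \<in> set xs \<Longrightarrow> N (x - y) \<le> D"
    and "\<And>t. length t = length xs \<Longrightarrow> set t \<subseteq> convex hull (set xs) \<Longrightarrow>
      (\<And>x y. x \<in> set t \<Longrightarrow> y \<in> set t \<Longrightarrow> N (x - y) \<le> (real (length xs) - 1) / real (length xs) * D) \<Longrightarrow> \<phi> t = 0"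
  shows "sdc bary \<phi> xs = 0"
  using assms
proof (induction xs arbitrary: \<phi> rule: length_induct)
  case (1 xs)
  note IH = 1(1) and z = 1(2) and xE = 1(3) and D0 = 1(4) and D = 1(5) and van = 1(6)
  show ?case
  proof (cases "xs = []")
    case True
    then show ?thesis using van[of "[]"] by simp
  next
    case False
    define r where "r = (real (length xs) - 1) / real (length xs) * D"
    have hE: "convex hull (set xs) \<subseteq> E" using xE sub by (simp add: hull_minimal subspace_imp_convex)
    have bh: "bary xs \<in> convex hull (set xs)" using bary_mean[OF False z] by auto
    have "as_cobound (sdc bary (\<lambda>t. \<phi> (bary xs # t))) xs = as_cobound (\<lambda>t. 0) xs"
    proof (rule as_cobound_cong)
      fix u assume u: "length xs = Suc (length u)" "set u \<subseteq> set xs"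
      have hu: "convex hull (set u) \<subseteq> convex hull (set xs)" using u by (intro hull_mono) auto
      show "sdc bary (\<lambda>t. \<phi> (bary xs # t)) u = 0"
      proof (rule IH[rule_format])
        show "length u < length xs" using u by simp
        show "0 \<notin> convex hull (set u)" using hu z by auto
        show "set u \<subseteq> E" using u xE by auto
        show "N (x - y) \<le> D" if "x \<in> set u" "y \<in> set u" for x y using D u that by auto
        fix t assume t: "length t = length u" "set t \<subseteq> convex hull (set u)"
          "\<And>x y. x \<in> set t \<Longrightarrow> y \<in> set t \<Longrightarrow> N (x - y) \<le> (real (length u) - 1) / real (length u) * D"
        show "\<phi> (bary xs # t) = 0"
        proof (rule van)
          show "length (bary xs # t) = length xs" using t u by simp
          show "set (bary xs # t) \<subseteq> convex hull (set xs)" using t hu bh by auto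
          fix x y assume xy: "x \<in> set (bary xs # t)" "y \<in> set (bary xs # t)"
          have r0: "0 \<le> r" using False D0 unfolding r_def by (cases xs) auto
          have bd: "N (y - bary xs) \<le> r" if "y \<in> set t" for y
            unfolding r_def using that t hu by (intro bary_dist False z xE D) auto
          have tE: "set t \<subseteq> E" "bary xs \<in> E" using t hu hE bh by auto
          have tt: "N (x - y) \<le> r" if "x \<in> set t" "y \<in> set t"
          proof -
            have pos: "length u > 0" using that t by (cases u) auto
            have "(real (length u) - 1) / real (length u) \<le> (real (length xs) - 1) / real (length xs)"
              using u pos by (simp add: field_simps)
            then have "(real (length u) - 1) / real (length u) * D \<le> r"
              unfolding r_def using D0 by (rule mult_right_mono)
            then show ?thesis using t(3)[OF that] by linarith
          qed
          have "N (x - y) \<le> r"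
          proof (cases "x \<in> set t")
            case True
            then show ?thesis using xy tt bd by auto
          next
            case False
            then have "x = bary xs" using xy by auto
            then show ?thesis using xy bd[of y] r0 N_diff_commute[of x y] tE by auto
          qed
          then show "N (x - y) \<le> (real (length xs) - 1) / real (length xs) * D" unfolding r_def .
        qed
      qed (rule D0)
    qed
    then show ?thesis using False by (simp add: sdc_rec)
  qed
qed

lemma sdc_funpow_vanish:
  assumes "0 \<notin> convex hull (set xs)" "set xs \<subseteq> E" "0 \<le> D"
    and "\<And>x y. x \<in> set xs \<Longrightarrow> y \<in> set xs \<Longrightarrow> N (x - y) \<le> D"
    and "\<And>t. length t = length xs \<Longrightarrow> set t \<subseteq> convex hull (set xs) \<Longrightarrow>
      (\<And>x y. x \<in> set t \<Longrightarrow> y \<in> set t \<Longrightarrow> N (x - y) \<le> ((real (length xs) - 1) / real (length xs)) ^ k * D) \<Longrightarrow> \<phi> t = 0"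
  shows "(sdc bary ^^ k) \<phi> xs = 0"
  using assms
proof (induction k arbitrary: xs D)
  case 0
  then show ?case by (auto simp: hull_subset)
next
  case (Suc k)
  define \<rho> where "\<rho> = (real (length xs) - 1) / real (length xs)"
  have \<rho>: "\<rho> \<ge> 0" unfolding \<rho>_def by (cases xs) auto
  have hE: "convex hull (set xs) \<subseteq> E" using Suc.prems(2) sub by (simp add: hull_minimal subspace_imp_convex)
  have "sdc bary ((sdc bary ^^ k) \<phi>) xs = 0"
  proof (rule sdc_vanish[OF Suc.prems(1-4)])
    fix t assume t: "length t = length xs" "set t \<subseteq> convex hull (set xs)"
      "\<And>x y. x \<in> set t \<Longrightarrow> y \<in> set t \<Longrightarrow> N (x - y) \<le> (real (length xs) - 1) / real (length xs) * D"
    have ht: "convex hull (set t) \<subseteq> convex hull (set xs)" using t(2) by (simp add: hull_minimal convex_convex_hull)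
    show "(sdc bary ^^ k) \<phi> t = 0"
    proof (rule Suc.IH[of t "\<rho> * D"])
      show "0 \<notin> convex hull (set t)" using ht Suc.prems(1) by auto
      show "set t \<subseteq> E" using t hE by auto
      show "0 \<le> \<rho> * D" using \<rho> Suc.prems(3) by simp
      show "N (x - y) \<le> \<rho> * D" if "x \<in> set t" "y \<in> set t" for x y using t(3)[OF that] unfolding \<rho>_def .
      fix u assume u: "length u = length t" "set u \<subseteq> convex hull (set t)"
        "\<And>x y. x \<in> set u \<Longrightarrow> y \<in> set u \<Longrightarrow> N (x - y) \<le> ((real (length t) - 1) / real (length t)) ^ k * (\<rho> * D)"
      show "\<phi> u = 0"
      proof (rule Suc.prems(5))
        show "length u = length xs" using u t by simp
        show "set u \<subseteq> convex hull (set xs)" using u ht by auto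
        fix x y assume "x \<in> set u" "y \<in> set u"
        from u(3)[OF this] show "N (x - y) \<le> ((real (length xs) - 1) / real (length xs)) ^ Suc k * D"
          unfolding t(1) \<rho>_def by (simp add: ac_simps)
      qed
    qed
  qed (auto)
  then show ?case by simp
qed

end

text \<open>A condition that reads finitely many values is closed in a product of two-point spaces.
  Tychonoff's theorem therefore solves any system of such conditions all of whose finite subsystems
  are solvable.\<close>

lemma compactness_bit:
  fixes \<C> :: "('b \<Rightarrow> bit) set set"
  assumes dep: "\<And>C. C \<in> \<C> \<Longrightarrow> \<exists>F. finite F \<and> (\<forall>\<psi>\<in>C. \<forall>\<psi>'. (\<forall>x\<in>F. \<psi> x = \<psi>' x) \<longrightarrow> \<psi>' \<in> C)"
    and fin: "\<And>\<F>. finite \<F> \<Longrightarrow> \<F> \<subseteq> \<C> \<Longrightarrow> \<Inter>\<F> \<noteq> {}"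
  shows "\<Inter>\<C> \<noteq> {}"
proof -
  define X where "X = product_topology (\<lambda>_::'b. discrete_topology (UNIV :: bit set)) UNIV"
  have "(UNIV :: bit set) = {0, 1}" by (auto intro: bit.exhaust)
  then have "finite (UNIV :: bit set)" by (metis finite.emptyI finite_insert)
  then have "compact_space X"
    unfolding X_def by (simp add: compact_space_product_topology compact_space_discrete_topology)
  moreover have top: "topspace X = UNIV" unfolding X_def by (simp add: PiE_UNIV_domain)
  moreover have "closedin X C" if C: "C \<in> \<C>" for C
  proof -
    obtain F where F: "finite F" "\<And>\<psi> \<psi>'. \<psi> \<in> C \<Longrightarrow> (\<forall>x\<in>F. \<psi> x = \<psi>' x) \<Longrightarrow> \<psi>' \<in> C"
      using dep[OF C] by blast
    have "openin X (- C)"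
    proof (subst openin_subopen, intro ballI)
      fix \<psi> assume \<psi>: "\<psi> \<in> - C"
      define T where "T = PiE UNIV (\<lambda>x. if x \<in> F then {\<psi> x} else (UNIV :: bit set))"
      have "openin X T"
        unfolding X_def T_def
      proof (rule product_topology_basis)
        show "finite {i. (if i \<in> F then {\<psi> i} else UNIV) \<noteq> topspace (discrete_topology (UNIV :: bit set))}"
          by (rule finite_subset[OF _ F(1)]) auto
      qed auto
      moreover have "\<psi> \<in> T" unfolding T_def by auto
      moreover have "T \<subseteq> - C"
      proof
        fix \<psi>' assume "\<psi>' \<in> T"
        then have "\<forall>x\<in>F. \<psi>' x = \<psi> x" unfolding T_def by (auto simp: PiE_iff split: if_splits)
        then show "\<psi>' \<in> - C" using F(2)[of \<psi>' \<psi>] \<psi> by auto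
      qed
      ultimately show "\<exists>T. openin X T \<and> \<psi> \<in> T \<and> T \<subseteq> - C" by blast
    qed
    then show ?thesis unfolding closedin_def top by (simp add: Compl_eq_Diff_UNIV)
  qed
  ultimately show ?thesis using fin unfolding compact_space_fip by blast
qed

section \<open>Detection of the class on compact subsets\<close>

context seminormed
begin

definition seqcomp :: "'a set \<Rightarrow> bool" where
  "seqcomp K \<longleftrightarrow> (\<forall>\<sigma>. (\<forall>n::nat. \<sigma> n \<in> K) \<longrightarrow>
     (\<exists>l\<in>K. \<exists>r. strict_mono (r :: nat \<Rightarrow> nat) \<and> (\<lambda>n. N (\<sigma> (r n) - l)) \<longlonglongrightarrow> 0))"

lemma seqcompE:
  assumes "seqcomp K" "\<And>n::nat. \<sigma> n \<in> K"
  obtains l r where "l \<in> K" "strict_mono (r :: nat \<Rightarrow> nat)" "(\<lambda>n. N (\<sigma> (r n) - l)) \<longlonglongrightarrow> 0"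
  using assms unfolding seqcomp_def by blast

lemma seqcomp_empty: "seqcomp {}"
  unfolding seqcomp_def by auto

lemma seqcomp_Un:
  assumes "seqcomp A" "seqcomp B"
  shows "seqcomp (A \<union> B)"
  unfolding seqcomp_def
proof (intro allI impI)
  fix \<sigma> assume \<sigma>: "\<forall>n::nat. \<sigma> n \<in> A \<union> B"
  have main: "\<exists>l\<in>C. \<exists>r. strict_mono (r :: nat \<Rightarrow> nat) \<and> (\<lambda>n. N (\<sigma> (r n) - l)) \<longlonglongrightarrow> 0"
    if inf: "infinite {n. \<sigma> n \<in> C}" and C: "seqcomp C" for C
  proof -
    obtain u :: "nat \<Rightarrow> nat" where u: "strict_mono u" "\<And>n. u n \<in> {n. \<sigma> n \<in> C}"
      using infinite_enumerate[OF inf] by auto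
    have "\<sigma> (u n) \<in> C" for n using u(2)[of n] by simp
    then obtain l r where "l \<in> C" "strict_mono (r :: nat \<Rightarrow> nat)" "(\<lambda>n. N (\<sigma> (u (r n)) - l)) \<longlonglongrightarrow> 0"
      using seqcompE[OF C, of "\<lambda>n. \<sigma> (u n)"] by blast
    then show ?thesis using strict_mono_o[OF u(1), of r] by (auto simp: comp_def)
  qed
  have "{n. \<sigma> n \<in> A} \<union> {n. \<sigma> n \<in> B} = UNIV" using \<sigma> by auto
  then have "infinite {n. \<sigma> n \<in> A} \<or> infinite {n. \<sigma> n \<in> B}" by (metis finite_Un infinite_UNIV_nat)
  then show "\<exists>l\<in>A \<union> B. \<exists>r. strict_mono (r :: nat \<Rightarrow> nat) \<and> (\<lambda>n. N (\<sigma> (r n) - l)) \<longlonglongrightarrow> 0"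
    using main assms by blast
qed

lemma seqcomp_uminus:
  assumes "seqcomp A" "A \<subseteq> E"
  shows "seqcomp (uminus ` A)"
  unfolding seqcomp_def
proof (intro allI impI)
  fix \<sigma> assume \<sigma>: "\<forall>n::nat. \<sigma> n \<in> uminus ` A"
  then have "- \<sigma> n \<in> A" for n by (metis (no_types, lifting) imageE minus_minus)
  then obtain l r where lr: "l \<in> A" "strict_mono (r :: nat \<Rightarrow> nat)" "(\<lambda>n. N (- \<sigma> (r n) - l)) \<longlonglongrightarrow> 0"
    using seqcompE[OF assms(1), of "\<lambda>n. - \<sigma> n"] by blast
  have "N (\<sigma> n - - l) = N (- \<sigma> n - l)" for n
  proof -
    have "\<sigma> n \<in> E" "l \<in> E" using \<sigma> assms lr by (auto simp: image_iff) (metis E_simps(5) subsetD)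
    then have "N (- (\<sigma> n + l)) = N (\<sigma> n + l)" by (intro N_minus) auto
    then show ?thesis by simp
  qed
  then show "\<exists>l\<in>uminus ` A. \<exists>r. strict_mono (r :: nat \<Rightarrow> nat) \<and> (\<lambda>n. N (\<sigma> (r n) - l)) \<longlonglongrightarrow> 0"
    using lr by (intro bexI[of _ "- l"] exI[of _ r]) auto
qed

text \<open>Induction on the vertices: a point of the larger hull is a parameter in the unit
  interval together with a point of the smaller hull, and subsequences are extracted for the two in
  turn.\<close>

lemma seqcomp_convex_hull:
  assumes "finite S" "S \<subseteq> E"
  shows "seqcomp (convex hull S)"
  using assms
proof (induction S rule: finite_induct)
  case empty
  then show ?case by (simp add: seqcomp_empty)
next
  case (insert a S)
  show ?case
  proof (cases "S = {}")
    case True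
    show ?thesis unfolding True seqcomp_def
      by (auto intro!: exI[of _ id] simp: strict_mono_def)
  next
    case False
    have IH: "seqcomp (convex hull S)" and aE: "a \<in> E" and hE: "convex hull S \<subseteq> E"
      using insert sub by (auto simp: hull_minimal subspace_imp_convex)
    show ?thesis unfolding seqcomp_def
    proof (intro allI impI)
      fix \<sigma> assume \<sigma>: "\<forall>n::nat. \<sigma> n \<in> convex hull (insert a S)"
      have "\<exists>t y. t \<in> {0..1} \<and> y \<in> convex hull S \<and> \<sigma> n = (1 - t) *\<^sub>R a + t *\<^sub>R y" for n
      proof -
        obtain u v y where "u \<ge> 0" "v \<ge> 0" "u + v = 1" "y \<in> convex hull S" "\<sigma> n = u *\<^sub>R a + v *\<^sub>R y"
          using \<sigma>[rule_format, of n] unfolding convex_hull_insert[OF False] by auto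
        moreover from this have "u = 1 - v" by simp
        ultimately show ?thesis by (intro exI[of _ v] exI[of _ y]) auto
      qed
      then obtain t y where t: "\<And>n. t n \<in> {0..1}" and y: "\<And>n. y n \<in> convex hull S"
        and eq: "\<And>n. \<sigma> n = (1 - t n) *\<^sub>R a + t n *\<^sub>R y n" by metis
      obtain l r where l: "l \<in> {0..1}" and r: "strict_mono (r :: nat \<Rightarrow> nat)" and lim: "(t \<circ> r) \<longlonglongrightarrow> l"
        using compact_Icc[of 0 "1::real"] t unfolding compact_def by metis
      obtain z r' where z: "z \<in> convex hull S" and r': "strict_mono (r' :: nat \<Rightarrow> nat)"
        and lim': "(\<lambda>n. N (y (r (r' n)) - z)) \<longlonglongrightarrow> 0"
        using seqcompE[OF IH, of "\<lambda>n. y (r n)"] y by blast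
      have zE: "z \<in> E" and yE: "\<And>n. y n \<in> E" using z y hE by auto
      define w where "w = (1 - l) *\<^sub>R a + l *\<^sub>R z"
      have wh: "w \<in> convex hull (insert a S)"
        unfolding convex_hull_insert[OF False] w_def using l z
        by (intro CollectI exI[of _ "1 - l"] exI[of _ l] exI[of _ z]) auto
      have bound: "N (\<sigma> (r (r' n)) - w) \<le> \<bar>t (r (r' n)) - l\<bar> * N (z - a) + N (y (r (r' n)) - z)" for n
      proof -
        define T where "T = t (r (r' n))"
        define Y where "Y = y (r (r' n))"
        have T: "T \<in> {0..1}" "Y \<in> E" unfolding T_def Y_def using t yE by auto
        have "\<sigma> (r (r' n)) - w = (T - l) *\<^sub>R (z - a) + T *\<^sub>R (Y - z)"
          unfolding eq w_def T_def[symmetric] Y_def[symmetric] by (simp add: algebra_simps)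
        then have "N (\<sigma> (r (r' n)) - w) \<le> N ((T - l) *\<^sub>R (z - a)) + N (T *\<^sub>R (Y - z))"
          using tri[of "(T - l) *\<^sub>R (z - a)" "T *\<^sub>R (Y - z)"] aE zE T by simp
        also have "\<dots> = \<bar>T - l\<bar> * N (z - a) + T * N (Y - z)" using aE zE T by (subst (1 2) hom) auto
        also have "T * N (Y - z) \<le> N (Y - z)"
          using T N_nonneg[of "Y - z"] zE by (intro mult_left_le_one_le) auto
        finally show ?thesis unfolding T_def Y_def by simp
      qed
      have "(\<lambda>n. (t \<circ> r) (r' n)) \<longlonglongrightarrow> l" using LIMSEQ_subseq_LIMSEQ[OF lim r'] by (simp add: comp_def)
      then have "(\<lambda>n. \<bar>t (r (r' n)) - l\<bar> * N (z - a) + N (y (r (r' n)) - z)) \<longlonglongrightarrow> \<bar>l - l\<bar> * N (z - a) + 0"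
        by (intro tendsto_intros lim') (simp add: comp_def)
      then have "(\<lambda>n. N (\<sigma> (r (r' n)) - w)) \<longlonglongrightarrow> 0"
      proof (intro tendsto_sandwich[of "\<lambda>_. 0" "\<lambda>n. N (\<sigma> (r (r' n)) - w)" sequentially
            "\<lambda>n. \<bar>t (r (r' n)) - l\<bar> * N (z - a) + N (y (r (r' n)) - z)" 0])
        have "w \<in> E" "\<And>n. \<sigma> n \<in> E" unfolding w_def eq using aE zE yE by auto
        then show "\<forall>\<^sub>F n in sequentially. 0 \<le> N (\<sigma> (r (r' n)) - w)" by (auto intro!: always_eventually N_nonneg)
      qed (use bound in auto)
      then show "\<exists>l\<in>convex hull (insert a S). \<exists>r. strict_mono (r :: nat \<Rightarrow> nat) \<and> (\<lambda>n. N (\<sigma> (r n) - l)) \<longlonglongrightarrow> 0"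
        using wh strict_mono_o[OF r r'] by (auto simp: comp_def)
    qed
  qed
qed

lemma seqcomp_UN:
  "finite I \<Longrightarrow> (\<And>i. i \<in> I \<Longrightarrow> seqcomp (f i)) \<Longrightarrow> seqcomp (\<Union>i\<in>I. f i)"
  by (induction I rule: finite_induct) (auto intro: seqcomp_empty seqcomp_Un)

lemma eqz_compact_uniform:
  assumes K: "K \<subseteq> E" "seqcomp K" "\<And>x. x \<in> K \<Longrightarrow> 0 < e x"
  obtains \<eta> where "\<eta> > 0" "\<And>t. t \<noteq> [] \<Longrightarrow> set t \<subseteq> K \<Longrightarrow> (\<And>x y. x \<in> set t \<Longrightarrow> y \<in> set t \<Longrightarrow> N (x - y) \<le> \<eta>) \<Longrightarrow>
     \<exists>x\<in>K. \<forall>y\<in>set t. N (x - y) < e x"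
proof (rule ccontr)
  assume "\<not> thesis"
  then have "\<exists>t. t \<noteq> [] \<and> set t \<subseteq> K \<and> (\<forall>x\<in>set t. \<forall>y\<in>set t. N (x - y) \<le> inverse (Suc n)) \<and>
     \<not> (\<exists>x\<in>K. \<forall>y\<in>set t. N (x - y) < e x)" for n
    using that[of "inverse (Suc n)"] by fastforce
  then obtain t where t: "\<And>n::nat. t n \<noteq> []" "\<And>n. set (t n) \<subseteq> K"
    "\<And>n x y. x \<in> set (t n) \<Longrightarrow> y \<in> set (t n) \<Longrightarrow> N (x - y) \<le> inverse (Suc n)"
    "\<And>n. \<not> (\<exists>x\<in>K. \<forall>y\<in>set (t n). N (x - y) < e x)" by metis
  have hdK: "hd (t n) \<in> set (t n)" "hd (t n) \<in> K" for n using t(1,2)[of n] by auto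
  obtain l r where l: "l \<in> K" "strict_mono (r :: nat \<Rightarrow> nat)" "(\<lambda>n. N (hd (t (r n)) - l)) \<longlonglongrightarrow> 0"
    using seqcompE[OF K(2), of "\<lambda>n. hd (t n)"] hdK by blast
  have "(\<lambda>n. N (hd (t (r n)) - l) + inverse (Suc n)) \<longlonglongrightarrow> 0 + 0"
    by (intro tendsto_intros l LIMSEQ_inverse_real_of_nat)
  then have "eventually (\<lambda>n. N (hd (t (r n)) - l) + inverse (Suc n) < e l) sequentially"
    using K(3)[OF l(1)] by (intro order_tendstoD) auto
  then obtain n where n: "N (hd (t (r n)) - l) + inverse (Suc n) < e l" by (auto simp: eventually_sequentially)
  have "Suc n \<le> Suc (r n)" using seq_suble[OF l(2)] by simp
  then have inv: "inverse (real (Suc (r n))) \<le> inverse (Suc n)" by (simp add: field_simps)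
  have "N (l - y) < e l" if y: "y \<in> set (t (r n))" for y
  proof -
    have E: "l \<in> E" "y \<in> E" "hd (t (r n)) \<in> E" using l y t(2)[of "r n"] hdK[of "r n"] K by auto
    have "N (l - y) \<le> N (l - hd (t (r n))) + N (hd (t (r n)) - y)" using E by (intro N_tri_diff)
    then show ?thesis using n inv t(3)[OF hdK(1) y] N_diff_commute[OF E(1,3)] by linarith
  qed
  then show False using t(4) l(1) by blast
qed

text \<open>If no cochain is a primitive on \<open>A\<close>, then finitely many of the defining
  conditions already contradict each other. The hulls of the tuples in these conditions, together
  with their reflections, form \<open>K\<close>. A primitive on \<open>K\<close> applies only to
  tuples finer than some \<open>\<eta>\<close>; repeated subdivision transports it to the given
  tuples and would resolve the contradiction.\<close>

theorem eqz_compact_subset: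
  assumes AE: "A \<subseteq> E" and op: "\<And>x. x \<in> A \<Longrightarrow> \<exists>e>0. \<forall>y\<in>E. N (x - y) < e \<longrightarrow> y \<in> A"
    and sym: "\<And>x. x \<in> A \<Longrightarrow> - x \<in> A" and A0: "0 \<notin> A"
    and nz: "\<not> eqz (\<lambda>x y. N (x - y)) uminus A q"
  obtains K where "K \<subseteq> A" "\<And>x. x \<in> K \<Longrightarrow> - x \<in> K" "seqcomp K" "\<not> eqz (\<lambda>x y. N (x - y)) uminus K q"
proof -
  have nx: "- x \<noteq> x" if "x \<in> - {0}" for x :: 'a
  proof
    assume "- x = x"
    then have "2 *\<^sub>R x = 0" by (metis add.right_inverse scaleR_2)
    then show False using that by simp
  qed
  obtain s :: "'a \<Rightarrow> bit" where s: "\<And>x. x \<in> - {0} \<Longrightarrow> s (- x) = s x + 1"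
    by (rule odd_bit_exists[of "- {0 :: 'a}" uminus]) (use nx in auto)
  have winv: "zinv (wp s)" unfolding zinv_def using wp_neg[of _ s uminus] s by (metis ComplI singletonD)
  obtain e where e: "\<And>x. x \<in> A \<Longrightarrow> e x > 0 \<and> (\<forall>y\<in>E. N (x - y) < e x \<longrightarrow> y \<in> A)" using op by metis
  define T where "T = {ys. length ys = Suc q \<and> set ys \<subseteq> A \<and> (\<exists>x\<in>A. \<forall>y\<in>set ys. N (x - y) < e x)}"
  define G where "G = (\<lambda>ys. {\<psi>. wp s ys = as_cobound \<psi> ys})"
  define I where "I = (\<lambda>xs. {\<psi> :: 'a cochain. \<psi> (map uminus xs) = \<psi> xs})"
  define Z where "Z = {\<psi> :: 'a cochain. \<psi> [] = 0}"
  \<comment> \<open>Every member reads only finitely many values of the cochain: the faces of one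
    tuple, a tuple and its reflection, or the empty tuple. Fixing \<open>s\<close> beforehand leaves
    the primitive as the only unknown.\<close>
  define \<C> where "\<C> = G ` T \<union> I ` {xs. 0 \<notin> set xs} \<union> {Z}"
  have empty: "\<Inter>\<C> = {}"
  proof (rule ccontr)
    assume "\<Inter>\<C> \<noteq> {}"
    then obtain \<psi> where \<psi>: "\<psi> \<in> \<Inter>\<C>" by blast
    have "eqze (\<lambda>x y. N (x - y)) uminus A q e"
      unfolding eqze_def
    proof (intro conjI exI[of _ s] exI[of _ \<psi>] ballI allI impI)
      show "\<psi> [] = 0" using \<psi> unfolding \<C>_def Z_def by auto
      show "\<psi> (map uminus xs) = \<psi> xs" if "set xs \<subseteq> A" for xs
      proof -
        have "xs \<in> {xs. 0 \<notin> set xs}" using that A0 by auto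
        then have "\<psi> \<in> I xs" using \<psi> unfolding \<C>_def by blast
        then show ?thesis unfolding I_def by simp
      qed
      show "wp s ys = as_cobound \<psi> ys"
        if "x \<in> A" "length ys = Suc q \<and> set ys \<subseteq> A \<and> (\<forall>y\<in>set ys. N (x - y) < e x)" for x ys
      proof -
        have "ys \<in> T" unfolding T_def using that by auto
        then show ?thesis using \<psi> unfolding \<C>_def G_def by auto
      qed
      show "s (- x) = s x + 1" if "x \<in> A" for x using s[of x] A0 that by auto
    qed (use e in auto)
    then show False using nz unfolding eqz_def by blast
  qed
  have "\<exists>F. finite F \<and> (\<forall>\<psi>\<in>C. \<forall>\<psi>'. (\<forall>x\<in>F. \<psi> x = \<psi>' x) \<longrightarrow> \<psi>' \<in> C)" if C: "C \<in> \<C>" for C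
  proof -
    consider ys where "C = G ys" | xs where "C = I xs" | "C = Z" using C unfolding \<C>_def by auto
    then show ?thesis
    proof cases
      case 1
      have "as_cobound \<psi> ys = as_cobound \<psi>' ys"
        if "\<forall>x\<in>(\<lambda>i. take i ys @ drop (Suc i) ys) ` {..<length ys}. \<psi> x = \<psi>' x" for \<psi> \<psi>' :: "'a cochain"
        unfolding as_cobound_def using that by (intro sum.cong) auto
      then show ?thesis unfolding 1 G_def
        by (intro exI[of _ "(\<lambda>i. take i ys @ drop (Suc i) ys) ` {..<length ys}"]) auto
    next
      case 2
      show ?thesis unfolding 2 I_def by (rule exI[of _ "{map uminus xs, xs}"]) auto
    next
      case 3
      show ?thesis unfolding 3 Z_def by (rule exI[of _ "{[]}"]) auto
    qed
  qed
  then obtain \<F> where \<F>: "finite \<F>" "\<F> \<subseteq> \<C>" "\<Inter>\<F> = {}"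
    using compactness_bit[of \<C>] empty by blast
  have "finite (\<F> \<inter> G ` T)" "\<F> \<inter> G ` T \<subseteq> G ` T" using \<F> by auto
  then obtain F where F: "F \<subseteq> T" "finite F" "\<F> \<inter> G ` T = G ` F" using finite_subset_image by metis
  have noF: False if \<psi>: "\<psi> [] = 0" "zinv \<psi>" "\<And>ys. ys \<in> F \<Longrightarrow> wp s ys = as_cobound \<psi> ys" for \<psi>
  proof -
    have "\<psi> \<in> C" if C: "C \<in> \<F>" for C
    proof -
      have "C \<in> G ` F \<or> C \<in> I ` {xs. 0 \<notin> set xs} \<or> C = Z" using C \<F>(2) F(3) unfolding \<C>_def by blast
      then consider "C \<in> G ` F" | xs where "C = I xs" "0 \<notin> set xs" | "C = Z" by auto
      then show ?thesis
        by cases (use \<psi> in \<open>auto simp: G_def I_def Z_def zinv_def\<close>)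
    qed
    then show False using \<F>(3) by auto
  qed
  have hull: "convex hull (set ys) \<subseteq> A" "set ys \<subseteq> E" if ys: "ys \<in> T" for ys
  proof -
    obtain x where x: "x \<in> A" "\<forall>y\<in>set ys. N (x - y) < e x" "set ys \<subseteq> A" "length ys = Suc q" using ys unfolding T_def by auto
    then show yE: "set ys \<subseteq> E" using AE by auto
    have xE: "x \<in> E" using x AE by auto
    define r where "r = Max ((\<lambda>y. N (x - y)) ` set ys)"
    have ne: "set ys \<noteq> {}" using x by auto
    have r: "r < e x" unfolding r_def using x ne by (subst Max_less_iff) auto
    have "set ys \<subseteq> {y\<in>E. N (y - x) \<le> r}"
    proof
      fix y assume y: "y \<in> set ys"
      then have "N (x - y) \<le> r" unfolding r_def by (intro Max_ge) auto
      then show "y \<in> {y\<in>E. N (y - x) \<le> r}" using N_diff_commute[OF xE, of y] y yE by auto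
    qed
    then have "convex hull (set ys) \<subseteq> {y\<in>E. N (y - x) \<le> r}" by (intro hull_minimal convex_seminorm_ball xE)
    also have "\<dots> \<subseteq> A" using e[OF x(1)] r N_diff_commute[OF xE] by fastforce
    finally show "convex hull (set ys) \<subseteq> A" .
  qed
  \<comment> \<open>Each tuple lies in a ball contained in \<open>A\<close>, so its hull does too
    and avoids the origin; every iterated subdivision of the tuples in \<open>F\<close> keeps its
    vertices in \<open>K\<close>.\<close>
  define K where "K = (\<Union>ys\<in>F. convex hull (set ys) \<union> uminus ` (convex hull (set ys)))"
  have KA: "K \<subseteq> A" unfolding K_def using hull F(1) sym by blast
  have Ksym: "- x \<in> K" if "x \<in> K" for x using that unfolding K_def by (auto simp: image_iff) 
  have Kc: "seqcomp K"
    unfolding K_def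
  proof (rule seqcomp_UN[OF F(2)])
    fix ys assume "ys \<in> F"
    then have h: "convex hull (set ys) \<subseteq> E" "set ys \<subseteq> E" using hull[of ys] F(1) AE by auto
    have "seqcomp (convex hull (set ys))" by (rule seqcomp_convex_hull) (use h in auto)
    then show "seqcomp (convex hull (set ys) \<union> uminus ` (convex hull (set ys)))"
      using seqcomp_Un seqcomp_uminus h(1) by blast
  qed
  have "\<not> eqz (\<lambda>x y. N (x - y)) uminus K q"
  proof
    assume "eqz (\<lambda>x y. N (x - y)) uminus K q"
    then obtain e' where e': "eqze (\<lambda>x y. N (x - y)) uminus K q e'" unfolding eqz_def by blast
    then have e'pos: "\<And>x. x \<in> K \<Longrightarrow> e' x > 0" unfolding eqze_def by blast
    have sK: "s (- x) = s x + 1" if "x \<in> K" for x using s[of x] that KA A0 by auto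
    obtain \<psi> where \<psi>: "\<psi> [] = 0" "\<And>xs. set xs \<subseteq> K \<Longrightarrow> \<psi> (map uminus xs) = \<psi> xs"
      "\<And>x ys. x \<in> K \<Longrightarrow> length ys = Suc q \<Longrightarrow> set ys \<subseteq> K \<Longrightarrow> (\<And>y. y \<in> set ys \<Longrightarrow> N (x - y) < e' x) \<Longrightarrow>
        wp s ys = as_cobound \<psi> ys"
      using eqze_section[OF e', of s] sK by blast
    obtain \<eta> where \<eta>: "\<eta> > 0" "\<And>t. t \<noteq> [] \<Longrightarrow> set t \<subseteq> K \<Longrightarrow> (\<And>x y. x \<in> set t \<Longrightarrow> y \<in> set t \<Longrightarrow> N (x - y) \<le> \<eta>) \<Longrightarrow>
       \<exists>x\<in>K. \<forall>y\<in>set t. N (x - y) < e' x"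
    proof (rule eqz_compact_uniform[of K e'])
      show "K \<subseteq> E" using KA AE by auto
    qed (use Kc e'pos in auto)
    \<comment> \<open>Extension by zero makes the cochain total, as subdivision requires, and
      preserves invariance because \<open>K\<close> is symmetric.\<close>
    define \<psi>' where "\<psi>' = (\<lambda>t. if set t \<subseteq> K then \<psi> t else 0)"
    have neg: "set (map uminus xs) \<subseteq> K \<longleftrightarrow> set xs \<subseteq> K" for xs
      using Ksym by (metis (no_types, opaque_lifting) image_subset_iff list.set_map minus_minus subset_iff)
    have \<psi>'inv: "zinv \<psi>'" unfolding zinv_def \<psi>'_def using neg \<psi>(2) by auto
    have van: "wp s t + as_cobound \<psi>' t = 0"
      if t: "length t = Suc q" "set t \<subseteq> K" "\<And>x y. x \<in> set t \<Longrightarrow> y \<in> set t \<Longrightarrow> N (x - y) \<le> \<eta>" for t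
    proof -
      have "t \<noteq> []" using t by auto
      then obtain x where x: "x \<in> K" "\<forall>y\<in>set t. N (x - y) < e' x" using \<eta>(2)[of t] t by blast
      then have "wp s t = as_cobound \<psi> t" using t by (intro \<psi>(3)[of x]) auto
      also have "\<dots> = as_cobound \<psi>' t" using t by (intro as_cobound_cong) (auto simp: \<psi>'_def)
      finally show ?thesis by simp
    qed
    define S where "S = (\<Union>ys\<in>F. \<Union>x\<in>set ys. (\<lambda>y. N (x - y)) ` set ys)"
    define D where "D = Max (insert 0 S)"
    have Sfin: "finite S" unfolding S_def using F by auto
    have D0: "0 \<le> D" unfolding D_def using Sfin by (intro Max_ge) auto
    have D: "N (x - y) \<le> D" if "ys \<in> F" "x \<in> set ys" "y \<in> set ys" for ys x y
      unfolding D_def using Sfin that by (intro Max_ge) (auto simp: S_def)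
    define \<rho> where "\<rho> = (real (Suc q) - 1) / real (Suc q)"
    have \<rho>: "0 \<le> \<rho>" "\<rho> < 1" unfolding \<rho>_def by (auto simp: field_simps)
    then have "(\<lambda>k. \<rho> ^ k * D) \<longlonglongrightarrow> 0 * D" by (intro tendsto_intros LIMSEQ_realpow_zero)
    then have "eventually (\<lambda>k. \<rho> ^ k * D < \<eta>) sequentially" using \<eta>(1) by (intro order_tendstoD) auto
    then obtain k where k: "\<rho> ^ k * D < \<eta>" by (auto simp: eventually_sequentially)
    obtain \<epsilon> where \<epsilon>: "zinv \<epsilon>" "\<epsilon> [] = 0" "\<And>xs. (sdc bary ^^ k) (wp s) xs = wp s xs + as_cobound \<epsilon> xs"
      using sdc_funpow_cohomologous[of "wp s" k] winv by auto
    \<comment> \<open>After \<open>k\<close> subdivisions the cochain \<open>wp s\<close> plus the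
      coboundary of \<open>\<psi>'\<close> vanishes on \<open>F\<close>. Subdivision commutes with
      the coboundary and changes \<open>wp s\<close> by the coboundary of \<open>\<epsilon>\<close>;
      collecting both terms leaves a primitive for the tuples of \<open>F\<close>
      themselves.\<close>
    define \<theta> where "\<theta> = (\<lambda>t. \<epsilon> t + (sdc bary ^^ k) \<psi>' t)"
    show False
    proof (rule noF[of \<theta>])
      show "\<theta> [] = 0" unfolding \<theta>_def by (simp add: \<epsilon> sdc_funpow_Nil \<psi>'_def \<psi>)
      show "zinv \<theta>" using \<epsilon>(1) zinv_sdc_funpow[OF \<psi>'inv, of k] unfolding \<theta>_def zinv_def by auto
      fix ys assume ys: "ys \<in> F"
      then have ysT: "ys \<in> T" "length ys = Suc q" using F unfolding T_def by auto
      have hK: "convex hull (set ys) \<subseteq> K" unfolding K_def using ys by auto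
      have "(sdc bary ^^ k) (\<lambda>t. wp s t + as_cobound \<psi>' t) ys = 0"
      proof (rule sdc_funpow_vanish[OF _ _ D0])
        show "0 \<notin> convex hull (set ys)" using hK KA A0 by auto
        show "set ys \<subseteq> E" using hull[OF ysT(1)] by auto
        fix t assume t: "length t = length ys" "set t \<subseteq> convex hull (set ys)"
          "\<And>x y. x \<in> set t \<Longrightarrow> y \<in> set t \<Longrightarrow> N (x - y) \<le> ((real (length ys) - 1) / real (length ys)) ^ k * D"
        show "wp s t + as_cobound \<psi>' t = 0"
        proof (rule van)
          show "N (x - y) \<le> \<eta>" if "x \<in> set t" "y \<in> set t" for x y
            using t(3)[OF that] k ysT unfolding \<rho>_def by auto
        qed (use t ysT hK in auto)
      qed (use D[OF ys] in auto)
      then have "wp s ys + as_cobound \<epsilon> ys + as_cobound ((sdc bary ^^ k) \<psi>') ys = 0"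
        by (simp add: sdc_funpow_add sdc_funpow_cobound \<epsilon>(3))
      then show "wp s ys = as_cobound \<theta> ys"
        unfolding \<theta>_def by (simp add: as_cobound_add add.assoc bit_add_eq_0_iff)
    qed
  qed
  then show ?thesis using that KA Ksym Kc by blast
qed

end

section \<open>Normalisation and finite nets\<close>

lemma (in seminormed) normalize_dist:
  assumes "x \<in> E" "z \<in> E" "N x > 0" "N z > 0"
  shows "N ((1 / N x) *\<^sub>R x - (1 / N z) *\<^sub>R z) \<le> 2 * N (x - z) / N z"
proof -
  have eq: "(1 / N x) *\<^sub>R x - (1 / N z) *\<^sub>R z = (1 / N z) *\<^sub>R (x - z) + (1 / N x - 1 / N z) *\<^sub>R x"
    by (simp add: scaleR_diff_right scaleR_diff_left)
  have "N ((1 / N x) *\<^sub>R x - (1 / N z) *\<^sub>R z) \<le> N ((1 / N z) *\<^sub>R (x - z)) + N ((1 / N x - 1 / N z) *\<^sub>R x)"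
    unfolding eq using assms by (intro tri) auto
  also have "\<dots> = N (x - z) / N z + \<bar>(1 / N x - 1 / N z) * N x\<bar>"
    using assms by (simp add: hom abs_mult)
  also have "(1 / N x - 1 / N z) * N x = (N z - N x) / N z"
    using assms by (simp add: left_diff_distrib diff_divide_distrib)
  also have "\<bar>(N z - N x) / N z\<bar> \<le> N (x - z) / N z"
    using N_abs_diff[OF assms(1,2)] assms by (auto intro!: divide_right_mono)
  finally show ?thesis by simp
qed

text \<open>Without a finite net, a greedy choice produces an infinite sequence whose members are
  pairwise at distance at least \<open>e\<close>.\<close>

lemma (in seminormed) finite_net:
  assumes S: "S \<subseteq> E" and e: "e > 0"
    and seq: "\<And>\<sigma>. (\<And>n::nat. \<sigma> n \<in> S) \<Longrightarrow> \<exists>m n. m < n \<and> N (\<sigma> n - \<sigma> m) < e"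
  obtains F where "finite F" "F \<subseteq> S" "\<And>x. x \<in> S \<Longrightarrow> \<exists>y\<in>F. N (x - y) < e"
proof (rule ccontr)
  assume "\<not> thesis"
  then have "\<forall>F. finite F \<longrightarrow> F \<subseteq> S \<longrightarrow> (\<exists>x\<in>S. \<forall>y\<in>F. N (x - y) \<ge> e)"
    using that by (meson not_le)
  then have ex: "\<exists>x\<in>S. \<forall>y\<in>F. N (x - y) \<ge> e" if "finite F" "F \<subseteq> S" for F using that by blast
  have "\<exists>\<sigma>. \<forall>n::nat. \<sigma> n \<in> S \<and> (\<forall>m<n. N (\<sigma> n - \<sigma> m) \<ge> e)"
  proof (rule dependent_wellorder_choice)
    fix r and f g :: "nat \<Rightarrow> 'a" and x :: nat assume "\<And>y. y < x \<Longrightarrow> f y = g y"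
    then show "(r \<in> S \<and> (\<forall>m<x. e \<le> N (r - f m))) = (r \<in> S \<and> (\<forall>m<x. e \<le> N (r - g m)))" by auto
  next
    fix x :: nat and f :: "nat \<Rightarrow> 'a" assume "\<And>y. y < x \<Longrightarrow> f y \<in> S \<and> (\<forall>m<y. e \<le> N (f y - f m))"
    then have "f ` {..<x} \<subseteq> S" by auto
    then show "\<exists>r. r \<in> S \<and> (\<forall>m<x. e \<le> N (r - f m))" using ex[of "f ` {..<x}"] by auto
  qed
  then obtain \<sigma> where \<sigma>: "\<And>n::nat. \<sigma> n \<in> S" "\<And>m n. m < n \<Longrightarrow> N (\<sigma> n - \<sigma> m) \<ge> e" by blast
  from seq[OF \<sigma>(1)] \<sigma>(2) show False by (meson not_le)
qed

section \<open>Convex functionals homogeneous of degree p\<close>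

locale phomogeneous =
  fixes E :: "'a::real_vector set" and F :: "'a \<Rightarrow> real" and p :: real
  assumes subE: "subspace E" and p: "1 < p"
    and F_nonneg: "\<And>u. u \<in> E \<Longrightarrow> 0 \<le> F u"
    and F_hom: "\<And>u c. u \<in> E \<Longrightarrow> F (c *\<^sub>R u) = \<bar>c\<bar> powr p * F u"
    and F_convex: "\<And>u v t. u \<in> E \<Longrightarrow> v \<in> E \<Longrightarrow> 0 \<le> t \<Longrightarrow> t \<le> 1 \<Longrightarrow>
       F ((1 - t) *\<^sub>R u + t *\<^sub>R v) \<le> (1 - t) * F u + t * F v"
begin

lemma F_powr: "u \<in> E \<Longrightarrow> (F u powr (1 / p)) powr p = F u"
  using p F_nonneg by (simp add: powr_powr)

lemma F_minus: "u \<in> E \<Longrightarrow> F (- u) = F u"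
  using F_hom[of u "-1"] by simp

lemma F_diff_commute: "u \<in> E \<Longrightarrow> v \<in> E \<Longrightarrow> F (u - v) = F (v - u)"
  using F_minus[of "u - v"] subspace_diff[OF subE] by simp

text \<open>Minkowski's inequality follows from convexity and homogeneity by rescaling both vectors to
  the unit ball.\<close>

sublocale seminormed E "\<lambda>u. F u powr (1 / p)"
proof
  show "subspace E" by (rule subE)
  fix u v assume u: "u \<in> E" and v: "v \<in> E"
  show "F (u + v) powr (1 / p) \<le> F u powr (1 / p) + F v powr (1 / p)"
  proof (rule field_le_epsilon)
    fix e :: real assume e: "e > 0"
    \<comment> \<open>The summand \<open>e / 2\<close> keeps the scaling factors positive even where
      the functional vanishes.\<close>
    define a where "a = F u powr (1 / p) + e / 2"
    define b where "b = F v powr (1 / p) + e / 2"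
    have ab: "a > 0" "b > 0" unfolding a_def b_def using e by (auto intro: add_nonneg_pos)
    have le1: "F ((1 / c) *\<^sub>R w) \<le> 1" if "w \<in> E" "F w powr (1 / p) \<le> c" "c > 0" for w c
    proof -
      have "F w \<le> c powr p" using F_powr[OF that(1)] that p by (metis less_imp_le powr_ge_zero powr_mono2 order.strict_trans zero_less_one)
      moreover have "c powr p > 0" using that by simp
      moreover have "F ((1 / c) *\<^sub>R w) = F w / c powr p" using that F_hom by (simp add: powr_divide)
      ultimately show ?thesis by simp
    qed
    define t where "t = b / (a + b)"
    have t: "0 \<le> t" "t \<le> 1" "1 - t = a / (a + b)" using ab unfolding t_def by (auto simp: field_simps)
    have eq: "u + v = (a + b) *\<^sub>R ((1 - t) *\<^sub>R ((1 / a) *\<^sub>R u) + t *\<^sub>R ((1 / b) *\<^sub>R v))"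
      unfolding t(3) using ab unfolding t_def by (simp add: scaleR_add_right)
    have "F ((1 - t) *\<^sub>R ((1 / a) *\<^sub>R u) + t *\<^sub>R ((1 / b) *\<^sub>R v)) \<le> (1 - t) * F ((1 / a) *\<^sub>R u) + t * F ((1 / b) *\<^sub>R v)"
      using u v t subspace_scale[OF subE] by (intro F_convex) auto
    also have "\<dots> \<le> (1 - t) * 1 + t * 1"
      using t ab e by (intro add_mono mult_left_mono le1 u v) (auto simp: a_def b_def)
    finally have le: "F ((1 - t) *\<^sub>R ((1 / a) *\<^sub>R u) + t *\<^sub>R ((1 / b) *\<^sub>R v)) \<le> 1" by simp
    have wE: "(1 - t) *\<^sub>R ((1 / a) *\<^sub>R u) + t *\<^sub>R ((1 / b) *\<^sub>R v) \<in> E"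
      using u v subE by (intro subspace_add subspace_scale) auto
    have "F (u + v) \<le> (a + b) powr p"
      unfolding eq F_hom[OF wE] using le ab by (simp add: mult_left_le)
    then have "F (u + v) powr (1 / p) \<le> ((a + b) powr p) powr (1 / p)"
      using p u v subspace_add[OF subE] by (intro powr_mono2) (auto intro!: F_nonneg)
    also have "\<dots> = a + b" using ab p by (simp add: powr_powr)
    finally show "F (u + v) powr (1 / p) \<le> F u powr (1 / p) + F v powr (1 / p) + e"
      unfolding a_def b_def by simp
  qed
next
  fix u c assume "u \<in> E"
  then show "F (c *\<^sub>R u) powr (1 / p) = \<bar>c\<bar> * F u powr (1 / p)"
    using p F_hom F_nonneg by (simp add: powr_mult powr_powr)
qed

lemma F_0: "F 0 = 0"
  using F_hom[of 0 0] by (simp add: subspace_0 subE)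

lemma F_tendsto:
  assumes "\<And>n. u n \<in> E" "v \<in> E" "(\<lambda>n::nat. F (u n - v)) \<longlonglongrightarrow> 0"
  shows "(\<lambda>n. F (u n)) \<longlonglongrightarrow> F v"
proof -
  have "(\<lambda>n. F (u n - v) powr (1 / p)) \<longlonglongrightarrow> 0 powr (1 / p)"
    using assms(3) p by (intro tendsto_powr2) (auto intro!: always_eventually F_nonneg E_simps assms)
  then have "(\<lambda>n. F (u n - v) powr (1 / p)) \<longlonglongrightarrow> 0" by simp
  then have "(\<lambda>n. F (u n) powr (1 / p) - F v powr (1 / p)) \<longlonglongrightarrow> 0"
    by (rule Lim_null_comparison[rotated]) (use N_abs_diff[OF assms(1,2)] in auto)
  then have "(\<lambda>n. F (u n) powr (1 / p)) \<longlonglongrightarrow> F v powr (1 / p)" by (simp add: LIM_zero_iff)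
  then have "(\<lambda>n. (F (u n) powr (1 / p)) powr p) \<longlonglongrightarrow> (F v powr (1 / p)) powr p"
    by (rule tendsto_powr2[OF _ tendsto_const]) (use p in auto)
  then show ?thesis using F_powr assms by simp
qed

end

text \<open>\<open>ucG\<close> and \<open>ucL\<close> express uniform convexity additively: the
  difference is bounded by a small multiple of the sizes plus a large multiple of the midpoint
  defect. In this form the property follows from a pointwise inequality by integration and requires
  no normalisation of the vectors.\<close>

locale rayleigh = G: phomogeneous E G p + L: phomogeneous E L p
  for E :: "'a::real_vector set" and G L :: "'a \<Rightarrow> real" and p :: real +
  assumes ucG: "\<And>\<epsilon>. \<epsilon> > 0 \<Longrightarrow> \<exists>c\<ge>0. \<forall>u\<in>E. \<forall>v\<in>E. G (u - v) \<le> \<epsilon> * (G u + G v) + c * ((G u + G v) / 2 - G ((1/2) *\<^sub>R (u + v)))"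
    and ucL: "\<And>\<epsilon>. \<epsilon> > 0 \<Longrightarrow> \<exists>c\<ge>0. \<forall>u\<in>E. \<forall>v\<in>E. L (u - v) \<le> \<epsilon> * (L u + L v) + c * ((L u + L v) / 2 - L ((1/2) *\<^sub>R (u + v)))"
    and complete: "\<And>u. (\<And>n::nat. u n \<in> E) \<Longrightarrow>
       (\<And>e. e > 0 \<Longrightarrow> \<exists>n0. \<forall>m\<ge>n0. \<forall>n\<ge>n0. G (u m - u n) + L (u m - u n) < e) \<Longrightarrow>
       \<exists>v\<in>E. (\<lambda>n. G (u n - v) + L (u n - v)) \<longlonglongrightarrow> 0"
    and compact_embedding: "\<And>u B. (\<And>n::nat. u n \<in> E) \<Longrightarrow> (\<And>n. G (u n) + L (u n) \<le> B) \<Longrightarrow>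
       \<exists>r. strict_mono (r :: nat \<Rightarrow> nat) \<and> (\<forall>e>0. \<exists>n0. \<forall>m\<ge>n0. \<forall>n\<ge>n0. L (u (r m) - u (r n)) < e)"
begin

abbreviation Phi :: "'a \<Rightarrow> real" where "Phi u \<equiv> G u + L u"
abbreviation N :: "'a \<Rightarrow> real" where "N u \<equiv> (G u + L u) powr (1 / p)"
abbreviation l :: "'a \<Rightarrow> real" where "l u \<equiv> L u powr (1 / p)"
abbreviation dN :: "'a \<Rightarrow> 'a \<Rightarrow> real" where "dN u v \<equiv> N (u - v)"

sublocale Phi: phomogeneous E "\<lambda>u. G u + L u" p
proof
  fix u v and t :: real assume "u \<in> E" "v \<in> E" "0 \<le> t" "t \<le> 1"
  then show "G ((1 - t) *\<^sub>R u + t *\<^sub>R v) + L ((1 - t) *\<^sub>R u + t *\<^sub>R v) \<le> (1 - t) * (G u + L u) + t * (G v + L v)"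
    using G.F_convex[of u v t] L.F_convex[of u v t] by (simp add: algebra_simps)
qed (auto simp: L.subE L.p G.F_nonneg L.F_nonneg G.F_hom L.F_hom algebra_simps)

lemma p_pos: "p > 0" using L.p by simp

lemma l_le_N: "u \<in> E \<Longrightarrow> l u \<le> N u"
  using G.F_nonneg L.F_nonneg p_pos by (intro powr_mono2) auto

lemma tendsto_components:
  assumes "\<And>n. u n \<in> E" "v \<in> E" "(\<lambda>n::nat. Phi (u n - v)) \<longlonglongrightarrow> 0"
  shows "(\<lambda>n. G (u n)) \<longlonglongrightarrow> G v" "(\<lambda>n. L (u n)) \<longlonglongrightarrow> L v"
proof -
  have nn: "0 \<le> G (u n - v)" "0 \<le> L (u n - v)" for n
    using assms G.F_nonneg[of "u n - v"] L.F_nonneg[of "u n - v"] by auto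
  have "(\<lambda>n. G (u n - v)) \<longlonglongrightarrow> 0" "(\<lambda>n. L (u n - v)) \<longlonglongrightarrow> 0"
    by (rule tendsto_sandwich[OF _ _ tendsto_const assms(3)]; use nn in auto)+
  then show "(\<lambda>n. G (u n)) \<longlonglongrightarrow> G v" "(\<lambda>n. L (u n)) \<longlonglongrightarrow> L v"
    using G.F_tendsto L.F_tendsto assms by auto
qed

lemma Phi_tendsto_0_iff:
  assumes "\<And>n. u n \<in> E"
  shows "(\<lambda>n::nat. Phi (u n)) \<longlonglongrightarrow> 0 \<longleftrightarrow> (\<lambda>n. N (u n)) \<longlonglongrightarrow> 0"
proof
  assume "(\<lambda>n. Phi (u n)) \<longlonglongrightarrow> 0"
  then have "(\<lambda>n. N (u n)) \<longlonglongrightarrow> 0 powr (1 / p)"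
    using p_pos by (intro tendsto_powr2) (auto intro!: always_eventually Phi.F_nonneg assms)
  then show "(\<lambda>n. N (u n)) \<longlonglongrightarrow> 0" by simp
next
  assume "(\<lambda>n. N (u n)) \<longlonglongrightarrow> 0"
  then have "(\<lambda>n. N (u n) powr p) \<longlonglongrightarrow> 0 powr p" using p_pos by (intro tendsto_powr2) auto
  then show "(\<lambda>n. Phi (u n)) \<longlonglongrightarrow> 0" using Phi.F_powr assms by simp
qed

lemma N_less_iff: "u \<in> E \<Longrightarrow> e > 0 \<Longrightarrow> N u < e \<longleftrightarrow> Phi u < e powr p"
proof -
  assume u: "u \<in> E" and e: "e > 0"
  have "N u < e \<longleftrightarrow> N u powr p < e powr p"
    using p_pos e by (metis less_imp_le linorder_not_le powr_ge_zero powr_less_mono2 powr_mono2)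
  then show ?thesis using Phi.F_powr[OF u] by simp
qed

lemma l_less_iff: "u \<in> E \<Longrightarrow> e > 0 \<Longrightarrow> l u < e \<longleftrightarrow> L u < e powr p"
proof -
  assume u: "u \<in> E" and e: "e > 0"
  have "l u < e \<longleftrightarrow> l u powr p < e powr p"
    using p_pos e by (metis less_imp_le linorder_not_le powr_ge_zero powr_less_mono2 powr_mono2)
  then show ?thesis using L.F_powr[OF u] by simp
qed

subsection \<open>The resolvent\<close>

definition J :: "real \<Rightarrow> 'a \<Rightarrow> 'a \<Rightarrow> real" where
  "J c u v = G v + c * L (u - v)"

definition ismin :: "real \<Rightarrow> 'a \<Rightarrow> 'a \<Rightarrow> bool" where
  "ismin c u v \<longleftrightarrow> v \<in> E \<and> (\<forall>w\<in>E. J c u v \<le> J c u w)"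

text \<open>One estimate yields existence, uniqueness and continuity of minimisers: the midpoint of
  two almost minimisers is no better than the infimum, so their midpoint defect is at most
  \<open>\<eta>\<close>, and uniform convexity turns a small defect into a small distance.
  Continuity relies on \<open>\<eta>\<close> being uniform in \<open>u\<close>.\<close>

lemma near_min_unique:
  assumes c: "c > 0" and e: "\<epsilon> > 0" and B: "B \<ge> 0"
  shows "\<exists>\<eta>>0. \<forall>u\<in>E. L u \<le> B \<longrightarrow> (\<forall>v\<in>E. \<forall>v'\<in>E.
    (\<forall>w\<in>E. J c u v \<le> J c u w + \<eta>) \<longrightarrow> (\<forall>w\<in>E. J c u v' \<le> J c u w + \<eta>) \<longrightarrow> Phi (v - v') < \<epsilon>)"
proof -
  define k where "k = min 1 c"
  have k: "k > 0" "k \<le> 1" "k \<le> c" using c unfolding k_def by auto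
  \<comment> \<open>Comparison with 0 bounds \<open>J\<close> at both points by
    \<open>c * B + 1\<close>, so the size term contributes \<open>k * \<epsilon> / 4\<close>. The
    choice of \<open>\<eta>\<close> makes the defect term at most as large. The factor
    \<open>k\<close> converts \<open>G + c * L\<close> into \<open>Phi\<close>.\<close>
  define \<epsilon>1 where "\<epsilon>1 = k * \<epsilon> / (8 * (c * B + 1))"
  have cB: "c * B + 1 > 0" using c B by (simp add: add_nonneg_pos)
  then have e1: "\<epsilon>1 > 0" "\<epsilon>1 * (2 * (c * B + 1)) = k * \<epsilon> / 4" using k e unfolding \<epsilon>1_def by (auto simp: field_simps)
  obtain c1 where c1: "c1 \<ge> 0" "\<And>u v. u \<in> E \<Longrightarrow> v \<in> E \<Longrightarrow> G (u - v) \<le> \<epsilon>1 * (G u + G v) + c1 * ((G u + G v) / 2 - G ((1/2) *\<^sub>R (u + v)))"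
    using ucG[OF e1(1)] by blast
  obtain c2 where c2: "c2 \<ge> 0" "\<And>u v. u \<in> E \<Longrightarrow> v \<in> E \<Longrightarrow> L (u - v) \<le> \<epsilon>1 * (L u + L v) + c2 * ((L u + L v) / 2 - L ((1/2) *\<^sub>R (u + v)))"
    using ucL[OF e1(1)] by blast
  define C where "C = max c1 c2"
  have C: "C \<ge> 0" "c1 \<le> C" "c2 \<le> C" unfolding C_def using c1 by auto
  define \<eta> where "\<eta> = min 1 (k * \<epsilon> / (4 * (C + 1)))"
  have eta: "\<eta> > 0" "\<eta> \<le> 1" "C * \<eta> \<le> k * \<epsilon> / 4"
  proof -
    show "\<eta> > 0" "\<eta> \<le> 1" unfolding \<eta>_def using k e C by auto
    have "C * \<eta> \<le> C * (k * \<epsilon> / (4 * (C + 1)))" unfolding \<eta>_def using C by (intro mult_left_mono) auto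
    also have "\<dots> \<le> k * \<epsilon> / 4" using C k e by (simp add: field_simps)
    finally show "C * \<eta> \<le> k * \<epsilon> / 4" .
  qed
  show ?thesis
  proof (intro exI[of _ \<eta>] conjI eta(1) ballI impI)
    fix u v v' assume u: "u \<in> E" "L u \<le> B" and v: "v \<in> E" "v' \<in> E"
      and m: "\<forall>w\<in>E. J c u v \<le> J c u w + \<eta>" "\<forall>w\<in>E. J c u v' \<le> J c u w + \<eta>"
    define h where "h = (1/2) *\<^sub>R (v + v')"
    have hE: "h \<in> E" unfolding h_def using v by auto
    have J0: "J c u 0 \<le> c * B" unfolding J_def using u c G.F_0 by (auto intro!: mult_left_mono)
    have Jle: "J c u v \<le> c * B + 1" "J c u v' \<le> c * B + 1"
      using m[rule_format, of 0] J0 eta by auto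
    have Jh: "(J c u v + J c u v') / 2 - J c u h \<le> \<eta>" 
    proof -
      have "J c u v \<le> J c u h + \<eta>" "J c u v' \<le> J c u h + \<eta>" using m hE by auto
      then show ?thesis by argo
    qed
    define dG where "dG = (G v + G v') / 2 - G h"
    define dL where "dL = (L (u - v) + L (u - v')) / 2 - L (u - h)"
    have uh: "u - h = (1/2) *\<^sub>R ((u - v) + (u - v'))"
    proof -
      have "(1/2) *\<^sub>R (u + u) = u" by (simp flip: scaleR_2)
      then show ?thesis unfolding h_def by (simp add: algebra_simps)
    qed
    have dG0: "dG \<ge> 0" using G.F_convex[of v v' "1/2"] v unfolding dG_def h_def by (simp add: scaleR_add_right)
    have dL0: "dL \<ge> 0" using L.F_convex[of "u - v" "u - v'" "1/2"] u v unfolding dL_def uh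
      by (simp add: scaleR_add_right)
    have dJ: "dG + c * dL \<le> \<eta>" using Jh unfolding dG_def dL_def J_def by (simp add: algebra_simps add_divide_distrib)
    have "G (v - v') \<le> \<epsilon>1 * (G v + G v') + c1 * dG" using c1(2)[OF v] unfolding dG_def h_def .
    also have "c1 * dG \<le> C * dG" using C dG0 by (intro mult_right_mono) auto
    finally have g: "G (v - v') \<le> \<epsilon>1 * (G v + G v') + C * dG" by simp
    have "L (v - v') = L ((u - v) - (u - v'))" using L.F_diff_commute[OF v] by simp
    also have "\<dots> \<le> \<epsilon>1 * (L (u - v) + L (u - v')) + c2 * dL"
      using c2(2)[of "u - v" "u - v'"] u v unfolding dL_def uh by auto
    also have "c2 * dL \<le> C * dL" using C dL0 by (intro mult_right_mono) auto
    finally have lq: "L (v - v') \<le> \<epsilon>1 * (L (u - v) + L (u - v')) + C * dL" by simp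
    have vv: "v - v' \<in> E" using v by auto
    have "k * Phi (v - v') \<le> G (v - v') + c * L (v - v')"
      using k G.F_nonneg[OF vv] L.F_nonneg[OF vv] mult_right_mono[OF k(2) G.F_nonneg[OF vv]] mult_right_mono[OF k(3) L.F_nonneg[OF vv]]
      by (simp add: algebra_simps)
    also have "\<dots> \<le> (\<epsilon>1 * (G v + G v') + C * dG) + c * (\<epsilon>1 * (L (u - v) + L (u - v')) + C * dL)"
      using g lq c by (intro add_mono mult_left_mono) auto
    also have "\<dots> = \<epsilon>1 * (J c u v + J c u v') + C * (dG + c * dL)" unfolding J_def by (simp add: algebra_simps)
    also have "\<dots> \<le> \<epsilon>1 * (2 * (c * B + 1)) + C * \<eta>"
      using Jle dJ e1 C by (intro add_mono mult_left_mono) auto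
    also have "\<dots> < k * \<epsilon>" using e1(2) eta(3) k e mult_pos_pos[OF k(1) e] by linarith
    finally show "Phi (v - v') < \<epsilon>" using k by simp
  qed
qed

lemma J_nonneg: "c \<ge> 0 \<Longrightarrow> u \<in> E \<Longrightarrow> v \<in> E \<Longrightarrow> J c u v \<ge> 0"
  unfolding J_def using G.F_nonneg[of v] L.F_nonneg[of "u - v"] by auto

text \<open>Late members of a minimising sequence are almost minimisers, so
  \<open>near_min_unique\<close> makes the sequence Cauchy; no weak topology is involved.\<close>

lemma ismin_exists:
  assumes c: "c > 0" and u: "u \<in> E"
  shows "\<exists>v. ismin c u v"
proof -
  define m where "m = Inf (J c u ` E)"
  have bdd: "bdd_below (J c u ` E)" using J_nonneg c u by (intro bdd_belowI[of _ 0]) auto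
  have ne: "J c u ` E \<noteq> {}" by auto
  have m: "m \<le> J c u w" if "w \<in> E" for w unfolding m_def using bdd that by (intro cInf_lower) auto
  have "\<exists>v\<in>E. J c u v < m + inverse (Suc n)" for n
    using cInf_lessD[OF ne, of "m + inverse (Suc n)"] unfolding m_def by auto
  then obtain v where v: "\<And>n. v n \<in> E" "\<And>n. J c u (v n) < m + inverse (Suc n)" by metis
  have "\<exists>x\<in>E. (\<lambda>n. Phi (v n - x)) \<longlonglongrightarrow> 0"
  proof (rule complete[OF v(1)])
    fix e :: real assume e: "e > 0"
    obtain \<eta> where \<eta>: "\<eta> > 0" "\<forall>u\<in>E. L u \<le> max 0 (L u') \<longrightarrow> (\<forall>v\<in>E. \<forall>v'\<in>E.
    (\<forall>w\<in>E. J c u v \<le> J c u w + \<eta>) \<longrightarrow> (\<forall>w\<in>E. J c u v' \<le> J c u w + \<eta>) \<longrightarrow> Phi (v - v') < e)" if "u' = u" for u'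
      using near_min_unique[OF c e, of "max 0 (L u)"] by (metis max.cobounded1)
    obtain n0 where n0: "inverse (Suc n0) < \<eta>" using reals_Archimedean[OF \<eta>(1)[OF refl]] by auto
    have "J c u (v n) \<le> J c u w + \<eta>" if "n \<ge> n0" "w \<in> E" for n w
    proof -
      have "inverse (real (Suc n)) \<le> inverse (real (Suc n0))" using that by (simp add: field_simps)
      then show ?thesis using v(2)[of n] m[OF that(2)] n0 by linarith
    qed
    then show "\<exists>n0. \<forall>m\<ge>n0. \<forall>n\<ge>n0. Phi (v m - v n) < e"
      using \<eta>(2)[OF refl] u v(1) by (intro exI[of _ n0]) auto
  qed
  then obtain x where x: "x \<in> E" "(\<lambda>n. Phi (v n - x)) \<longlonglongrightarrow> 0" by blast
  have 1: "(\<lambda>n. G (v n)) \<longlonglongrightarrow> G x" using tendsto_components v x by blast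
  have "Phi ((u - v n) - (u - x)) = Phi (v n - x)" for n
    using Phi.F_diff_commute[of "v n" x] v x by simp
  then have 2: "(\<lambda>n. L (u - v n)) \<longlonglongrightarrow> L (u - x)"
    using tendsto_components(2)[of "\<lambda>n. u - v n" "u - x"] v x u by auto
  have "(\<lambda>n. J c u (v n)) \<longlonglongrightarrow> J c u x" unfolding J_def by (intro tendsto_intros 1 2)
  moreover have "(\<lambda>n. m + inverse (real (Suc n))) \<longlonglongrightarrow> m + 0"
    by (intro tendsto_intros LIMSEQ_inverse_real_of_nat)
  ultimately have "J c u x \<le> m + 0" by (rule LIMSEQ_le) (use v(2) less_imp_le in blast)
  then show ?thesis unfolding ismin_def using x m by (intro exI[of _ x]) fastforce
qed

text \<open>The competitor is the multiple \<open>\<theta> *\<^sub>R u\<close> with the same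
  \<open>L\<close> as \<open>v\<close>. By the reverse triangle inequality it is at least as close
  to \<open>u\<close> in \<open>L\<close> as \<open>v\<close> is, so minimality must be paid for by
  \<open>G\<close>.\<close>

lemma ismin_rayleigh:
  assumes c: "c > 0" and u: "u \<in> E" and v: "ismin c u v"
  shows "G v * L u \<le> G u * L v"
proof (cases "L u = 0")
  case True
  have "v \<in> E" using v unfolding ismin_def by auto
  then show ?thesis using True u G.F_nonneg L.F_nonneg by auto
next
  case False
  have vE: "v \<in> E" using v unfolding ismin_def by auto
  have Lu: "L u > 0" using False L.F_nonneg[OF u] by simp
  then have lu: "l u > 0" by simp
  define \<theta> where "\<theta> = l v / l u"
  have \<theta>: "\<theta> \<ge> 0" unfolding \<theta>_def by auto
  have "\<theta> powr p = L v / L u" unfolding \<theta>_def using L.F_powr u vE lu by (simp add: powr_divide)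
  then have \<theta>p: "\<theta> powr p * L u = L v" using Lu by simp
  have "J c u v \<le> J c u (\<theta> *\<^sub>R u)" using v u unfolding ismin_def by auto
  moreover have "u - \<theta> *\<^sub>R u = (1 - \<theta>) *\<^sub>R u" by (simp add: algebra_simps)
  ultimately have 1: "G v + c * L (u - v) \<le> \<theta> powr p * G u + c * (\<bar>1 - \<theta>\<bar> powr p * L u)"
    unfolding J_def using u \<theta> by (simp add: G.F_hom L.F_hom)
  have "\<bar>1 - \<theta>\<bar> * l u = \<bar>l u - l v\<bar>"
  proof -
    have "\<bar>1 - \<theta>\<bar> * l u = \<bar>(1 - \<theta>) * l u\<bar>" using lu by (simp add: abs_mult)
    also have "(1 - \<theta>) * l u = l u - l v" unfolding \<theta>_def using lu by (simp add: field_simps)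
    finally show ?thesis .
  qed
  also have "\<dots> \<le> l (u - v)" using L.N_abs_diff u vE by auto
  finally have "(\<bar>1 - \<theta>\<bar> * l u) powr p \<le> l (u - v) powr p" using lu p_pos by (intro powr_mono2) auto
  then have "\<bar>1 - \<theta>\<bar> powr p * L u \<le> L (u - v)"
    using L.F_powr[OF u] L.F_powr[of "u - v"] u vE lu by (simp add: powr_mult)
  then have "c * (\<bar>1 - \<theta>\<bar> powr p * L u) \<le> c * L (u - v)" using c by simp
  then have "G v \<le> \<theta> powr p * G u" using 1 by linarith
  then have "G v * L u \<le> \<theta> powr p * G u * L u" using Lu by (intro mult_right_mono) auto
  also have "\<dots> = G u * L v" using \<theta>p by (simp add: ac_simps flip: \<theta>p)
  finally show ?thesis .
qed

text \<open>Testing with \<open>u\<close> itself gives \<open>c * L (u - v) \<le> \<kappa>\<close>.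
  A penalty \<open>c\<close> above the level thus keeps the minimiser away from zero.\<close>

lemma ismin_lower:
  assumes c: "0 \<le> \<kappa>" "\<kappa> < c" and u: "u \<in> E" "L u = 1" "G u \<le> \<kappa>" and v: "ismin c u v"
  shows "1 - (\<kappa> / c) powr (1 / p) \<le> l v"
proof -
  have vE: "v \<in> E" using v unfolding ismin_def by auto
  have "J c u v \<le> J c u u" using v u unfolding ismin_def by auto
  then have "c * L (u - v) \<le> \<kappa>" unfolding J_def using u G.F_nonneg[OF vE] L.F_0 by simp
  then have "L (u - v) \<le> \<kappa> / c" using c by (simp add: field_simps)
  then have "l (u - v) \<le> (\<kappa> / c) powr (1 / p)" using p_pos u vE by (intro powr_mono2) (auto intro!: L.F_nonneg)
  moreover have "l u \<le> l v + l (u - v)" by (rule L.N_le) (use u vE in auto)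
  ultimately show ?thesis using u by simp
qed

lemma lower_pos: "0 \<le> \<kappa> \<Longrightarrow> \<kappa> < c \<Longrightarrow> 0 < 1 - (\<kappa> / c) powr (1 / p)"
proof -
  assume k: "0 \<le> \<kappa>" "\<kappa> < c"
  then have "\<kappa> / c < 1" "0 \<le> \<kappa> / c" by (auto simp: field_simps)
  then have "(\<kappa> / c) powr (1 / p) < 1 powr (1 / p)" using p_pos by (intro powr_less_mono2) auto
  then show ?thesis by simp
qed

text \<open>The data are measured by \<open>L\<close> alone, the minimisers by the full norm. This
  gain, combined with the compact embedding, makes the resolvent compact. The reason is that a
  minimiser for \<open>u'\<close> is an almost minimiser for \<open>u\<close>.\<close>

lemma ismin_continuous:
  assumes c: "c > 0" and e: "\<epsilon> > 0"
  shows "\<exists>\<delta>>0. \<forall>u\<in>E. \<forall>u'\<in>E. L u \<le> 1 \<longrightarrow> L u' \<le> 1 \<longrightarrow> L (u - u') < \<delta> \<longrightarrow>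
     (\<forall>v v'. ismin c u v \<longrightarrow> ismin c u' v' \<longrightarrow> Phi (v - v') < \<epsilon>)"
proof -
  obtain \<eta> where \<eta>: "\<eta> > 0" "\<And>u v v'. u \<in> E \<Longrightarrow> L u \<le> 1 \<Longrightarrow> v \<in> E \<Longrightarrow> v' \<in> E \<Longrightarrow>
    (\<forall>w\<in>E. J c u v \<le> J c u w + \<eta>) \<Longrightarrow> (\<forall>w\<in>E. J c u v' \<le> J c u w + \<eta>) \<Longrightarrow> Phi (v - v') < \<epsilon>"
    using near_min_unique[OF c e, of 1] by auto
  \<comment> \<open>On \<open>{0..2}\<close> because minimisers satisfy
    \<open>l (u - v) \<le> 1\<close> and the data move by at most 1.\<close>
  have "uniformly_continuous_on {0..2} (\<lambda>t::real. t powr p)"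
    using p_pos by (intro compact_uniformly_continuous continuous_on_powr' continuous_intros) auto
  moreover have "\<eta> / (2 * c) > 0" using \<eta> c by auto
  ultimately obtain \<delta>1 where \<delta>1: "\<delta>1 > 0" "\<And>x y. x \<in> {0..2} \<Longrightarrow> y \<in> {0..2} \<Longrightarrow> \<bar>y - x\<bar> < \<delta>1 \<Longrightarrow> \<bar>y powr p - x powr p\<bar> < \<eta> / (2 * c)"
    unfolding uniformly_continuous_on_def dist_real_def by meson
  define \<delta>2 where "\<delta>2 = min \<delta>1 1"
  have \<delta>2: "\<delta>2 > 0" "\<delta>2 \<le> 1" "\<delta>2 \<le> \<delta>1" unfolding \<delta>2_def using \<delta>1 by auto
  have lbound: "l (u - v) \<le> 1" if u: "u \<in> E" "L u \<le> 1" and v: "ismin c u v" for u v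
  proof -
    have vE: "v \<in> E" using v unfolding ismin_def by auto
    have "J c u v \<le> J c u 0" using v unfolding ismin_def by auto
    then have "c * L (u - v) \<le> c * L u" unfolding J_def using G.F_0 G.F_nonneg[OF vE] by simp
    then have "L (u - v) \<le> 1" using c u by simp
    then have "l (u - v) \<le> 1 powr (1 / p)" using p_pos u vE by (intro powr_mono2) (auto intro!: L.F_nonneg)
    then show ?thesis by simp
  qed
  have Jdiff: "J c a w \<le> J c b w + \<eta> / 2" if ab: "a \<in> E" "b \<in> E" "w \<in> E" "l (a - b) < \<delta>2" and w: "l (a - w) \<le> 1 \<or> l (b - w) \<le> 1" for a b w
  proof -
    have "\<bar>l (a - w) - l (b - w)\<bar> \<le> l ((a - w) - (b - w))" using ab by (intro L.N_abs_diff) auto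
    then have d: "\<bar>l (a - w) - l (b - w)\<bar> < \<delta>2" using ab by simp
    then have "l (a - w) \<in> {0..2}" "l (b - w) \<in> {0..2}" using w \<delta>2 by auto
    then have "\<bar>l (a - w) powr p - l (b - w) powr p\<bar> < \<eta> / (2 * c)" using d \<delta>2 by (intro \<delta>1) auto
    then have "L (a - w) < L (b - w) + \<eta> / (2 * c)" using L.F_powr ab by auto
    then have "c * L (a - w) \<le> c * (L (b - w) + \<eta> / (2 * c))" using c by (intro mult_left_mono) auto
    then show ?thesis unfolding J_def using c by (simp add: algebra_simps)
  qed
  show ?thesis
  proof (intro exI[of _ "\<delta>2 powr p"] conjI ballI allI impI)
    fix u u' v v' assume u: "u \<in> E" "u' \<in> E" "L u \<le> 1" "L u' \<le> 1" "L (u - u') < \<delta>2 powr p"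
      and v: "ismin c u v" "ismin c u' v'"
    have vE: "v \<in> E" "v' \<in> E" using v unfolding ismin_def by auto
    have d: "l (u - u') < \<delta>2" "l (u' - u) < \<delta>2"
      using l_less_iff[of "u - u'" \<delta>2] u \<delta>2 L.N_diff_commute[OF u(1,2)] by auto
    have a: "J c u v' \<le> J c u' v' + \<eta> / 2" using u vE d lbound[OF u(2,4) v(2)] by (intro Jdiff) auto
    have b: "J c u' v' \<le> J c u' v" using v vE unfolding ismin_def by auto
    have c: "J c u' v \<le> J c u v + \<eta> / 2" using u vE d lbound[OF u(1,3) v(1)] by (intro Jdiff) auto
    have m: "J c u v \<le> J c u w" if "w \<in> E" for w using v that unfolding ismin_def by auto
    show "Phi (v - v') < \<epsilon>"
    proof (rule \<eta>(2)[OF u(1,3) vE])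
      show "\<forall>w\<in>E. J c u v \<le> J c u w + \<eta>" using m \<eta>(1) by fastforce
      show "\<forall>w\<in>E. J c u v' \<le> J c u w + \<eta>" using m a b c by fastforce
    qed
  qed (use \<delta>2 in auto)
qed

lemma ismin_minus:
  assumes "u \<in> E" "ismin c u v"
  shows "ismin c (- u) (- v)"
proof -
  have Jm: "J c (- u) w = J c u (- w)" if "w \<in> E" for w
  proof -
    have "L (- (u + w)) = L (u + w)" using that assms by (intro L.F_minus) auto
    then show ?thesis unfolding J_def using G.F_minus[OF that] by (simp add: algebra_simps)
  qed
  show ?thesis using assms Jm unfolding ismin_def by auto
qed

end

section \<open>Sublevel sets of the Rayleigh quotient\<close>

context rayleigh
begin

lemma resolvent_cauchy_subseq:
  assumes c: "c > 0" and u: "\<And>n::nat. u n \<in> E" "\<And>n. L (u n) \<le> 1" "\<And>n. Phi (u n) \<le> B"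
    and v: "\<And>n. ismin c (u n) (v n)"
  obtains r where "strict_mono (r :: nat \<Rightarrow> nat)"
    "\<And>e. e > 0 \<Longrightarrow> \<exists>n0. \<forall>m\<ge>n0. \<forall>n\<ge>n0. Phi (v (r m) - v (r n)) < e"
proof -
  obtain r where r: "strict_mono (r :: nat \<Rightarrow> nat)" "\<And>e. e > 0 \<Longrightarrow> \<exists>n0. \<forall>m\<ge>n0. \<forall>n\<ge>n0. L (u (r m) - u (r n)) < e"
    using compact_embedding[of u B] u by auto
  have "\<exists>n0. \<forall>m\<ge>n0. \<forall>n\<ge>n0. Phi (v (r m) - v (r n)) < e" if e: "e > 0" for e
  proof -
    obtain \<delta> where \<delta>: "\<delta> > 0" "\<And>u u' v v'. u \<in> E \<Longrightarrow> u' \<in> E \<Longrightarrow> L u \<le> 1 \<Longrightarrow> L u' \<le> 1 \<Longrightarrow> L (u - u') < \<delta> \<Longrightarrow>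
       ismin c u v \<Longrightarrow> ismin c u' v' \<Longrightarrow> Phi (v - v') < e"
      using ismin_continuous[OF c e] by blast
    obtain n0 where n0: "\<forall>m\<ge>n0. \<forall>n\<ge>n0. L (u (r m) - u (r n)) < \<delta>" using r(2)[OF \<delta>(1)] by blast
    have "\<forall>m\<ge>n0. \<forall>n\<ge>n0. Phi (v (r m) - v (r n)) < e"
    proof (intro allI impI)
      fix m n assume "n0 \<le> m" "n0 \<le> n"
      then show "Phi (v (r m) - v (r n)) < e"
        using n0 by (intro \<delta>(2)[OF u(1) u(1) u(2) u(2) _ v v]) auto
    qed
    then show ?thesis by blast
  qed
  then show ?thesis using that r(1) by blast
qed

lemma N_pos: "u \<in> E \<Longrightarrow> L u > 0 \<Longrightarrow> N u > 0"
  using G.F_nonneg[of u] by simp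

lemma uminus_fixed: "- x = x \<Longrightarrow> x = (0::'a)"
proof -
  assume "- x = x"
  then have "2 *\<^sub>R x = 0" by (metis add.right_inverse scaleR_2)
  then show "x = 0" by simp
qed

lemma L_pos_not_fixed: "L x > 0 \<Longrightarrow> - x \<noteq> x"
  using uminus_fixed[of x] L.F_0 by auto

text \<open>The class vanishes on a neighbourhood \<open>M\<close> of the closed cone. If for every
  \<open>\<epsilon>\<close> some resolvent image left \<open>M\<close>, the images of a bad sequence
  would have a limit; the Rayleigh quotient does not increase and \<open>ismin_lower\<close>
  excludes zero, so this limit lies in the cone, which is absurd. For small
  \<open>\<epsilon>\<close> the resolvent maps the sublevel into \<open>M\<close>, and the vanishing
  is pulled back along it.\<close>

theorem eqz_sublevel_propagates:
  assumes lam: "0 \<le> lam" and z: "eqz dN uminus {u\<in>E. L u > 0 \<and> G u \<le> lam * L u} q"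
  obtains \<epsilon> where "\<epsilon> > 0" "\<And>B. B \<subseteq> {u\<in>E. L u = 1 \<and> G u \<le> lam + \<epsilon>} \<Longrightarrow> (\<And>u. u \<in> B \<Longrightarrow> - u \<in> B) \<Longrightarrow> eqz dN uminus B q"
proof -
  define C where "C = {u\<in>E. L u > 0 \<and> G u \<le> lam * L u}"
  obtain r where r: "\<And>x. x \<in> C \<Longrightarrow> r x > 0" "eqz dN uminus {y\<in>E. \<exists>x\<in>C. dN x y < r x} q"
  proof (rule eqz_neighbourhood[of E dN uminus C q])
    show "dN x z \<le> dN x y + dN y z" if "x \<in> E" "y \<in> E" "z \<in> E" for x y z
      using Phi.N_tri_diff that by blast
    show "dN x y = dN y x" if "x \<in> E" "y \<in> E" for x y using Phi.N_diff_commute that by blast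
    show "dN (- x) (- y) = dN x y" if "x \<in> E" "y \<in> E" for x y
    proof -
      have "N (- (x - y)) = N (x - y)" using that by (intro Phi.N_minus) auto
      then show ?thesis by simp
    qed
    show "- x \<in> C" if "x \<in> C" for x using that G.F_minus L.F_minus unfolding C_def by auto
    show "dN x (- x) > 0" if "x \<in> C" for x
    proof -
      have xE: "x \<in> E" "L x > 0" using that unfolding C_def by auto
      have "x - - x = 2 *\<^sub>R x" by (simp add: scaleR_2)
      then have "dN x (- x) = 2 * N x" using Phi.hom[OF xE(1), of 2] by simp
      then show ?thesis using N_pos[OF xE] by simp
    qed
    show "eqz dN uminus C q" using z unfolding C_def .
  qed (auto simp: C_def)
  define M where "M = {y\<in>E. \<exists>x\<in>C. dN x y < r x}"
  \<comment> \<open>Larger than \<open>lam + 1\<close>, which bounds all levels met below, so that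
    \<open>ismin_lower\<close> applies with a constant independent of the sequence.\<close>
  define c where "c = lam + 2"
  have c: "c > 0" "lam + 1 < c" using lam unfolding c_def by auto
  have "\<exists>\<epsilon>>0. \<forall>u\<in>E. L u = 1 \<longrightarrow> G u \<le> lam + \<epsilon> \<longrightarrow> (\<forall>v. ismin c u v \<longrightarrow> v \<in> M)"
  proof (rule ccontr)
    assume no: "\<not> ?thesis"
    have "\<exists>u\<in>E. L u = 1 \<and> G u \<le> lam + inverse (Suc n) \<and> (\<exists>v. ismin c u v \<and> v \<notin> M)" for n
      using no by (metis inverse_positive_iff_positive of_nat_0_less_iff zero_less_Suc)
    then obtain u v where u: "\<And>n::nat. u n \<in> E" "\<And>n. L (u n) = 1" "\<And>n. G (u n) \<le> lam + inverse (Suc n)"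
      and v: "\<And>n. ismin c (u n) (v n)" "\<And>n. v n \<notin> M" by metis
    have inv1: "inverse (real (Suc n)) \<le> 1" for n by (simp add: field_simps)
    have vE: "v n \<in> E" for n using v unfolding ismin_def by auto
    have G1: "G (u n) \<le> lam + 1" for n using u(3)[of n] inv1[of n] by linarith
    obtain k where k: "strict_mono (k :: nat \<Rightarrow> nat)"
      "\<And>e. e > 0 \<Longrightarrow> \<exists>n0. \<forall>m\<ge>n0. \<forall>n\<ge>n0. Phi (v (k m) - v (k n)) < e"
    proof (rule resolvent_cauchy_subseq[of c u "lam + 2" v])
      show "Phi (u n) \<le> lam + 2" for n using u(2)[of n] G1[of n] by linarith
    qed (use u v c in auto)
    obtain w where w: "w \<in> E" "(\<lambda>n. Phi (v (k n) - w)) \<longlonglongrightarrow> 0"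
      using complete[of "\<lambda>n. v (k n)"] vE k(2) by blast
    have lims: "(\<lambda>n. G (v (k n))) \<longlonglongrightarrow> G w" "(\<lambda>n. L (v (k n))) \<longlonglongrightarrow> L w"
      using tendsto_components[of "\<lambda>n. v (k n)" w] vE w by auto
    define \<delta> where "\<delta> = 1 - ((lam + 1) / c) powr (1 / p)"
    have \<delta>: "\<delta> > 0" unfolding \<delta>_def using lam c by (intro lower_pos) auto
    have "\<delta> powr p \<le> L (v n)" for n
    proof -
      have "\<delta> \<le> l (v n)" unfolding \<delta>_def using lam c u G1 v by (intro ismin_lower[of _ _ "u n"]) auto
      then have "\<delta> powr p \<le> l (v n) powr p" using \<delta> p_pos by (intro powr_mono2) auto
      then show ?thesis using L.F_powr[OF vE] by simp
    qed
    then have "\<delta> powr p \<le> L w" using lims(2) by (intro LIMSEQ_le_const) auto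
    moreover have "\<delta> powr p > 0" using \<delta> by simp
    ultimately have Lw: "L w > 0" by linarith
    have le: "G (v (k n)) \<le> (lam + inverse (Suc n)) * L (v (k n))" for n
    proof -
      have "G (v (k n)) * L (u (k n)) \<le> G (u (k n)) * L (v (k n))" by (rule ismin_rayleigh[OF c(1) u(1) v(1)])
      also have "\<dots> \<le> (lam + inverse (Suc (k n))) * L (v (k n))"
        using u(3) L.F_nonneg[OF vE] by (intro mult_right_mono) auto
      also have "\<dots> \<le> (lam + inverse (Suc n)) * L (v (k n))"
        using seq_suble[OF k(1), of n] L.F_nonneg[OF vE] by (intro mult_right_mono) (auto simp: field_simps)
      finally show ?thesis using u(2) by simp
    qed
    have "(\<lambda>n. (lam + inverse (real (Suc n))) * L (v (k n))) \<longlonglongrightarrow> (lam + 0) * L w"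
      by (intro tendsto_intros lims LIMSEQ_inverse_real_of_nat)
    with lims(1) have "G w \<le> (lam + 0) * L w" by (rule LIMSEQ_le) (use le in auto)
    then have wC: "w \<in> C" using w Lw unfolding C_def by auto
    have "(\<lambda>n. N (v (k n) - w)) \<longlonglongrightarrow> 0"
      using Phi_tendsto_0_iff[of "\<lambda>n. v (k n) - w"] vE w by auto
    then have "eventually (\<lambda>n. N (v (k n) - w) < r w) sequentially" using r(1)[OF wC] by (intro order_tendstoD) auto
    then obtain n where "N (v (k n) - w) < r w" by (auto simp: eventually_sequentially)
    then have "dN w (v (k n)) < r w" using Phi.N_diff_commute[OF w(1) vE] by simp
    then have "v (k n) \<in> M" unfolding M_def using wC vE by auto
    then show False using v(2) by simp
  qed
  then obtain \<epsilon> where \<epsilon>: "\<epsilon> > 0" "\<And>u v. u \<in> E \<Longrightarrow> L u = 1 \<Longrightarrow> G u \<le> lam + \<epsilon> \<Longrightarrow> ismin c u v \<Longrightarrow> v \<in> M" by blast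
  show ?thesis
  proof (rule that[OF \<epsilon>(1)])
    fix B assume B: "B \<subseteq> {u\<in>E. L u = 1 \<and> G u \<le> lam + \<epsilon>}" and Bsym: "\<And>u. u \<in> B \<Longrightarrow> - u \<in> B"
    have BE: "u \<in> E" "L u = 1" if "u \<in> B" for u using that B by auto
    \<comment> \<open>Minimisers are determined only up to seminorm zero. Any equivariant choice is
      good enough, because \<open>ismin_continuous\<close> compares arbitrary minimisers.\<close>
    obtain f where f: "\<And>u. u \<in> B \<Longrightarrow> ismin c u (f u)" "\<And>u. u \<in> B \<Longrightarrow> f (- u) = - f u"
    proof (rule odd_choice[of B uminus "ismin c" uminus])
      show "\<exists>v. ismin c x v" if "x \<in> B" for x using ismin_exists[OF c(1)] BE that by blast
      show "ismin c (- x) (- v)" if "x \<in> B" "ismin c x v" for x v using ismin_minus BE that by blast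
      show "- x \<noteq> x" if "x \<in> B" for x using L_pos_not_fixed BE[OF that] by simp
    qed (use Bsym in auto)
    show "eqz dN uminus B q"
    proof (rule eqz_pull[of dN uminus M q B f])
      show "eqz dN uminus M q" using r(2) unfolding M_def .
      show "f y \<in> M" if "y \<in> B" for y using \<epsilon>(2)[OF _ _ _ f(1)] that B by auto
      show "f (- y) = - f y" if "y \<in> B" for y using f that by auto
      fix y and e :: real assume y: "y \<in> B" and e: "e > 0"
      obtain \<delta> where \<delta>: "\<delta> > 0" "\<And>u u' v v'. u \<in> E \<Longrightarrow> u' \<in> E \<Longrightarrow> L u \<le> 1 \<Longrightarrow> L u' \<le> 1 \<Longrightarrow> L (u - u') < \<delta> \<Longrightarrow>
       ismin c u v \<Longrightarrow> ismin c u' v' \<Longrightarrow> Phi (v - v') < e powr p"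
        using ismin_continuous[OF c(1), of "e powr p"] e by (metis powr_gt_zero less_irrefl)
      show "\<exists>\<delta>>0. \<forall>z\<in>B. dN y z < \<delta> \<longrightarrow> dN (f y) (f z) < e"
      proof (intro exI[of _ "\<delta> powr (1 / p)"] conjI ballI impI)
        fix z assume zB: "z \<in> B" and d: "dN y z < \<delta> powr (1 / p)"
        have yz: "y - z \<in> E" using y zB BE by auto
        have "Phi (y - z) < (\<delta> powr (1 / p)) powr p" using N_less_iff[OF yz] d \<delta>(1) by simp
        then have "Phi (y - z) < \<delta>" using \<delta>(1) p_pos by (simp add: powr_powr)
        then have "L (y - z) < \<delta>" using G.F_nonneg[OF yz] by linarith
        then have "Phi (f y - f z) < e powr p" using BE y zB by (intro \<delta>(2)[OF _ _ _ _ _ f(1) f(1)]) auto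
        moreover have "f y - f z \<in> E" using f(1) y zB unfolding ismin_def by auto
        ultimately show "dN (f y) (f z) < e" using N_less_iff e by blast
      qed (use \<delta> in auto)
    qed
  qed
qed

lemma l_normalize:
  assumes "u \<in> E" "L u > 0"
  shows "(1 / l u) *\<^sub>R u \<in> E" "L ((1 / l u) *\<^sub>R u) = 1" "G ((1 / l u) *\<^sub>R u) = G u / L u"
proof -
  have lu: "l u > 0" using assms by simp
  have "\<bar>1 / l u\<bar> powr p = 1 / L u" using lu L.F_powr[OF assms(1)] by (simp add: powr_divide)
  then show "L ((1 / l u) *\<^sub>R u) = 1" "G ((1 / l u) *\<^sub>R u) = G u / L u"
    using assms by (simp_all add: L.F_hom G.F_hom)
  show "(1 / l u) *\<^sub>R u \<in> E" using assms by auto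
qed

text \<open>After normalisation the resolvent has a totally bounded image at distance at least
  \<open>\<delta>0\<close> from 0. Each point \<open>x\<close> of a finite net contributes one
  coordinate, the bump at \<open>x\<close> minus the bump at \<open>- x\<close>; this is odd, and
  close to \<open>x\<close> it is not zero.\<close>

theorem odd_finite_map_exists:
  assumes k: "0 \<le> \<kappa>"
  defines "D \<equiv> {u\<in>E. L u > 0 \<and> G u \<le> \<kappa> * L u}"
  obtains n f where "\<And>u. u \<in> D \<Longrightarrow> f u \<in> Efin n" "\<And>u. u \<in> D \<Longrightarrow> f u \<noteq> 0" "\<And>u. u \<in> D \<Longrightarrow> f (- u) = - f u"
    "\<And>u e. u \<in> D \<Longrightarrow> e > 0 \<Longrightarrow> \<exists>\<delta>>0. \<forall>v\<in>D. dN u v < \<delta> \<longrightarrow> (\<forall>i. \<bar>f v i - f u i\<bar> < e)"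
proof -
  define c where "c = \<kappa> + 1"
  have c: "c > 0" "\<kappa> < c" using k unfolding c_def by auto
  define \<delta>0 where "\<delta>0 = 1 - (\<kappa> / c) powr (1 / p)"
  have \<delta>0: "\<delta>0 > 0" unfolding \<delta>0_def using k c by (intro lower_pos) auto
  define h where "h = (\<lambda>u. (1 / l u) *\<^sub>R u)"
  define T where "T = (\<lambda>u. SOME v. ismin c (h u) v)"
  have hE: "h u \<in> E" "L (h u) = 1" "G (h u) \<le> \<kappa>" if "u \<in> D" for u
  proof -
    have u: "u \<in> E" "L u > 0" "G u \<le> \<kappa> * L u" using that unfolding D_def by auto
    show "h u \<in> E" "L (h u) = 1" unfolding h_def using l_normalize[OF u(1,2)] by auto
    show "G (h u) \<le> \<kappa>" unfolding h_def l_normalize(3)[OF u(1,2)] using u by (simp add: field_simps)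
  qed
  have T: "ismin c (h u) (T u)" if "u \<in> D" for u
    unfolding T_def by (rule someI_ex) (rule ismin_exists[OF c(1) hE(1)[OF that]])
  have TE: "T u \<in> E" if "u \<in> D" for u using T[OF that] unfolding ismin_def by auto
  have Tl: "\<delta>0 \<le> N (T u)" if "u \<in> D" for u
    using ismin_lower[OF k c(2) hE[OF that] T[OF that]] l_le_N[OF TE[OF that]] unfolding \<delta>0_def by linarith
  have Dm: "- u \<in> D" if "u \<in> D" for u using that G.F_minus L.F_minus unfolding D_def by auto
  obtain F where F: "finite F" "F \<subseteq> T ` D" "\<And>x. x \<in> T ` D \<Longrightarrow> \<exists>y\<in>F. N (x - y) < \<delta>0 / 4"
  proof (rule Phi.finite_net[of "T ` D" "\<delta>0 / 4"])
    fix \<sigma> assume "\<And>n::nat. \<sigma> n \<in> T ` D"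
    then have "\<forall>n. \<exists>x. x \<in> D \<and> \<sigma> n = T x" by auto
    then obtain u where u: "\<And>n::nat. u n \<in> D" "\<And>n. \<sigma> n = T (u n)" by metis
    obtain r where r: "strict_mono (r :: nat \<Rightarrow> nat)"
      "\<And>e. e > 0 \<Longrightarrow> \<exists>n0. \<forall>m\<ge>n0. \<forall>n\<ge>n0. Phi (T (u (r m)) - T (u (r n))) < e"
    proof (rule resolvent_cauchy_subseq[of c "\<lambda>n. h (u n)" "\<kappa> + 1" "\<lambda>n. T (u n)"])
      show "Phi (h (u n)) \<le> \<kappa> + 1" for n using hE[OF u(1)] by (metis add_right_mono)
    qed (use hE u T c in auto)
    have "(\<delta>0 / 4) powr p > 0" using \<delta>0 by simp
    then obtain n0 where n0: "\<forall>m\<ge>n0. \<forall>n\<ge>n0. Phi (T (u (r m)) - T (u (r n))) < (\<delta>0 / 4) powr p" using r(2) by blast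
    have "Phi (\<sigma> (r (Suc n0)) - \<sigma> (r n0)) < (\<delta>0 / 4) powr p" using n0 u by auto
    moreover have "\<sigma> (r (Suc n0)) - \<sigma> (r n0) \<in> E" using u TE by auto
    ultimately have "N (\<sigma> (r (Suc n0)) - \<sigma> (r n0)) < \<delta>0 / 4"
      using N_less_iff[of "\<sigma> (r (Suc n0)) - \<sigma> (r n0)" "\<delta>0 / 4"] \<delta>0 by simp
    moreover have "r n0 < r (Suc n0)" using r(1) by (simp add: strict_mono_def)
    ultimately show "\<exists>m n. m < n \<and> N (\<sigma> n - \<sigma> m) < \<delta>0 / 4" by blast
  qed (use TE \<delta>0 in auto)
  obtain xs where xs: "set xs = F" using finite_list[OF F(1)] by blast
  have FE: "x \<in> E" if "x \<in> F" for x using F TE that by auto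
  \<comment> \<open>A net point \<open>y\<close> within \<open>\<delta>0 / 4\<close> of
    \<open>T u\<close> satisfies \<open>N (T u + y) > \<delta>0 / 2\<close>, because
    \<open>N (T u)\<close> is at least \<open>\<delta>0\<close>; so only the first bump is active
    there.\<close>
  define \<beta> where "\<beta> = (\<lambda>v x. max 0 (\<delta>0 / 2 - N (v - x)) - max 0 (\<delta>0 / 2 - N (v + x)))"
  define f where "f = (\<lambda>u i. if i < length xs then \<beta> (T u) (xs ! i) else 0)"
  \<comment> \<open>\<open>T\<close> is selected pointwise and is odd only up to seminorm zero; the
    bumps, being Lipschitz, do not notice the difference.\<close>
  have Tm: "N (T (- u) + T u) = 0" if u: "u \<in> D" for u
  proof -
    have "h (- u) = - h u" unfolding h_def using u L.F_minus unfolding D_def by simp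
    then have 1: "ismin c (h (- u)) (- T u)" using ismin_minus[OF hE(1) T] u by simp
    have "Phi (T (- u) - - T u) < e" if e: "e > 0" for e
    proof -
      obtain \<delta> where \<delta>: "\<delta> > 0" "\<And>u u' v v'. u \<in> E \<Longrightarrow> u' \<in> E \<Longrightarrow> L u \<le> 1 \<Longrightarrow> L u' \<le> 1 \<Longrightarrow> L (u - u') < \<delta> \<Longrightarrow>
       ismin c u v \<Longrightarrow> ismin c u' v' \<Longrightarrow> Phi (v - v') < e"
        using ismin_continuous[OF c(1) e] by blast
      show ?thesis
        by (rule \<delta>(2)[OF _ _ _ _ _ T[OF Dm[OF u]] 1]) (use hE[OF Dm[OF u]] L.F_0 \<delta>(1) in auto)
    qed
    then have "Phi (T (- u) + T u) \<le> 0" by (simp add: field_le_epsilon less_imp_le)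
    moreover have "Phi (T (- u) + T u) \<ge> 0" using TE[OF u] TE[OF Dm[OF u]] by (intro Phi.F_nonneg) auto
    ultimately have "Phi (T (- u) + T u) = 0" by linarith
    then show ?thesis by simp
  qed
  have \<beta>lip: "\<bar>\<beta> v x - \<beta> w x\<bar> \<le> 2 * N (v - w)" if "v \<in> E" "w \<in> E" "x \<in> E" for v w x
  proof -
    have "\<bar>N (v - x) - N (w - x)\<bar> \<le> N ((v - x) - (w - x))" using that by (intro Phi.N_abs_diff) auto
    moreover have "\<bar>N (v + x) - N (w + x)\<bar> \<le> N ((v + x) - (w + x))" using that by (intro Phi.N_abs_diff) auto
    ultimately show ?thesis unfolding \<beta>_def by simp
  qed
  show ?thesis
  proof (rule that[of f "length xs"])
    fix u assume u: "u \<in> D"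
    show "f u \<in> Efin (length xs)" unfolding f_def Efin_def by auto
    obtain y where y: "y \<in> F" "N (T u - y) < \<delta>0 / 4" using F(3)[of "T u"] u by auto
    then obtain i where i: "i < length xs" "xs ! i = y" using xs by (metis in_set_conv_nth)
    have "N (2 *\<^sub>R T u) \<le> N (T u + y) + N (2 *\<^sub>R T u - (T u + y))" using TE[OF u] FE[OF y(1)] by (intro Phi.N_le) auto
    moreover have "2 *\<^sub>R T u - (T u + y) = T u - y" by (simp add: scaleR_2)
    moreover have "N (2 *\<^sub>R T u) = 2 * N (T u)" using Phi.hom[OF TE[OF u], of 2] by simp
    ultimately have "N (T u + y) > \<delta>0 / 2" using Tl[OF u] y \<delta>0 by simp
    then have "f u i \<noteq> 0" using i y \<delta>0 unfolding f_def \<beta>_def by auto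
    then show "f u \<noteq> 0" by auto
    show "f (- u) = - f u"
    proof
      fix i
      have "\<beta> (T (- u)) x = - \<beta> (T u) x" if x: "x \<in> E" for x
      proof -
        have E: "T u \<in> E" "T (- u) \<in> E" "- T u \<in> E" using TE u Dm by auto
        have "\<bar>\<beta> (T (- u)) x - \<beta> (- T u) x\<bar> \<le> 2 * N (T (- u) - - T u)" using E x by (intro \<beta>lip) auto
        then have 1: "\<beta> (T (- u)) x = \<beta> (- T u) x" using Tm[OF u] by simp
        have "N (- T u - x) = N (T u + x)" "N (- T u + x) = N (T u - x)"
          using Phi.N_minus[of "T u + x"] Phi.N_minus[of "T u - x"] E x by auto
        then have "\<beta> (- T u) x = - \<beta> (T u) x" unfolding \<beta>_def by simp
        then show ?thesis using 1 by simp
      qed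
      moreover have "xs ! i \<in> E" if "i < length xs" using that FE xs by auto
      ultimately show "f (- u) i = (- f u) i" unfolding f_def by auto
    qed
    fix e :: real assume e: "e > 0"
    obtain \<delta> where \<delta>: "\<delta> > 0" "\<And>u u' v v'. u \<in> E \<Longrightarrow> u' \<in> E \<Longrightarrow> L u \<le> 1 \<Longrightarrow> L u' \<le> 1 \<Longrightarrow> L (u - u') < \<delta> \<Longrightarrow>
       ismin c u v \<Longrightarrow> ismin c u' v' \<Longrightarrow> Phi (v - v') < (e / 2) powr p"
      using ismin_continuous[OF c(1), of "(e / 2) powr p"] e by (metis powr_gt_zero less_irrefl half_gt_zero)
    have uE: "u \<in> E" "L u > 0" "l u > 0" using u unfolding D_def by auto
    show "\<exists>\<delta>>0. \<forall>v\<in>D. dN u v < \<delta> \<longrightarrow> (\<forall>i. \<bar>f v i - f u i\<bar> < e)"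
    proof (intro exI[of _ "\<delta> powr (1 / p) * l u / 2"] conjI ballI impI allI)
      fix v i assume v: "v \<in> D" and d: "dN u v < \<delta> powr (1 / p) * l u / 2"
      have vE: "v \<in> E" "L v > 0" "l v > 0" using v unfolding D_def by auto
      have "l (h v - h u) \<le> 2 * l (v - u) / l u" unfolding h_def using uE vE by (intro L.normalize_dist) auto
      also have "\<dots> \<le> 2 * dN u v / l u"
        using l_le_N[of "u - v"] uE vE L.N_diff_commute[OF uE(1) vE(1)] by (intro divide_right_mono mult_left_mono) auto
      also have "\<dots> < \<delta> powr (1 / p)" using d uE by (simp add: field_simps)
      finally have "l (h v - h u) < \<delta> powr (1 / p)" .
      then have "L (h v - h u) < (\<delta> powr (1 / p)) powr p" using l_less_iff[of "h v - h u"] hE u v \<delta>(1) by auto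
      then have "L (h v - h u) < \<delta>" using \<delta>(1) p_pos by (simp add: powr_powr)
      then have "Phi (T v - T u) < (e / 2) powr p" using hE u v by (intro \<delta>(2)[OF _ _ _ _ _ T T]) auto
      then have less: "N (T v - T u) < e / 2" using N_less_iff[of "T v - T u" "e / 2"] TE u v e by auto
      show "\<bar>f v i - f u i\<bar> < e"
      proof (cases "i < length xs")
        case True
        then have "xs ! i \<in> E" using FE xs by auto
        then have "\<bar>\<beta> (T v) (xs ! i) - \<beta> (T u) (xs ! i)\<bar> \<le> 2 * N (T v - T u)" using TE u v by (intro \<beta>lip) auto
        then show ?thesis using True less unfolding f_def by simp
      qed (use e in \<open>auto simp: f_def\<close>)
    qed (use \<delta> uE in auto)
  qed
qed

lemma normalize_tendsto:
  assumes u: "\<And>n::nat. u n \<in> E" "\<And>n. L (u n) > 0" and w: "w \<in> E" "L w > 0" and lim: "(\<lambda>n. N (u n - w)) \<longlonglongrightarrow> 0"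
  shows "(\<lambda>n. N ((1 / l (u n)) *\<^sub>R u n - (1 / l w) *\<^sub>R w)) \<longlonglongrightarrow> 0"
proof -
  have "(\<lambda>n. L (u n)) \<longlonglongrightarrow> L w"
    using tendsto_components(2)[of u w] Phi_tendsto_0_iff[of "\<lambda>n. u n - w"] u w lim by auto
  then have ll: "(\<lambda>n. l (u n)) \<longlonglongrightarrow> l w" using w by (intro tendsto_powr) auto
  have lw: "l w > 0" using w by simp
  have "N ((1 / l (u n)) *\<^sub>R u n - (1 / l w) *\<^sub>R w) \<le> N (u n - w) / l (u n) + \<bar>1 / l (u n) - 1 / l w\<bar> * N w" for n
  proof -
    have "(1 / l (u n)) *\<^sub>R u n - (1 / l w) *\<^sub>R w = (1 / l (u n)) *\<^sub>R (u n - w) + (1 / l (u n) - 1 / l w) *\<^sub>R w"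
      by (simp add: scaleR_diff_right scaleR_diff_left)
    then have "N ((1 / l (u n)) *\<^sub>R u n - (1 / l w) *\<^sub>R w) \<le> N ((1 / l (u n)) *\<^sub>R (u n - w)) + N ((1 / l (u n) - 1 / l w) *\<^sub>R w)"
      using Phi.tri[of "(1 / l (u n)) *\<^sub>R (u n - w)" "(1 / l (u n) - 1 / l w) *\<^sub>R w"] u w by simp
    also have "N ((1 / l (u n)) *\<^sub>R (u n - w)) = N (u n - w) / l (u n)" using u w by (subst Phi.hom) auto
    also have "N ((1 / l (u n) - 1 / l w) *\<^sub>R w) = \<bar>1 / l (u n) - 1 / l w\<bar> * N w" using w by (subst Phi.hom) auto
    finally show ?thesis .
  qed
  then have le: "\<forall>\<^sub>F n in sequentially. N ((1 / l (u n)) *\<^sub>R u n - (1 / l w) *\<^sub>R w)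
      \<le> N (u n - w) / l (u n) + \<bar>1 / l (u n) - 1 / l w\<bar> * N w" by (rule always_eventually[OF allI])
  have "(\<lambda>n. N (u n - w) / l (u n) + \<bar>1 / l (u n) - 1 / l w\<bar> * N w) \<longlonglongrightarrow> 0 / l w + \<bar>1 / l w - 1 / l w\<bar> * N w"
    using lw by (intro tendsto_intros lim ll) auto
  then have "(\<lambda>n. N (u n - w) / l (u n) + \<bar>1 / l (u n) - 1 / l w\<bar> * N w) \<longlonglongrightarrow> 0" by simp
  from tendsto_sandwich[OF _ le tendsto_const this] show ?thesis by simp
qed

text \<open>The compact set found inside the open cone is projected radially to
  \<open>L u = 1\<close>. Pulling back along the projection shows that the class survives on the
  image, and compactness turns the pointwise strict bound on \<open>G\<close> into a uniform
  one.\<close>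

theorem eqz_compact_sublevel:
  assumes nz: "\<not> eqz dN uminus {u\<in>E. L u > 0 \<and> G u < lam * L u} q"
  obtains K lam' where "K \<subseteq> {u\<in>E. L u = 1 \<and> G u \<le> lam'}" "lam' < lam" "\<And>u. u \<in> K \<Longrightarrow> - u \<in> K"
    "Phi.seqcomp K" "\<not> eqz dN uminus K q"
proof -
  define A where "A = {u\<in>E. L u > 0 \<and> G u < lam * L u}"
  obtain K0 where K0: "K0 \<subseteq> A" "\<And>x. x \<in> K0 \<Longrightarrow> - x \<in> K0" "Phi.seqcomp K0" "\<not> eqz dN uminus K0 q"
  proof (rule Phi.eqz_compact_subset[of A q])
    show "A \<subseteq> E" "0 \<notin> A" "\<not> eqz dN uminus A q" using nz L.F_0 unfolding A_def by auto
    show "- x \<in> A" if "x \<in> A" for x using that G.F_minus L.F_minus unfolding A_def by auto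
    show "\<exists>e>0. \<forall>y\<in>E. dN x y < e \<longrightarrow> y \<in> A" if x: "x \<in> A" for x
    proof (rule ccontr)
      assume no: "\<not> ?thesis"
      have "\<exists>y\<in>E. dN x y < inverse (Suc n) \<and> y \<notin> A" for n
        using no by (metis inverse_positive_iff_positive of_nat_0_less_iff zero_less_Suc)
      then obtain y where y: "\<And>n::nat. y n \<in> E" "\<And>n. dN x (y n) < inverse (Suc n)" "\<And>n. y n \<notin> A" by metis
      have xE: "x \<in> E" "L x > 0" "G x < lam * L x" using x unfolding A_def by auto
      have "(\<lambda>n. N (y n - x)) \<longlonglongrightarrow> 0"
        by (rule tendsto_sandwich[OF _ _ tendsto_const LIMSEQ_inverse_real_of_nat])
          (use y(2) Phi.N_diff_commute[OF y(1) xE(1)] in \<open>auto intro!: always_eventually simp: less_imp_le\<close>)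
      then have "(\<lambda>n. Phi (y n - x)) \<longlonglongrightarrow> 0" using Phi_tendsto_0_iff[of "\<lambda>n. y n - x"] y xE by auto
      note lims = tendsto_components[OF y(1) xE(1) this]
      have "(\<lambda>n. lam * L (y n) - G (y n)) \<longlonglongrightarrow> lam * L x - G x" by (intro tendsto_intros lims)
      then have "eventually (\<lambda>n. 0 < lam * L (y n) - G (y n)) sequentially"
        by (rule order_tendstoD(1)) (use xE in simp)
      moreover have "eventually (\<lambda>n. 0 < L (y n)) sequentially" using lims(2) xE by (intro order_tendstoD) auto
      ultimately have "eventually (\<lambda>n. y n \<in> A) sequentially" by eventually_elim (use y in \<open>auto simp: A_def\<close>)
      then show False using y(3) by auto
    qed
  qed auto
  have K0E: "u \<in> E" "L u > 0" "G u < lam * L u" "l u > 0" if "u \<in> K0" for u using that K0(1) unfolding A_def by auto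
  define h where "h = (\<lambda>u. (1 / l u) *\<^sub>R u)"
  define K where "K = h ` K0"
  have hm: "h (- u) = - h u" if "u \<in> K0" for u unfolding h_def using L.F_minus[OF K0E(1)[OF that]] by simp
  have KE: "u \<in> E" "L u = 1" "G u < lam" if uK: "u \<in> K" for u
  proof -
    obtain v where v: "v \<in> K0" "u = h v" using uK unfolding K_def by auto
    note n = l_normalize[OF K0E(1,2)[OF v(1)]]
    show "u \<in> E" "L u = 1" using n v unfolding h_def by auto
    show "G u < lam" unfolding v(2) h_def n(3) using K0E[OF v(1)] by (simp add: field_simps)
  qed
  have Ks: "- u \<in> K" if uK: "u \<in> K" for u
  proof -
    obtain v where "v \<in> K0" "u = h v" using uK unfolding K_def by auto
    then show ?thesis unfolding K_def using hm[of v] K0(2)[of v] by (intro image_eqI[of _ h "- v"]) auto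
  qed
  have Kc: "Phi.seqcomp K"
    unfolding Phi.seqcomp_def
  proof (intro allI impI)
    fix \<sigma> assume "\<forall>n::nat. \<sigma> n \<in> K"
    then have "\<forall>n. \<exists>v. v \<in> K0 \<and> \<sigma> n = h v" unfolding K_def by auto
    then obtain v where v: "\<And>n. v n \<in> K0" "\<And>n. \<sigma> n = h (v n)" by metis
    obtain w r where w: "w \<in> K0" "strict_mono (r :: nat \<Rightarrow> nat)" "(\<lambda>n. N (v (r n) - w)) \<longlonglongrightarrow> 0"
      using Phi.seqcompE[OF K0(3), of v] v by blast
    have "(\<lambda>n. N (h (v (r n)) - h w)) \<longlonglongrightarrow> 0"
      unfolding h_def using K0E v w by (intro normalize_tendsto[of "\<lambda>n. v (r n)"]) auto
    then show "\<exists>l\<in>K. \<exists>r. strict_mono (r :: nat \<Rightarrow> nat) \<and> (\<lambda>n. N (\<sigma> (r n) - l)) \<longlonglongrightarrow> 0"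
      using w v unfolding K_def by (intro bexI[of _ "h w"] exI[of _ r]) auto
  qed
  have Kz: "\<not> eqz dN uminus K q"
  proof
    assume z: "eqz dN uminus K q"
    have "eqz dN uminus K0 q"
    proof (rule eqz_pull[OF z, of K0 h])
      show "\<And>y. y \<in> K0 \<Longrightarrow> h y \<in> K" unfolding K_def by auto
      show "\<And>y. y \<in> K0 \<Longrightarrow> h (- y) = - h y" by (rule hm)
      fix y and e :: real assume y: "y \<in> K0" and e: "e > 0"
      show "\<exists>\<delta>>0. \<forall>z\<in>K0. dN y z < \<delta> \<longrightarrow> dN (h y) (h z) < e"
      proof (rule ccontr)
        assume no: "\<not> ?thesis"
        have "\<exists>z\<in>K0. dN y z < inverse (Suc n) \<and> \<not> dN (h y) (h z) < e" for n
          using no by (metis inverse_positive_iff_positive of_nat_0_less_iff zero_less_Suc)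
        then obtain z where z: "\<And>n::nat. z n \<in> K0" "\<And>n. dN y (z n) < inverse (Suc n)" "\<And>n. \<not> dN (h y) (h (z n)) < e" by metis
        have "(\<lambda>n. N (z n - y)) \<longlonglongrightarrow> 0"
          by (rule tendsto_sandwich[OF _ _ tendsto_const LIMSEQ_inverse_real_of_nat])
            (use z(2) Phi.N_diff_commute[OF K0E(1)[OF z(1)] K0E(1)[OF y]] in \<open>auto intro!: always_eventually simp: less_imp_le\<close>)
        then have "(\<lambda>n. N (h (z n) - h y)) \<longlonglongrightarrow> 0"
          unfolding h_def using K0E z y by (intro normalize_tendsto) auto
        then have "eventually (\<lambda>n. N (h (z n) - h y) < e) sequentially" using e by (intro order_tendstoD) auto
        then obtain n where "N (h (z n) - h y) < e" by (auto simp: eventually_sequentially)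
        moreover have "h (z n) \<in> E" "h y \<in> E" using KE(1) z(1) y unfolding K_def by auto
        ultimately show False using z(3)[of n] Phi.N_diff_commute[of "h (z n)" "h y"] by simp
      qed
    qed
    then show False using K0(4) by simp
  qed
  \<comment> \<open>Otherwise \<open>G\<close> would come arbitrarily close to \<open>lam\<close> on
    \<open>K\<close>, and a limit point in \<open>K\<close> would attain it.\<close>
  have "\<exists>lam'<lam. \<forall>u\<in>K. G u \<le> lam'"
  proof (rule ccontr)
    assume no: "\<not> ?thesis"
    have "\<exists>u\<in>K. G u > lam - inverse (Suc n)" for n
      using no by (metis diff_less_eq inverse_positive_iff_positive less_add_same_cancel1 not_le of_nat_0_less_iff zero_less_Suc)
    then obtain u where u: "\<And>n::nat. u n \<in> K" "\<And>n. G (u n) > lam - inverse (Suc n)" by metis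
    obtain w r where w: "w \<in> K" "strict_mono (r :: nat \<Rightarrow> nat)" "(\<lambda>n. N (u (r n) - w)) \<longlonglongrightarrow> 0"
      using Phi.seqcompE[OF Kc, of u] u by blast
    have "(\<lambda>n. G (u (r n))) \<longlonglongrightarrow> G w"
      using tendsto_components(1)[of "\<lambda>n. u (r n)" w] Phi_tendsto_0_iff[of "\<lambda>n. u (r n) - w"] KE u w by auto
    moreover have "(\<lambda>n. lam - inverse (real (Suc n))) \<longlonglongrightarrow> lam - 0"
      by (intro tendsto_intros LIMSEQ_inverse_real_of_nat)
    moreover have "lam - inverse (real (Suc n)) \<le> G (u (r n))" for n
    proof -
      have "inverse (real (Suc (r n))) \<le> inverse (real (Suc n))" using seq_suble[OF w(2), of n] by (simp add: field_simps)
      then show ?thesis using u(2)[of "r n"] by linarith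
    qed
    ultimately have "lam - 0 \<le> G w" by (intro LIMSEQ_le) auto
    then show False using KE(3)[OF w(1)] by simp
  qed
  then obtain lam' where "lam' < lam" "\<And>u. u \<in> K \<Longrightarrow> G u \<le> lam'" by blast
  then show ?thesis using that[of K lam'] KE Ks Kc Kz by blast
qed

end

subsection \<open>Uniform convexity of p-th powers\<close>

lemma continuous_on_abs_powr:
  fixes f :: "'a::topological_space \<Rightarrow> real"
  assumes "continuous_on S f" "p > 0"
  shows "continuous_on S (\<lambda>x. \<bar>f x\<bar> powr p)"
  using assms by (intro continuous_on_powr' continuous_intros) auto

text \<open>The mean value theorem on both halves of the interval: the derivative of the power is
  strictly increasing, so the right half gains more than the left.\<close>

lemma powr_strict_midpoint_less:
  fixes x y p :: real
  assumes p: "1 < p" and xy: "0 \<le> x" "x < y"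
  shows "((x + y) / 2) powr p < (x powr p + y powr p) / 2"
proof -
  define m where "m = (x + y) / 2"
  have m: "x < m" "m < y" "0 < m" using xy unfolding m_def by auto
  have mvt: "\<exists>z. a < z \<and> z < b \<and> b powr p - a powr p = (b - a) * (p * z powr (p - 1))" if ab: "0 \<le> a" "a < b" for a b :: real
  proof -
    have D: "((\<lambda>t. t powr p) has_real_derivative p * z powr (p - 1)) (at z)" if "z > 0" for z :: real
      using that by (auto intro!: derivative_eq_intros)
    have "continuous_on {a..b} (\<lambda>t. t powr p)"
      using p ab by (intro continuous_on_powr' continuous_intros) auto
    then obtain l z where z: "a < z" "z < b" "DERIV (\<lambda>t. t powr p) z :> l" "b powr p - a powr p = (b - a) * l"
      using MVT[OF ab(2), of "\<lambda>t. t powr p"] D ab by (metis le_less_trans real_differentiable_def)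
    moreover have "l = p * z powr (p - 1)" using DERIV_unique[OF z(3) D] z ab by auto
    ultimately show ?thesis by blast
  qed
  obtain z1 where z1: "x < z1" "z1 < m" "m powr p - x powr p = (m - x) * (p * z1 powr (p - 1))" using mvt[of x m] xy m by auto
  obtain z2 where z2: "m < z2" "z2 < y" "y powr p - m powr p = (y - m) * (p * z2 powr (p - 1))" using mvt[of m y] m by auto
  have "z1 powr (p - 1) < z2 powr (p - 1)" using z1 z2 xy p by (intro powr_less_mono2) auto
  then have "(m - x) * (p * z1 powr (p - 1)) < (m - x) * (p * z2 powr (p - 1))" using m p by simp
  also have "m - x = y - m" unfolding m_def by (simp add: field_simps)
  finally have "m powr p - x powr p < y powr p - m powr p" using z1(3) z2(3) by (simp add: \<open>m - x = y - m\<close>)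
  then show ?thesis unfolding m_def by simp
qed

lemma abs_powr_strict_midpoint:
  fixes a b p :: real
  assumes p: "1 < p" and "a \<noteq> b"
  shows "\<bar>(a + b) / 2\<bar> powr p < (\<bar>a\<bar> powr p + \<bar>b\<bar> powr p) / 2"
proof (cases "\<bar>a\<bar> = \<bar>b\<bar>")
  case True
  then have "a + b = 0" "b \<noteq> 0" using assms by (auto simp: abs_if split: if_splits)
  then show ?thesis using True by simp
next
  case False
  have "\<bar>(a + b) / 2\<bar> powr p \<le> ((\<bar>a\<bar> + \<bar>b\<bar>) / 2) powr p" using p by (intro powr_mono2) auto
  also have "\<dots> < (\<bar>a\<bar> powr p + \<bar>b\<bar> powr p) / 2"
  proof (cases "\<bar>a\<bar> < \<bar>b\<bar>")
    case True
    then show ?thesis using powr_strict_midpoint_less[OF p, of "\<bar>a\<bar>" "\<bar>b\<bar>"] by simp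
  next
    case F: False
    then show ?thesis using powr_strict_midpoint_less[OF p, of "\<bar>b\<bar>" "\<bar>a\<bar>"] False by (simp add: add.commute)
  qed
  finally show ?thesis .
qed

lemma abs_powr_convex:
  fixes a b p t :: real
  assumes p: "1 < p" and t: "0 \<le> t" "t \<le> 1"
  shows "\<bar>(1 - t) * a + t * b\<bar> powr p \<le> (1 - t) * \<bar>a\<bar> powr p + t * \<bar>b\<bar> powr p"
proof -
  have le: "s powr p \<le> s" if "0 \<le> s" "s \<le> 1" for s :: real
    using powr_mono'[of 1 p s] that p by (cases "s = 0") auto
  have "\<bar>(1 - t) * a + t * b\<bar> \<le> (1 - t) * \<bar>a\<bar> + t * \<bar>b\<bar>"
    using t by (intro order_trans[OF abs_triangle_ineq]) (auto simp: abs_mult)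
  then have "\<bar>(1 - t) * a + t * b\<bar> powr p \<le> ((1 - t) * \<bar>a\<bar> + t * \<bar>b\<bar>) powr p" using p by (intro powr_mono2) auto
  also have "\<dots> \<le> (1 - t) * \<bar>a\<bar> powr p + t * \<bar>b\<bar> powr p"
  proof (cases "a = 0 \<or> b = 0")
    case True
    then show ?thesis
      using t le[of t] le[of "1 - t"] by (auto simp: powr_mult intro!: mult_right_mono)
  next
    case False
    then show ?thesis using convex_onD[OF powr_convex[of p], of t "\<bar>a\<bar>" "\<bar>b\<bar>"] t p by auto
  qed
  finally show ?thesis .
qed

text \<open>By homogeneity the pair may be scaled to maximum norm 1. The pairs for which the first
  term does not suffice lie in the compact set \<open>S\<close>, which misses the diagonal, so the
  midpoint defect has a positive lower bound \<open>m\<close> on \<open>S\<close>; since the left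
  side is at most \<open>2 powr p\<close>, the constant \<open>2 powr p / m\<close> works.\<close>

lemma abs_powr_uniformly_convex:
  fixes p \<epsilon> :: real
  assumes p: "1 < p" and e: "\<epsilon> > 0"
  obtains c where "c \<ge> 0" "\<And>a b::real. \<bar>a - b\<bar> powr p
     \<le> \<epsilon> * (\<bar>a\<bar> powr p + \<bar>b\<bar> powr p) + c * ((\<bar>a\<bar> powr p + \<bar>b\<bar> powr p) / 2 - \<bar>(a + b) / 2\<bar> powr p)"
proof -
  define g where "g = (\<lambda>x::real\<times>real. (\<bar>fst x\<bar> powr p + \<bar>snd x\<bar> powr p) / 2 - \<bar>(fst x + snd x) / 2\<bar> powr p)"
  have g0: "g x \<ge> 0" for x
    using abs_powr_convex[OF p, of "1/2" "fst x" "snd x"] unfolding g_def by (simp add: add_divide_distrib)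
  define S where "S = {x::real\<times>real. max \<bar>fst x\<bar> \<bar>snd x\<bar> = 1 \<and> \<epsilon> * (\<bar>fst x\<bar> powr p + \<bar>snd x\<bar> powr p) \<le> \<bar>fst x - snd x\<bar> powr p}"
  have "closed S" unfolding S_def using p
    by (intro closed_Collect_conj closed_Collect_eq closed_Collect_le continuous_intros continuous_on_abs_powr) auto
  moreover have "bounded S"
  proof (rule bounded_subset)
    show "S \<subseteq> cbox (-1, -1) (1, 1)"
    proof
      fix x assume "x \<in> S"
      then have "\<bar>fst x\<bar> \<le> 1" "\<bar>snd x\<bar> \<le> 1" unfolding S_def by auto
      then show "x \<in> cbox (-1, -1) (1, 1)" by (cases x) (auto simp: mem_box Basis_prod_def)
    qed
  qed simp
  ultimately have S: "compact S" by (simp add: compact_eq_bounded_closed)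
  have gc: "continuous_on S g" unfolding g_def using p by (intro continuous_intros continuous_on_abs_powr) auto
  obtain m where m: "m > 0" "\<And>x. x \<in> S \<Longrightarrow> m \<le> g x"
  proof (cases "S = {}")
    case False
    obtain x0 where x0: "x0 \<in> S" "\<And>x. x \<in> S \<Longrightarrow> g x0 \<le> g x" using continuous_attains_inf[OF S False gc] by blast
    have "fst x0 \<noteq> snd x0"
    proof
      assume eq: "fst x0 = snd x0"
      then have "\<bar>snd x0\<bar> = 1" "\<epsilon> * (\<bar>snd x0\<bar> powr p + \<bar>snd x0\<bar> powr p) \<le> 0" using x0(1) unfolding S_def by auto
      then show False using e by simp
    qed
    then have "g x0 > 0" unfolding g_def using abs_powr_strict_midpoint[OF p] by auto
    then show ?thesis using that x0 by blast
  qed (use that[of 1] in auto)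
  define c where "c = 2 powr p / m"
  show ?thesis
  proof (rule that[of c])
    show "c \<ge> 0" unfolding c_def using m by simp
    fix a b :: real
    define r where "r = max \<bar>a\<bar> \<bar>b\<bar>"
    show "\<bar>a - b\<bar> powr p \<le> \<epsilon> * (\<bar>a\<bar> powr p + \<bar>b\<bar> powr p) + c * ((\<bar>a\<bar> powr p + \<bar>b\<bar> powr p) / 2 - \<bar>(a + b) / 2\<bar> powr p)"
    proof (cases "r = 0")
      case True
      then have "a = 0" "b = 0" unfolding r_def by (auto simp: max_def split: if_splits)
      then show ?thesis by simp
    next
      case False
      then have r: "r > 0" unfolding r_def by auto
      define x where "x = (a / r, b / r)"
      have max1: "max \<bar>fst x\<bar> \<bar>snd x\<bar> = 1" using r unfolding x_def r_def by (auto simp: max_def field_simps)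
      have main: "\<bar>fst x - snd x\<bar> powr p \<le> \<epsilon> * (\<bar>fst x\<bar> powr p + \<bar>snd x\<bar> powr p) + c * g x"
      proof (cases "x \<in> S")
        case True
        have "\<bar>fst x - snd x\<bar> \<le> 2" using max1 by (auto simp: max_def split: if_splits)
        then have "\<bar>fst x - snd x\<bar> powr p \<le> 2 powr p" using p by (intro powr_mono2) auto
        also have "\<dots> \<le> c * g x" unfolding c_def using m(2)[OF True] m(1) by (simp add: field_simps)
        also have "\<dots> \<le> \<epsilon> * (\<bar>fst x\<bar> powr p + \<bar>snd x\<bar> powr p) + c * g x" using e by simp
        finally show ?thesis .
      next
        case False
        then have "\<bar>fst x - snd x\<bar> powr p \<le> \<epsilon> * (\<bar>fst x\<bar> powr p + \<bar>snd x\<bar> powr p)" using max1 unfolding S_def by auto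
        moreover have "c * g x \<ge> 0" using g0 m unfolding c_def by simp
        ultimately show ?thesis by linarith
      qed
      have sc: "\<bar>u / r\<bar> powr p = \<bar>u\<bar> powr p / r powr p" for u using r by (simp add: powr_divide)
      have "fst x - snd x = (a - b) / r" "(fst x + snd x) / 2 = ((a + b) / 2) / r" unfolding x_def using r by (auto simp: field_simps)
      then have "\<bar>fst x - snd x\<bar> powr p = \<bar>a - b\<bar> powr p / r powr p"
        "\<bar>(fst x + snd x) / 2\<bar> powr p = \<bar>(a + b) / 2\<bar> powr p / r powr p"
        "\<bar>fst x\<bar> powr p = \<bar>a\<bar> powr p / r powr p" "\<bar>snd x\<bar> powr p = \<bar>b\<bar> powr p / r powr p"
        using sc[of "a - b"] sc[of "(a + b) / 2"] sc[of a] sc[of b] by (simp_all only: x_def fst_conv snd_conv)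
      then have "\<bar>a - b\<bar> powr p / r powr p \<le> \<epsilon> * (\<bar>a\<bar> powr p / r powr p + \<bar>b\<bar> powr p / r powr p)
         + c * ((\<bar>a\<bar> powr p / r powr p + \<bar>b\<bar> powr p / r powr p) / 2 - \<bar>(a + b) / 2\<bar> powr p / r powr p)"
        using main unfolding g_def by (simp only:)
      also have "\<dots> = (\<epsilon> * (\<bar>a\<bar> powr p + \<bar>b\<bar> powr p) + c * ((\<bar>a\<bar> powr p + \<bar>b\<bar> powr p) / 2 - \<bar>(a + b) / 2\<bar> powr p)) / r powr p"
        by (simp add: add_divide_distrib diff_divide_distrib right_diff_distrib distrib_left)
      finally show ?thesis using r by (simp add: divide_le_cancel)
    qed
  qed
qed

lemma abs_powr_add_le:
  fixes a b p :: real
  assumes "0 < p"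
  shows "\<bar>a + b\<bar> powr p \<le> 2 powr p * (\<bar>a\<bar> powr p + \<bar>b\<bar> powr p)"
proof -
  have "\<bar>a + b\<bar> powr p \<le> (2 * max \<bar>a\<bar> \<bar>b\<bar>) powr p" using assms by (intro powr_mono2) auto
  also have "\<dots> = 2 powr p * max \<bar>a\<bar> \<bar>b\<bar> powr p" by (simp add: powr_mult)
  also have "\<dots> \<le> 2 powr p * (\<bar>a\<bar> powr p + \<bar>b\<bar> powr p)" by (intro mult_left_mono) (auto simp: max_def)
  finally show ?thesis .
qed

text \<open>Both the Gagliardo seminorm and the norm of \<open>L\<^sup>p(\<Omega>)\<close> are \<open>L\<^sup>p\<close> norms of a linear image \<open>A u\<close>.\<close>

locale Lp_functional =
  fixes E :: "'a::real_vector set" and M :: "'b measure" and A :: "'a \<Rightarrow> 'b \<Rightarrow> real" and p :: real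
  assumes subE: "subspace E" and p: "1 < p"
    and A_add: "\<And>u v x. A (u + v) x = A u x + A v x" and A_scale: "\<And>c u x. A (c *\<^sub>R u) x = c * A u x"
    and A_meas: "\<And>u. u \<in> E \<Longrightarrow> A u \<in> borel_measurable M"
    and A_fin: "\<And>u. u \<in> E \<Longrightarrow> (\<integral>\<^sup>+x. ennreal (\<bar>A u x\<bar> powr p) \<partial>M) < \<infinity>"
begin

definition F :: "'a \<Rightarrow> real" where
  "F u = enn2real (\<integral>\<^sup>+x. ennreal (\<bar>A u x\<bar> powr p) \<partial>M)"

lemma A_diff: "A (u - v) x = A u x - A v x"
  using A_add[of u "(-1) *\<^sub>R v" x] A_scale[of "-1" v x] by simp

lemma A_int: "u \<in> E \<Longrightarrow> integrable M (\<lambda>x. \<bar>A u x\<bar> powr p)"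
  using A_meas[of u] A_fin[of u] by (intro integrableI_bounded) auto

lemma F_int: "u \<in> E \<Longrightarrow> F u = (\<integral>x. \<bar>A u x\<bar> powr p \<partial>M)"
  unfolding F_def using A_meas[of u] by (subst integral_eq_nn_integral) auto

lemma F_ennreal: "u \<in> E \<Longrightarrow> ennreal (F u) = (\<integral>\<^sup>+x. ennreal (\<bar>A u x\<bar> powr p) \<partial>M)"
  unfolding F_def using A_fin[of u] by simp

sublocale phomogeneous E F p
proof
  show "subspace E" "1 < p" by (rule subE, rule p)
  show "0 \<le> F u" for u unfolding F_def by simp
  fix u v assume u: "u \<in> E"
  show "F (c *\<^sub>R u) = \<bar>c\<bar> powr p * F u" for c
    using F_int[OF u] F_int[of "c *\<^sub>R u"] u subspace_scale[OF subE u]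
    by (simp add: A_scale abs_mult powr_mult)
  fix t :: real assume v: "v \<in> E" and t: "0 \<le> t" "t \<le> 1"
  have w: "(1 - t) *\<^sub>R u + t *\<^sub>R v \<in> E" using u v subE by (intro subspace_add subspace_scale) auto
  have "F ((1 - t) *\<^sub>R u + t *\<^sub>R v) \<le> (\<integral>x. (1 - t) * \<bar>A u x\<bar> powr p + t * \<bar>A v x\<bar> powr p \<partial>M)"
    unfolding F_int[OF w]
    using A_int[OF u] A_int[OF v] A_int[OF w] abs_powr_convex[OF p t]
    by (intro integral_mono) (auto simp: A_add A_scale)
  also have "\<dots> = (1 - t) * F u + t * F v"
    using A_int[OF u] A_int[OF v] F_int u v by simp
  finally show "F ((1 - t) *\<^sub>R u + t *\<^sub>R v) \<le> (1 - t) * F u + t * F v" .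
qed

lemma F_uniformly_convex:
  assumes "\<epsilon> > 0"
  shows "\<exists>c\<ge>0. \<forall>u\<in>E. \<forall>v\<in>E. F (u - v) \<le> \<epsilon> * (F u + F v) + c * ((F u + F v) / 2 - F ((1/2) *\<^sub>R (u + v)))"
proof -
  obtain c where c: "c \<ge> 0" "\<And>a b::real. \<bar>a - b\<bar> powr p
     \<le> \<epsilon> * (\<bar>a\<bar> powr p + \<bar>b\<bar> powr p) + c * ((\<bar>a\<bar> powr p + \<bar>b\<bar> powr p) / 2 - \<bar>(a + b) / 2\<bar> powr p)"
    using abs_powr_uniformly_convex[OF p assms] by blast
  show ?thesis
  proof (intro exI[of _ c] conjI ballI c(1))
    fix u v assume u: "u \<in> E" and v: "v \<in> E"
    have d: "u - v \<in> E" and s: "(1/2) *\<^sub>R (u + v) \<in> E"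
      using u v subE by (auto intro!: subspace_add subspace_scale subspace_diff)
    note I = A_int[OF u] A_int[OF v] A_int[OF s]
    have "F (u - v) \<le> (\<integral>x. \<epsilon> * (\<bar>A u x\<bar> powr p + \<bar>A v x\<bar> powr p)
        + c * ((\<bar>A u x\<bar> powr p + \<bar>A v x\<bar> powr p) / 2 - \<bar>A ((1/2) *\<^sub>R (u + v)) x\<bar> powr p) \<partial>M)"
      unfolding F_int[OF d]
    proof (rule integral_mono)
      show "integrable M (\<lambda>x. \<bar>A (u - v) x\<bar> powr p)" by (rule A_int[OF d])
      show "integrable M (\<lambda>x. \<epsilon> * (\<bar>A u x\<bar> powr p + \<bar>A v x\<bar> powr p)
        + c * ((\<bar>A u x\<bar> powr p + \<bar>A v x\<bar> powr p) / 2 - \<bar>A ((1/2) *\<^sub>R (u + v)) x\<bar> powr p))"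
        using I by auto
      show "\<bar>A (u - v) x\<bar> powr p \<le> \<epsilon> * (\<bar>A u x\<bar> powr p + \<bar>A v x\<bar> powr p)
        + c * ((\<bar>A u x\<bar> powr p + \<bar>A v x\<bar> powr p) / 2 - \<bar>A ((1/2) *\<^sub>R (u + v)) x\<bar> powr p)" for x
        using c(2)[of "A u x" "A v x"] unfolding A_diff A_add A_scale by (simp add: add_divide_distrib)
    qed
    also have "\<dots> = \<epsilon> * (F u + F v) + c * ((F u + F v) / 2 - F ((1/2) *\<^sub>R (u + v)))"
      using I F_int[OF u] F_int[OF v] F_int[OF s] by simp
    finally show "F (u - v) \<le> \<epsilon> * (F u + F v) + c * ((F u + F v) / 2 - F ((1/2) *\<^sub>R (u + v)))" .
  qed
qed

end

section \<open>Integrals of p-th powers and almost everywhere limits\<close>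

lemma nn_integral_abs_powr_add_finite:
  assumes "f \<in> borel_measurable M" "g \<in> borel_measurable M" "0 < p"
    and "(\<integral>\<^sup>+x. ennreal (\<bar>f x\<bar> powr p) \<partial>M) < \<infinity>" "(\<integral>\<^sup>+x. ennreal (\<bar>g x\<bar> powr p) \<partial>M) < \<infinity>"
  shows "(\<integral>\<^sup>+x. ennreal (\<bar>f x + g x\<bar> powr p) \<partial>M) < \<infinity>"
proof -
  have "(\<integral>\<^sup>+x. ennreal (\<bar>f x + g x\<bar> powr p) \<partial>M) \<le>
     (\<integral>\<^sup>+x. ennreal (2 powr p) * (ennreal (\<bar>f x\<bar> powr p) + ennreal (\<bar>g x\<bar> powr p)) \<partial>M)"
    using abs_powr_add_le[OF assms(3)]
    by (intro nn_integral_mono) (auto simp: ennreal_mult[symmetric] ennreal_plus[symmetric] simp del: ennreal_plus)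
  also have "\<dots> = ennreal (2 powr p) * ((\<integral>\<^sup>+x. ennreal (\<bar>f x\<bar> powr p) \<partial>M) + (\<integral>\<^sup>+x. ennreal (\<bar>g x\<bar> powr p) \<partial>M))"
    using assms by (simp add: nn_integral_cmult nn_integral_add)
  also have "\<dots> < \<infinity>" using assms by (simp add: ennreal_mult_less_top)
  finally show ?thesis .
qed

text \<open>Increments of norm at most \<open>(1/4) ^ k\<close> remain summable after multiplication
  by \<open>2 ^ k\<close>. Almost everywhere the increments are therefore bounded by a constant
  times \<open>(1/2) ^ k\<close>, and the telescoping series converges absolutely.\<close>

lemma AE_convergent_of_fast:
  fixes f :: "nat \<Rightarrow> 'b \<Rightarrow> real"
  assumes p: "1 < p" and meas: "\<And>k. f k \<in> borel_measurable M"
    and fast: "\<And>k. (\<integral>\<^sup>+x. ennreal (\<bar>f (Suc k) x - f k x\<bar> powr p) \<partial>M) \<le> ennreal (((1/4) ^ k) powr p)"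
  shows "AE x in M. convergent (\<lambda>k. f k x)"
proof -
  define h where "h = (\<lambda>k x. ennreal ((2 ^ k * \<bar>f (Suc k) x - f k x\<bar>) powr p))"
  have hm: "h k \<in> borel_measurable M" for k unfolding h_def using meas by measurable
  define q where "q = (1/2) powr p"
  have q: "0 < q" "q < 1" unfolding q_def using p powr_less_mono2[of p "1/2" 1] by auto
  have hle: "(\<integral>\<^sup>+x. h k x \<partial>M) \<le> ennreal (q ^ k)" for k
  proof -
    have "(\<integral>\<^sup>+x. h k x \<partial>M) = (\<integral>\<^sup>+x. ennreal ((2 ^ k) powr p) * ennreal (\<bar>f (Suc k) x - f k x\<bar> powr p) \<partial>M)"
      unfolding h_def by (simp add: powr_mult ennreal_mult)
    also have "\<dots> = ennreal ((2 ^ k) powr p) * (\<integral>\<^sup>+x. ennreal (\<bar>f (Suc k) x - f k x\<bar> powr p) \<partial>M)"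
      using meas by (intro nn_integral_cmult) measurable
    also have "\<dots> \<le> ennreal ((2 ^ k) powr p) * ennreal (((1/4) ^ k) powr p)" by (intro mult_left_mono fast) auto
    also have "\<dots> = ennreal ((2 ^ k * (1/4) ^ k) powr p)" by (simp add: powr_mult ennreal_mult)
    also have "2 ^ k * (1/4) ^ k = (1/2::real) ^ k" by (simp flip: power_mult_distrib)
    also have "((1/2::real) ^ k) powr p = q ^ k" unfolding q_def by (simp add: powr_realpow[symmetric] powr_powr mult.commute)
    finally show ?thesis .
  qed
  have "(\<integral>\<^sup>+x. (\<Sum>k. h k x) \<partial>M) = (\<Sum>k. \<integral>\<^sup>+x. h k x \<partial>M)" using hm by (rule nn_integral_suminf)
  also have "\<dots> \<le> (\<Sum>k. ennreal (q ^ k))" using hle by (intro suminf_le) auto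
  also have "\<dots> = ennreal (\<Sum>k. q ^ k)" using q by (intro suminf_ennreal2) (auto intro!: summable_geometric)
  also have "\<dots> < \<infinity>" by simp
  finally have "(\<integral>\<^sup>+x. (\<Sum>k. h k x) \<partial>M) \<noteq> \<infinity>" by simp
  then have "AE x in M. (\<Sum>k. h k x) \<noteq> \<infinity>" using hm by (intro nn_integral_noteq_infinite) auto
  then show ?thesis
  proof (eventually_elim)
    fix x assume fin: "(\<Sum>k. h k x) \<noteq> \<infinity>"
    define S where "S = enn2real (\<Sum>k. h k x)"
    have hS: "h k x \<le> ennreal S" for k
    proof -
      have "h k x \<le> (\<Sum>k. h k x)" using sum_le_suminf[of "\<lambda>k. h k x" "{k}"] by auto
      also have "\<dots> = ennreal S" unfolding S_def using fin by (simp add: less_top)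
      finally show ?thesis .
    qed
    have S0: "S \<ge> 0" unfolding S_def by simp
    have bound: "\<bar>f (Suc k) x - f k x\<bar> \<le> S powr (1 / p) * (1/2) ^ k" for k
    proof -
      have "(2 ^ k * \<bar>f (Suc k) x - f k x\<bar>) powr p \<le> S" using hS[of k] S0 unfolding h_def by simp
      then have "((2 ^ k * \<bar>f (Suc k) x - f k x\<bar>) powr p) powr (1 / p) \<le> S powr (1 / p)" using p by (intro powr_mono2) auto
      then have "2 ^ k * \<bar>f (Suc k) x - f k x\<bar> \<le> S powr (1 / p)" using p by (simp add: powr_powr)
      then show ?thesis by (simp add: field_simps power_one_over)
    qed
    have "summable (\<lambda>k. f (Suc k) x - f k x)"
    proof (rule summable_comparison_test')
      show "summable (\<lambda>k. S powr (1 / p) * (1/2) ^ k)" by (intro summable_mult summable_geometric) auto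
      show "norm (f (Suc k) x - f k x) \<le> S powr (1 / p) * (1/2) ^ k" if "k \<ge> 0" for k using bound by simp
    qed
    then have "convergent (\<lambda>n. \<Sum>k<n. f (Suc k) x - f k x)" by (simp add: summable_iff_convergent)
    moreover have "(\<Sum>k<n. f (Suc k) x - f k x) = f n x - f 0 x" for n
      using sum_lessThan_telescope[of "\<lambda>k. f k x" n] .
    ultimately have "convergent (\<lambda>n. f n x - f 0 x)" by (simp only:)
    then have "convergent (\<lambda>n. (f n x - f 0 x) + f 0 x)" by (intro convergent_add convergent_const)
    then show "convergent (\<lambda>k. f k x)" by simp
  qed
qed

lemma nn_integral_abs_powr_Fatou:
  fixes f :: "nat \<Rightarrow> 'b \<Rightarrow> real"
  assumes p: "0 < p" and meas: "\<And>k. f k \<in> borel_measurable M" "g \<in> borel_measurable M"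
    and lim: "AE x in M. (\<lambda>k. f k x) \<longlonglongrightarrow> v x"
    and le: "\<And>k. k \<ge> k0 \<Longrightarrow> (\<integral>\<^sup>+x. ennreal (\<bar>g x - f k x\<bar> powr p) \<partial>M) \<le> c"
  shows "(\<integral>\<^sup>+x. ennreal (\<bar>g x - v x\<bar> powr p) \<partial>M) \<le> c"
proof -
  have "(\<integral>\<^sup>+x. ennreal (\<bar>g x - v x\<bar> powr p) \<partial>M) = (\<integral>\<^sup>+x. liminf (\<lambda>k. ennreal (\<bar>g x - f k x\<bar> powr p)) \<partial>M)"
  proof (rule nn_integral_cong_AE)
    show "AE x in M. ennreal (\<bar>g x - v x\<bar> powr p) = liminf (\<lambda>k. ennreal (\<bar>g x - f k x\<bar> powr p))"
      using lim
    proof (eventually_elim)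
      fix x assume "(\<lambda>k. f k x) \<longlonglongrightarrow> v x"
      then have "(\<lambda>k. \<bar>g x - f k x\<bar>) \<longlonglongrightarrow> \<bar>g x - v x\<bar>" by (intro tendsto_intros)
      then have "(\<lambda>k. \<bar>g x - f k x\<bar> powr p) \<longlonglongrightarrow> \<bar>g x - v x\<bar> powr p"
        by (rule tendsto_powr2[OF _ tendsto_const]) (use p in auto)
      then have "(\<lambda>k. ennreal (\<bar>g x - f k x\<bar> powr p)) \<longlonglongrightarrow> ennreal (\<bar>g x - v x\<bar> powr p)" by (rule tendsto_ennrealI)
      then show "ennreal (\<bar>g x - v x\<bar> powr p) = liminf (\<lambda>k. ennreal (\<bar>g x - f k x\<bar> powr p))"
        using lim_imp_Liminf[OF trivial_limit_sequentially] by metis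
    qed
  qed
  also have "\<dots> \<le> liminf (\<lambda>k. \<integral>\<^sup>+x. ennreal (\<bar>g x - f k x\<bar> powr p) \<partial>M)"
    using meas by (intro nn_integral_liminf) measurable
  also have "\<dots> \<le> limsup (\<lambda>k. \<integral>\<^sup>+x. ennreal (\<bar>g x - f k x\<bar> powr p) \<partial>M)" by (rule Liminf_le_Limsup) simp
  also have "\<dots> \<le> c" by (rule Limsup_bounded) (use le in \<open>auto simp: eventually_sequentially\<close>)
  finally show ?thesis .
qed

subsection \<open>The Neumann space\<close>

lemma null_sets_lborel_Times:
  fixes N :: "'a::euclidean_space set"
  assumes "N \<in> null_sets lborel"
  shows "N \<times> (UNIV :: 'b::euclidean_space set) \<in> null_sets lborel"
    and "(UNIV :: 'b::euclidean_space set) \<times> N \<in> null_sets lborel"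
proof -
  have N: "N \<in> sets lborel" "emeasure lborel N = 0" using assms by (auto simp: null_sets_def)
  have "emeasure (lborel \<Otimes>\<^sub>M lborel) (N \<times> (UNIV :: 'b set)) = emeasure lborel N * emeasure lborel (UNIV :: 'b set)"
    using N by (intro lborel.emeasure_pair_measure_Times) auto
  moreover have "emeasure (lborel \<Otimes>\<^sub>M lborel) ((UNIV :: 'b set) \<times> N) = emeasure lborel (UNIV :: 'b set) * emeasure lborel N"
    using N by (intro lborel.emeasure_pair_measure_Times) auto
  moreover have "N \<times> (UNIV :: 'b set) \<in> sets (lborel \<Otimes>\<^sub>M lborel)" "(UNIV :: 'b set) \<times> N \<in> sets (lborel \<Otimes>\<^sub>M lborel)"
    using N by (auto intro!: pair_measureI)
  ultimately show "N \<times> (UNIV :: 'b set) \<in> null_sets lborel" "(UNIV :: 'b set) \<times> N \<in> null_sets lborel"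
    using N unfolding lborel_prod by (auto simp: null_sets_def)
qed

lemma AE_lborel_fst:
  assumes "AE x in lborel. P (x :: 'a::euclidean_space)"
  shows "AE z in lborel. P (fst (z :: 'a \<times> 'b::euclidean_space))"
proof -
  obtain N where N: "N \<in> null_sets lborel" "{x \<in> space lborel. \<not> P x} \<subseteq> N" using assms unfolding eventually_ae_filter by auto
  show ?thesis
    by (rule AE_I'[OF null_sets_lborel_Times(1)[OF N(1)]]) (use N(2) in auto)
qed

lemma AE_lborel_snd:
  assumes "AE x in lborel. P (x :: 'a::euclidean_space)"
  shows "AE z in lborel. P (snd (z :: 'b::euclidean_space \<times> 'a))"
proof -
  obtain N where N: "N \<in> null_sets lborel" "{x \<in> space lborel. \<not> P x} \<subseteq> N" using assms unfolding eventually_ae_filter by auto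
  show ?thesis
    by (rule AE_I'[OF null_sets_lborel_Times(2)[OF N(1)]]) (use N(2) in auto)
qed

text \<open>For completed sigma-algebras Borel measurability is not enough: preimages of null sets
  must be null, which is the content of \<open>null_sets_lborel_Times\<close>.\<close>

lemma measurable_fst_lebesgue: "(fst :: 'a::euclidean_space \<times> 'b::euclidean_space \<Rightarrow> 'a) \<in> lebesgue \<rightarrow>\<^sub>M lebesgue"
proof (rule completion.measurable_completion2)
  have 1: "(fst :: 'a \<times> 'b \<Rightarrow> 'a) \<in> lborel \<rightarrow>\<^sub>M lborel"
    by (simp add: measurable_lborel1 measurable_lborel2 borel_measurable_continuous_onI continuous_on_fst)
  then show "(fst :: 'a \<times> 'b \<Rightarrow> 'a) \<in> lebesgue \<rightarrow>\<^sub>M lborel" by (rule measurable_completion)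
  show "null_sets lborel \<subseteq> null_sets (distr lebesgue lborel (fst :: 'a \<times> 'b \<Rightarrow> 'a))"
  proof
    fix N :: "'a set" assume N: "N \<in> null_sets lborel"
    have "fst -` N = N \<times> (UNIV :: 'b set)" by auto
    then have "emeasure lborel (fst -` N :: ('a \<times> 'b) set) = 0" "(fst -` N :: ('a \<times> 'b) set) \<in> sets lborel"
      using null_sets_lborel_Times(1)[OF N, where 'b = 'b] by (auto simp: null_sets_def)
    then show "N \<in> null_sets (distr lebesgue lborel (fst :: 'a \<times> 'b \<Rightarrow> 'a))"
      using N measurable_completion[OF 1] by (auto simp: null_sets_def emeasure_distr)
  qed
qed

lemma measurable_snd_lebesgue: "(snd :: 'b::euclidean_space \<times> 'a::euclidean_space \<Rightarrow> 'a) \<in> lebesgue \<rightarrow>\<^sub>M lebesgue"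
proof (rule completion.measurable_completion2)
  have 1: "(snd :: 'b \<times> 'a \<Rightarrow> 'a) \<in> lborel \<rightarrow>\<^sub>M lborel"
    by (simp add: measurable_lborel1 measurable_lborel2 borel_measurable_continuous_onI continuous_on_snd)
  then show "(snd :: 'b \<times> 'a \<Rightarrow> 'a) \<in> lebesgue \<rightarrow>\<^sub>M lborel" by (rule measurable_completion)
  show "null_sets lborel \<subseteq> null_sets (distr lebesgue lborel (snd :: 'b \<times> 'a \<Rightarrow> 'a))"
  proof
    fix N :: "'a set" assume N: "N \<in> null_sets lborel"
    have "snd -` N = (UNIV :: 'b set) \<times> N" by auto
    then have "emeasure lborel (snd -` N :: ('b \<times> 'a) set) = 0" "(snd -` N :: ('b \<times> 'a) set) \<in> sets lborel"
      using null_sets_lborel_Times(2)[OF N, where 'b = 'b] by (auto simp: null_sets_def)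
    then show "N \<in> null_sets (distr lebesgue lborel (snd :: 'b \<times> 'a \<Rightarrow> 'a))"
      using N measurable_completion[OF 1] by (auto simp: null_sets_def emeasure_distr)
  qed
qed

lemma AE_lebesgue_iff: "(AE x in lebesgue. P x) \<longleftrightarrow> (AE x in lborel. P x)"
  by (rule AE_completion_iff)

definition dif :: "('a \<Rightarrow> real) \<Rightarrow> 'a \<times> 'a \<Rightarrow> real" where
  "dif u z = u (fst z) - u (snd z)"

locale neumann =
  fixes p s :: real and \<Omega> :: "(real^'n) set"
  assumes s: "0 < s" and p: "1 < p" and \<Omega>: "open \<Omega>" "\<Omega> \<noteq> {}" "bounded \<Omega>"
begin

abbreviation X :: "(real^'n \<Rightarrow> real) set" where "X \<equiv> Xraw p s \<Omega>"

definition \<kappa> :: real where "\<kappa> = real CARD('n) + p * s"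

text \<open>On the diagonal the conventions \<open>0 powr \<kappa> = 0\<close> and
  \<open>1 / 0 = 0\<close> give the value 0, so positivity holds only off the diagonal.\<close>

definition ker :: "(real^'n) \<times> (real^'n) \<Rightarrow> ennreal" where
  "ker z = ennreal (1 / norm (fst z - snd z) powr \<kappa>) * indicator (Qset \<Omega>) z"

definition \<mu>G where "\<mu>G = density lebesgue ker"
definition \<mu>L where "\<mu>L = density lebesgue (indicator \<Omega> :: real^'n \<Rightarrow> ennreal)"

lemma \<kappa>_pos: "\<kappa> > 0" using s p unfolding \<kappa>_def by (simp add: add_pos_pos)

lemma open_Qset: "open (Qset \<Omega>)"
proof -
  have "Qset \<Omega> = \<Omega> \<times> UNIV \<union> UNIV \<times> \<Omega>" unfolding Qset_def by auto
  then show ?thesis using \<Omega>(1) by (auto intro!: open_Times)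
qed

lemma ker_borel: "ker \<in> borel_measurable borel"
proof -
  have [measurable]: "Qset \<Omega> \<in> sets borel" using open_Qset by auto
  have [measurable]: "(\<lambda>z::(real^'n) \<times> (real^'n). norm (fst z - snd z)) \<in> borel_measurable borel"
    by (intro borel_measurable_continuous_onI continuous_intros)
  show ?thesis unfolding ker_def by measurable
qed

lemma ker_meas: "ker \<in> borel_measurable lebesgue"
  using ker_borel by (intro measurable_completion) simp

lemma \<Omega>_meas [measurable]: "\<Omega> \<in> sets lborel" "\<Omega> \<in> sets lebesgue" "\<Omega> \<in> sets borel"
  using \<Omega>(1) by auto

lemma ind_\<Omega>_meas: "(indicator \<Omega> :: real^'n \<Rightarrow> ennreal) \<in> borel_measurable lebesgue"
  by simp

lemma dif_meas: "u \<in> borel_measurable lebesgue \<Longrightarrow> dif u \<in> borel_measurable lebesgue"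
  unfolding dif_def
  by (intro borel_measurable_diff measurable_compose[OF measurable_fst_lebesgue] measurable_compose[OF measurable_snd_lebesgue])

lemma powr_meas: "f \<in> borel_measurable M \<Longrightarrow> (\<lambda>x. ennreal (\<bar>f x\<bar> powr p)) \<in> borel_measurable M"
  by measurable

lemma gagp_eq:
  assumes u: "u \<in> borel_measurable lebesgue"
  shows "gagp p s \<Omega> u = (\<integral>\<^sup>+z. ennreal (\<bar>dif u z\<bar> powr p) \<partial>\<mu>G)"
proof -
  have "(\<integral>\<^sup>+z. ennreal (\<bar>dif u z\<bar> powr p) \<partial>\<mu>G) = (\<integral>\<^sup>+z. ker z * ennreal (\<bar>dif u z\<bar> powr p) \<partial>lebesgue)"
    unfolding \<mu>G_def by (intro nn_integral_density ker_meas powr_meas dif_meas u)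
  also have "\<dots> = gagp p s \<Omega> u"
    unfolding gagp_def ker_def dif_def \<kappa>_def
    by (intro nn_integral_cong) (auto simp: ennreal_mult[symmetric] indicator_def)
  finally show ?thesis by simp
qed

lemma gagp_lborel: "gagp p s \<Omega> u = (\<integral>\<^sup>+z. ker z * ennreal (\<bar>dif u z\<bar> powr p) \<partial>lborel)"
  unfolding gagp_def ker_def dif_def \<kappa>_def nn_integral_completion
  by (intro nn_integral_cong) (auto simp: ennreal_mult[symmetric] indicator_def)

lemma Lpp_eq:
  assumes u: "u \<in> borel_measurable lebesgue"
  shows "Lpp p \<Omega> u = (\<integral>\<^sup>+x. ennreal (\<bar>u x\<bar> powr p) \<partial>\<mu>L)"
  unfolding \<mu>L_def using u unfolding Lpp_def
  by (subst nn_integral_density) (auto intro!: nn_integral_cong powr_meas simp: mult.commute)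

lemma X_iff: "u \<in> X \<longleftrightarrow> u \<in> borel_measurable lebesgue \<and> (\<integral>\<^sup>+z. ennreal (\<bar>dif u z\<bar> powr p) \<partial>\<mu>G) < \<infinity>
    \<and> (\<integral>\<^sup>+x. ennreal (\<bar>u x\<bar> powr p) \<partial>\<mu>L) < \<infinity>"
  unfolding Xraw_def using gagp_eq Lpp_eq by auto

lemma \<mu>_meas: "u \<in> borel_measurable lebesgue \<Longrightarrow> dif u \<in> borel_measurable \<mu>G"
  "u \<in> borel_measurable lebesgue \<Longrightarrow> u \<in> borel_measurable \<mu>L"
  unfolding \<mu>G_def \<mu>L_def using dif_meas by auto

lemma dif_add: "dif (u + v) z = dif u z + dif v z" and dif_scale: "dif (c *\<^sub>R u) z = c * dif u z"
  and dif_diff: "dif (u - v) z = dif u z - dif v z"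
  unfolding dif_def by (auto simp: algebra_simps)

lemma subspace_X: "subspace X"
  unfolding subspace_def
proof (intro conjI ballI allI)
  show "0 \<in> X" unfolding X_iff dif_def using p by (simp add: zero_fun_def)
  fix u v assume u: "u \<in> X" and v: "v \<in> X"
  have m: "u \<in> borel_measurable lebesgue" "v \<in> borel_measurable lebesgue" using u v unfolding X_iff by auto
  then have "u + v \<in> borel_measurable lebesgue" unfolding plus_fun_def by measurable
  then show "u + v \<in> X"
    using u v p nn_integral_abs_powr_add_finite[of "dif u" \<mu>G "dif v" p] nn_integral_abs_powr_add_finite[of u \<mu>L v p]
      \<mu>_meas[OF m(1)] \<mu>_meas[OF m(2)]
    unfolding X_iff by (auto simp: dif_add)
next
  fix u and c :: real assume u: "u \<in> X"
  then have m: "u \<in> borel_measurable lebesgue" unfolding X_iff by auto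
  then have cm: "c *\<^sub>R u \<in> borel_measurable lebesgue" unfolding scaleR_fun_def by measurable
  have eq: "ennreal (\<bar>c * a\<bar> powr p) = ennreal (\<bar>c\<bar> powr p) * ennreal (\<bar>a\<bar> powr p)" for a
    by (simp add: abs_mult powr_mult ennreal_mult)
  have "(\<integral>\<^sup>+z. ennreal (\<bar>dif (c *\<^sub>R u) z\<bar> powr p) \<partial>\<mu>G) = ennreal (\<bar>c\<bar> powr p) * (\<integral>\<^sup>+z. ennreal (\<bar>dif u z\<bar> powr p) \<partial>\<mu>G)"
    unfolding dif_scale eq using \<mu>_meas(1)[OF m] by (intro nn_integral_cmult powr_meas)
  moreover have "(\<integral>\<^sup>+z. ennreal (\<bar>(c *\<^sub>R u) z\<bar> powr p) \<partial>\<mu>L) = ennreal (\<bar>c\<bar> powr p) * (\<integral>\<^sup>+z. ennreal (\<bar>u z\<bar> powr p) \<partial>\<mu>L)"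
    unfolding scaleR_fun_apply real_scaleR_def eq using \<mu>_meas(2)[OF m] by (intro nn_integral_cmult powr_meas)
  ultimately show "c *\<^sub>R u \<in> X" using u cm unfolding X_iff by (auto simp: ennreal_mult_less_top)
qed

lemma X_measurable: "u \<in> X \<Longrightarrow> u \<in> borel_measurable lebesgue"
  by (simp add: X_iff)

sublocale G: Lp_functional X \<mu>G dif p
proof
  show "(\<integral>\<^sup>+z. ennreal (\<bar>dif u z\<bar> powr p) \<partial>\<mu>G) < \<infinity>" if "u \<in> X" for u using that by (simp add: X_iff)
qed (auto simp: subspace_X p dif_add dif_scale \<mu>_meas X_measurable)

sublocale L: Lp_functional X \<mu>L "\<lambda>u. u" p
proof
  show "(\<integral>\<^sup>+z. ennreal (\<bar>u z\<bar> powr p) \<partial>\<mu>L) < \<infinity>" if "u \<in> X" for u using that by (simp add: X_iff)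
qed (auto simp: subspace_X p \<mu>_meas X_measurable)

lemma G_gagp: "u \<in> X \<Longrightarrow> G.F u = enn2real (gagp p s \<Omega> u)"
  unfolding G.F_def by (simp add: gagp_eq X_measurable)

lemma L_Lpp: "u \<in> X \<Longrightarrow> L.F u = enn2real (Lpp p \<Omega> u)"
  unfolding L.F_def by (simp add: Lpp_eq X_measurable)

lemma L_diff: "u - v \<in> X \<Longrightarrow> (\<integral>\<^sup>+x. ennreal (\<bar>u x - v x\<bar> powr p) \<partial>\<mu>L) = ennreal (L.F (u - v))"
  by (subst L.F_ennreal) simp_all

lemma G_diff: "u - v \<in> X \<Longrightarrow> (\<integral>\<^sup>+x. ennreal (\<bar>dif u x - dif v x\<bar> powr p) \<partial>\<mu>G) = ennreal (G.F (u - v))"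
  by (subst G.F_ennreal) (simp_all add: dif_diff)

lemma AE_\<mu>G_I: "AE z in lborel. P z \<Longrightarrow> AE z in \<mu>G. P z"
  unfolding \<mu>G_def AE_density[OF ker_meas] AE_lebesgue_iff by auto

lemma AE_\<mu>L_I: "AE z in lborel. P z \<Longrightarrow> AE z in \<mu>L. P z"
  unfolding \<mu>L_def AE_density[OF ind_\<Omega>_meas] AE_lebesgue_iff by auto

lemma ker_pos: "z \<in> Qset \<Omega> \<Longrightarrow> fst z \<noteq> snd z \<Longrightarrow> ker z > 0"
  unfolding ker_def by simp

lemma \<Omega>_pos: "emeasure lborel \<Omega> > 0"
proof -
  obtain x e where "e > 0" "ball x e \<subseteq> \<Omega>" using \<Omega> by (meson ex_in_conv openE)
  moreover have "emeasure lborel (ball x e) > 0" using \<open>e > 0\<close> by (simp add: emeasure_ball)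
  ultimately show ?thesis using emeasure_mono[of "ball x e" \<Omega> lborel] by (metis \<Omega>_meas(1) order_less_le_trans)
qed

text \<open>Outside \<open>\<Omega>\<close> only differences with points of \<open>\<Omega>\<close>
  are controlled. By Fubini, and because \<open>\<Omega>\<close> has positive measure, some
  \<open>x\<close> in \<open>\<Omega>\<close> has a convergent sequence of values and convergent
  differences to almost every \<open>y\<close>; subtracting gives convergence at
  \<open>y\<close>.\<close>

lemma X_ae_limit:
  assumes m: "\<And>k. f k \<in> borel_measurable lebesgue"
    and cG: "AE z in \<mu>G. convergent (\<lambda>k. dif (f k) z)" and cL: "AE x in \<mu>L. convergent (\<lambda>k. f k x)"
  shows "AE x in lborel. convergent (\<lambda>k. f k x)"
proof -
  have 1: "AE x in lborel. x \<in> \<Omega> \<longrightarrow> convergent (\<lambda>k. f k x)"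
    using cL unfolding \<mu>L_def AE_density[OF ind_\<Omega>_meas] AE_lebesgue_iff
    by (rule AE_mp) (auto intro!: AE_I2 simp: indicator_def)
  have "AE z in lborel. fst z \<in> \<Omega> \<and> fst z \<noteq> snd z \<longrightarrow> convergent (\<lambda>k. dif (f k) z)"
    using cG unfolding \<mu>G_def AE_density[OF ker_meas] AE_lebesgue_iff
  proof (rule AE_mp, intro AE_I2 impI)
    fix z assume "0 < ker z \<longrightarrow> convergent (\<lambda>k. dif (f k) z)" "fst z \<in> \<Omega> \<and> fst z \<noteq> snd z"
    moreover have "fst z \<in> \<Omega> \<Longrightarrow> z \<in> Qset \<Omega>" by (auto simp: Qset_def)
    ultimately show "convergent (\<lambda>k. dif (f k) z)" using ker_pos by blast
  qed
  then have "AE z in lborel \<Otimes>\<^sub>M lborel. fst z \<in> \<Omega> \<and> fst z \<noteq> snd z \<longrightarrow> convergent (\<lambda>k. dif (f k) z)"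
    unfolding lborel_prod .
  then have 2: "AE x in lborel. AE y in lborel. x \<in> \<Omega> \<and> x \<noteq> y \<longrightarrow> convergent (\<lambda>k. f k x - f k y)"
    using lborel_pair.AE_pair[of "\<lambda>z. fst z \<in> \<Omega> \<and> fst z \<noteq> snd z \<longrightarrow> convergent (\<lambda>k. dif (f k) z)"]
    by (simp add: dif_def)
  have "\<exists>x\<in>\<Omega>. convergent (\<lambda>k. f k x) \<and> (AE y in lborel. x \<noteq> y \<longrightarrow> convergent (\<lambda>k. f k x - f k y))"
  proof (rule ccontr)
    assume no: "\<not> ?thesis"
    have "AE x in lborel. x \<notin> \<Omega>"
      using 1 2
    proof eventually_elim
      fix x assume a: "x \<in> \<Omega> \<longrightarrow> convergent (\<lambda>k. f k x)"
        and b: "AE y in lborel. x \<in> \<Omega> \<and> x \<noteq> y \<longrightarrow> convergent (\<lambda>k. f k x - f k y)"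
      show "x \<notin> \<Omega>"
      proof
        assume x: "x \<in> \<Omega>"
        have "AE y in lborel. x \<noteq> y \<longrightarrow> convergent (\<lambda>k. f k x - f k y)" using b x by simp
        then show False using no a x by blast
      qed
    qed
    then have "emeasure lborel \<Omega> = 0" using AE_iff_measurable[of \<Omega> lborel "\<lambda>x. x \<notin> \<Omega>"] by auto
    then show False using \<Omega>_pos by simp
  qed
  then obtain x where x: "convergent (\<lambda>k. f k x)" "AE y in lborel. x \<noteq> y \<longrightarrow> convergent (\<lambda>k. f k x - f k y)" by blast
  show ?thesis using x(2) AE_lborel_singleton[of x]
  proof eventually_elim
    fix y assume "x \<noteq> y \<longrightarrow> convergent (\<lambda>k. f k x - f k y)" "y \<noteq> x"
    then have "convergent (\<lambda>k. f k x - f k y)" by auto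
    with x(1) have "convergent (\<lambda>k. f k x - (f k x - f k y))" by (rule convergent_diff)
    then show "convergent (\<lambda>k. f k y)" by simp
  qed
qed

text \<open>The Riesz-Fischer argument for both functionals at once: a fast subsequence converges
  almost everywhere in the whole space, so one limit function serves \<open>G\<close> and
  \<open>L\<close>, and Fatou's lemma returns convergence of the full sequence in norm.\<close>

lemma X_complete:
  assumes u: "\<And>n::nat. u n \<in> X"
    and cauchy: "\<And>e. e > 0 \<Longrightarrow> \<exists>n0. \<forall>m\<ge>n0. \<forall>n\<ge>n0. G.F (u m - u n) + L.F (u m - u n) < e"
  shows "\<exists>v\<in>X. (\<lambda>n. G.F (u n - v) + L.F (u n - v)) \<longlonglongrightarrow> 0"
proof -
  have um: "u n \<in> borel_measurable lebesgue" for n using u by (rule X_measurable)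
  have uX: "u m - u n \<in> X" for m n using u by auto
  have nn: "G.F (u m - u n) \<ge> 0" "L.F (u m - u n) \<ge> 0" for m n using uX G.F_nonneg L.F_nonneg by auto
  have "\<exists>n0. \<forall>m\<ge>n0. \<forall>n\<ge>n0. G.F (u m - u n) + L.F (u m - u n) < ((1/4) ^ k) powr p" for k by (rule cauchy) simp
  then obtain n0 where n0: "\<And>k m n. m \<ge> n0 k \<Longrightarrow> n \<ge> n0 k \<Longrightarrow> G.F (u m - u n) + L.F (u m - u n) < ((1/4) ^ k) powr p" by metis
  \<comment> \<open>The summand \<open>k\<close> makes \<open>r\<close> strictly increasing, and the
    sum puts \<open>r k\<close> beyond every threshold up to \<open>n0 k\<close>.\<close>
  define r where "r = (\<lambda>k. k + (\<Sum>j\<le>k. n0 j))"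
  have r: "strict_mono r" unfolding r_def by (intro strict_monoI_Suc) simp
  have rn: "r k \<ge> n0 k" for k unfolding r_def using member_le_sum[of k "{..k}" n0] by auto
  have rn': "r (Suc k) \<ge> n0 k" for k using rn[of k] strict_mono_less[OF r, of k "Suc k"] by linarith
  define f where "f = (\<lambda>k. u (r k))"
  have fm: "f k \<in> borel_measurable lebesgue" for k unfolding f_def by (rule um)
  have fast: "G.F (f (Suc k) - f k) \<le> ((1/4) ^ k) powr p" "L.F (f (Suc k) - f k) \<le> ((1/4) ^ k) powr p" for k
    using n0[OF rn'[of k] rn[of k]] nn[of "r (Suc k)" "r k"] unfolding f_def by auto
  have fX: "f k - f j \<in> X" "u n - f k \<in> X" for k j n unfolding f_def by (rule uX)+
  have cG: "AE z in \<mu>G. convergent (\<lambda>k. dif (f k) z)"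
  proof (rule AE_convergent_of_fast[OF p])
    show "dif (f k) \<in> borel_measurable \<mu>G" for k by (rule \<mu>_meas(1)[OF fm])
    show "(\<integral>\<^sup>+ x. ennreal (\<bar>dif (f (Suc k)) x - dif (f k) x\<bar> powr p) \<partial>\<mu>G) \<le> ennreal (((1/4) ^ k) powr p)" for k
      unfolding G_diff[OF fX(1)] by (rule ennreal_leI[OF fast(1)])
  qed
  have cL: "AE z in \<mu>L. convergent (\<lambda>k. f k z)"
  proof (rule AE_convergent_of_fast[OF p])
    show "f k \<in> borel_measurable \<mu>L" for k by (rule \<mu>_meas(2)[OF fm])
    show "(\<integral>\<^sup>+ x. ennreal (\<bar>f (Suc k) x - f k x\<bar> powr p) \<partial>\<mu>L) \<le> ennreal (((1/4) ^ k) powr p)" for k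
      unfolding L_diff[OF fX(1)] by (rule ennreal_leI[OF fast(2)])
  qed
  define v where "v = (\<lambda>x. lim (\<lambda>k. f k x))"
  have vm: "v \<in> borel_measurable lebesgue" unfolding v_def using fm by (intro borel_measurable_lim_metric)
  have "AE x in lborel. (\<lambda>k. f k x) \<longlonglongrightarrow> v x"
    using X_ae_limit[OF fm cG cL] unfolding v_def by eventually_elim (simp add: convergent_LIMSEQ_iff)
  note lim = this AE_lborel_fst[OF this, where 'b = "real^'n"] AE_lborel_snd[OF this, where 'b = "real^'n"]
  have limL: "AE x in \<mu>L. (\<lambda>k. f k x) \<longlonglongrightarrow> v x" using lim(1) by (rule AE_\<mu>L_I)
  have limG: "AE z in \<mu>G. (\<lambda>k. dif (f k) z) \<longlonglongrightarrow> dif v z"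
    using lim(2,3) by (intro AE_\<mu>G_I, eventually_elim) (auto simp: dif_def intro!: tendsto_diff)
  have bound: "(\<integral>\<^sup>+z. ennreal (\<bar>dif (u n) z - dif v z\<bar> powr p) \<partial>\<mu>G) \<le> ennreal e
      \<and> (\<integral>\<^sup>+x. ennreal (\<bar>u n x - v x\<bar> powr p) \<partial>\<mu>L) \<le> ennreal e"
    if m: "\<And>m n. m \<ge> N \<Longrightarrow> n \<ge> N \<Longrightarrow> G.F (u m - u n) + L.F (u m - u n) < e" "n \<ge> N" for e n N
  proof -
    have rk: "r k \<ge> N" if "k \<ge> N" for k using seq_suble[OF r, of k] that by linarith
    have le: "G.F (u n - f k) \<le> e" "L.F (u n - f k) \<le> e" if "k \<ge> N" for k
      using m(1)[OF m(2) rk[OF that]] nn[of n "r k"] unfolding f_def by auto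
    have "(\<integral>\<^sup>+z. ennreal (\<bar>dif (u n) z - dif v z\<bar> powr p) \<partial>\<mu>G) \<le> ennreal e"
    proof (rule nn_integral_abs_powr_Fatou[OF _ _ _ limG, of _ _ N])
      show "(\<integral>\<^sup>+ x. ennreal (\<bar>dif (u n) x - dif (f k) x\<bar> powr p) \<partial>\<mu>G) \<le> ennreal e" if "k \<ge> N" for k
        unfolding G_diff[OF fX(2)] by (rule ennreal_leI[OF le(1)[OF that]])
    qed (use p in \<open>auto intro!: \<mu>_meas fm um\<close>)
    moreover have "(\<integral>\<^sup>+x. ennreal (\<bar>u n x - v x\<bar> powr p) \<partial>\<mu>L) \<le> ennreal e"
    proof (rule nn_integral_abs_powr_Fatou[OF _ _ _ limL, of _ _ N])
      show "(\<integral>\<^sup>+ x. ennreal (\<bar>u n x - f k x\<bar> powr p) \<partial>\<mu>L) \<le> ennreal e" if "k \<ge> N" for k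
        unfolding L_diff[OF fX(2)] by (rule ennreal_leI[OF le(2)[OF that]])
    qed (use p in \<open>auto intro!: \<mu>_meas fm um\<close>)
    ultimately show ?thesis by simp
  qed
  have mem: "u n - v \<in> X" if "\<And>m n. m \<ge> N \<Longrightarrow> n \<ge> N \<Longrightarrow> G.F (u m - u n) + L.F (u m - u n) < e" "n \<ge> N" for e n N
  proof -
    have "u n - v \<in> borel_measurable lebesgue" using um[of n] vm unfolding fun_diff_def by measurable
    then show ?thesis using bound[OF that] unfolding X_iff dif_diff by (auto simp: le_less_trans[OF _ ennreal_less_top])
  qed
  obtain N1 where N1: "\<And>m n. m \<ge> N1 \<Longrightarrow> n \<ge> N1 \<Longrightarrow> G.F (u m - u n) + L.F (u m - u n) < 1" using cauchy[of 1] by auto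
  have "u N1 - (u N1 - v) \<in> X" 
    by (rule subspace_diff[OF subspace_X u mem[OF N1 order_refl]])
  then have vX: "v \<in> X" by simp
  have "(\<lambda>n. G.F (u n - v) + L.F (u n - v)) \<longlonglongrightarrow> 0"
  proof (rule LIMSEQ_I)
    fix e :: real assume e: "e > 0"
    obtain N where N: "\<And>m n. m \<ge> N \<Longrightarrow> n \<ge> N \<Longrightarrow> G.F (u m - u n) + L.F (u m - u n) < e / 4" using cauchy[of "e / 4"] e by auto
    have "norm (G.F (u n - v) + L.F (u n - v) - 0) < e" if n: "n \<ge> N" for n
    proof -
      have X: "u n - v \<in> X" using mem[OF N n] .
      have "ennreal (G.F (u n - v)) \<le> ennreal (e / 4)" "ennreal (L.F (u n - v)) \<le> ennreal (e / 4)"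
        using bound[OF N n] unfolding G_diff[OF X] L_diff[OF X] by auto
      then have "G.F (u n - v) \<le> e / 4" "L.F (u n - v) \<le> e / 4" using e by auto
      moreover have "G.F (u n - v) \<ge> 0" "L.F (u n - v) \<ge> 0" using X G.F_nonneg L.F_nonneg by auto
      ultimately show ?thesis using e by simp
    qed
    then show "\<exists>N. \<forall>n\<ge>N. norm (G.F (u n - v) + L.F (u n - v) - 0) < e" by blast
  qed
  then show ?thesis using vX by blast
qed

end

subsection \<open>Compact embedding\<close>

lemma abs_powr_add3_le:
  fixes a b c p :: real
  assumes "0 < p"
  shows "\<bar>a + b + c\<bar> powr p \<le> 3 powr p * (\<bar>a\<bar> powr p + \<bar>b\<bar> powr p + \<bar>c\<bar> powr p)"
proof -
  define m where "m = max \<bar>a\<bar> (max \<bar>b\<bar> \<bar>c\<bar>)"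
  have "\<bar>a + b + c\<bar> powr p \<le> (3 * m) powr p" using assms unfolding m_def by (intro powr_mono2) auto
  also have "\<dots> = 3 powr p * m powr p" unfolding m_def by (simp add: powr_mult)
  also have "m powr p \<le> \<bar>a\<bar> powr p + \<bar>b\<bar> powr p + \<bar>c\<bar> powr p" unfolding m_def by (auto simp: max_def)
  finally show ?thesis by simp
qed

context neumann
begin

text \<open>On a cell \<open>S \<subseteq> \<Omega>\<close> inside a ball, \<open>u\<close> is compared with one of its values on the whole ball; this
  is where the part of the seminorm outside \<open>\<Omega> \<times> \<Omega>\<close> replaces an extension theorem.\<close>

lemma cell_approximation:
  fixes u :: "real^'n \<Rightarrow> real"
  assumes u: "u \<in> borel_measurable borel" and h: "h > 0"
    and S: "S \<in> sets borel" "S \<subseteq> \<Omega>" "S \<subseteq> ball c h" and d: "\<delta> > 0"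
    and fin: "(\<integral>\<^sup>+z. ker z * ennreal (\<bar>dif u z\<bar> powr p) * indicator (S \<times> ball c h) z \<partial>lborel) < \<infinity>"
  shows "\<exists>a. (\<integral>\<^sup>+x. ennreal (\<bar>u x - a\<bar> powr p) * indicator S x \<partial>lborel)
     \<le> ennreal ((2 * h) powr \<kappa> / (unit_ball_vol (real CARD('n)) * h ^ CARD('n))) *
        ((\<integral>\<^sup>+z. ker z * ennreal (\<bar>dif u z\<bar> powr p) * indicator (S \<times> ball c h) z \<partial>lborel) + ennreal \<delta>)"
proof (rule ccontr)
  define W where "W = (\<lambda>z. ker z * ennreal (\<bar>dif u z\<bar> powr p) * indicator (S \<times> ball c h) z)"
  define I where "I = enn2real (\<integral>\<^sup>+z. W z \<partial>lborel)"
  have I: "(\<integral>\<^sup>+z. W z \<partial>lborel) = ennreal I" unfolding I_def using fin unfolding W_def by simp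
  have I0: "I \<ge> 0" unfolding I_def by simp
  define V where "V = unit_ball_vol (real CARD('n)) * h ^ CARD('n)"
  have V: "V > 0" unfolding V_def using h by simp
  \<comment> \<open>Points of \<open>S\<close> and of the ball are at distance at most
    \<open>2 * h\<close>, so there the kernel is at least \<open>1 / (2 * h) powr \<kappa>\<close>;
    the division by \<open>V\<close> comes from averaging over the ball.\<close>
  define K where "K = (2 * h) powr \<kappa> / V"
  have K: "K > 0" unfolding K_def using V h by simp
  define g where "g = (\<lambda>y. \<integral>\<^sup>+x. ennreal (\<bar>u x - u y\<bar> powr p) * indicator S x \<partial>lborel)"
  \<comment> \<open>If every constant \<open>u y\<close> failed, integration over \<open>y\<close>
    in the ball would exceed the energy on \<open>S \<times> ball c h\<close>. The surplus
    \<open>\<delta>\<close> keeps the inequality strict when that energy is zero.\<close>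
  assume "\<not> ?thesis"
  then have "\<not> g y \<le> ennreal K * ((\<integral>\<^sup>+z. W z \<partial>lborel) + ennreal \<delta>)" for y
    unfolding g_def W_def K_def V_def by blast
  then have gy: "ennreal (K * (I + \<delta>)) \<le> g y" for y
    unfolding I using I0 d K by (simp add: ennreal_plus[symmetric] ennreal_mult[symmetric] less_imp_le not_le del: ennreal_plus)
  have vol: "emeasure lborel (ball c h) = ennreal V" unfolding V_def using h by (simp add: emeasure_ball)
  have [measurable]: "u \<in> borel_measurable borel" "S \<in> sets borel" by (fact u, fact S)
  have difb[measurable]: "dif u \<in> borel_measurable (borel :: ((real^'n) \<times> (real^'n)) measure)"
    unfolding dif_def borel_prod[symmetric] by measurable
  have [measurable]: "ker \<in> borel_measurable borel" by (rule ker_borel)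
  have [measurable]: "(S \<times> ball c h) \<in> sets borel" using S(1) by (auto intro!: borel_Times)
  have Wm: "W \<in> borel_measurable (lborel \<Otimes>\<^sub>M lborel)" unfolding W_def lborel_prod by measurable
  have pt: "ennreal (\<bar>u x - u y\<bar> powr p) * indicator S x * indicator (ball c h) y \<le> ennreal ((2 * h) powr \<kappa>) * W (x, y)" for x y
  proof (cases "x \<in> S \<and> y \<in> ball c h \<and> x \<noteq> y")
    case True
    then have "dist x y \<le> dist c x + dist c y" by (metis dist_commute dist_triangle)
    then have n: "norm (x - y) \<le> 2 * h" "norm (x - y) > 0" using True S(3) by (auto simp: dist_norm subset_iff)
    then have n2: "norm (x - y) powr \<kappa> \<le> (2 * h) powr \<kappa>" "norm (x - y) powr \<kappa> > 0" using \<kappa>_pos by (auto intro!: powr_mono2)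
    have "(x, y) \<in> Qset \<Omega>" using True S(2) by (auto simp: Qset_def)
    then have "ennreal ((2 * h) powr \<kappa>) * W (x, y) = ennreal ((2 * h) powr \<kappa> * (1 / norm (x - y) powr \<kappa> * \<bar>u x - u y\<bar> powr p))"
    proof -
      have "W (x, y) = ennreal (1 / norm (x - y) powr \<kappa>) * ennreal (\<bar>u x - u y\<bar> powr p)"
        unfolding W_def ker_def dif_def using True \<open>(x, y) \<in> Qset \<Omega>\<close> by simp
      moreover have "ennreal a * (ennreal b * ennreal c) = ennreal (a * (b * c))" if "0 \<le> a" "0 \<le> b" "0 \<le> c" for a b c :: real
        using that by (simp add: ennreal_mult)
      ultimately show ?thesis using \<open>0 < norm (x - y) powr \<kappa>\<close> by simp
    qed
    moreover have "\<bar>u x - u y\<bar> powr p \<le> (2 * h) powr \<kappa> * (1 / norm (x - y) powr \<kappa> * \<bar>u x - u y\<bar> powr p)"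
    proof -
      have "1 \<le> (2 * h) powr \<kappa> * (1 / norm (x - y) powr \<kappa>)" using n2 by (simp add: field_simps)
      then have "1 * \<bar>u x - u y\<bar> powr p \<le> (2 * h) powr \<kappa> * (1 / norm (x - y) powr \<kappa>) * \<bar>u x - u y\<bar> powr p" by (intro mult_right_mono) auto
      then show ?thesis by (simp add: ac_simps)
    qed
    ultimately show ?thesis using True by (simp add: ennreal_leI)
  next
    case False
    then show ?thesis by (auto simp: indicator_def)
  qed
  have "ennreal ((2 * h) powr \<kappa> * (I + \<delta>)) = ennreal (K * (I + \<delta>)) * emeasure lborel (ball c h)"
    unfolding vol K_def using V I0 d by (simp add: ennreal_mult[symmetric])
  also have "\<dots> = (\<integral>\<^sup>+y. ennreal (K * (I + \<delta>)) * indicator (ball c h) y \<partial>lborel)"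
    by (simp add: nn_integral_cmult_indicator)
  also have "\<dots> \<le> (\<integral>\<^sup>+y. g y * indicator (ball c h) y \<partial>lborel)"
    using gy by (intro nn_integral_mono mult_right_mono) auto
  also have "\<dots> = (\<integral>\<^sup>+y. (\<integral>\<^sup>+x. ennreal (\<bar>u x - u y\<bar> powr p) * indicator S x * indicator (ball c h) y \<partial>lborel) \<partial>lborel)"
    unfolding g_def by (intro nn_integral_cong nn_integral_multc[symmetric]) measurable
  also have "\<dots> \<le> (\<integral>\<^sup>+y. (\<integral>\<^sup>+x. ennreal ((2 * h) powr \<kappa>) * W (x, y) \<partial>lborel) \<partial>lborel)"
    using pt by (intro nn_integral_mono) auto
  also have "\<dots> = (\<integral>\<^sup>+z. ennreal ((2 * h) powr \<kappa>) * W z \<partial>(lborel \<Otimes>\<^sub>M lborel))"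
    using Wm by (intro lborel_pair.nn_integral_snd borel_measurable_times) auto
  also have "\<dots> = ennreal ((2 * h) powr \<kappa>) * (\<integral>\<^sup>+z. W z \<partial>lborel)"
    unfolding lborel_prod using Wm unfolding lborel_prod by (intro nn_integral_cmult) auto
  also have "\<dots> = ennreal ((2 * h) powr \<kappa> * I)" unfolding I using I0 by (simp add: ennreal_mult)
  finally have "(2 * h) powr \<kappa> * (I + \<delta>) \<le> (2 * h) powr \<kappa> * I" using I0 by (simp add: ennreal_le_iff)
  moreover have "(2 * h) powr \<kappa> > 0" using h by simp
  ultimately have "I + \<delta> \<le> I" by (simp only: mult_le_cancel_left_pos)
  then show False using d by simp
qed

text \<open>The partition depends only on \<open>e\<close> and \<open>B\<close>. The cells are
  disjoint, so their local energies add up to at most \<open>G\<close>, although the balls attached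
  to them overlap.\<close>

lemma step_approximation:
  assumes e: "e > 0" and B: "B \<ge> 0"
  obtains S m where "\<And>i. S i \<in> sets borel" "disjoint_family S" "(\<Union>i<(m::nat). S i) = \<Omega>"
    "\<And>u. u \<in> X \<Longrightarrow> G.F u \<le> B \<Longrightarrow>
       \<exists>a. (\<Sum>i<m. \<integral>\<^sup>+x. ennreal (\<bar>u x - a i\<bar> powr p) * indicator (S i) x \<partial>lborel) \<le> ennreal e"
proof -
  define \<omega> where "\<omega> = unit_ball_vol (real CARD('n))"
  have \<omega>: "\<omega> > 0" unfolding \<omega>_def by simp
  define Kf where "Kf = (\<lambda>h. (2 * h) powr \<kappa> / (\<omega> * h ^ CARD('n)))"
  \<comment> \<open>Solves \<open>Kf h * (B + 1) = e\<close>. Since \<open>\<kappa>\<close> exceeds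
    the dimension by \<open>p * s\<close>, the constant \<open>Kf h\<close> is a multiple of
    \<open>h powr (p * s)\<close>.\<close>
  define h where "h = (e * \<omega> / (2 powr \<kappa> * (B + 1))) powr (1 / (p * s))"
  have ps: "p * s > 0" using p s by simp
  have h: "h > 0" unfolding h_def using e \<omega> B by simp
  have Kh: "Kf h * (B + 1) = e"
  proof -
    have "Kf h = 2 powr \<kappa> * (h powr (real CARD('n)) * h powr (p * s)) / (\<omega> * h ^ CARD('n))"
      unfolding Kf_def \<kappa>_def using h by (simp add: powr_mult powr_add)
    also have "\<dots> = 2 powr \<kappa> / \<omega> * h powr (p * s)" using h \<omega> by (simp add: powr_realpow field_simps)
    also have "h powr (p * s) = e * \<omega> / (2 powr \<kappa> * (B + 1))"
      unfolding h_def using p s e \<omega> B by (simp add: powr_powr)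
    finally have *: "Kf h = 2 powr \<kappa> / \<omega> * (e * \<omega> / (2 powr \<kappa> * (B + 1)))" .
    have "c / \<omega> * (e * \<omega> / (c * b)) * b = e" if "c > 0" "b > 0" for c b :: real using that \<omega> by simp
    then show ?thesis unfolding * using B \<omega> by simp
  qed
  have "compact (closure \<Omega>)" using \<Omega>(3) by simp
  then obtain C where C: "finite C" "closure \<Omega> \<subseteq> (\<Union>x\<in>C. ball x h)"
    using compact_imp_seq_compact[THEN seq_compact_imp_totally_bounded] h by metis
  obtain xs where xs: "set xs = C" using finite_list[OF C(1)] by blast
  define m where "m = length xs"
  define b where "b = (\<lambda>i. if i < m then ball (xs ! i) h else {})"
  define S where "S = (\<lambda>i. \<Omega> \<inter> disjointed b i)"
  have Sb: "S i \<in> sets borel" for i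
  proof -
    have "b j \<in> sets borel" for j unfolding b_def by auto
    then have "disjointed b i \<in> sets borel" unfolding disjointed_def by (intro sets.Diff sets.finite_UN) auto
    then show ?thesis unfolding S_def by (intro sets.Int \<Omega>_meas)
  qed
  have Sd: "disjoint_family S"
    using disjoint_family_disjointed[of b] unfolding S_def disjoint_family_on_def by auto
  have Ssub: "S i \<subseteq> \<Omega>" "S i \<subseteq> b i" for i unfolding S_def using disjointed_subset[of b i] by auto
  have SU: "(\<Union>i<m. S i) = \<Omega>"
  proof
    show "\<Omega> \<subseteq> (\<Union>i<m. S i)"
    proof
      fix x assume x: "x \<in> \<Omega>"
      then have "x \<in> (\<Union>x\<in>C. ball x h)" using C(2) closure_subset by blast
      then obtain i where "i < m" "x \<in> ball (xs ! i) h" unfolding xs[symmetric] m_def by (auto simp: in_set_conv_nth)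
      then have "x \<in> (\<Union>i. b i)" unfolding b_def by auto
      then obtain j where j: "x \<in> disjointed b j" using UN_disjointed_eq[of b] by blast
      then have "x \<in> b j" using disjointed_subset[of b j] by (rule subsetD[rotated])
      then have "j < m" unfolding b_def by (auto split: if_splits)
      then show "x \<in> (\<Union>i<m. S i)" using x j unfolding S_def by auto
    qed
  qed (auto simp: S_def)
  show ?thesis
  proof (rule that[of S m])
    fix u assume u: "u \<in> X" and GB: "G.F u \<le> B"
    \<comment> \<open>A Borel representative, because the Fubini argument in
      \<open>cell_approximation\<close> works with Borel functions.\<close>
    obtain u' where u': "u' \<in> borel_measurable lborel" "AE x in lborel. u x = u' x"
      using completion_ex_borel_measurable_real[OF X_measurable[OF u]] by blast
    have u'b[measurable]: "u' \<in> borel_measurable borel" using u' by simp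
    have difb[measurable]: "dif u' \<in> borel_measurable (borel :: ((real^'n) \<times> (real^'n)) measure)"
      unfolding dif_def borel_prod[symmetric] by measurable
    have [measurable]: "ker \<in> borel_measurable borel" by (rule ker_borel)
    have Ta[measurable]: "(S i \<times> ball (xs ! i) h) \<in> sets borel" for i using Sb by (auto intro!: borel_Times)
    define W where "W = (\<lambda>i z. ker z * ennreal (\<bar>dif u' z\<bar> powr p) * indicator (S i \<times> ball (xs ! i) h) z)"
    define I where "I = (\<lambda>i. \<integral>\<^sup>+z. W i z \<partial>lborel)"
    have Wm: "W i \<in> borel_measurable lborel" for i unfolding W_def by measurable
    have "gagp p s \<Omega> u = (\<integral>\<^sup>+z. ker z * ennreal (\<bar>dif u' z\<bar> powr p) \<partial>lborel)"
      unfolding gagp_lborel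
    proof (rule nn_integral_cong_AE)
      show "AE z in lborel. ker z * ennreal (\<bar>dif u z\<bar> powr p) = ker z * ennreal (\<bar>dif u' z\<bar> powr p)"
        using AE_lborel_fst[OF u'(2), where 'b = "real^'n"] AE_lborel_snd[OF u'(2), where 'b = "real^'n"]
        by eventually_elim (simp add: dif_def)
    qed
    moreover have "gagp p s \<Omega> u = ennreal (G.F u)" using G.F_ennreal[OF u] gagp_eq[OF X_measurable[OF u]] by simp
    ultimately have tot: "(\<integral>\<^sup>+z. ker z * ennreal (\<bar>dif u' z\<bar> powr p) \<partial>lborel) \<le> ennreal B"
      using ennreal_leI[OF GB] by (simp only:)
    have sumI: "(\<Sum>i<m. I i) \<le> ennreal B"
    proof -
      have "(\<Sum>i<m. I i) = (\<integral>\<^sup>+z. (\<Sum>i<m. W i z) \<partial>lborel)" unfolding I_def using Wm by (intro nn_integral_sum[symmetric]) auto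
      also have "\<dots> \<le> (\<integral>\<^sup>+z. ker z * ennreal (\<bar>dif u' z\<bar> powr p) \<partial>lborel)"
      proof (rule nn_integral_mono)
        fix z :: "(real^'n) \<times> (real^'n)"
        have "(\<Sum>i<m. indicator (S i \<times> ball (xs ! i) h) z) \<le> (1 :: ennreal)"
        proof -
          have "(\<Sum>i<m. indicator (S i \<times> ball (xs ! i) h) z) \<le> (\<Sum>i<m. indicator (S i) (fst z) :: ennreal)"
            by (intro sum_mono) (auto simp: indicator_def)
          also have "\<dots> = indicator (\<Union>i<m. S i) (fst z)"
            using Sd by (intro indicator_UN_disjoint[symmetric]) (auto simp: disjoint_family_on_def)
          also have "\<dots> \<le> 1" by (simp add: indicator_def)
          finally show ?thesis .
        qed
        then have "ker z * ennreal (\<bar>dif u' z\<bar> powr p) * (\<Sum>i<m. indicator (S i \<times> ball (xs ! i) h) z) \<le> ker z * ennreal (\<bar>dif u' z\<bar> powr p) * 1"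
          by (intro mult_left_mono) auto
        then show "(\<Sum>i<m. W i z) \<le> ker z * ennreal (\<bar>dif u' z\<bar> powr p)" unfolding W_def by (simp add: sum_distrib_left)
      qed
      finally show ?thesis using tot by simp
    qed
    \<comment> \<open>The surpluses of the \<open>m\<close> cells add up to at most 1; this is the 1
      in \<open>B + 1\<close>.\<close>
    define \<delta> where "\<delta> = 1 / (real m + 1)"
    have \<delta>: "\<delta> > 0" "real m * \<delta> \<le> 1" unfolding \<delta>_def by (auto simp: field_simps)
    have "\<exists>a. (\<integral>\<^sup>+x. ennreal (\<bar>u x - a\<bar> powr p) * indicator (S i) x \<partial>lborel) \<le> ennreal (Kf h) * (I i + ennreal \<delta>)" if i: "i < m" for i
    proof -
      have "I i \<le> (\<Sum>i<m. I i)" using i by (intro member_le_sum) auto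
      then have "I i \<le> ennreal B" using sumI by (rule order_trans)
      then have "I i < \<infinity>" by (simp add: le_less_trans[OF _ ennreal_less_top])
      then obtain a where "(\<integral>\<^sup>+x. ennreal (\<bar>u' x - a\<bar> powr p) * indicator (S i) x \<partial>lborel) \<le> ennreal (Kf h) * (I i + ennreal \<delta>)"
        using cell_approximation[OF u'b h Sb[of i] Ssub(1), of "xs ! i" \<delta>] Ssub(2)[of i] i \<delta>
        unfolding Kf_def \<omega>_def I_def W_def b_def by auto
      moreover have "(\<integral>\<^sup>+x. ennreal (\<bar>u x - a\<bar> powr p) * indicator (S i) x \<partial>lborel) = (\<integral>\<^sup>+x. ennreal (\<bar>u' x - a\<bar> powr p) * indicator (S i) x \<partial>lborel)"
      proof (rule nn_integral_cong_AE)
        show "AE x in lborel. ennreal (\<bar>u x - a\<bar> powr p) * indicator (S i) x = ennreal (\<bar>u' x - a\<bar> powr p) * indicator (S i) x"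
          using u'(2) by eventually_elim simp
      qed
      ultimately show ?thesis by (intro exI[of _ a]) (simp only:)
    qed
    then have "\<forall>i. \<exists>a. i < m \<longrightarrow> (\<integral>\<^sup>+x. ennreal (\<bar>u x - a\<bar> powr p) * indicator (S i) x \<partial>lborel) \<le> ennreal (Kf h) * (I i + ennreal \<delta>)"
      by blast
    from choice[OF this] obtain a where a: "\<forall>i. i < m \<longrightarrow> (\<integral>\<^sup>+x. ennreal (\<bar>u x - a i\<bar> powr p) * indicator (S i) x \<partial>lborel) \<le> ennreal (Kf h) * (I i + ennreal \<delta>)" ..
    have K0: "Kf h > 0" unfolding Kf_def using h \<omega> by simp
    have "(\<Sum>i<m. \<integral>\<^sup>+x. ennreal (\<bar>u x - a i\<bar> powr p) * indicator (S i) x \<partial>lborel) \<le> (\<Sum>i<m. ennreal (Kf h) * (I i + ennreal \<delta>))"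
      using a by (intro sum_mono) auto
    also have "\<dots> = ennreal (Kf h) * ((\<Sum>i<m. I i) + of_nat m * ennreal \<delta>)"
      by (simp add: sum_distrib_left[symmetric] sum.distrib)
    also have "\<dots> \<le> ennreal (Kf h) * (ennreal B + ennreal 1)"
    proof (intro mult_left_mono add_mono sumI)
      have "of_nat m * ennreal \<delta> = ennreal (real m * \<delta>)" using \<delta> by (simp add: ennreal_mult ennreal_of_nat_eq_real_of_nat)
      then show "of_nat m * ennreal \<delta> \<le> ennreal 1" using \<delta> by (simp add: ennreal_leI)
    qed auto
    also have "\<dots> = ennreal (Kf h * (B + 1))" using B K0 ennreal_plus[of B 1] by (simp only: ennreal_mult[of "Kf h" "B + 1"])
    finally show "\<exists>a. (\<Sum>i<m. \<integral>\<^sup>+x. ennreal (\<bar>u x - a i\<bar> powr p) * indicator (S i) x \<partial>lborel) \<le> ennreal e" unfolding Kh by blast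
  qed (use Sb Sd SU in auto)
qed

lemma L_lborel: "u \<in> X \<Longrightarrow> ennreal (L.F u) = (\<integral>\<^sup>+x. ennreal (\<bar>u x\<bar> powr p) * indicator \<Omega> x \<partial>lborel)"
  unfolding L.F_ennreal Lpp_eq[OF X_measurable, symmetric] Lpp_def nn_integral_completion ..

text \<open>Total boundedness in \<open>L\<close>: each function is replaced by its step
  approximation and labelled by the rounded values on the cells. The values are bounded, so the
  labels are finitely many, and equal labels force the functions to be close.\<close>

lemma finite_classification:
  assumes u: "\<And>n::nat. u n \<in> X" and B: "\<And>n. G.F (u n) + L.F (u n) \<le> B" and e: "e > 0"
  obtains f :: "nat \<Rightarrow> nat \<Rightarrow> int" where "finite (range f)" "\<And>m n. f m = f n \<Longrightarrow> L.F (u m - u n) < e"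
proof -
  have nn: "G.F (u n) \<ge> 0" "L.F (u n) \<ge> 0" for n using u G.F_nonneg L.F_nonneg by auto
  have B0: "B \<ge> 0" using B[of 0] nn[of 0] by linarith
  \<comment> \<open>The final bound is \<open>3 powr p\<close> times two step errors
    \<open>e1\<close> and one rounding error. The two step errors make up \<open>e / 4\<close>, and
    \<open>\<tau>\<close> below is chosen so that rounding costs at most another
    \<open>e / 4\<close>.\<close>
  define e1 where "e1 = e / (8 * 3 powr p)"
  have e1: "e1 > 0" unfolding e1_def using e by simp
  obtain S m where S: "\<And>i. S i \<in> sets borel" "disjoint_family S" "(\<Union>i<(m::nat). S i) = \<Omega>"
    and ap: "\<And>u. u \<in> X \<Longrightarrow> G.F u \<le> B \<Longrightarrow>
       \<exists>a. (\<Sum>i<m. \<integral>\<^sup>+x. ennreal (\<bar>u x - a i\<bar> powr p) * indicator (S i) x \<partial>lborel) \<le> ennreal e1"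
    by (rule step_approximation[OF e1 B0], rule that)
  have GB: "G.F (u n) \<le> B" "L.F (u n) \<le> B" for n using B[of n] nn[of n] by auto
  obtain a where a: "\<And>n. (\<Sum>i<m. \<integral>\<^sup>+x. ennreal (\<bar>u n x - a n i\<bar> powr p) * indicator (S i) x \<partial>lborel) \<le> ennreal e1"
  proof -
    have "\<forall>n. \<exists>a. (\<Sum>i<m. \<integral>\<^sup>+x. ennreal (\<bar>u n x - a i\<bar> powr p) * indicator (S i) x \<partial>lborel) \<le> ennreal e1"
      by (intro allI ap[OF u GB(1)])
    from choice[OF this] obtain a' where "\<forall>n. (\<Sum>i<m. \<integral>\<^sup>+x. ennreal (\<bar>u n x - a' n i\<bar> powr p) * indicator (S i) x \<partial>lborel) \<le> ennreal e1" ..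
    then show ?thesis by (intro that[of a']) (rule spec)
  qed
  have Sm[measurable]: "S i \<in> sets borel" "S i \<in> sets lborel" for i using S(1) by auto
  have sub: "S i \<subseteq> \<Omega>" if "i < m" for i using S(3) that by auto
  have fin\<Omega>: "emeasure lborel \<Omega> < \<infinity>" using \<Omega>(3) emeasure_bounded_finite by blast
  define w where "w = measure lborel \<Omega>"
  have w: "emeasure lborel \<Omega> = ennreal w" "w \<ge> 0" unfolding w_def using fin\<Omega> by (auto simp: emeasure_eq_ennreal_measure)
  define ws where "ws = (\<lambda>i. measure lborel (S i))"
  have ws: "emeasure lborel (S i) = ennreal (ws i)" if "i < m" for i
  proof -
    have "emeasure lborel (S i) \<le> emeasure lborel \<Omega>" using sub[OF that] by (intro emeasure_mono) auto
    then have "emeasure lborel (S i) < \<infinity>" using fin\<Omega> by (rule le_less_trans)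
    then show ?thesis unfolding ws_def by (intro emeasure_eq_ennreal_measure) auto
  qed
  have ws0: "ws i \<ge> 0" for i unfolding ws_def by simp
  have um: "(\<lambda>x. ennreal (\<bar>u n x - c\<bar> powr p) * indicator (S i) x) \<in> borel_measurable lebesgue"
    "(\<lambda>x. ennreal (\<bar>u n x\<bar> powr p) * indicator (S i) x) \<in> borel_measurable lebesgue"
    "(\<lambda>x. ennreal (\<bar>u n x - u k x\<bar> powr p) * indicator (S i) x) \<in> borel_measurable lebesgue" for n k i c
  proof -
    have [measurable]: "u n \<in> borel_measurable lebesgue" "u k \<in> borel_measurable lebesgue" "S i \<in> sets lebesgue"
      using X_measurable[OF u] Sm(2) by (auto intro: sets_completionI_sets)
    show "(\<lambda>x. ennreal (\<bar>u n x - c\<bar> powr p) * indicator (S i) x) \<in> borel_measurable lebesgue" by measurable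
    show "(\<lambda>x. ennreal (\<bar>u n x\<bar> powr p) * indicator (S i) x) \<in> borel_measurable lebesgue" by measurable
    show "(\<lambda>x. ennreal (\<bar>u n x - u k x\<bar> powr p) * indicator (S i) x) \<in> borel_measurable lebesgue" by measurable
  qed
  have ale: "(\<integral>\<^sup>+x. ennreal (\<bar>u n x - a n i\<bar> powr p) * indicator (S i) x \<partial>lborel) \<le> ennreal e1" if "i < m" for n i
    using a[of n] member_le_sum[of i "{..<m}" "\<lambda>i. \<integral>\<^sup>+x. ennreal (\<bar>u n x - a n i\<bar> powr p) * indicator (S i) x \<partial>lborel"] that by auto
  have abd: "\<bar>a n i\<bar> powr p * ws i \<le> 2 powr p * (e1 + B)" if i: "i < m" for n i
  proof -
    have "ennreal (\<bar>a n i\<bar> powr p * ws i) = (\<integral>\<^sup>+x. ennreal (\<bar>a n i\<bar> powr p) * indicator (S i) x \<partial>lebesgue)"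
      using ws[OF i] ws0 Sm by (simp add: nn_integral_cmult_indicator ennreal_mult)
    also have "\<dots> \<le> (\<integral>\<^sup>+x. ennreal (2 powr p) * (ennreal (\<bar>u n x - a n i\<bar> powr p) * indicator (S i) x
         + ennreal (\<bar>u n x\<bar> powr p) * indicator (S i) x) \<partial>lebesgue)"
    proof (rule nn_integral_mono)
      fix x
      have "\<bar>a n i\<bar> powr p \<le> 2 powr p * (\<bar>u n x - a n i\<bar> powr p + \<bar>u n x\<bar> powr p)"
        using abs_powr_add_le[of p "- (u n x - a n i)" "u n x"] p by (simp add: abs_minus_commute)
      then have "ennreal (\<bar>a n i\<bar> powr p) \<le> ennreal (2 powr p) * (ennreal (\<bar>u n x - a n i\<bar> powr p) + ennreal (\<bar>u n x\<bar> powr p))"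
        by (simp add: ennreal_mult[symmetric] ennreal_plus[symmetric] ennreal_leI del: ennreal_plus)
      then show "ennreal (\<bar>a n i\<bar> powr p) * indicator (S i) x \<le> ennreal (2 powr p) * (ennreal (\<bar>u n x - a n i\<bar> powr p) * indicator (S i) x
         + ennreal (\<bar>u n x\<bar> powr p) * indicator (S i) x)" by (cases "x \<in> S i") auto
    qed
    also have "\<dots> = ennreal (2 powr p) * ((\<integral>\<^sup>+x. ennreal (\<bar>u n x - a n i\<bar> powr p) * indicator (S i) x \<partial>lebesgue)
         + (\<integral>\<^sup>+x. ennreal (\<bar>u n x\<bar> powr p) * indicator (S i) x \<partial>lebesgue))"
      using um by (subst nn_integral_cmult) (auto simp: nn_integral_add)
    also have "\<dots> \<le> ennreal (2 powr p) * (ennreal e1 + ennreal B)"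
    proof (intro mult_left_mono add_mono)
      show "(\<integral>\<^sup>+x. ennreal (\<bar>u n x - a n i\<bar> powr p) * indicator (S i) x \<partial>lebesgue) \<le> ennreal e1"
        unfolding nn_integral_completion by (rule ale[OF i])
      have "(\<integral>\<^sup>+x. ennreal (\<bar>u n x\<bar> powr p) * indicator (S i) x \<partial>lebesgue) \<le> (\<integral>\<^sup>+x. ennreal (\<bar>u n x\<bar> powr p) * indicator \<Omega> x \<partial>lborel)"
        unfolding nn_integral_completion using sub[OF i] by (intro nn_integral_mono mult_left_mono) (auto simp: indicator_def)
      also have "\<dots> = ennreal (L.F (u n))" using L_lborel[OF u] by simp
      also have "\<dots> \<le> ennreal B" by (rule ennreal_leI[OF GB(2)])
      finally show "(\<integral>\<^sup>+x. ennreal (\<bar>u n x\<bar> powr p) * indicator (S i) x \<partial>lebesgue) \<le> ennreal B" .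
    qed auto
    also have "\<dots> = ennreal (2 powr p * (e1 + B))" using e1 B0 by (simp add: ennreal_mult ennreal_plus[symmetric] del: ennreal_plus)
    finally show ?thesis using e1 B0 by (simp add: ennreal_le_iff)
  qed
  define \<tau> where "\<tau> = (e / (4 * 3 powr p * (w + 1))) powr (1 / p)"
  have \<tau>: "\<tau> > 0" "\<tau> powr p = e / (4 * 3 powr p * (w + 1))" unfolding \<tau>_def using e w p by (auto simp: powr_powr)
  \<comment> \<open>On a cell of measure zero the approximating value is not controlled, but such a
    cell contributes nothing; it gets the label 0.\<close>
  define R where "R = {i. i < m \<and> ws i > 0}"
  have Rf: "finite R" unfolding R_def by auto
  define A where "A = (\<Sum>i\<in>R. (2 powr p * (e1 + B) / ws i) powr (1 / p))"
  have aA: "\<bar>a n i\<bar> \<le> A" if i: "i \<in> R" for n i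
  proof -
    have "\<bar>a n i\<bar> powr p \<le> 2 powr p * (e1 + B) / ws i" using abd[of i n] i unfolding R_def by (simp add: field_simps)
    then have "(\<bar>a n i\<bar> powr p) powr (1 / p) \<le> (2 powr p * (e1 + B) / ws i) powr (1 / p)" using p by (intro powr_mono2) auto
    then have "\<bar>a n i\<bar> \<le> (2 powr p * (e1 + B) / ws i) powr (1 / p)" using p by (simp add: powr_powr)
    also have "\<dots> \<le> A" unfolding A_def using i Rf by (intro member_le_sum) auto
    finally show ?thesis .
  qed
  define f where "f = (\<lambda>n i. if i \<in> R then \<lfloor>a n i / \<tau>\<rfloor> else 0)"
  have "range f \<subseteq> {f. \<forall>x. (x \<in> R \<longrightarrow> f x \<in> {\<lfloor>- A / \<tau>\<rfloor>..\<lfloor>A / \<tau>\<rfloor>}) \<and> (x \<notin> R \<longrightarrow> f x = 0)}"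
    using aA \<tau>(1) unfolding f_def by (auto intro!: floor_mono divide_right_mono simp: abs_le_iff) (metis floor_mono divide_right_mono less_imp_le minus_divide_left minus_le_iff)
  then have ff: "finite (range f)" by (rule finite_subset) (intro finite_set_of_finite_funs Rf, auto)
  have "L.F (u j - u k) < e" if eq: "f j = f k" for j k
  proof -
    have close: "\<bar>a j i - a k i\<bar> \<le> \<tau>" if i: "i \<in> R" for i
    proof -
      have "\<lfloor>a j i / \<tau>\<rfloor> = \<lfloor>a k i / \<tau>\<rfloor>" using fun_cong[OF eq, of i] i unfolding f_def by simp
      then have "\<bar>a j i / \<tau> - a k i / \<tau>\<bar> < 1" by linarith
      then have "\<bar>(a j i - a k i) / \<tau>\<bar> < 1" by (simp add: diff_divide_distrib)
      then show ?thesis using \<tau>(1) by (simp add: field_simps)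
    qed
    have mid: "(\<integral>\<^sup>+x. ennreal (\<bar>a j i - a k i\<bar> powr p) * indicator (S i) x \<partial>lborel) \<le> ennreal (\<tau> powr p) * emeasure lborel (S i)" if i: "i < m" for i
    proof (cases "i \<in> R")
      case True
      have "\<bar>a j i - a k i\<bar> powr p \<le> \<tau> powr p" using close[OF True] p by (intro powr_mono2) auto
      then show ?thesis by (simp add: nn_integral_cmult_indicator ennreal_leI mult_right_mono)
    next
      case False
      then have "emeasure lborel (S i) = 0" using ws[OF i] ws0[of i] i unfolding R_def by auto
      then show ?thesis by (simp add: nn_integral_cmult_indicator)
    qed
    define P where "P = (\<lambda>n i. \<integral>\<^sup>+x. ennreal (\<bar>u n x - a n i\<bar> powr p) * indicator (S i) x \<partial>lborel)"
    have cell: "(\<integral>\<^sup>+x. ennreal (\<bar>u j x - u k x\<bar> powr p) * indicator (S i) x \<partial>lebesgue)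
        \<le> ennreal (3 powr p) * (P j i + ennreal (\<tau> powr p) * emeasure lborel (S i) + P k i)" if i: "i < m" for i
    proof -
      have "(\<integral>\<^sup>+x. ennreal (\<bar>u j x - u k x\<bar> powr p) * indicator (S i) x \<partial>lebesgue)
        \<le> (\<integral>\<^sup>+x. ennreal (3 powr p) * (ennreal (\<bar>u j x - a j i\<bar> powr p) * indicator (S i) x
           + ennreal (\<bar>a j i - a k i\<bar> powr p) * indicator (S i) x + ennreal (\<bar>u k x - a k i\<bar> powr p) * indicator (S i) x) \<partial>lebesgue)"
      proof (rule nn_integral_mono)
        fix x
        have "\<bar>u j x - u k x\<bar> powr p \<le> 3 powr p * (\<bar>u j x - a j i\<bar> powr p + \<bar>a j i - a k i\<bar> powr p + \<bar>u k x - a k i\<bar> powr p)"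
          using abs_powr_add3_le[of p "u j x - a j i" "a j i - a k i" "- (u k x - a k i)"] p by (simp add: abs_minus_commute)
        then have "ennreal (\<bar>u j x - u k x\<bar> powr p) \<le> ennreal (3 powr p) * (ennreal (\<bar>u j x - a j i\<bar> powr p) + ennreal (\<bar>a j i - a k i\<bar> powr p) + ennreal (\<bar>u k x - a k i\<bar> powr p))"
          by (simp add: ennreal_mult[symmetric] ennreal_plus[symmetric] ennreal_leI del: ennreal_plus)
        then show "ennreal (\<bar>u j x - u k x\<bar> powr p) * indicator (S i) x \<le> ennreal (3 powr p) * (ennreal (\<bar>u j x - a j i\<bar> powr p) * indicator (S i) x
           + ennreal (\<bar>a j i - a k i\<bar> powr p) * indicator (S i) x + ennreal (\<bar>u k x - a k i\<bar> powr p) * indicator (S i) x)" by (cases "x \<in> S i") auto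
      qed
      also have "\<dots> = ennreal (3 powr p) * (P j i + (\<integral>\<^sup>+x. ennreal (\<bar>a j i - a k i\<bar> powr p) * indicator (S i) x \<partial>lborel) + P k i)"
      proof -
        have cm: "(\<lambda>x. ennreal (\<bar>a j i - a k i\<bar> powr p) * indicator (S i) x) \<in> borel_measurable lebesgue" 
        proof -
          have [measurable]: "S i \<in> sets lebesgue" using Sm(2) by (auto intro: sets_completionI_sets)
          show ?thesis by measurable
        qed
        have "(\<integral>\<^sup>+x. c * (f1 x + f2 x + f3 x) \<partial>lebesgue)
            = c * ((\<integral>\<^sup>+x. f1 x \<partial>lborel) + (\<integral>\<^sup>+x. f2 x \<partial>lborel) + (\<integral>\<^sup>+x. f3 x \<partial>lborel))"
          if [measurable]: "f1 \<in> borel_measurable lebesgue" "f2 \<in> borel_measurable lebesgue" "f3 \<in> borel_measurable lebesgue"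
          for f1 f2 f3 :: "real^'n \<Rightarrow> ennreal" and c
        proof -
          have "(\<integral>\<^sup>+x. c * (f1 x + f2 x + f3 x) \<partial>lebesgue)
              = c * ((\<integral>\<^sup>+x. f1 x \<partial>lebesgue) + (\<integral>\<^sup>+x. f2 x \<partial>lebesgue) + (\<integral>\<^sup>+x. f3 x \<partial>lebesgue))"
            by (simp add: nn_integral_cmult nn_integral_add)
          then show ?thesis by (simp only: nn_integral_completion)
        qed
        from this[OF um(1) cm um(1)] show ?thesis unfolding P_def .
      qed
      also have "\<dots> \<le> ennreal (3 powr p) * (P j i + ennreal (\<tau> powr p) * emeasure lborel (S i) + P k i)"
        using mid[OF i] by (intro mult_left_mono add_mono) auto
      finally show ?thesis .
    qed
    have ind: "indicator \<Omega> x = (\<Sum>i<m. indicator (S i) x :: ennreal)" for x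
      unfolding S(3)[symmetric] using S(2) by (intro indicator_UN_disjoint) (auto simp: disjoint_family_on_def)
    have X: "u j - u k \<in> X" using u by auto
    have "ennreal (L.F (u j - u k)) = (\<integral>\<^sup>+x. (\<Sum>i<m. ennreal (\<bar>u j x - u k x\<bar> powr p) * indicator (S i) x) \<partial>lebesgue)"
      unfolding L_lborel[OF X] nn_integral_completion ind by (simp add: sum_distrib_left)
    also have "\<dots> = (\<Sum>i<m. \<integral>\<^sup>+x. ennreal (\<bar>u j x - u k x\<bar> powr p) * indicator (S i) x \<partial>lebesgue)"
      using um(3) by (intro nn_integral_sum) auto
    also have "\<dots> \<le> (\<Sum>i<m. ennreal (3 powr p) * (P j i + ennreal (\<tau> powr p) * emeasure lborel (S i) + P k i))"
      using cell by (intro sum_mono) auto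
    also have "\<dots> = ennreal (3 powr p) * ((\<Sum>i<m. P j i) + ennreal (\<tau> powr p) * (\<Sum>i<m. emeasure lborel (S i)) + (\<Sum>i<m. P k i))"
      by (simp add: sum_distrib_left[symmetric] sum.distrib)
    also have "(\<Sum>i<m. emeasure lborel (S i)) = emeasure lborel (\<Union>i<m. S i)"
      using S(2) by (intro sum_emeasure) (auto simp: disjoint_family_on_def)
    also have "\<dots> = ennreal w" unfolding S(3) by (rule w(1))
    also have "ennreal (3 powr p) * ((\<Sum>i<m. P j i) + ennreal (\<tau> powr p) * ennreal w + (\<Sum>i<m. P k i))
       \<le> ennreal (3 powr p) * (ennreal e1 + ennreal (\<tau> powr p) * ennreal w + ennreal e1)"
      using a unfolding P_def by (intro mult_left_mono add_mono) auto
    also have "\<dots> = ennreal (3 powr p * (e1 + \<tau> powr p * w + e1))"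
      using e1 w by (simp add: ennreal_mult[symmetric] ennreal_plus[symmetric] del: ennreal_plus)
    finally have "L.F (u j - u k) \<le> 3 powr p * (e1 + \<tau> powr p * w + e1)" using e1 w by (simp add: ennreal_le_iff fun_diff_def)
    also have "\<dots> = e / 4 + (e / 4) * (w / (w + 1))" 
    proof -
      have "t * (e / (8 * t) + e / (4 * t * v) * w + e / (8 * t)) = e / 4 + e / 4 * (w / v)" if "t > 0" "v > 0" for t v :: real
        using that by (simp add: field_simps)
      from this[of "3 powr p" "w + 1"] show ?thesis unfolding \<tau>(2) e1_def using w by simp
    qed
    also have "\<dots> \<le> e / 4 + (e / 4) * 1" using e w by (intro add_mono mult_left_mono) auto
    also have "\<dots> < e" using e by simp
    finally show ?thesis .
  qed
  then show ?thesis using that ff by blast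
qed

text \<open>At each precision the pigeonhole principle yields a subsequence with one common label. A
  diagonal subsequence, from some index on, satisfies all of these requirements.\<close>

lemma X_compact_embedding:
  assumes u: "\<And>n::nat. u n \<in> X" and B: "\<And>n. G.F (u n) + L.F (u n) \<le> B"
  shows "\<exists>r. strict_mono (r :: nat \<Rightarrow> nat) \<and> (\<forall>e>0. \<exists>n0. \<forall>m\<ge>n0. \<forall>n\<ge>n0. L.F (u (r m) - u (r n)) < e)"
proof -
  define P where "P = (\<lambda>n (r :: nat \<Rightarrow> nat). \<forall>i j. L.F (u (r i) - u (r j)) < inverse (real (Suc n)))"
  interpret subseqs P
  proof
    fix n and r :: "nat \<Rightarrow> nat" assume r: "strict_mono r"
    obtain f :: "nat \<Rightarrow> nat \<Rightarrow> int" where f: "finite (range f)" "\<And>i j. f i = f j \<Longrightarrow> L.F (u i - u j) < inverse (real (Suc n))"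
      by (rule finite_classification[of u B "inverse (real (Suc n))"]) (use u B in auto)
    have "finite (range (\<lambda>i. f (r i)))" by (rule finite_subset[OF _ f(1)]) auto
    then obtain v where v: "infinite {i \<in> UNIV. f (r i) = v}"
      using pigeonhole_infinite[of "UNIV :: nat set" "\<lambda>i. f (r i)"] by auto
    then obtain r' :: "nat \<Rightarrow> nat" where r': "strict_mono r'" "\<And>i. f (r (r' i)) = v"
      using infinite_enumerate[OF v] by auto
    then show "\<exists>r'. strict_mono r' \<and> P n (r \<circ> r')" unfolding P_def using f(2) by (intro exI[of _ r']) auto
  qed
  have hold: "P k (diagseq \<circ> ((+) (Suc k)))" for k by (rule diagseq_holds) (auto simp: P_def)
  show ?thesis
  proof (intro exI[of _ diagseq] conjI subseq_diagseq allI impI)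
    fix e :: real assume "e > 0"
    then obtain k where k: "inverse (real (Suc k)) < e" using reals_Archimedean by blast
    have "L.F (u (diagseq m) - u (diagseq n)) < e" if "m \<ge> Suc k" "n \<ge> Suc k" for m n
    proof -
      have mn: "Suc k + (m - Suc k) = m" "Suc k + (n - Suc k) = n" using that by auto
      have "L.F (u ((diagseq \<circ> (+) (Suc k)) (m - Suc k)) - u ((diagseq \<circ> (+) (Suc k)) (n - Suc k))) < inverse (real (Suc k))"
        using hold[of k] unfolding P_def by blast
      then have "L.F (u (diagseq m) - u (diagseq n)) < inverse (real (Suc k))" unfolding comp_def mn .
      then show ?thesis using k by linarith
    qed
    then show "\<exists>n0. \<forall>m\<ge>n0. \<forall>n\<ge>n0. L.F (u (diagseq m) - u (diagseq n)) < e" by blast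
  qed
qed

sublocale rayleigh X G.F L.F p
  by unfold_locales (fact G.F_uniformly_convex L.F_uniformly_convex X_complete X_compact_embedding)+

end

subsection \<open>The index of the cones\<close>

lemma finite_enat_eqI: "enat m \<le> x \<Longrightarrow> \<not> enat (Suc m) \<le> x \<Longrightarrow> x = enat m"
  by (cases x) auto

context neumann
begin

abbreviation "Xs \<equiv> Xsp p s \<Omega>"
abbreviation "cls \<equiv> Xcls p s \<Omega>"
abbreviation "dX \<equiv> Xdist p s \<Omega>"

text \<open>\<open>L\<close> sees only \<open>\<Omega>\<close> and \<open>G\<close> only
  differences, so vanishing outside \<open>\<Omega>\<close> has to be deduced through
  \<open>X_ae_limit\<close>. This makes the distance on classes definite.\<close>

lemma N_zero_iff:
  assumes w: "w \<in> X"
  shows "N w = 0 \<longleftrightarrow> (AE x in lebesgue. w x = 0)"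
proof
  assume "AE x in lebesgue. w x = 0"
  then have ae: "AE x in lborel. w x = 0" unfolding AE_lebesgue_iff .
  have "(\<integral>\<^sup>+x. ennreal (\<bar>w x\<bar> powr p) \<partial>\<mu>L) = (\<integral>\<^sup>+x. 0 \<partial>\<mu>L)"
  proof (rule nn_integral_cong_AE)
    show "AE x in \<mu>L. ennreal (\<bar>w x\<bar> powr p) = 0" using AE_\<mu>L_I[OF ae] by eventually_elim simp
  qed
  moreover have "(\<integral>\<^sup>+z. ennreal (\<bar>dif w z\<bar> powr p) \<partial>\<mu>G) = (\<integral>\<^sup>+z. 0 \<partial>\<mu>G)"
  proof (rule nn_integral_cong_AE)
    show "AE z in \<mu>G. ennreal (\<bar>dif w z\<bar> powr p) = 0"
      using AE_\<mu>G_I[OF AE_lborel_fst[OF ae]] AE_\<mu>G_I[OF AE_lborel_snd[OF ae]] by eventually_elim (simp add: dif_def)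
  qed
  ultimately show "N w = 0" unfolding G.F_def L.F_def by simp
next
  assume "N w = 0"
  then have "G.F w = 0" "L.F w = 0" using G.F_nonneg[OF w] L.F_nonneg[OF w] by (auto simp: add_nonneg_eq_0_iff)
  then have "(\<integral>\<^sup>+z. ennreal (\<bar>dif w z\<bar> powr p) \<partial>\<mu>G) = 0" "(\<integral>\<^sup>+x. ennreal (\<bar>w x\<bar> powr p) \<partial>\<mu>L) = 0"
    using G.F_ennreal[OF w] L.F_ennreal[OF w] by auto
  then have aG: "AE z in \<mu>G. ennreal (\<bar>dif w z\<bar> powr p) = 0" and aL: "AE x in \<mu>L. ennreal (\<bar>w x\<bar> powr p) = 0"
    using \<mu>_meas[OF X_measurable[OF w]] by (auto simp: nn_integral_0_iff_AE powr_meas)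
  \<comment> \<open>\<open>w x = 0\<close> exactly where the sequence \<open>k * w x\<close> converges.\<close>
  have "AE x in lborel. convergent (\<lambda>k. real k * w x)"
  proof (rule X_ae_limit)
    show "(\<lambda>x. real k * w x) \<in> borel_measurable lebesgue" for k using X_measurable[OF w] by measurable
    show "AE z in \<mu>G. convergent (\<lambda>k. dif (\<lambda>x. real k * w x) z)"
      using aG
    proof eventually_elim
      fix z assume "ennreal (\<bar>dif w z\<bar> powr p) = 0"
      then have "dif w z = 0" by auto
      then have "dif (\<lambda>x. real k * w x) z = 0" for k unfolding dif_def by simp
      then show "convergent (\<lambda>k. dif (\<lambda>x. real k * w x) z)" by (simp add: convergent_const)
    qed
    show "AE x in \<mu>L. convergent (\<lambda>k. real k * w x)"
      using aL by eventually_elim (auto simp: convergent_const)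
  qed
  then show "AE x in lebesgue. w x = 0"
    unfolding AE_lebesgue_iff
  proof eventually_elim
    fix x assume "convergent (\<lambda>k. real k * w x)"
    then obtain b where b: "\<And>k. norm (real k * w x) \<le> b" using Bseq_def convergent_imp_Bseq by metis
    show "w x = 0"
    proof (rule ccontr)
      assume "w x \<noteq> 0"
      then obtain k where "real k * \<bar>w x\<bar> > b" using reals_Archimedean3[of "\<bar>w x\<bar>"] by auto
      then show False using b[of k] by (simp add: abs_mult)
    qed
  qed
qed

lemma cls_eq_iff: "u \<in> X \<Longrightarrow> v \<in> X \<Longrightarrow> cls u = cls v \<longleftrightarrow> N (u - v) = 0"
proof -
  assume u: "u \<in> X" and v: "v \<in> X"
  have "cls u = cls v \<longleftrightarrow> (AE x in lebesgue. u x = v x)"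
  proof
    assume "cls u = cls v"
    moreover have "u \<in> cls u" unfolding Xcls_def using u by simp
    ultimately show "AE x in lebesgue. u x = v x" unfolding Xcls_def by auto
  next
    assume ae: "AE x in lebesgue. u x = v x"
    have "(AE x in lebesgue. w x = u x) \<longleftrightarrow> (AE x in lebesgue. w x = v x)" for w
    proof
      assume "AE x in lebesgue. w x = u x" then show "AE x in lebesgue. w x = v x" using ae by eventually_elim simp
    next
      assume "AE x in lebesgue. w x = v x" then show "AE x in lebesgue. w x = u x" using ae by eventually_elim simp
    qed
    then show "cls u = cls v" unfolding Xcls_def by simp
  qed
  also have "\<dots> \<longleftrightarrow> N (u - v) = 0" using N_zero_iff[of "u - v"] u v by simp
  finally show ?thesis .
qed

lemma rep_in: "U \<in> Xs \<Longrightarrow> rep U \<in> X" and cls_rep: "U \<in> Xs \<Longrightarrow> cls (rep U) = U"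
proof -
  assume "U \<in> Xs"
  then obtain u where u: "u \<in> X" "U = cls u" unfolding Xsp_def by auto
  have "u \<in> U" unfolding u(2) Xcls_def using u(1) by simp
  then have "rep U \<in> U" unfolding rep_def by (rule someI[of "\<lambda>u. u \<in> U"])
  then have r: "rep U \<in> X" "AE x in lebesgue. rep U x = u x" unfolding u(2) Xcls_def by auto
  then show "rep U \<in> X" by simp
  have "AE x in lebesgue. (rep U - u) x = 0" using r(2) by eventually_elim simp
  then have "N (rep U - u) = 0" using N_zero_iff[of "rep U - u"] r u by auto
  then show "cls (rep U) = U" using cls_eq_iff[OF r(1) u(1)] u by simp
qed

lemma cls_in: "u \<in> X \<Longrightarrow> cls u \<in> Xs"
  unfolding Xsp_def by auto

lemma rep_cls: "u \<in> X \<Longrightarrow> N (rep (cls u) - u) = 0"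
  using cls_eq_iff[of "rep (cls u)" u] rep_in cls_rep cls_in by blast

lemma null_invariant:
  assumes "u \<in> X" "v \<in> X" "N (u - v) = 0"
  shows "N u = N v" "G.F u = G.F v" "L.F u = L.F v"
proof -
  show "N u = N v" using Phi.N_abs_diff[OF assms(1,2)] assms(3) by simp
  have d: "u - v \<in> X" using assms by auto
  have "G.F (u - v) = 0" "L.F (u - v) = 0"
    using assms(3) G.F_nonneg[OF d] L.F_nonneg[OF d] by (auto simp: add_nonneg_eq_0_iff)
  then have "G.F u powr (1 / p) = G.F v powr (1 / p)" "L.F u powr (1 / p) = L.F v powr (1 / p)"
    using G.N_abs_diff[OF assms(1,2)] L.N_abs_diff[OF assms(1,2)] by auto
  then show "G.F u = G.F v" "L.F u = L.F v" using G.F_powr L.F_powr assms by metis+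
qed

lemma semp_rep: "U \<in> Xs \<Longrightarrow> semp p s \<Omega> U = G.F (rep U)"
  unfolding semp_def using G_gagp rep_in by simp

lemma lpp_rep: "U \<in> Xs \<Longrightarrow> lpp p \<Omega> U = L.F (rep U)"
  unfolding lpp_def using L_Lpp rep_in by simp

lemma semp_cls: "u \<in> X \<Longrightarrow> semp p s \<Omega> (cls u) = G.F u"
  using semp_rep[OF cls_in] null_invariant(2)[OF rep_in[OF cls_in] _ rep_cls] by simp

lemma lpp_cls: "u \<in> X \<Longrightarrow> lpp p \<Omega> (cls u) = L.F u"
  using lpp_rep[OF cls_in] null_invariant(3)[OF rep_in[OF cls_in] _ rep_cls] by simp

lemma dX_rep: "U \<in> Xs \<Longrightarrow> V \<in> Xs \<Longrightarrow> dX U V = dN (rep U) (rep V)"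
proof -
  assume "U \<in> Xs" "V \<in> Xs"
  then have "rep U - rep V \<in> X" using rep_in by auto
  then show ?thesis unfolding Xdist_def Let_def using G_gagp[of "rep U - rep V"] L_Lpp[of "rep U - rep V"]
    by (simp add: fun_diff_def)
qed

lemma dN_null:
  assumes "a \<in> X" "b \<in> X" "c \<in> X" "d \<in> X" "N (a - c) = 0" "N (b - d) = 0"
  shows "dN a b = dN c d"
proof -
  have eq: "(a - b) - (c - d) = (a - c) + - (b - d)" by (simp add: algebra_simps)
  have X: "a - c \<in> X" "b - d \<in> X" "- (b - d) \<in> X" "(a - c) + - (b - d) \<in> X" using assms by (auto simp del: minus_diff_eq)
  have "N ((a - c) + - (b - d)) = 0"
    using Phi.tri[OF X(1,3)] Phi.N_minus[OF X(2)] Phi.N_nonneg[OF X(4)] assms(5,6) by (simp only: add_0_right order_antisym)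
  then have "N ((a - b) - (c - d)) = 0" unfolding eq .
  then show ?thesis using null_invariant(1)[of "a - b" "c - d"] assms by auto
qed

lemma dX_cls: "u \<in> X \<Longrightarrow> v \<in> X \<Longrightarrow> dX (cls u) (cls v) = dN u v"
  using dX_rep[OF cls_in cls_in] dN_null[OF rep_in[OF cls_in] rep_in[OF cls_in] _ _ rep_cls rep_cls] by simp

lemma Xneg_cls: "u \<in> X \<Longrightarrow> Xneg (cls u) = cls (- u)"
proof -
  assume u: "u \<in> X"
  have 1: "Xneg (cls u) \<subseteq> cls (- u)" if "u \<in> X" for u
  proof
    fix v assume "v \<in> Xneg (cls u)"
    then obtain w where w: "w \<in> X" "AE x in lebesgue. w x = u x" "v = - w" unfolding Xneg_def Xcls_def by (auto simp: fun_Compl_def)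
    have "AE x in lebesgue. (- w) x = (- u) x" using w(2) by eventually_elim simp
    then show "v \<in> cls (- u)" unfolding Xcls_def using w by auto
  qed
  have "cls (- u) \<subseteq> Xneg (cls u)"
  proof
    fix v assume v: "v \<in> cls (- u)"
    have "- v \<in> Xneg (cls (- u))" unfolding Xneg_def fun_Compl_def[of v] using v by (rule imageI)
    then have "- v \<in> cls (- (- u))" using 1[of "- u"] u by blast
    then have "- v \<in> cls u" by simp
    then show "v \<in> Xneg (cls u)" unfolding Xneg_def by (intro image_eqI[of _ _ "- v"]) (auto simp: fun_eq_iff)
  qed
  then show ?thesis using 1[OF u] by auto
qed

lemma Xneg_Xneg: "Xneg (Xneg U) = U"
  unfolding Xneg_def by (auto simp: image_image)

lemma Xneg_rep: "U \<in> Xs \<Longrightarrow> Xneg U = cls (- rep U)"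
  using Xneg_cls[OF rep_in] cls_rep by simp

sublocale IM: invol_metric Xs dX Xneg
proof
  show "0 \<le> dX U V" for U V unfolding Xdist_def Let_def by simp
  have "gagp p s \<Omega> (\<lambda>x. f x - g x) = gagp p s \<Omega> (\<lambda>x. g x - f x)" for f g :: "real^'n \<Rightarrow> real"
  proof -
    have "\<bar>(f x - g x) - (f y - g y)\<bar> = \<bar>(g x - f x) - (g y - f y)\<bar>" for x y by linarith
    then show ?thesis unfolding gagp_def by presburger
  qed
  moreover have "Lpp p \<Omega> (\<lambda>x. f x - g x) = Lpp p \<Omega> (\<lambda>x. g x - f x)" for f g :: "real^'n \<Rightarrow> real"
    unfolding Lpp_def by (simp add: abs_minus_commute)
  ultimately show "dX U V = dX V U" for U V unfolding Xdist_def Let_def by metis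
  fix U V assume U: "U \<in> Xs" and V: "V \<in> Xs"
  show "dX U V = 0 \<longleftrightarrow> U = V"
    using dX_rep[OF U V] cls_eq_iff[OF rep_in[OF U] rep_in[OF V]] cls_rep U V by simp
  show "Xneg U \<in> Xs" using Xneg_rep[OF U] rep_in[OF U] by (auto intro!: cls_in)
  show "Xneg (Xneg U) = U" by (rule Xneg_Xneg)
  show "dX (Xneg U) (Xneg V) = dX U V"
  proof -
    have m: "- rep U \<in> X" "- rep V \<in> X" using rep_in U V by auto
    have "N (- (rep U - rep V)) = N (rep U - rep V)" using rep_in U V by (intro Phi.N_minus) auto
    then show ?thesis unfolding Xneg_rep[OF U] Xneg_rep[OF V] dX_cls[OF m] dX_rep[OF U V] by simp
  qed
  fix W assume W: "W \<in> Xs"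
  show "dX U W \<le> dX U V + dX V W"
    unfolding dX_rep[OF U V] dX_rep[OF V W] dX_rep[OF U W] using rep_in U V W by (intro Phi.N_tri_diff) auto
qed

lemma Xindex_eq: "Xindex p s \<Omega> A = FR_index IM.mtopology Xneg A"
  unfolding Xindex_def Xtop_def ..

definition raw :: "(real^'n \<Rightarrow> real) set set \<Rightarrow> (real^'n \<Rightarrow> real) set" where
  "raw A = {u \<in> X. cls u \<in> A}"

lemma not_fixed: "U \<in> Xs \<Longrightarrow> lpp p \<Omega> U > 0 \<Longrightarrow> Xneg U \<noteq> U"
proof
  assume U: "U \<in> Xs" "lpp p \<Omega> U > 0" and eq: "Xneg U = U"
  define u where "u = rep U"
  have u: "u \<in> X" "L.F u > 0" "U = cls u" using U rep_in lpp_rep cls_rep unfolding u_def by auto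
  have "cls (- u) = cls u" using eq Xneg_cls[OF u(1)] u(3) by simp
  then have "N (- u - u) = 0" using cls_eq_iff u by auto
  moreover have "- u - u = (-2) *\<^sub>R u" by (simp add: fun_eq_iff scaleR_fun_def)
  ultimately have "N u = 0" using Phi.hom[OF u(1), of "-2"] by simp
  then show False using N_pos[OF u(1,2)] by simp
qed

text \<open>\<open>cls\<close> preserves distances, and so does an equivariant choice of
  representatives in the other direction; both directions are pull-backs. The resolvent can thus be
  used on functions and the index on classes.\<close>

lemma eqz_raw_iff:
  assumes A: "A \<subseteq> Xs" "\<And>U. U \<in> A \<Longrightarrow> Xneg U \<in> A" "\<And>U. U \<in> A \<Longrightarrow> lpp p \<Omega> U > 0"
  shows "eqz dX Xneg A q \<longleftrightarrow> eqz dN uminus (raw A) q"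
proof
  assume "eqz dX Xneg A q"
  then show "eqz dN uminus (raw A) q"
  proof (rule eqz_pull[where f = cls])
    show "cls (- y) = Xneg (cls y)" if "y \<in> raw A" for y using Xneg_cls that unfolding raw_def by auto
    show "\<exists>\<delta>>0. \<forall>z\<in>raw A. dN y z < \<delta> \<longrightarrow> dX (cls y) (cls z) < e" if "y \<in> raw A" "e > 0" for y e
      using that dX_cls unfolding raw_def by (intro exI[of _ e]) auto
  qed (auto simp: raw_def)
next
  assume z: "eqz dN uminus (raw A) q"
  obtain f where f: "\<And>U. U \<in> A \<Longrightarrow> f U \<in> X \<and> cls (f U) = U" "\<And>U. U \<in> A \<Longrightarrow> f (Xneg U) = - f U"
  proof (rule odd_choice[of A Xneg "\<lambda>U u. u \<in> X \<and> cls u = U" uminus])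
    show "\<exists>v. v \<in> X \<and> cls v = U" if "U \<in> A" for U using rep_in cls_rep that A(1) by blast
    show "- v \<in> X \<and> cls (- v) = Xneg U" if "U \<in> A" "v \<in> X \<and> cls v = U" for U v using that Xneg_cls by auto
    show "Xneg U \<noteq> U" if "U \<in> A" for U using not_fixed that A by auto
  qed (use A in \<open>auto simp: Xneg_Xneg\<close>)
  from z show "eqz dX Xneg A q"
  proof (rule eqz_pull[where f = f])
    show "f U \<in> raw A" if "U \<in> A" for U using f(1)[OF that] that unfolding raw_def by auto
    show "\<exists>\<delta>>0. \<forall>V\<in>A. dX U V < \<delta> \<longrightarrow> dN (f U) (f V) < e" if "U \<in> A" "e > 0" for U e
      using that f(1) dX_cls by (intro exI[of _ e]) metis
  qed (use f in auto)
qed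

lemma odd_map_on_sublevel:
  assumes k: "0 \<le> k" and A: "A \<subseteq> Xs" "\<And>U. U \<in> A \<Longrightarrow> Xneg U \<in> A"
    and sub: "\<And>U. U \<in> A \<Longrightarrow> lpp p \<Omega> U > 0 \<and> semp p s \<Omega> U \<le> k * lpp p \<Omega> U"
  shows "\<exists>g. IM.odd_map A g"
proof -
  define D where "D = {u\<in>X. L.F u > 0 \<and> G.F u \<le> k * L.F u}"
  obtain n f where f: "\<And>u. u \<in> D \<Longrightarrow> f u \<in> Efin n" "\<And>u. u \<in> D \<Longrightarrow> f u \<noteq> 0" "\<And>u. u \<in> D \<Longrightarrow> f (- u) = - f u"
    "\<And>u e. u \<in> D \<Longrightarrow> e > 0 \<Longrightarrow> \<exists>\<delta>>0. \<forall>v\<in>D. dN u v < \<delta> \<longrightarrow> (\<forall>i. \<bar>f v i - f u i\<bar> < e)"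
    by (rule odd_finite_map_exists[OF k, folded D_def], rule that)
  have rD: "rep U \<in> D" if "U \<in> A" for U
    using sub[OF that] A(1) that rep_in[of U] lpp_rep[of U] semp_rep[of U] unfolding D_def by auto
  have Dm: "- u \<in> D" if "u \<in> D" for u using that G.F_minus L.F_minus unfolding D_def by auto
  \<comment> \<open>Continuity of \<open>f\<close> for a seminorm makes it constant on classes, so
    the arbitrary representatives \<open>rep U\<close> define an odd continuous map on
    classes.\<close>
  have inv: "f v = f u" if uv: "u \<in> D" "v \<in> D" "dN u v = 0" for u v
  proof
    fix i
    have "\<bar>f v i - f u i\<bar> \<le> 0 + e" if e: "e > 0" for e
    proof -
      obtain \<delta> where "\<delta> > 0" "\<forall>v\<in>D. dN u v < \<delta> \<longrightarrow> (\<forall>i. \<bar>f v i - f u i\<bar> < e)" using f(4)[OF uv(1) e] by (elim exE conjE)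
      then have "\<bar>f v i - f u i\<bar> < e" using uv(2,3) by simp
      then show ?thesis by simp
    qed
    then have "\<bar>f v i - f u i\<bar> \<le> 0" by (rule field_le_epsilon)
    then show "f v i = f u i" by simp
  qed
  have "IM.odd_map A (\<lambda>U. nrm (f (rep U)))"
  proof (rule IM.odd_map_exists[of A "\<lambda>U. f (rep U)" n])
    show "f (rep (Xneg U)) = - f (rep U)" if U: "U \<in> A" for U
    proof -
      have UX: "U \<in> Xs" "Xneg U \<in> Xs" "Xneg U \<in> A" using U A by auto
      have "cls (rep (Xneg U)) = cls (- rep U)" using cls_rep[OF UX(2)] Xneg_rep[OF UX(1)] by simp
      then have "N (- rep U - rep (Xneg U)) = 0" using cls_eq_iff[of "- rep U" "rep (Xneg U)"] rep_in UX by auto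
      then have "f (rep (Xneg U)) = f (- rep U)" using rD U UX Dm by (intro inv) auto
      then show ?thesis using f(3) rD U by simp
    qed
    show "\<exists>\<delta>>0. \<forall>V\<in>A. dX U V < \<delta> \<longrightarrow> (\<forall>i. \<bar>f (rep V) i - f (rep U) i\<bar> < e)" if U: "U \<in> A" "e > 0" for U e
    proof -
      obtain \<delta> where "\<delta> > 0" "\<And>v i. v \<in> D \<Longrightarrow> dN (rep U) v < \<delta> \<Longrightarrow> \<bar>f v i - f (rep U) i\<bar> < e"
        using f(4)[OF rD[OF U(1)] U(2)] by blast
      moreover have "dX U V = dN (rep U) (rep V)" if "V \<in> A" for V using dX_rep that U A(1) by blast
      ultimately show ?thesis using rD by (intro exI[of _ \<delta>]) auto
    qed
  qed (use A rD f in auto)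
  then show ?thesis by blast
qed

lemma compactin_cls_image:
  assumes "K \<subseteq> X" "Phi.seqcomp K"
  shows "compactin IM.mtopology (cls ` K)"
  unfolding IM.compactin_sequentially
proof (intro conjI allI impI)
  show "cls ` K \<subseteq> Xs" using assms cls_in by auto
  fix \<sigma> :: "nat \<Rightarrow> (real^'n \<Rightarrow> real) set" assume "range \<sigma> \<subseteq> cls ` K"
  then have "\<forall>n. \<exists>u. u \<in> K \<and> \<sigma> n = cls u" by auto
  then obtain u where u: "\<And>n::nat. u n \<in> K" "\<And>n. \<sigma> n = cls (u n)" by metis
  obtain l r where l: "l \<in> K" "strict_mono (r :: nat \<Rightarrow> nat)" "(\<lambda>n. N (u (r n) - l)) \<longlonglongrightarrow> 0"
    using Phi.seqcompE[OF assms(2), of u] u by blast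
  have "limitin IM.mtopology (\<sigma> \<circ> r) (cls l) sequentially"
    unfolding IM.limitin_metric
  proof (intro conjI allI impI)
    show "cls l \<in> Xs" using l assms cls_in by auto
    fix e :: real assume "e > 0"
    then have "eventually (\<lambda>n. N (u (r n) - l) < e) sequentially" using l(3) by (intro order_tendstoD) auto
    then show "\<forall>\<^sub>F n in sequentially. (\<sigma> \<circ> r) n \<in> Xs \<and> dX ((\<sigma> \<circ> r) n) (cls l) < e"
      by eventually_elim (use u l assms cls_in dX_cls in \<open>auto simp: subset_iff\<close>)
  qed
  then show "\<exists>l r. l \<in> cls ` K \<and> strict_mono r \<and> limitin IM.mtopology (\<sigma> \<circ> r) l sequentially" using l by blast
qed

section \<open>Eigenvalues and the index of the cones\<close>

definition admissible :: "nat \<Rightarrow> (real^'n \<Rightarrow> real) set set \<Rightarrow> bool" where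
  "admissible m K \<longleftrightarrow> K \<subseteq> Mset p s \<Omega> \<and> (\<forall>U\<in>K. Xneg U \<in> K) \<and> compactin IM.mtopology K \<and> enat m \<le> Xindex p s \<Omega> K"

abbreviation "lam \<equiv> eigval p s \<Omega>"

lemma eigval_eq: "lam m = Inf ((\<lambda>K. SUP U\<in>K. semp p s \<Omega> U) ` {K. admissible m K})"
  unfolding eigval_def admissible_def Xtop_def by (intro arg_cong[where f = Inf]) auto

lemma semp_nonneg: "semp p s \<Omega> U \<ge> 0"
  unfolding semp_def by simp

lemma Mset_sub: "U \<in> Mset p s \<Omega> \<Longrightarrow> U \<in> Xs \<and> lpp p \<Omega> U = 1"
  unfolding Mset_def by auto

text \<open>Nonemptiness and boundedness ensure that the \<open>SUP\<close> in the definition of the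
  eigenvalues is a true supremum and not a default value.\<close>

lemma admissible_index:
  assumes "admissible m K" "1 \<le> m"
  shows "\<not> eqz dX Xneg K (m - 1)" "K \<noteq> {}" "bdd_above (semp p s \<Omega> ` K)"
proof -
  have K: "K \<subseteq> Xs" "\<And>U. U \<in> K \<Longrightarrow> Xneg U \<in> K" "\<And>U. U \<in> K \<Longrightarrow> Xneg U \<noteq> U"
    using assms Mset_sub not_fixed unfolding admissible_def by (auto simp: subset_iff)
  have "enat m \<le> FR_index IM.mtopology Xneg K" using assms Xindex_eq unfolding admissible_def by auto
  then show nz: "\<not> eqz dX Xneg K (m - 1)" using IM.FR_index_ge_iff[of K m] K assms(2) by blast
  have "eqz dX Xneg {} (m - 1)" unfolding eqz_def eqze_def by (auto intro: exI[of _ "\<lambda>_. 0"])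
  then show "K \<noteq> {}" using nz by auto
  have "IM.mbounded K" using assms IM.compactin_imp_mbounded unfolding admissible_def by auto
  then obtain C b where C: "K \<subseteq> IM.mcball C b" unfolding IM.mbounded_def by blast
  show "bdd_above (semp p s \<Omega> ` K)"
  proof (rule bdd_aboveI2)
    fix U assume U: "U \<in> K"
    then have c: "C \<in> Xs" "U \<in> Xs" "dX C U \<le> b" using C by (auto simp: IM.in_mcball subset_iff)
    have r: "rep C \<in> X" "rep U \<in> X" using rep_in c by auto
    have "N (rep U) \<le> N (rep C) + N (rep U - rep C)" using r by (intro Phi.N_le)
    also have "N (rep U - rep C) = dX C U" using Phi.N_diff_commute[OF r] dX_rep[OF c(1,2)] by simp
    finally have "N (rep U) \<le> N (rep C) + b" using c by linarith
    then have "N (rep U) powr p \<le> (N (rep C) + b) powr p" using p by (intro powr_mono2) auto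
    then show "semp p s \<Omega> U \<le> (N (rep C) + b) powr p"
      using semp_rep[OF c(2)] Phi.F_powr[OF r(2)] L.F_nonneg[OF r(2)] by simp
  qed
qed

lemma SUP_semp_nonneg: "admissible m K \<Longrightarrow> 1 \<le> m \<Longrightarrow> 0 \<le> (SUP U\<in>K. semp p s \<Omega> U)"
  using admissible_index[of m K] semp_nonneg by (metis all_not_in_conv cSUP_upper2)

lemma neg_closed:
  assumes "U \<in> Xs"
  shows "semp p s \<Omega> (Xneg U) = semp p s \<Omega> U" "lpp p \<Omega> (Xneg U) = lpp p \<Omega> U"
proof -
  have r: "rep U \<in> X" "- rep U \<in> X" using rep_in[OF assms] by auto
  show "semp p s \<Omega> (Xneg U) = semp p s \<Omega> U" "lpp p \<Omega> (Xneg U) = lpp p \<Omega> U"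
    using r Xneg_rep[OF assms] semp_cls[OF r(2)] lpp_cls[OF r(2)] semp_rep[OF assms] lpp_rep[OF assms] G.F_minus[OF r(1)] L.F_minus[OF r(1)]
    by auto
qed

theorem index_cones:
  assumes m: "1 \<le> m" and gap: "lam m < lam (Suc m)"
  shows "Xindex p s \<Omega> (Cminus p s \<Omega> m - {Xzero p s \<Omega>}) = enat m"
    and "Xindex p s \<Omega> (Xs - Cplus p s \<Omega> m) = enat m"
proof -
  \<comment> \<open>The infimum of the empty set is an unspecified real. If no set were admissible
    for \<open>m\<close>, none would be for \<open>Suc m\<close>, and both eigenvalues would be that
    same number, against the gap.\<close>
  have ne: "{K. admissible m K} \<noteq> {}"
  proof
    assume "{K. admissible m K} = {}"
    moreover have "admissible m K" if "admissible (Suc m) K" for K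
    proof -
      have "enat m \<le> enat (Suc m)" by simp
      then show ?thesis using that unfolding admissible_def by (meson order_trans)
    qed
    ultimately have "{K. admissible (Suc m) K} = {}" by auto
    then have "lam m = lam (Suc m)" using \<open>{K. admissible m K} = {}\<close> unfolding eigval_eq by (simp only: image_empty)
    then show False using gap by simp
  qed
  have lam0: "lam m \<ge> 0" unfolding eigval_eq using ne SUP_semp_nonneg m by (intro cInf_greatest) auto
  then have lam1: "lam (Suc m) > 0" using gap by linarith
  define A1 where "A1 = Cminus p s \<Omega> m - {Xzero p s \<Omega>}"
  define A2 where "A2 = Xs - Cplus p s \<Omega> m"
  have zero: "Xzero p s \<Omega> = cls 0" unfolding Xzero_def zero_fun_def by simp
  have A1_iff: "U \<in> A1 \<longleftrightarrow> U \<in> Xs \<and> lpp p \<Omega> U > 0 \<and> semp p s \<Omega> U \<le> lam m * lpp p \<Omega> U" for U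
  proof -
    \<comment> \<open>Inside the closed cone \<open>L\<close> controls \<open>G\<close>, so removing
      the zero class amounts to \<open>L\<close> being positive.\<close>
    have "U \<noteq> cls 0 \<longleftrightarrow> lpp p \<Omega> U > 0" if U: "U \<in> Xs" "semp p s \<Omega> U \<le> lam m * lpp p \<Omega> U"
    proof -
      have r: "rep U \<in> X" using rep_in U by auto
      have "U = cls 0 \<longleftrightarrow> N (rep U) = 0" using cls_eq_iff[OF r Phi.E_simps(1)] cls_rep[OF U(1)] by simp
      also have "\<dots> \<longleftrightarrow> L.F (rep U) = 0"
        using U semp_rep[OF U(1)] lpp_rep[OF U(1)] G.F_nonneg[OF r] L.F_nonneg[OF r] by (auto simp: add_nonneg_eq_0_iff)
      finally show ?thesis using lpp_rep[OF U(1)] L.F_nonneg[OF r] by auto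
    qed
    then show ?thesis unfolding A1_def Cminus_def zero by auto
  qed
  have A2_iff: "U \<in> A2 \<longleftrightarrow> U \<in> Xs \<and> lpp p \<Omega> U > 0 \<and> semp p s \<Omega> U < lam (Suc m) * lpp p \<Omega> U" for U
  proof -
    have "lpp p \<Omega> U > 0" if "semp p s \<Omega> U < lam (Suc m) * lpp p \<Omega> U"
    proof -
      have "0 < lam (Suc m) * lpp p \<Omega> U" using that semp_nonneg[of U] by linarith
      then show ?thesis using lam1 by (simp add: zero_less_mult_iff)
    qed
    then show ?thesis unfolding A2_def Cplus_def by auto
  qed
  have A12: "A1 \<subseteq> A2"
  proof
    fix U assume "U \<in> A1"
    then have U: "U \<in> Xs" "lpp p \<Omega> U > 0" "semp p s \<Omega> U \<le> lam m * lpp p \<Omega> U" using A1_iff by auto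
    have "lam m * lpp p \<Omega> U < lam (Suc m) * lpp p \<Omega> U" using gap U(2) by simp
    with U(3) have "semp p s \<Omega> U < lam (Suc m) * lpp p \<Omega> U" by linarith
    then show "U \<in> A2" unfolding A2_iff using U(1,2) by (simp only:)
  qed
  have A1p: "A1 \<subseteq> Xs" "\<And>U. U \<in> A1 \<Longrightarrow> Xneg U \<in> A1" "\<And>U. U \<in> A1 \<Longrightarrow> lpp p \<Omega> U > 0" "\<And>U. U \<in> A1 \<Longrightarrow> Xneg U \<noteq> U"
    using A1_iff neg_closed IM.ng_M not_fixed by auto
  have A2p: "A2 \<subseteq> Xs" "\<And>U. U \<in> A2 \<Longrightarrow> Xneg U \<in> A2" "\<And>U. U \<in> A2 \<Longrightarrow> lpp p \<Omega> U > 0" "\<And>U. U \<in> A2 \<Longrightarrow> Xneg U \<noteq> U"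
    using A2_iff neg_closed IM.ng_M not_fixed by auto
  have raw1: "raw A1 = {u\<in>X. L.F u > 0 \<and> G.F u \<le> lam m * L.F u}"
    unfolding raw_def A1_iff using semp_cls lpp_cls cls_in by auto
  have raw2: "raw A2 = {u\<in>X. L.F u > 0 \<and> G.F u < lam (Suc m) * L.F u}"
    unfolding raw_def A2_iff using semp_cls lpp_cls cls_in by auto
  have g2: "\<exists>g. IM.odd_map A2 g" using A2p A2_iff lam1 by (intro odd_map_on_sublevel[of "lam (Suc m)"]) auto
  have g1: "\<exists>g. IM.odd_map A1 g" using A1p A1_iff lam0 by (intro odd_map_on_sublevel[of "lam m"]) auto
  \<comment> \<open>Restriction along the inclusion: the lower bound on the smaller set and the
    upper bound on the larger one determine the index of both.\<close>
  have mono: "eqz dX Xneg A1 q" if "eqz dX Xneg A2 q" for q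
    using that by (rule eqz_pull[where f = "\<lambda>U. U"]) (use A12 in auto)
  have lower: "\<not> eqz dX Xneg A1 (m - 1)"
  proof
    assume "eqz dX Xneg A1 (m - 1)"
    then have z: "eqz dN uminus {u\<in>X. L.F u > 0 \<and> G.F u \<le> lam m * L.F u} (m - 1)"
      using eqz_raw_iff[OF A1p(1-3)] raw1 by simp
    obtain \<epsilon> where \<epsilon>: "\<epsilon> > 0" "\<And>B. B \<subseteq> {u\<in>X. L.F u = 1 \<and> G.F u \<le> lam m + \<epsilon>} \<Longrightarrow> (\<And>u. u \<in> B \<Longrightarrow> - u \<in> B) \<Longrightarrow> eqz dN uminus B (m - 1)"
    proof (rule eqz_sublevel_propagates[OF lam0 z])
      fix \<epsilon> :: real
      assume pos: "\<epsilon> > 0" and zero: "\<And>B. B \<subseteq> {u\<in>X. L.F u = 1 \<and> G.F u \<le> lam m + \<epsilon>} \<Longrightarrow> (\<And>u. u \<in> B \<Longrightarrow> - u \<in> B) \<Longrightarrow> eqz dN uminus B (m - 1)"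
      show thesis by (rule that[OF pos zero])
    qed
    \<comment> \<open>Any level above the infimum is reached by some admissible set, and
      \<open>\<epsilon>\<close> places that set where the class already vanishes.\<close>
    have "Inf ((\<lambda>K. SUP U\<in>K. semp p s \<Omega> U) ` {K. admissible m K}) < lam m + \<epsilon>" using \<epsilon>(1) unfolding eigval_eq by simp
    then obtain K where K: "admissible m K" "(SUP U\<in>K. semp p s \<Omega> U) < lam m + \<epsilon>"
      using cInf_lessD[of "(\<lambda>K. SUP U\<in>K. semp p s \<Omega> U) ` {K. admissible m K}"] ne by blast
    note ad = admissible_index[OF K(1) m]
    have Kp: "K \<subseteq> Xs" "\<And>U. U \<in> K \<Longrightarrow> Xneg U \<in> K" "\<And>U. U \<in> K \<Longrightarrow> lpp p \<Omega> U = 1"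
      using K(1) Mset_sub unfolding admissible_def by auto
    have "eqz dN uminus (raw K) (m - 1)"
    proof (rule \<epsilon>(2))
      show "raw K \<subseteq> {u\<in>X. L.F u = 1 \<and> G.F u \<le> lam m + \<epsilon>}"
      proof
        fix u assume "u \<in> raw K"
        then have u: "u \<in> X" "cls u \<in> K" unfolding raw_def by auto
        have "semp p s \<Omega> (cls u) \<le> (SUP U\<in>K. semp p s \<Omega> U)" using u ad(3) by (intro cSUP_upper)
        then show "u \<in> {u\<in>X. L.F u = 1 \<and> G.F u \<le> lam m + \<epsilon>}"
          using u K(2) semp_cls[OF u(1)] lpp_cls[OF u(1)] Kp(3)[OF u(2)] by auto
      qed
      show "- u \<in> raw K" if "u \<in> raw K" for u
        using that Kp(2)[of "cls u"] Xneg_cls[of u] unfolding raw_def by auto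
    qed
    then have "eqz dX Xneg K (m - 1)" using eqz_raw_iff[OF Kp(1,2)] Kp(3) by auto
    then show False using ad(1) by simp
  qed
  have upper: "eqz dX Xneg A2 m"
  proof (rule ccontr)
    assume "\<not> eqz dX Xneg A2 m"
    then have nz: "\<not> eqz dN uminus {u\<in>X. L.F u > 0 \<and> G.F u < lam (Suc m) * L.F u} m"
      using eqz_raw_iff[OF A2p(1-3)] raw2 by simp
    obtain K lam' where K: "K \<subseteq> {u\<in>X. L.F u = 1 \<and> G.F u \<le> lam'}" "lam' < lam (Suc m)" "\<And>u. u \<in> K \<Longrightarrow> - u \<in> K"
      "Phi.seqcomp K" "\<not> eqz dN uminus K m"
      by (rule eqz_compact_sublevel[OF nz], rule that)
    define C where "C = cls ` K"
    have KX: "K \<subseteq> X" using K(1) by auto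
    have CM: "C \<subseteq> Mset p s \<Omega>" unfolding C_def Mset_def using K(1) cls_in lpp_cls by auto
    have Cp: "C \<subseteq> Xs" "\<And>U. U \<in> C \<Longrightarrow> Xneg U \<in> C" "\<And>U. U \<in> C \<Longrightarrow> lpp p \<Omega> U = 1"
    proof -
      show "C \<subseteq> Xs" "\<And>U. U \<in> C \<Longrightarrow> lpp p \<Omega> U = 1" using CM Mset_sub by auto
      show "Xneg U \<in> C" if U: "U \<in> C" for U
      proof -
        obtain u where "u \<in> K" "U = cls u" using U unfolding C_def by auto
        then show ?thesis using Xneg_cls[of u] K(3)[of u] KX unfolding C_def by auto
      qed
    qed
    have Cs: "semp p s \<Omega> U \<le> lam'" if U: "U \<in> C" for U
    proof -
      obtain u where "u \<in> K" "U = cls u" using U unfolding C_def by auto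
      then show ?thesis using semp_cls[of u] K(1) by auto
    qed
    have "\<not> eqz dX Xneg C m"
    proof
      assume "eqz dX Xneg C m"
      then have "eqz dN uminus (raw C) m" using eqz_raw_iff[OF Cp(1,2)] Cp(3) by auto
      \<comment> \<open>\<open>K\<close> is contained in \<open>raw C\<close>, which consists of all
        representatives of its classes, so the vanishing restricts to \<open>K\<close>.\<close>
      then have "eqz dN uminus K m"
        by (rule eqz_pull[where f = "\<lambda>u. u"]) (use KX in \<open>auto simp: raw_def C_def\<close>)
      then show False using K(5) by simp
    qed
    moreover have "\<exists>g. IM.odd_map C g"
    proof (rule odd_map_on_sublevel[of "lam (Suc m)"])
      show "lpp p \<Omega> U > 0 \<and> semp p s \<Omega> U \<le> lam (Suc m) * lpp p \<Omega> U" if "U \<in> C" for U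
        using Cp(3)[OF that] Cs[OF that] K(2) by simp
    qed (use lam1 Cp in auto)
    ultimately have "enat (Suc m) \<le> FR_index IM.mtopology Xneg C"
      using IM.FR_index_ge_iff[of C "Suc m"] Cp not_fixed by (auto simp: subset_iff)
    then have ad: "admissible (Suc m) C"
      unfolding admissible_def Xindex_eq using CM Cp compactin_cls_image[OF KX K(4)] C_def by auto
    have "lam (Suc m) \<le> (SUP U\<in>C. semp p s \<Omega> U)"
      unfolding eigval_eq
    proof (rule cInf_lower)
      show "bdd_below ((\<lambda>K. SUP U\<in>K. semp p s \<Omega> U) ` {K. admissible (Suc m) K})"
        by (rule bdd_belowI[of _ 0]) (use SUP_semp_nonneg[of "Suc m"] in auto)
    qed (use ad in auto)
    also have "\<dots> \<le> lam'" using admissible_index(2)[OF ad] Cs by (intro cSUP_least) auto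
    finally show False using K(2) by simp
  qed
  have idx: "Xindex p s \<Omega> A = enat m"
    if A: "A \<subseteq> Xs" "\<And>U. U \<in> A \<Longrightarrow> Xneg U \<in> A" "\<And>U. U \<in> A \<Longrightarrow> Xneg U \<noteq> U" "\<exists>g. IM.odd_map A g"
      "\<not> eqz dX Xneg A (m - 1)" "eqz dX Xneg A m" for A
    unfolding Xindex_eq
    using IM.FR_index_ge_iff[OF A(1-3), of m] IM.FR_index_ge_iff[OF A(1-3), of "Suc m"] m A
    by (intro finite_enat_eqI) auto
  show "Xindex p s \<Omega> (Cminus p s \<Omega> m - {Xzero p s \<Omega>}) = enat m"
    using idx[OF A1p(1,2,4) g1 lower mono[OF upper]] unfolding A1_def .
  show "Xindex p s \<Omega> (Xs - Cplus p s \<Omega> m) = enat m"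
    using idx[OF A2p(1,2,4) g2 _ upper] lower mono unfolding A2_def by blast
qed

end

theorem mainTheorem2:
  fixes p s :: real and \<Omega> :: "(real^'n) set" and m :: nat
  assumes "0 < s" "s < 1" "1 < p"
    and "bounded_Lipschitz_domain \<Omega>"
    and "1 \<le> m"
    and "eigval p s \<Omega> m < eigval p s \<Omega> (Suc m)"
  shows "Xindex p s \<Omega> (Cminus p s \<Omega> m - {Xzero p s \<Omega>}) = enat m
       \<and> Xindex p s \<Omega> (Xsp p s \<Omega> - Cplus p s \<Omega> m) = enat m"
proof -
  interpret neumann p s \<Omega>
    using assms by unfold_locales (auto simp: bounded_Lipschitz_domain_def)
  show ?thesis using index_cones[OF assms(5,6)] by simp
qed

end
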